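(* Let $K$ be the Sierpiński gasket or the Sierpiński carpet. In each case there exists some positive constant $C$ such that for all $u\in\mathcal{F}_{\mathrm{loc}}$, $$\frac1C\,\mathcal{E}_{\mathrm{loc}}(u,u)\le\liminf_{\beta\uparrow\beta^*}(\beta^*-\beta)\mathcal{E}_\beta(u,u)\le\limsup_{\beta\uparrow\beta^*}(\beta^*-\beta)\mathcal{E}_\beta(u,u)\le C\,\mathcal{E}_{\mathrm{loc}}(u,u).$$
   Context: Sierpiński gasket (SG): $p_0=(0,0)$, $p_1=(1,0)$, $p_2=(\frac12,\frac{\sqrt3}{2})$, $f_i(x)=(x+p_i)/2$, $i=0,1,2$; $K$ is the unique non-empty compact set with $K=\bigcup_{i=0}^2f_i(K)$; $\alpha=\log3/\log2$; $\beta^*=\log5/\log2$. $W_n=\{0,1,2\}^n$. Sierpiński carpet (SC): $p_0=(0,0)$, $p_1=(\frac12,0)$, $p_2=(1,0)$, $p_3=(1,\frac12)$, $p_4=(1,1)$, $p_5=(\frac12,1)$, $p_6=(0,1)$, $p_7=(0,\frac12)$, $f_i(x)=(x+2p_i)/3$, $i=0,\ldots,7$; $K$ is the unique non-empty compact set with $K=\bigcup_{i=0}^7f_i(K)$; $\alpha=\log8/\log3$; $V_0=\{p_0,\ldots,p_7\}$, $V_{n+1}=\bigcup_if_i(V_n)$, $W_n=\{0,\ldots,7\}^n$. With $D_n(u,u)=\sum_{w\in W_n}\sum_{p,q\in V_w,\,|p-q|=2^{-1}3^{-n}}(u(p)-u(q))^2$, where $V_w=f_w(V_0)$, and $R_n^V=\left(\inf\{D_n(u,u):u:V_n\to\mathbb{R},\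 u=0\text{ on }V_n\cap(\{0\}\times[0,1]),\ u=1\text{ on }V_n\cap(\{1\}\times[0,1])\}\right)^{-1}$, the number $\rho\in[7/6,3/2]$ is the (unique, existing) constant such that $R_n^V/\rho^n$ is bounded above and below by positive constants uniformly in $n\ge1$, and $\beta^*=\log(8\rho)/\log3$. In both cases $f_w=f_{w_1}\circ\cdots\circ f_{w_n}$ and $K_w=f_w(K)$ for $w=w_1\ldots w_n\in W_n$, $\nu$ is the normalized $\alpha$-dimensional Hausdorff measure on $K$, and $\mathcal{E}_\beta(u,u)=\int_K\int_K\frac{(u(x)-u(y))^2}{|x-y|^{\alpha+\beta}}\nu(dx)\nu(dy)$. $(\mathcal{E}_{\mathrm{loc}},\mathcal{F}_{\mathrm{loc}})$ denotes a self-similar strongly local regular Dirichlet form on $L^2(K;\nu)$ as follows ($\asymp$ means the ratio is bounded above and below by positive constants independent of $u$). For the SG: $\mathcal{F}_{\mathrm{loc}}$ is the set of $u\in L^2(K;\nu)$ for which $S(u)=\sup_{n\ge1}(5/3)^n\sum_{w^{(1)}\sim_nw^{(2)}}(P_nu(w^{(1)})-P_nu(w^{(2)}))^2<+\infty$, and $\mathcal{E}_{\mathrm{loc}}(u,u)\asymp S(u)$, where $P_nu(w)=\frac1{\nu(K_w)}\int_{K_w}u\,d\nu$ and $w^{(1)}\sim_nw^{(2)}$ means $w^{(1)}\neq w^{(2)}\in W_n$ and $K_{w^{(1)}}\cap K_{w^{(2)}}\ne\emptyset$. For the SC: $\mathcal{F}_{\mathrm{loc}}$ is the set of $u\in C(K)$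 for which $S(u)=\sup_{n\ge1}3^{(\beta^*-\alpha)n}D_n(u,u)<+\infty$, and $\mathcal{E}_{\mathrm{loc}}(u,u)\asymp S(u)$. Such forms exist. Self-similar means that $u\circ f_i\in\mathcal{F}_{\mathrm{loc}}$ for $u\in\mathcal{F}_{\mathrm{loc}}$ and $\mathcal{E}_{\mathrm{loc}}(u,u)=r\sum_i\mathcal{E}_{\mathrm{loc}}(u\circ f_i,u\circ f_i)$ for some constant $r>0$. Strongly local means $\mathcal{E}_{\mathrm{loc}}(u,v)=0$ whenever $v$ is constant in an open neighborhood of $\mathrm{supp}(u)$. *)

theory Defs
  imports "HOL-Analysis.Analysis"
begin

type_synonym plane = "real \<times> real"

subsection \<open>Self-similar sets\<close>

definition attractor :: "nat \<Rightarrow> (nat \<Rightarrow> 'a::metric_space \<Rightarrow> 'a) \<Rightarrow> 'a set" where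
  "attractor N f = (THE K. K \<noteq> {} \<and> compact K \<and> K = (\<Union>i<N. f i ` K))"

definition words :: "nat \<Rightarrow> nat \<Rightarrow> nat list set" where
  "words N n = {w. length w = n \<and> set w \<subseteq> {..<N}}"

primrec word_map :: "(nat \<Rightarrow> 'a \<Rightarrow> 'a) \<Rightarrow> nat list \<Rightarrow> 'a \<Rightarrow> 'a" where
  "word_map f [] = id"
| "word_map f (i # w) = f i \<circ> word_map f w"

subsection \<open>Hausdorff measure\<close>

text \<open>Only the case \<open>s > 0\<close> is meaningful, as \<open>0 powr 0 = 0\<close>. Boundedness of the covering
  sets is required because \<^const>\<open>diameter\<close> is unspecified on unbounded sets.\<close>

definition hausdorff_premeasure :: "real \<Rightarrow> real \<Rightarrow> 'a::metric_space set \<Rightarrow> ennreal" where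
  "hausdorff_premeasure \<delta> s A =
     (INF U \<in> {U :: nat \<Rightarrow> 'a set. A \<subseteq> (\<Union>i. U i) \<and> (\<forall>i. bounded (U i) \<and> diameter (U i) \<le> \<delta>)}.
        \<Sum>i. ennreal (diameter (U i) powr s))"

definition hausdorff_outer :: "real \<Rightarrow> 'a::metric_space set \<Rightarrow> ennreal" where
  "hausdorff_outer s A = (SUP \<delta> \<in> {0<..}. hausdorff_premeasure \<delta> s A)"

definition hausdorff_measure :: "real \<Rightarrow> 'a::metric_space measure" where
  "hausdorff_measure s = measure_of UNIV (sets borel) (hausdorff_outer s)"

text \<open>The underlying space of this measure is \<open>K\<close>, so almost-everywhere statements and
  measurability below only see the values of a function on \<open>K\<close>.\<close>

definition normalized_hausdorff :: "real \<Rightarrow> 'a::metric_space set \<Rightarrow> 'a measure" where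
  "normalized_hausdorff s K = restrict_space (uniform_measure (hausdorff_measure s) K) K"

subsection \<open>Dirichlet forms\<close>

text \<open>Elements of \<open>L\<^sup>2\<close> are represented by functions instead of equivalence classes; form domains
  are therefore required to be saturated under almost-everywhere equality.\<close>

definition L2 :: "'a measure \<Rightarrow> ('a \<Rightarrow> real) set" where
  "L2 M = {u \<in> borel_measurable M. integrable M (\<lambda>x. (u x)\<^sup>2)}"

definition energy_1 :: "'a measure \<Rightarrow> (('a \<Rightarrow> real) \<Rightarrow> ('a \<Rightarrow> real) \<Rightarrow> real) \<Rightarrow> ('a \<Rightarrow> real) \<Rightarrow> real" where
  "energy_1 M E u = E u u + (LINT x|M. (u x)\<^sup>2)"

locale dirichlet_form =
  fixes M :: "'a measure"
    and F :: "('a \<Rightarrow> real) set"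
    and E :: "('a \<Rightarrow> real) \<Rightarrow> ('a \<Rightarrow> real) \<Rightarrow> real"
  assumes domain_L2: "F \<subseteq> L2 M"
    and domain_cong: "\<lbrakk>u \<in> F; v \<in> borel_measurable M; AE x in M. u x = v x\<rbrakk> \<Longrightarrow> v \<in> F"
    and domain_zero: "(\<lambda>_. 0) \<in> F"
    and domain_add: "\<lbrakk>u \<in> F; v \<in> F\<rbrakk> \<Longrightarrow> (\<lambda>x. u x + v x) \<in> F"
    and domain_scale: "u \<in> F \<Longrightarrow> (\<lambda>x. c * u x) \<in> F"
    and domain_dense: "\<lbrakk>u \<in> L2 M; 0 < e\<rbrakk> \<Longrightarrow> \<exists>v\<in>F. (LINT x|M. (u x - v x)\<^sup>2) < e"
    and form_cong: "\<lbrakk>u \<in> F; u' \<in> F; v \<in> F; AE x in M. u x = u' x\<rbrakk> \<Longrightarrow> E u v = E u' v"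
    and form_sym: "\<lbrakk>u \<in> F; v \<in> F\<rbrakk> \<Longrightarrow> E u v = E v u"
    and form_add: "\<lbrakk>u \<in> F; u' \<in> F; v \<in> F\<rbrakk> \<Longrightarrow> E (\<lambda>x. u x + u' x) v = E u v + E u' v"
    and form_scale: "\<lbrakk>u \<in> F; v \<in> F\<rbrakk> \<Longrightarrow> E (\<lambda>x. c * u x) v = c * E u v"
    and form_nonneg: "u \<in> F \<Longrightarrow> 0 \<le> E u u"
    and form_closed:
      "\<lbrakk>\<And>n. s n \<in> F;
        \<And>e. 0 < e \<Longrightarrow> \<exists>N::nat. \<forall>m\<ge>N. \<forall>n\<ge>N. energy_1 M E (\<lambda>x. s m x - s n x) < e\<rbrakk>
       \<Longrightarrow> \<exists>u\<in>F. (\<lambda>n. energy_1 M E (\<lambda>x. s n x - u x)) \<longlonglongrightarrow> 0"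
    and form_markov:
      "u \<in> F \<Longrightarrow> (\<lambda>x. min 1 (max 0 (u x))) \<in> F \<and>
               E (\<lambda>x. min 1 (max 0 (u x))) (\<lambda>x. min 1 (max 0 (u x))) \<le> E u u"

text \<open>Regularity on a compact space, where every continuous function has compact support.\<close>

definition regular_form ::
  "'a::metric_space set \<Rightarrow> 'a measure \<Rightarrow> ('a \<Rightarrow> real) set \<Rightarrow>
     (('a \<Rightarrow> real) \<Rightarrow> ('a \<Rightarrow> real) \<Rightarrow> real) \<Rightarrow> bool" where
  "regular_form K M F E \<longleftrightarrow>
     (\<forall>u\<in>F. \<forall>e>0. \<exists>v\<in>F. continuous_on K v \<and> energy_1 M E (\<lambda>x. u x - v x) < e) \<and>
     (\<forall>u. continuous_on K u \<longrightarrow>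
        (\<forall>e>0. \<exists>v\<in>F. continuous_on K v \<and> (\<forall>x\<in>K. \<bar>u x - v x\<bar> < e)))"

definition ess_supp :: "'a::topological_space measure \<Rightarrow> ('a \<Rightarrow> real) \<Rightarrow> 'a set" where
  "ess_supp M u = {x \<in> space M. \<forall>U. open U \<and> x \<in> U \<longrightarrow> \<not> (AE y in M. y \<in> U \<longrightarrow> u y = 0)}"

definition strongly_local ::
  "'a::topological_space measure \<Rightarrow> ('a \<Rightarrow> real) set \<Rightarrow>
     (('a \<Rightarrow> real) \<Rightarrow> ('a \<Rightarrow> real) \<Rightarrow> real) \<Rightarrow> bool" where
  "strongly_local M F E \<longleftrightarrow>
     (\<forall>u\<in>F. \<forall>v\<in>F.
        (\<exists>U c. open U \<and> ess_supp M u \<subseteq> U \<and> (AE x in M. x \<in> U \<longrightarrow> v x = c)) \<longrightarrow> E u v = 0)"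

definition self_similar_form ::
  "nat \<Rightarrow> (nat \<Rightarrow> 'a \<Rightarrow> 'a) \<Rightarrow> ('a \<Rightarrow> real) set \<Rightarrow>
     (('a \<Rightarrow> real) \<Rightarrow> ('a \<Rightarrow> real) \<Rightarrow> real) \<Rightarrow> bool" where
  "self_similar_form N f F E \<longleftrightarrow>
     (\<forall>u\<in>F. \<forall>i<N. u \<circ> f i \<in> F) \<and>
     (\<exists>r>0. \<forall>u\<in>F. E u u = r * (\<Sum>i<N. E (u \<circ> f i) (u \<circ> f i)))"

text \<open>On the diagonal the integrand is \<open>0 / 0 = 0\<close>.\<close>

definition nonlocal_energy ::
  "'a::metric_space measure \<Rightarrow> real \<Rightarrow> real \<Rightarrow> ('a \<Rightarrow> real) \<Rightarrow> ennreal" where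
  "nonlocal_energy M \<alpha> \<beta> u =
     (\<integral>\<^sup>+ x. (\<integral>\<^sup>+ y. ennreal ((u x - u y)\<^sup>2 / dist x y powr (\<alpha> + \<beta>)) \<partial>M) \<partial>M)"

subsection \<open>The gasket\<close>

definition gasket_point :: "nat \<Rightarrow> plane" where
  "gasket_point i = [(0, 0), (1, 0), (1/2, sqrt 3 / 2)] ! i"

definition gasket_map :: "nat \<Rightarrow> plane \<Rightarrow> plane" where
  "gasket_map i x = (1/2) *\<^sub>R (x + gasket_point i)"

definition gasket :: "plane set" where
  "gasket = attractor 3 gasket_map"

definition gasket_dim :: real where
  "gasket_dim = log 2 3"

definition gasket_walk_dim :: real where
  "gasket_walk_dim = log 2 5"

definition gasket_measure :: "plane measure" where
  "gasket_measure = normalized_hausdorff gasket_dim gasket"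

definition gasket_cell :: "nat list \<Rightarrow> plane set" where
  "gasket_cell w = word_map gasket_map w ` gasket"

definition gasket_mean :: "(plane \<Rightarrow> real) \<Rightarrow> nat list \<Rightarrow> real" where
  "gasket_mean u w =
     (1 / measure gasket_measure (gasket_cell w)) * (LINT x:gasket_cell w|gasket_measure. u x)"

text \<open>Neighbouring pairs of words are ordered, so each unordered pair is counted twice; this does
  not matter as the seminorm is only used up to multiplicative constants. The same remark applies
  to \<open>carpet_energy\<close> below.\<close>

definition gasket_neighbours :: "nat \<Rightarrow> (nat list \<times> nat list) set" where
  "gasket_neighbours n =
     {(v, w). v \<in> words 3 n \<and> w \<in> words 3 n \<and> v \<noteq> w \<and> gasket_cell v \<inter> gasket_cell w \<noteq> {}}"

definition gasket_seminorm :: "(plane \<Rightarrow> real) \<Rightarrow> ennreal" where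
  "gasket_seminorm u =
     (SUP n \<in> {1..}. ennreal ((5/3) ^ n *
        (\<Sum>(v, w) \<in> gasket_neighbours n. (gasket_mean u v - gasket_mean u w)\<^sup>2)))"

definition gasket_local_form ::
  "(plane \<Rightarrow> real) set \<Rightarrow> ((plane \<Rightarrow> real) \<Rightarrow> (plane \<Rightarrow> real) \<Rightarrow> real) \<Rightarrow> bool" where
  "gasket_local_form F E \<longleftrightarrow>
     dirichlet_form gasket_measure F E \<and>
     regular_form gasket gasket_measure F E \<and>
     strongly_local gasket_measure F E \<and>
     self_similar_form 3 gasket_map F E \<and>
     F = {u \<in> L2 gasket_measure. gasket_seminorm u < \<infinity>} \<and>
     (\<exists>c>0. \<forall>u\<in>F. ennreal (E u u / c) \<le> gasket_seminorm u \<and>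
                  gasket_seminorm u \<le> ennreal (c * E u u))"

subsection \<open>The carpet\<close>

definition carpet_point :: "nat \<Rightarrow> plane" where
  "carpet_point i =
     [(0, 0), (1/2, 0), (1, 0), (1, 1/2), (1, 1), (1/2, 1), (0, 1), (0, 1/2)] ! i"

definition carpet_map :: "nat \<Rightarrow> plane \<Rightarrow> plane" where
  "carpet_map i x = (1/3) *\<^sub>R (x + 2 *\<^sub>R carpet_point i)"

definition carpet :: "plane set" where
  "carpet = attractor 8 carpet_map"

definition carpet_dim :: real where
  "carpet_dim = log 3 8"

definition carpet_measure :: "plane measure" where
  "carpet_measure = normalized_hausdorff carpet_dim carpet"

primrec carpet_vertices :: "nat \<Rightarrow> plane set" where
  "carpet_vertices 0 = carpet_point ` {..<8}"
| "carpet_vertices (Suc n) = (\<Union>i<8. carpet_map i ` carpet_vertices n)"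

definition carpet_cell_vertices :: "nat list \<Rightarrow> plane set" where
  "carpet_cell_vertices w = word_map carpet_map w ` carpet_vertices 0"

definition carpet_energy :: "nat \<Rightarrow> (plane \<Rightarrow> real) \<Rightarrow> real" where
  "carpet_energy n u =
     (\<Sum>w \<in> words 8 n.
        \<Sum>(p, q) \<in> {(p, q). p \<in> carpet_cell_vertices w \<and> q \<in> carpet_cell_vertices w \<and>
                          dist p q = 1 / (2 * 3 ^ n)}.
          (u p - u q)\<^sup>2)"

definition carpet_resistance :: "nat \<Rightarrow> real" where
  "carpet_resistance n =
     inverse (INF u \<in> {u. (\<forall>p \<in> carpet_vertices n \<inter> ({0} \<times> {0..1}). u p = 0) \<and>
                         (\<forall>p \<in> carpet_vertices n \<inter> ({1} \<times> {0..1}). u p = 1)}.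
                carpet_energy n u)"

definition carpet_resistance_factor :: "real \<Rightarrow> bool" where
  "carpet_resistance_factor \<rho> \<longleftrightarrow>
     \<rho> \<in> {7/6..3/2} \<and>
     (\<exists>c>0. \<forall>n\<ge>1. 1 / c \<le> carpet_resistance n / \<rho> ^ n \<and> carpet_resistance n / \<rho> ^ n \<le> c)"

definition carpet_walk_dim :: "real \<Rightarrow> real" where
  "carpet_walk_dim \<rho> = log 3 (8 * \<rho>)"

definition carpet_seminorm :: "real \<Rightarrow> (plane \<Rightarrow> real) \<Rightarrow> ennreal" where
  "carpet_seminorm \<rho> u =
     (SUP n \<in> {1..}. ennreal (3 powr ((carpet_walk_dim \<rho> - carpet_dim) * real n) * carpet_energy n u))"

text \<open>The seminorm depends on point values, so it is evaluated at continuous representatives; the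
  domain consists of the \<open>L\<^sup>2\<close> functions having a continuous version of finite seminorm.\<close>

definition carpet_local_form ::
  "real \<Rightarrow> (plane \<Rightarrow> real) set \<Rightarrow> ((plane \<Rightarrow> real) \<Rightarrow> (plane \<Rightarrow> real) \<Rightarrow> real) \<Rightarrow> bool" where
  "carpet_local_form \<rho> F E \<longleftrightarrow>
     dirichlet_form carpet_measure F E \<and>
     regular_form carpet carpet_measure F E \<and>
     strongly_local carpet_measure F E \<and>
     self_similar_form 8 carpet_map F E \<and>
     F = {u \<in> L2 carpet_measure.
            \<exists>v. continuous_on carpet v \<and> (AE x in carpet_measure. u x = v x) \<and>
                carpet_seminorm \<rho> v < \<infinity>} \<and>
     (\<exists>c>0. \<forall>u\<in>F. continuous_on carpet u \<longrightarrow>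
        ennreal (E u u / c) \<le> carpet_seminorm \<rho> u \<and>
        carpet_seminorm \<rho> u \<le> ennreal (c * E u u))"

end

theory Submission
  imports Defs
begin

text \<open>
  Let \<open>B\<^sub>n\<close> be the integral of \<open>(u x - u y)\<^sup>2\<close> over pairs of points at distance at most a multiple of
  \<open>L\<^sup>-\<^sup>n\<close>. The nonlocal energy is comparable to \<open>\<Sum>n. L powr ((\<alpha> + \<beta>) n) B\<^sub>n\<close>, so that multiplication with
  \<open>\<beta>* - \<beta>\<close> turns it into an Abel mean of \<open>b\<^sub>n = L powr ((\<alpha> + \<beta>*) n) B\<^sub>n\<close>. It remains to compare the local
  seminorm with the supremum of \<open>b\<^sub>n\<close> from above and with its lower limit from below.

  The upper estimates are telescoping arguments over cells, with cell averages (orthogonal increments) for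
  the gasket and with vertex values for the carpet. The lower estimate says that discrete energies are
  monotone in the level up to a constant. On the gasket this is a resistance estimate, obtained from the
  delta-star transformation. On the carpet, averages over level \<open>n\<close> cells are extended to a continuous function
  by gluing copies of a bilinear interpolation in two coordinate-like functions supplied by regularity.
  Self-similarity controls the energy of the extension, where the scaling constant of the form is at
  most \<open>\<rho>\<close> because one coordinate function competes in the definition of the resistances.\<close>

section \<open>Hausdorff measure\<close>

text \<open>The Abel means are asymptotically bounded below only by the lower limit of their terms,
  whereas the seminorm is a supremum over levels. Every level \<open>k\<close> must therefore be
  bounded by all later levels with one constant, and one-level estimates cannot be iterated. On the
  carpet there is a second obstacle: the discrete energies use point values, which integrals over
  pairs of points do not control. Averages over cells of level \<open>n\<close> are turned into a
  function whose energy is bounded at every level and which is uniformly close to \<open>u\<close>;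
  the comparison with \<open>u\<close> is made at a fixed level \<open>k\<close>, where only
  finitely many edges matter. The geometry enters through one fact: cells of level \<open>n\<close>
  sit at distinct points of a planar lattice scaled by \<open>1 / L ^ n\<close>. This bounds the
  number of neighbours, keeps disjoint cells uniformly apart and, by counting, makes the Hausdorff
  measure of the attractor positive.\<close>

lemma countably_subadditive_Un:
  fixes \<mu> :: "'a set \<Rightarrow> ennreal"
  assumes emp: "\<mu> {} = 0" and sub: "\<And>A :: nat \<Rightarrow> 'a set. \<mu> (\<Union>i. A i) \<le> (\<Sum>i. \<mu> (A i))"
  shows "\<mu> (A \<union> B) \<le> \<mu> A + \<mu> B"
proof -
  define X where "X i = (if i = 0 then A else if i = 1 then B else {})" for i :: nat
  have "A \<union> B = (\<Union>i. X i)" unfolding X_def by (auto split: if_splits)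
  then have "\<mu> (A \<union> B) \<le> (\<Sum>i. \<mu> (X i))" using sub[of X] by simp
  also have "\<dots> = (\<Sum>i\<in>{0,1}. \<mu> (X i))"
    by (rule suminf_finite) (auto simp: X_def emp)
  also have "\<dots> = \<mu> A + \<mu> B" by (simp add: X_def)
  finally show ?thesis .
qed

text \<open>The distance shells \<open>R k\<close> around \<open>F\<close> with indices of equal parity are mutually separated, so their
  measures are summable; hence \<open>A - F\<close> is approximated from inside by points far away from \<open>F\<close>.\<close>

lemma metric_outer_measure_closed:
  fixes \<mu> :: "'a::metric_space set \<Rightarrow> ennreal"
  assumes emp: "\<mu> {} = 0" and mono: "\<And>A B. A \<subseteq> B \<Longrightarrow> \<mu> A \<le> \<mu> B"
    and sub: "\<And>A :: nat \<Rightarrow> 'a set. \<mu> (\<Union>i. A i) \<le> (\<Sum>i. \<mu> (A i))"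
    and sep: "\<And>A B d. 0 < d \<Longrightarrow> (\<And>x y. x \<in> A \<Longrightarrow> y \<in> B \<Longrightarrow> d \<le> dist x y) \<Longrightarrow> \<mu> A + \<mu> B \<le> \<mu> (A \<union> B)"
    and F: "closed F"
  shows "\<mu> (A \<inter> F) + \<mu> (A - F) \<le> \<mu> A"
proof (cases "F = {} \<or> \<mu> A = \<infinity>")
  case True
  then show ?thesis using emp by auto
next
  case False
  then have F0: "F \<noteq> {}" and fin: "\<mu> A < \<infinity>" by (auto simp: top.not_eq_extremum)
  define B where "B n = {x \<in> A. 1 / real (n + 1) \<le> infdist x F}" for n :: nat
  define R where "R k = {x \<in> A. 1 / real (k + 2) \<le> infdist x F \<and> infdist x F < 1 / real (k + 1)}" for k :: nat
  have sep_infdist: "\<mu> X + \<mu> Y \<le> \<mu> (X \<union> Y)"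
    if "s < t" "\<And>x. x \<in> X \<Longrightarrow> t \<le> infdist x F" "\<And>y. y \<in> Y \<Longrightarrow> infdist y F \<le> s" for s t X Y
  proof (rule sep)
    show "0 < t - s" using that by simp
    fix x y assume "x \<in> X" "y \<in> Y"
    then have "t \<le> infdist x F" "infdist y F \<le> s" using that by auto
    moreover have "infdist x F \<le> infdist y F + dist x y" by (rule infdist_triangle)
    ultimately show "t - s \<le> dist x y" by simp
  qed
  have far: "\<mu> (A \<inter> F) + \<mu> (B n) \<le> \<mu> A" for n
  proof -
    have "\<mu> (B n) + \<mu> (A \<inter> F) \<le> \<mu> (B n \<union> (A \<inter> F))"
      by (rule sep_infdist[of 0 "1 / real (n + 1)"]) (auto simp: B_def)
    also have "\<dots> \<le> \<mu> A" by (rule mono) (auto simp: B_def)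
    finally show ?thesis by (simp add: add.commute)
  qed
  have parity: "(\<Sum>k<m. \<mu> (R (2 * k + p))) \<le> \<mu> (\<Union>k<m. R (2 * k + p))" for m p
  proof (induction m)
    case (Suc m)
    have "(\<Sum>k<Suc m. \<mu> (R (2 * k + p))) \<le> \<mu> (\<Union>k<m. R (2 * k + p)) + \<mu> (R (2 * m + p))"
      using Suc by (simp add: add_mono)
    also have "\<dots> \<le> \<mu> ((\<Union>k<m. R (2 * k + p)) \<union> R (2 * m + p))"
    \<comment> \<open>Here \<open>m = 0\<close> and the union is empty; the case is split off
      because the bound \<open>1 / real (2 * m + p)\<close> used below would be
      \<open>1 / 0 = 0\<close>.\<close>
    proof (cases "2 * m + p = 0")
      case True
      then show ?thesis by (simp add: emp)
    next
      case False
      show ?thesis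
      proof (rule sep_infdist[of "1 / real (2 * m + p + 1)" "1 / real (2 * m + p)"])
        show "1 / real (2 * m + p + 1) < 1 / real (2 * m + p)"
          using False by (intro divide_strict_left_mono) auto
        fix x assume "x \<in> (\<Union>k<m. R (2 * k + p))"
        then obtain k where k: "k < m" "1 / real (2 * k + p + 2) \<le> infdist x F" by (auto simp: R_def)
        have "1 / real (2 * m + p) \<le> 1 / real (2 * k + p + 2)"
          using k(1) by (intro divide_left_mono) (auto simp del: of_nat_add of_nat_mult)
        then show "1 / real (2 * m + p) \<le> infdist x F" using k by simp
      qed (auto simp: R_def)
    qed
    also have "\<dots> = \<mu> (\<Union>k<Suc m. R (2 * k + p))" by (simp add: lessThan_Suc Un_commute)
    finally show ?case .
  qed (simp add: emp)
  have parity': "(\<Sum>k<m. \<mu> (R (2 * k + p))) \<le> \<mu> A" for m p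
    by (rule order_trans[OF parity], rule mono) (auto simp: R_def)
  have two: "(\<Sum>k<2 * m. \<mu> (R k)) = (\<Sum>k<m. \<mu> (R (2 * k))) + (\<Sum>k<m. \<mu> (R (2 * k + 1)))" for m
    by (induction m) (auto simp: algebra_simps)
  have partial: "(\<Sum>k<m. \<mu> (R k)) \<le> 2 * \<mu> A" for m
  proof -
    have "(\<Sum>k<m. \<mu> (R k)) \<le> (\<Sum>k<2 * m. \<mu> (R k))" by (rule sum_mono2) auto
    also have "\<dots> \<le> \<mu> A + \<mu> A" unfolding two
      using parity'[where m=m and p=0] parity'[where m=m and p=1] by (simp add: add_mono)
    finally show ?thesis by (simp add: mult_2)
  qed
  have Rfin: "\<mu> (R k) < \<infinity>" for k
    using mono[of "R k" A] fin by (auto simp: R_def intro: le_less_trans)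
  define r where "r k = enn2real (\<mu> (R k))" for k
  have r: "\<mu> (R k) = ennreal (r k)" "0 \<le> r k" for k using Rfin[of k] by (auto simp: r_def)
  have summ: "summable r"
  proof (rule summableI_nonneg_bounded)
    show "0 \<le> r n" for n by (rule r)
    show "sum r {..<n} \<le> 2 * enn2real (\<mu> A)" for n
    proof -
      have "ennreal (sum r {..<n}) = (\<Sum>k<n. \<mu> (R k))" using r by (simp add: sum_ennreal)
      also have "\<dots> \<le> 2 * \<mu> A" by (rule partial)
      also have "\<dots> = ennreal (2 * enn2real (\<mu> A))" using fin by (simp add: ennreal_mult)
      finally show ?thesis by (subst (asm) ennreal_le_iff) auto
    qed
  qed
  show ?thesis
  proof (rule ennreal_le_epsilon)
    fix e :: real assume e: "0 < e"
    obtain n where n: "norm (\<Sum>k. r (k + n)) < e"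
      using suminf_exist_split[OF e summ] by auto
    \<comment> \<open>Points off the closed set \<open>F\<close> have positive distance to it. One
      outside \<open>B n\<close> lies in a shell of index at least \<open>n\<close>, so beyond
      \<open>B n\<close> only a tail of the summable sequence \<open>r\<close> is lost.\<close>
    have "A - F \<subseteq> B n \<union> (\<Union>k. R (k + n))"
    proof
      fix x assume x: "x \<in> A - F"
      then have pos: "0 < infdist x F"
        using F F0 in_closed_iff_infdist_zero[OF F F0, of x] infdist_nonneg[of x F] by (auto simp: less_le)
      show "x \<in> B n \<union> (\<Union>k. R (k + n))"
      proof (cases "x \<in> B n")
        case False
        then have lt: "infdist x F < 1 / real (n + 1)" using x by (auto simp: B_def)
        obtain j where "1 / real (Suc j) < infdist x F" using pos nat_approx_posE by blast
        then have ex: "\<exists>j. 1 / real (j + 2) \<le> infdist x F"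
          using pos by (intro exI[of _ j]) (simp add: field_simps)
        obtain j where j: "1 / real (j + 2) \<le> infdist x F"
            and least: "\<forall>i<j. \<not> 1 / real (i + 2) \<le> infdist x F"
          using exists_least_iff[THEN iffD1, OF ex] by blast
        have nj: "n \<le> j"
        proof (rule ccontr)
          assume "\<not> n \<le> j"
          then have "1 / real (n + 1) \<le> 1 / real (j + 2)" by (intro divide_left_mono) auto
          then show False using j lt by simp
        qed
        have "infdist x F < 1 / real (j + 1)"
        proof (cases "j = 0")
          case True then show ?thesis using nj lt by simp
        next
          case False
          then have "\<not> 1 / real ((j - 1) + 2) \<le> infdist x F" using least by (metis diff_less less_one neq0_conv)
          then show ?thesis using False by (simp add: not_le of_nat_diff algebra_simps)
        qed
        then have "x \<in> R j" using x j by (auto simp: R_def)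
        then show ?thesis using nj by (auto intro!: exI[of _ "j - n"])
      qed simp
    qed
    then have "\<mu> (A - F) \<le> \<mu> (B n \<union> (\<Union>k. R (k + n)))" by (rule mono)
    also have "\<dots> \<le> \<mu> (B n) + \<mu> (\<Union>k. R (k + n))" by (rule countably_subadditive_Un[OF emp sub])
    also have "\<dots> \<le> \<mu> (B n) + (\<Sum>k. \<mu> (R (k + n)))" by (intro add_left_mono sub)
    also have "(\<Sum>k. \<mu> (R (k + n))) = ennreal (\<Sum>k. r (k + n))"
      unfolding r using summ by (intro suminf_ennreal2) (auto simp: r summable_ignore_initial_segment)
    also have "\<dots> \<le> ennreal e" using n by (intro ennreal_leI) auto
    finally have "\<mu> (A - F) \<le> \<mu> (B n) + ennreal e" by (simp add: add_left_mono)
    then have "\<mu> (A \<inter> F) + \<mu> (A - F) \<le> \<mu> (A \<inter> F) + \<mu> (B n) + ennreal e"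
      by (simp add: add_left_mono add.assoc)
    also have "\<dots> \<le> \<mu> A + ennreal e" by (intro add_right_mono far)
    finally show "\<mu> (A \<inter> F) + \<mu> (A - F) \<le> \<mu> A + ennreal e" .
  qed
qed

text \<open>Caratheodory: the sets that split every test set additively form a sigma-algebra on
  which \<open>\<mu>\<close> is a measure. Closed sets split by the preceding lemma, and they
  generate the Borel sets.\<close>

lemma metric_outer_measure_borel:
  fixes \<mu> :: "'a::metric_space set \<Rightarrow> ennreal"
  assumes emp: "\<mu> {} = 0" and mono: "\<And>A B. A \<subseteq> B \<Longrightarrow> \<mu> A \<le> \<mu> B"
    and sub: "\<And>A :: nat \<Rightarrow> 'a set. \<mu> (\<Union>i. A i) \<le> (\<Sum>i. \<mu> (A i))"
    and sep: "\<And>A B d. 0 < d \<Longrightarrow> (\<And>x y. x \<in> A \<Longrightarrow> y \<in> B \<Longrightarrow> d \<le> dist x y) \<Longrightarrow> \<mu> A + \<mu> B \<le> \<mu> (A \<union> B)"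
  shows "measure_space UNIV (sets borel) \<mu>"
proof -
  interpret P: sigma_algebra UNIV "Pow UNIV :: 'a set set" by (rule sigma_algebra_Pow)
  have oms: "outer_measure_space (Pow UNIV) \<mu>"
    using emp mono sub
    by (auto simp: outer_measure_space_def positive_def increasing_def countably_subadditive_def)
  let ?L = "lambda_system UNIV (Pow UNIV) \<mu>"
  have L: "measure_space UNIV ?L \<mu>" using P.caratheodory_lemma[OF oms] .
  then have salg: "sigma_algebra UNIV ?L" by (simp add: measure_space_def)
  have closed: "F \<in> ?L" if "closed F" for F
  proof -
    have "\<mu> (A \<inter> F) + \<mu> (A - F) = \<mu> A" for A
    proof (rule antisym)
      show "\<mu> (A \<inter> F) + \<mu> (A - F) \<le> \<mu> A"
        using emp mono sub sep that by (rule metric_outer_measure_closed)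
      show "\<mu> A \<le> \<mu> (A \<inter> F) + \<mu> (A - F)"
        using countably_subadditive_Un[of \<mu> "A \<inter> F" "A - F", OF emp sub] by (simp add: Int_Diff_Un)
    qed
    then have "\<forall>A\<in>Pow UNIV. \<mu> (A \<inter> F) + \<mu> (A - F) = \<mu> A" by blast
    then show ?thesis unfolding P.lambda_system_eq by blast
  qed
  have "sets borel \<subseteq> ?L"
    unfolding borel_eq_closed using closed sigma_algebra.sigma_sets_subset[OF salg, of "{S. closed S}"]
    by (subst sets_measure_of) auto
  moreover have "sigma_algebra UNIV (sets borel :: 'a set set)"
    using sets.sigma_algebra_axioms[of "borel :: 'a measure"] by simp
  ultimately show ?thesis using measure_down[OF L] by blast
qed

section \<open>The Hausdorff premeasures and the Hausdorff measure\<close>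

lemma hausdorff_premeasure_le:
  assumes "A \<subseteq> (\<Union>i. U i)" "\<And>i. bounded (U i)" "\<And>i. diameter (U i) \<le> \<delta>"
  shows "hausdorff_premeasure \<delta> s A \<le> (\<Sum>i. ennreal (diameter (U i) powr s))"
  unfolding hausdorff_premeasure_def using assms by (intro INF_lower) auto

lemma hausdorff_premeasure_greatest:
  assumes "\<And>U. A \<subseteq> (\<Union>i. U i) \<Longrightarrow> (\<And>i. bounded (U i)) \<Longrightarrow> (\<And>i. diameter (U i) \<le> \<delta>) \<Longrightarrow>
    c \<le> (\<Sum>i. ennreal (diameter (U i) powr s))"
  shows "c \<le> hausdorff_premeasure \<delta> s A"
  unfolding hausdorff_premeasure_def using assms by (intro INF_greatest) auto

lemma hausdorff_premeasure_antimono: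
  "\<delta> \<le> \<delta>' \<Longrightarrow> hausdorff_premeasure \<delta>' s A \<le> hausdorff_premeasure \<delta> s A"
  by (rule hausdorff_premeasure_greatest) (blast intro: hausdorff_premeasure_le order_trans)

lemma hausdorff_premeasure_mono:
  "A \<subseteq> B \<Longrightarrow> hausdorff_premeasure \<delta> s A \<le> hausdorff_premeasure \<delta> s B"
  by (rule hausdorff_premeasure_greatest) (blast intro: hausdorff_premeasure_le order_trans)

lemma hausdorff_premeasure_empty:
  assumes "0 \<le> \<delta>" shows "hausdorff_premeasure \<delta> s {} = 0"
  using hausdorff_premeasure_le[of "{}" "\<lambda>_. {}" \<delta> s] assms by simp

text \<open>Near-optimal covers of the pieces, with excess below \<open>e / 2 ^ (i + 1)\<close> for
  the \<open>i\<close>-th, are merged into one sequence along a pairing of indices. An infinite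
  premeasure admits no cover with strictly smaller sum than itself plus an excess, hence the case
  distinction.\<close>

lemma hausdorff_premeasure_countable_subadditive:
  fixes A :: "nat \<Rightarrow> 'a::metric_space set"
  shows "hausdorff_premeasure \<delta> s (\<Union>i. A i) \<le> (\<Sum>i. hausdorff_premeasure \<delta> s (A i))"
proof (cases "\<exists>i. hausdorff_premeasure \<delta> s (A i) = \<infinity>")
  case True
  then obtain i where "hausdorff_premeasure \<delta> s (A i) = \<infinity>" by auto
  then have "(\<Sum>i. hausdorff_premeasure \<delta> s (A i)) = \<infinity>"
    using sum_le_suminf[of "\<lambda>i. hausdorff_premeasure \<delta> s (A i)" "{i}"] by (auto simp: top_unique)
  then show ?thesis by simp
next
  case False
  show ?thesis
  proof (rule ennreal_le_epsilon)
    fix e :: real assume e: "0 < e"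
    have "\<exists>U. A i \<subseteq> (\<Union>j. U j) \<and> (\<forall>j. bounded (U j) \<and> diameter (U j) \<le> \<delta>) \<and>
      (\<Sum>j. ennreal (diameter (U j) powr s)) < hausdorff_premeasure \<delta> s (A i) + ennreal (e * (1/2)^Suc i)" for i
    proof -
      have "hausdorff_premeasure \<delta> s (A i) < hausdorff_premeasure \<delta> s (A i) + ennreal (e * (1/2)^Suc i)"
        using False e by (cases "hausdorff_premeasure \<delta> s (A i)")
          (auto simp del: power_Suc ennreal_plus simp: ennreal_plus[symmetric] ennreal_less_iff)
      then show ?thesis unfolding hausdorff_premeasure_def[of \<delta> s "A i"] INF_less_iff by blast
    qed
    then obtain U where U: "\<And>i. A i \<subseteq> (\<Union>j. U i j)" "\<And>i j. bounded (U i j)" "\<And>i j. diameter (U i j) \<le> \<delta>"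
      "\<And>i. (\<Sum>j. ennreal (diameter (U i j) powr s)) < hausdorff_premeasure \<delta> s (A i) + ennreal (e * (1/2)^Suc i)"
      by metis
    define V where "V k = (case prod_decode k of (i, j) \<Rightarrow> U i j)" for k
    have "(\<Union>i. A i) \<subseteq> (\<Union>k. V k)"
    proof
      fix x assume "x \<in> (\<Union>i. A i)"
      then obtain i j where "x \<in> U i j" using U(1) by blast
      then show "x \<in> (\<Union>k. V k)" by (auto simp: V_def intro!: exI[of _ "prod_encode (i, j)"])
    qed
    then have "hausdorff_premeasure \<delta> s (\<Union>i. A i) \<le> (\<Sum>k. ennreal (diameter (V k) powr s))"
      by (rule hausdorff_premeasure_le) (simp_all add: V_def U split: prod.split)
    also have "\<dots> = (\<Sum>k. (\<lambda>(i, j). ennreal (diameter (U i j) powr s)) (prod_decode k))"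
      by (intro suminf_cong) (simp add: V_def split: prod.split)
    also have "\<dots> = (\<Sum>i. \<Sum>j. ennreal (diameter (U i j) powr s))"
      by (rule suminf_ennreal_2dimen) simp
    also have "\<dots> \<le> (\<Sum>i. hausdorff_premeasure \<delta> s (A i) + ennreal (e * (1/2)^Suc i))"
      using U(4) by (intro suminf_le) (auto intro: less_imp_le)
    also have "\<dots> = (\<Sum>i. hausdorff_premeasure \<delta> s (A i)) + (\<Sum>i. ennreal (e * (1/2)^Suc i))"
      by (rule suminf_add[symmetric]) auto
    also have "(\<Sum>i. ennreal (e * (1/2)^Suc i)) = ennreal e"
      using e sums_mult[OF power_half_series, of e] by (intro suminf_ennreal_eq) auto
    finally show "hausdorff_premeasure \<delta> s (\<Union>i. A i) \<le> (\<Sum>i. hausdorff_premeasure \<delta> s (A i)) + ennreal e" .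
  qed
qed

text \<open>A covering set of diameter below the gap \<open>d\<close> meets at most one of the two
  sets, so a cover of the union splits into two disjoint subfamilies. Discarded members become
  \<open>{}\<close>, whose diameter contributes 0.\<close>

lemma hausdorff_premeasure_separated:
  fixes A B :: "'a::metric_space set"
  assumes "\<delta> < d" and far: "\<And>x y. x \<in> A \<Longrightarrow> y \<in> B \<Longrightarrow> d \<le> dist x y"
  shows "hausdorff_premeasure \<delta> s A + hausdorff_premeasure \<delta> s B \<le> hausdorff_premeasure \<delta> s (A \<union> B)"
proof (rule hausdorff_premeasure_greatest)
  fix U :: "nat \<Rightarrow> 'a set"
  assume U: "A \<union> B \<subseteq> (\<Union>i. U i)" "\<And>i. bounded (U i)" "\<And>i. diameter (U i) \<le> \<delta>"
  define V where "V i = (if U i \<inter> A = {} then {} else U i)" for i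
  define W where "W i = (if U i \<inter> B = {} then {} else U i)" for i
  have \<delta>: "0 \<le> \<delta>" using U(3)[of 0] diameter_ge_0[OF U(2)[of 0]] by simp
  have disj: "U i \<inter> A = {} \<or> U i \<inter> B = {}" for i
  proof (rule ccontr)
    assume "\<not> ?thesis"
    then obtain x y where "x \<in> U i" "x \<in> A" "y \<in> U i" "y \<in> B" by blast
    then have "d \<le> dist x y" "dist x y \<le> diameter (U i)" using far diameter_bounded_bound[OF U(2)] by auto
    then show False using U(3)[of i] assms(1) by simp
  qed
  have "hausdorff_premeasure \<delta> s A \<le> (\<Sum>i. ennreal (diameter (V i) powr s))"
  proof (rule hausdorff_premeasure_le)
    show "A \<subseteq> (\<Union>i. V i)"
    proof
      fix x assume "x \<in> A"
      moreover from this obtain i where "x \<in> U i" using U(1) by blast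
      ultimately have "x \<in> V i" by (auto simp: V_def)
      then show "x \<in> (\<Union>i. V i)" by blast
    qed
  qed (use U \<delta> in \<open>simp_all add: V_def\<close>)
  moreover have "hausdorff_premeasure \<delta> s B \<le> (\<Sum>i. ennreal (diameter (W i) powr s))"
  proof (rule hausdorff_premeasure_le)
    show "B \<subseteq> (\<Union>i. W i)"
    proof
      fix x assume "x \<in> B"
      moreover from this obtain i where "x \<in> U i" using U(1) by blast
      ultimately have "x \<in> W i" by (auto simp: W_def)
      then show "x \<in> (\<Union>i. W i)" by blast
    qed
  qed (use U \<delta> in \<open>simp_all add: W_def\<close>)
  ultimately have "hausdorff_premeasure \<delta> s A + hausdorff_premeasure \<delta> s B \<le>
      (\<Sum>i. ennreal (diameter (V i) powr s)) + (\<Sum>i. ennreal (diameter (W i) powr s))"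
    by (rule add_mono)
  also have "\<dots> = (\<Sum>i. ennreal (diameter (V i) powr s) + ennreal (diameter (W i) powr s))"
    by (rule suminf_add) auto
  also have "\<dots> \<le> (\<Sum>i. ennreal (diameter (U i) powr s))"
    using disj by (intro suminf_le) (auto simp: V_def W_def)
  finally show "hausdorff_premeasure \<delta> s A + hausdorff_premeasure \<delta> s B \<le> (\<Sum>i. ennreal (diameter (U i) powr s))" .
qed

lemma hausdorff_premeasure_le_outer:
  "0 < \<delta> \<Longrightarrow> hausdorff_premeasure \<delta> s A \<le> hausdorff_outer s A"
  unfolding hausdorff_outer_def by (intro SUP_upper) auto

lemma hausdorff_outer_mono: "A \<subseteq> B \<Longrightarrow> hausdorff_outer s A \<le> hausdorff_outer s B"
  unfolding hausdorff_outer_def by (intro SUP_mono') (rule hausdorff_premeasure_mono)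

text \<open>\<open>measure_of\<close> takes the intended values only if the given set function
  really is a measure on the Borel sets; the point is therefore that the Hausdorff outer measure is
  a metric outer measure.\<close>

lemma emeasure_hausdorff_measure:
  fixes A :: "'a::metric_space set"
  assumes "A \<in> sets borel"
  shows "emeasure (hausdorff_measure s) A = hausdorff_outer s A"
proof -
  have "measure_space UNIV (sets borel) (hausdorff_outer s :: 'a set \<Rightarrow> ennreal)"
  proof (rule metric_outer_measure_borel)
    show "hausdorff_outer s {} = 0" unfolding hausdorff_outer_def by (simp add: hausdorff_premeasure_empty)
    show "hausdorff_outer s A \<le> hausdorff_outer s B" if "A \<subseteq> B" for A B :: "'a set"
      using that by (rule hausdorff_outer_mono)
    show "hausdorff_outer s (\<Union>i. A i) \<le> (\<Sum>i. hausdorff_outer s (A i))" for A :: "nat \<Rightarrow> 'a set"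
      unfolding hausdorff_outer_def[of s "\<Union>i. A i"]
    proof (rule SUP_least)
      fix \<delta> :: real assume "\<delta> \<in> {0<..}"
      then show "hausdorff_premeasure \<delta> s (\<Union>i. A i) \<le> (\<Sum>i. hausdorff_outer s (A i))"
        by (intro order_trans[OF hausdorff_premeasure_countable_subadditive] suminf_le)
          (auto intro: hausdorff_premeasure_le_outer)
    qed
    fix A B :: "'a set" and d :: real
    assume d: "0 < d" "\<And>x y. x \<in> A \<Longrightarrow> y \<in> B \<Longrightarrow> d \<le> dist x y"
    \<comment> \<open>The two suprema run over independent scales; passing to a common scale below
      the gap \<open>d\<close> decreases neither premeasure.\<close>
    have *: "hausdorff_premeasure \<delta> s A + hausdorff_premeasure \<delta>' s B \<le> hausdorff_outer s (A \<union> B)"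
      if "0 < \<delta>" "0 < \<delta>'" for \<delta> \<delta>'
    proof -
      define \<epsilon> where "\<epsilon> = min (min \<delta> \<delta>') (d / 2)"
      have "hausdorff_premeasure \<delta> s A + hausdorff_premeasure \<delta>' s B \<le>
          hausdorff_premeasure \<epsilon> s A + hausdorff_premeasure \<epsilon> s B"
        by (intro add_mono hausdorff_premeasure_antimono) (auto simp: \<epsilon>_def)
      also have "\<dots> \<le> hausdorff_premeasure \<epsilon> s (A \<union> B)"
        using d by (intro hausdorff_premeasure_separated[of _ d]) (auto simp: \<epsilon>_def)
      also have "\<dots> \<le> hausdorff_outer s (A \<union> B)"
        using that d by (intro hausdorff_premeasure_le_outer) (auto simp: \<epsilon>_def)
      finally show ?thesis .
    qed
    show "hausdorff_outer s A + hausdorff_outer s B \<le> hausdorff_outer s (A \<union> B)"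
    proof -
      have "hausdorff_outer s A + hausdorff_outer s B =
          (SUP \<delta>\<in>{0<..}. hausdorff_premeasure \<delta> s A + hausdorff_outer s B)"
        unfolding hausdorff_outer_def[of s A] by (rule ennreal_SUP_add_left[OF greaterThan_non_empty, symmetric])
      also have "\<dots> = (SUP \<delta>\<in>{0<..}. SUP \<delta>'\<in>{0<..}. hausdorff_premeasure \<delta> s A + hausdorff_premeasure \<delta>' s B)"
        unfolding hausdorff_outer_def[of s B] ennreal_SUP_add_right[OF greaterThan_non_empty] ..
      also have "\<dots> \<le> hausdorff_outer s (A \<union> B)" using * by (intro SUP_least) auto
      finally show ?thesis .
    qed
  qed
  then show ?thesis
    unfolding hausdorff_measure_def using assms
    by (subst emeasure_measure_of_sigma)
       (auto simp: measure_space_def intro: sets.sigma_algebra_axioms[of borel, simplified])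
qed

lemma sets_hausdorff_measure: "sets (hausdorff_measure s :: 'a::metric_space measure) = sets borel"
  using sets.sigma_sets_eq[of "borel :: 'a measure"] by (simp add: hausdorff_measure_def)

lemma space_hausdorff_measure: "space (hausdorff_measure s) = UNIV"
  by (simp add: hausdorff_measure_def)

text \<open>The image of a cover at scale \<open>\<delta> / c\<close> is a cover at scale
  \<open>\<delta>\<close>, with sums multiplied by at most \<open>c powr s\<close>. Applied to word
  maps and to their inverses it yields the exact measure of cells.\<close>

lemma hausdorff_outer_lipschitz_image:
  fixes g :: "'a::metric_space \<Rightarrow> 'b::metric_space"
  assumes c: "0 < c" and s: "0 \<le> s" and lip: "\<And>x y. dist (g x) (g y) \<le> c * dist x y"
  shows "hausdorff_outer s (g ` A) \<le> ennreal (c powr s) * hausdorff_outer s A"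
  unfolding hausdorff_outer_def[of s "g ` A"]
proof (rule SUP_least)
  fix \<delta> :: real assume "\<delta> \<in> {0<..}"
  then have \<delta>: "0 < \<delta> / c" using c by simp
  have "hausdorff_premeasure \<delta> s (g ` A) / ennreal (c powr s) \<le> hausdorff_premeasure (\<delta> / c) s A"
  proof (rule hausdorff_premeasure_greatest)
    fix U :: "nat \<Rightarrow> 'a set"
    assume U: "A \<subseteq> (\<Union>i. U i)" "\<And>i. bounded (U i)" "\<And>i. diameter (U i) \<le> \<delta> / c"
    have bd: "bounded (g ` U i)" for i
    proof -
      obtain x e where "\<forall>y\<in>U i. dist x y \<le> e" using U(2)[of i] unfolding bounded_def by auto
      then have "\<forall>y\<in>U i. dist (g x) (g y) \<le> c * e"
        using lip c by (meson mult_left_mono order_trans less_imp_le)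
      then show ?thesis unfolding bounded_def by (intro exI[of _ "g x"] exI[of _ "c * e"]) auto
    qed
    have diam: "diameter (g ` U i) \<le> c * diameter (U i)" for i
    proof (cases "U i = {}")
      case False
      have "dist (g x) (g y) \<le> c * diameter (U i)" if "x \<in> U i" "y \<in> U i" for x y
        using lip[of x y] diameter_bounded_bound[OF U(2) that] c by (meson mult_left_mono order_trans less_imp_le)
      then show ?thesis using False unfolding diameter_def by (auto intro!: cSUP_least)
    qed simp
    have "hausdorff_premeasure \<delta> s (g ` A) \<le> (\<Sum>i. ennreal (diameter (g ` U i) powr s))"
    proof (rule hausdorff_premeasure_le)
      show "g ` A \<subseteq> (\<Union>i. g ` U i)" using U(1) by blast
      show "diameter (g ` U i) \<le> \<delta>" for i
        using diam[of i] U(3)[of i] c by (simp add: field_simps)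
    qed (rule bd)
    also have "\<dots> \<le> (\<Sum>i. ennreal (c powr s) * ennreal (diameter (U i) powr s))"
    proof (rule suminf_le)
      fix i
      have "diameter (g ` U i) powr s \<le> (c * diameter (U i)) powr s"
        using diam diameter_ge_0[OF bd] s by (intro powr_mono2) auto
      also have "\<dots> = c powr s * diameter (U i) powr s"
        by (rule powr_mult)
      finally show "ennreal (diameter (g ` U i) powr s) \<le> ennreal (c powr s) * ennreal (diameter (U i) powr s)"
        by (simp add: ennreal_mult[symmetric] ennreal_leI)
    qed auto
    also have "\<dots> = ennreal (c powr s) * (\<Sum>i. ennreal (diameter (U i) powr s))" by simp
    finally show "hausdorff_premeasure \<delta> s (g ` A) / ennreal (c powr s) \<le> (\<Sum>i. ennreal (diameter (U i) powr s))"
      using c by (intro divide_le_posI_ennreal) (auto simp: mult.commute)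
  qed
  also have "\<dots> \<le> hausdorff_outer s A" using \<delta> by (rule hausdorff_premeasure_le_outer)
  finally have "ennreal (c powr s) * (hausdorff_premeasure \<delta> s (g ` A) / ennreal (c powr s))
      \<le> ennreal (c powr s) * hausdorff_outer s A" by (rule mult_left_mono) simp
  also have "ennreal (c powr s) * (hausdorff_premeasure \<delta> s (g ` A) / ennreal (c powr s)) =
      hausdorff_premeasure \<delta> s (g ` A)"
    by (subst ennreal_times_divide, subst mult.commute, rule ennreal_mult_divide_eq) (use c in auto)
  finally show "hausdorff_premeasure \<delta> s (g ` A) \<le> ennreal (c powr s) * hausdorff_outer s A" .
qed

section \<open>Words\<close>

lemma words_0: "words N 0 = {[]}"
  by (auto simp: words_def)

lemma words_Suc: "words N (Suc n) = (\<lambda>(i, w). i # w) ` ({..<N} \<times> words N n)"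
  by (fastforce simp: words_def length_Suc_conv image_iff)

lemma append_in_words: "v \<in> words N n \<Longrightarrow> w \<in> words N m \<Longrightarrow> v @ w \<in> words N (n + m)"
  by (auto simp: words_def)

lemma length_words: "w \<in> words N n \<Longrightarrow> length w = n"
  by (simp add: words_def)

lemma take_drop_words:
  assumes "w \<in> words N (n + m)"
  shows "take n w \<in> words N n" "drop n w \<in> words N m" "take n w @ drop n w = w"
  using assms by (auto simp: words_def dest: in_set_takeD in_set_dropD)

lemma bij_betw_append_words:
  "bij_betw (\<lambda>(v, w). v @ w) (words N n \<times> words N m) (words N (n + m))"
proof (rule bij_betwI[where g = "\<lambda>w. (take n w, drop n w)"])
qed (auto simp: append_in_words take_drop_words length_words)

lemma card_words: "card (words N n) = N ^ n"
proof (induction n)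
  case (Suc n)
  have "inj_on (\<lambda>(i, w). i # w) ({..<N} \<times> words N n)" by (auto simp: inj_on_def)
  then show ?case unfolding words_Suc by (subst card_image) (auto simp: card_cartesian_product Suc)
qed (simp add: words_0)

lemma finite_words [simp]: "finite (words N n)"
  by (induction n) (auto simp: words_0 words_Suc)

lemma sum_words_append:
  fixes g :: "nat list \<Rightarrow> 'b::comm_monoid_add"
  shows "(\<Sum>w\<in>words N (n + m). g w) = (\<Sum>v\<in>words N n. \<Sum>w\<in>words N m. g (v @ w))"
  using sum.reindex_bij_betw[OF bij_betw_append_words, of g N n m]
  by (simp add: sum.cartesian_product case_prod_unfold)

lemma sum_words_1:
  fixes g :: "nat list \<Rightarrow> 'b::comm_monoid_add"
  shows "(\<Sum>w\<in>words N (Suc 0). g w) = (\<Sum>i<N. g [i])"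
proof -
  have "words N (Suc 0) = (\<lambda>i. [i]) ` {..<N}" by (auto simp: words_Suc words_0)
  then show ?thesis by (simp add: sum.reindex inj_on_def)
qed

lemma sum_words_snoc:
  fixes g :: "nat list \<Rightarrow> 'b::comm_monoid_add"
  shows "(\<Sum>w\<in>words N (Suc n). g w) = (\<Sum>v\<in>words N n. \<Sum>i<N. g (v @ [i]))"
  using sum_words_append[of g N n 1] by (simp add: sum_words_1)

lemma word_map_append: "word_map f (v @ w) x = word_map f v (word_map f w x)"
  by (induction v) auto

text \<open>Base-\<open>L\<close> value of the word read through the digit map \<open>a\<close>,
  first letter most significant. For the two digit maps of a planar system these values are the
  lattice coordinates of a cell.\<close>

primrec digit_value :: "nat \<Rightarrow> (nat \<Rightarrow> nat) \<Rightarrow> nat list \<Rightarrow> nat" where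
  "digit_value L a [] = 0"
| "digit_value L a (i # w) = L ^ length w * a i + digit_value L a w"

section \<open>Self-similar sets with digits on a planar lattice\<close>

text \<open>A common frame for both fractals: every map has ratio \<open>1 / L\<close> and
  translates by a lattice vector with digits below \<open>L\<close>. Hence words of level
  \<open>n\<close> occupy distinct points of a scaled lattice, and \<open>\<kappa>\<close>, which
  bounds lattice coordinates by the norm, turns closeness of cells into finiteness of relative
  positions.\<close>

locale lattice_ifs =
  fixes N L :: nat and a b :: "nat \<Rightarrow> nat" and e1 e2 :: plane and \<kappa> :: real
    and f :: "nat \<Rightarrow> plane \<Rightarrow> plane"
  assumes N: "2 \<le> N" and L: "2 \<le> L"
    and f: "\<And>i x. i < N \<Longrightarrow> f i x = (1 / real L) *\<^sub>R (x + (real (a i) *\<^sub>R e1 + real (b i) *\<^sub>R e2))"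
    and digits: "\<And>i. i < N \<Longrightarrow> a i < L \<and> b i < L"
    and digits_inj: "inj_on (\<lambda>i. (a i, b i)) {..<N}"
    and basis: "0 < \<kappa>" "\<And>s t. \<bar>s\<bar> \<le> \<kappa> * norm (s *\<^sub>R e1 + t *\<^sub>R e2)"
      "\<And>s t. \<bar>t\<bar> \<le> \<kappa> * norm (s *\<^sub>R e1 + t *\<^sub>R e2)"
begin

definition K :: "plane set" where "K = attractor N f"
definition cell :: "nat list \<Rightarrow> plane set" where "cell w = word_map f w ` K"
definition offset :: "nat list \<Rightarrow> plane" where
  "offset w = real (digit_value L a w) *\<^sub>R e1 + real (digit_value L b w) *\<^sub>R e2"
definition \<alpha> :: real where "\<alpha> = log (real L) (real N)"
definition \<nu> :: "plane measure" where "\<nu> = normalized_hausdorff \<alpha> K"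

lemma L_pos [simp]: "0 < L" "L \<noteq> 0" "Suc 0 < L" "L \<noteq> Suc 0" using L by auto
lemma N_pos [simp]: "0 < N" "N \<noteq> 0" "Suc 0 < N" "N \<noteq> Suc 0" using N by auto

lemma L_powr_alpha: "real L powr \<alpha> = real N"
  by (simp add: \<alpha>_def)

lemma alpha_pos: "0 < \<alpha>"
  by (simp add: \<alpha>_def log_def)

lemma L_power_powr_alpha: "(real L ^ n) powr \<alpha> = real N ^ n"
proof -
  have "(real L ^ n) powr \<alpha> = (real L powr \<alpha>) ^ n"
    by (simp add: powr_realpow[symmetric] powr_powr mult.commute powr_power)
  then show ?thesis by (simp add: L_powr_alpha)
qed

lemma word_map_eq:
  assumes "w \<in> words N n"
  shows "word_map f w x = (1 / real L ^ n) *\<^sub>R (x + offset w)"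
  using assms
proof (induction w arbitrary: n)
  case Nil
  then show ?case by (simp add: words_def offset_def)
next
  case (Cons i w)
  then obtain m where m: "n = Suc m" "i < N" "w \<in> words N m"
    by (cases n) (auto simp: words_def)
  have len: "length w = m" using m by (simp add: words_def)
  have "word_map f (i # w) x = (1 / real L) *\<^sub>R ((1 / real L ^ m) *\<^sub>R (x + offset w) +
      (real (a i) *\<^sub>R e1 + real (b i) *\<^sub>R e2))"
    using Cons.IH[OF m(3)] m by (simp add: f)
  also have "\<dots> = (1 / real L ^ n) *\<^sub>R (x + offset w +
      real L ^ m *\<^sub>R (real (a i) *\<^sub>R e1 + real (b i) *\<^sub>R e2))"
    by (simp add: m(1) scaleR_add_right)
  also have "x + offset w + real L ^ m *\<^sub>R (real (a i) *\<^sub>R e1 + real (b i) *\<^sub>R e2) = x + offset (i # w)"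
    by (simp add: offset_def len scaleR_add_right scaleR_add_left)
  finally show ?case .
qed

lemma dist_word_map:
  assumes "w \<in> words N n"
  shows "dist (word_map f w x) (word_map f w y) = dist x y / real L ^ n"
proof -
  have "word_map f w x - word_map f w y = (1 / real L ^ n) *\<^sub>R (x - y)"
    by (simp add: word_map_eq[OF assms] scaleR_diff_right[symmetric])
  then show ?thesis by (simp add: dist_norm)
qed

lemma word_map_inj: "w \<in> words N n \<Longrightarrow> word_map f w x = word_map f w y \<Longrightarrow> x = y"
  by (simp add: word_map_eq)

lemma singleton_words: "i < N \<Longrightarrow> [i] \<in> words N (Suc 0)"
  by (simp add: words_def)

lemma continuous_word_map: "w \<in> words N n \<Longrightarrow> continuous_on S (word_map f w)"
  by (subst continuous_on_cong[OF refl word_map_eq]) (auto intro!: continuous_intros)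

lemma digit_value_less:
  assumes "w \<in> words N n" "\<And>i. i < N \<Longrightarrow> c i < L"
  shows "digit_value L c w < L ^ n"
  using assms(1)
proof (induction w arbitrary: n)
  case (Cons i w)
  then obtain m where m: "n = Suc m" "i < N" "w \<in> words N m"
    by (cases n) (auto simp: words_def)
  have len: "length w = m" using m by (simp add: words_def)
  have "digit_value L c (i # w) < L ^ m * c i + L ^ m" using Cons.IH[OF m(3)] by (simp add: len)
  also have "\<dots> = L ^ m * (c i + 1)" by simp
  also have "\<dots> \<le> L ^ m * L" using assms(2)[OF m(2)] by (intro mult_left_mono) auto
  finally show ?case by (simp add: m mult.commute)
qed (simp add: words_def)

text \<open>Uniqueness of base-\<open>L\<close> expansions: division by \<open>L ^ m\<close>
  isolates the leading digit, and the two leading digits determine the letter.\<close>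

lemma offset_inj:
  assumes "v \<in> words N n" "w \<in> words N n"
    "digit_value L a v = digit_value L a w" "digit_value L b v = digit_value L b w"
  shows "v = w"
  using assms
proof (induction v arbitrary: w n)
  case Nil
  then show ?case by (auto simp: words_def)
next
  case (Cons i v)
  then obtain m where m: "n = Suc m" "i < N" "v \<in> words N m" by (cases n) (auto simp: words_def)
  then obtain j u where w: "w = j # u" "j < N" "u \<in> words N m"
    using Cons.prems(2) by (cases w) (auto simp: words_def)
  have len: "length v = m" "length u = m" using m w by (auto simp: words_def)
  have *: "c i = c j \<and> digit_value L c v = digit_value L c u"
    if "\<And>i. i < N \<Longrightarrow> c i < L" "digit_value L c (i # v) = digit_value L c w" for c
  proof -
    have lt: "digit_value L c v < L ^ m" "digit_value L c u < L ^ m"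
      using that(1) m w digit_value_less by auto
    have eq: "L ^ m * c i + digit_value L c v = L ^ m * c j + digit_value L c u"
      using that(2) w len by simp
    then have "(L ^ m * c i + digit_value L c v) div L ^ m = (L ^ m * c j + digit_value L c u) div L ^ m" by simp
    then have "c i = c j" using lt by simp
    then show ?thesis using eq by simp
  qed
  have "a i = a j" "digit_value L a v = digit_value L a u" using *[of a] digits Cons.prems by auto
  moreover have "b i = b j" "digit_value L b v = digit_value L b u" using *[of b] digits Cons.prems by auto
  ultimately have "i = j" "v = u" using digits_inj m w Cons.IH by (auto simp: inj_on_def)
  then show ?case by (simp add: w)
qed

section \<open>Existence and uniqueness of the attractor\<close>

lemma invariant_words:
  assumes "A = (\<Union>i<N. f i ` A)"
  shows "A = (\<Union>w\<in>words N n. word_map f w ` A)"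
proof (induction n)
  case (Suc n)
  have "(\<Union>w\<in>words N (Suc n). word_map f w ` A) = (\<Union>i<N. f i ` (\<Union>w\<in>words N n. word_map f w ` A))"
    unfolding words_Suc by (force simp: image_iff)
  then show ?case using Suc assms by simp
qed (simp add: words_0)

lemma closed_approx:
  assumes "closed S" "\<And>n. \<exists>y\<in>S. dist y x \<le> c / real L ^ n"
  shows "x \<in> S"
proof -
  obtain y where y: "\<And>n. y n \<in> S" "\<And>n. dist (y n) x \<le> c / real L ^ n" using assms(2) by metis
  have "(\<lambda>n. c / real L ^ n) \<longlonglongrightarrow> 0" by (rule LIMSEQ_divide_realpow_zero) simp
  then have "(\<lambda>n. dist (y n) x) \<longlonglongrightarrow> 0"
    by (rule tendsto_sandwich[rotated 3]) (auto simp: y intro!: tendsto_const)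
  then have "y \<longlonglongrightarrow> x" by (rule tendsto_dist_iff[THEN iffD2])
  then show ?thesis using closed_sequentially[OF assms(1)] y by blast
qed

text \<open>The words applied to a single point of \<open>B\<close> stay in \<open>B\<close> and
  come within \<open>c / L ^ n\<close> of each point of \<open>A\<close>. Besides uniqueness of the
  attractor this one-sided form gives bounding boxes and invariance under symmetries.\<close>

lemma invariant_compact_subset:
  assumes A: "compact A" "A = (\<Union>i<N. f i ` A)" and B: "B \<noteq> {}" "closed B" "\<And>i. i < N \<Longrightarrow> f i ` B \<subseteq> B"
  shows "A \<subseteq> B"
proof
  have word_B: "word_map f w y \<in> B" if "w \<in> words N n" "y \<in> B" for w n y
    using that(1)
  proof (induction w arbitrary: n)
    case Nil
    then show ?case using that(2) by simp
  next
    case (Cons i w)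
    then have "i < N" "w \<in> words N (length w)" by (auto simp: words_def)
    then show ?case using Cons.IH B(3) by auto
  qed
  fix x assume x: "x \<in> A"
  obtain y where y: "y \<in> B" using B by blast
  obtain c where c: "\<And>z. z \<in> A \<Longrightarrow> dist y z \<le> c"
    using compact_imp_bounded[OF A(1)] bounded_any_center[of A y] by auto
  show "x \<in> B"
  proof (rule closed_approx[OF B(2)])
    fix n
    obtain w z where w: "w \<in> words N n" "z \<in> A" "x = word_map f w z"
      using x invariant_words[OF A(2), of n] by blast
    have "word_map f w y \<in> B" using w y by (intro word_B)
    moreover have "dist (word_map f w y) x \<le> c / real L ^ n"
      using w c by (simp add: dist_word_map divide_right_mono)
    ultimately show "\<exists>y\<in>B. dist y x \<le> c / real L ^ n" by blast
  qed
qed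

lemma invariant_set_exists: "\<exists>A. A \<noteq> {} \<and> compact A \<and> A = (\<Union>i<N. f i ` A)"
proof -
  \<comment> \<open>Translation vectors have norm at most \<open>r\<close>, and
    \<open>(r + r) / L \<le> r\<close> because \<open>L \<ge> 2\<close>; so the ball of radius
    \<open>r\<close> is mapped into itself.\<close>
  define r where "r = real L * (norm e1 + norm e2)"
  define Q where "Q n = (\<Union>w\<in>words N n. word_map f w ` cball 0 r)" for n
  have r: "0 \<le> r" by (simp add: r_def)
  have Q_Suc: "Q (Suc n) = (\<Union>i<N. f i ` Q n)" for n
    unfolding Q_def words_Suc by (force simp: image_iff)
  have cball: "f i x \<in> cball 0 r" if "i < N" "x \<in> cball 0 r" for i x
  proof -
    have "norm (real (a i) *\<^sub>R e1 + real (b i) *\<^sub>R e2) \<le> real (a i) * norm e1 + real (b i) * norm e2"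
      by (rule order_trans[OF norm_triangle_ineq]) simp
    also have "\<dots> \<le> real L * norm e1 + real L * norm e2"
      using digits[OF that(1)] by (intro add_mono mult_right_mono) auto
    also have "\<dots> = r" by (simp add: r_def algebra_simps)
    finally have "norm (x + (real (a i) *\<^sub>R e1 + real (b i) *\<^sub>R e2)) \<le> r + r"
      using that(2) norm_triangle_ineq[of x "real (a i) *\<^sub>R e1 + real (b i) *\<^sub>R e2"] by simp
    also have "\<dots> \<le> real L * r" using L r by (simp add: mult_right_mono flip: mult_2)
    finally have "norm (x + (real (a i) *\<^sub>R e1 + real (b i) *\<^sub>R e2)) / real L \<le> r"
      by (simp add: divide_le_eq mult.commute)
    moreover have "norm (f i x) = norm (x + (real (a i) *\<^sub>R e1 + real (b i) *\<^sub>R e2)) / real L"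
      unfolding f[OF that(1)] norm_scaleR by simp
    ultimately show ?thesis by simp
  qed
  have Q_mono: "Q (Suc n) \<subseteq> Q n" for n
  proof (induction n)
    case 0
    then show ?case using cball by (auto simp: Q_Suc) (auto simp: Q_def words_0)
  next
    case (Suc n)
    then show ?case by (subst (1 2) Q_Suc) blast
  qed
  then have dec: "m \<le> n \<Longrightarrow> Q n \<subseteq> Q m" for m n by (rule lift_Suc_antimono_le)
  have comp: "compact (Q n)" for n
    unfolding Q_def by (intro compact_UN compact_continuous_image continuous_word_map) auto
  have ne: "Q n \<noteq> {}" for n
  proof -
    have "words N n \<noteq> {}" using card_words[of N n] by (metis N_pos(1) card.empty power_eq_0_iff less_not_refl)
    then show ?thesis using r by (auto simp: Q_def)
  qed
  define A where "A = \<Inter>(range Q)"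
  have "A \<noteq> {}" unfolding A_def using compact_nest[OF comp ne dec] .
  moreover have "compact A" unfolding A_def using comp by (intro compact_Inter) auto
  moreover have "A = (\<Union>i<N. f i ` A)"
  proof
    show "(\<Union>i<N. f i ` A) \<subseteq> A"
    proof (intro UN_least image_subsetI)
      fix i x assume "i \<in> {..<N}" "x \<in> A"
      then have "f i x \<in> Q (Suc n)" for n by (auto simp: Q_Suc A_def)
      then have "f i x \<in> Q n" for n using Q_mono by blast
      then show "f i x \<in> A" by (simp add: A_def)
    qed
    show "A \<subseteq> (\<Union>i<N. f i ` A)"
    proof
      fix x assume x: "x \<in> A"
      \<comment> \<open>One index must serve all levels: if each \<open>i\<close> failed at a level
        \<open>k i\<close>, then at the maximum of these finitely many levels no index would work,
        as the sets \<open>Q n\<close> decrease.\<close>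
      have "\<exists>i<N. \<forall>n. x \<in> f i ` Q n"
      proof (rule ccontr)
        assume "\<not> ?thesis"
        then obtain k where k: "\<And>i. i < N \<Longrightarrow> x \<notin> f i ` Q (k i)" by metis
        define n where "n = Max (k ` {..<N})"
        have "x \<in> Q (Suc n)" using x by (simp add: A_def)
        then obtain i where i: "i < N" "x \<in> f i ` Q n" by (auto simp: Q_Suc)
        then have "k i \<le> n" by (simp add: n_def)
        then show False using k[OF i(1)] i(2) dec by blast
      qed
      then obtain i where i: "i < N" "\<And>n. x \<in> f i ` Q n" by blast
      have "\<forall>n. \<exists>y. y \<in> Q n \<and> x = f i y" using i(2) by blast
      from choice[OF this] obtain y where y: "\<And>n. y n \<in> Q n" "\<And>n. x = f i (y n)" by blast
      have eq: "y n = y 0" for n using y(2) word_map_inj[OF singleton_words[OF i(1)], of "y n" "y 0"] by simp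
      have "y 0 \<in> Q n" for n using y(1)[of n] unfolding eq[of n] .
      then have "y 0 \<in> A" by (simp add: A_def)
      then show "x \<in> (\<Union>i<N. f i ` A)" using i(1) y(2)[of 0] by blast
    qed
  qed
  ultimately show ?thesis by blast
qed

text \<open>Existence together with uniqueness is what makes the definite description in
  \<open>attractor\<close> denote an invariant set.\<close>

lemma K_props: "K \<noteq> {}" "compact K" "K = (\<Union>i<N. f i ` K)"
proof -
  have "\<exists>!K. K \<noteq> {} \<and> compact K \<and> K = (\<Union>i<N. f i ` K)"
  proof (rule ex_ex1I[OF invariant_set_exists])
    fix A B assume A: "A \<noteq> {} \<and> compact A \<and> A = (\<Union>i<N. f i ` A)" and B: "B \<noteq> {} \<and> compact B \<and> B = (\<Union>i<N. f i ` B)"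
    have "A \<subseteq> B" by (rule invariant_compact_subset) (use A B compact_imp_closed in blast)+
    moreover have "B \<subseteq> A" by (rule invariant_compact_subset) (use A B compact_imp_closed in blast)+
    ultimately show "A = B" by blast
  qed
  from theI'[OF this] show "K \<noteq> {}" "compact K" "K = (\<Union>i<N. f i ` K)"
    unfolding K_def attractor_def by blast+
qed

lemma K_words: "K = (\<Union>w\<in>words N n. cell w)"
  unfolding cell_def by (rule invariant_words[OF K_props(3)])

lemma cell_Nil: "cell [] = K" by (simp add: cell_def)

lemma cell_append: "cell (v @ w) = word_map f v ` cell w"
  by (auto simp: cell_def word_map_append image_iff)

lemma cell_subset_K: "w \<in> words N n \<Longrightarrow> cell w \<subseteq> K"
  using K_words[of n] by blast

lemma word_map_in_K: "w \<in> words N n \<Longrightarrow> x \<in> K \<Longrightarrow> word_map f w x \<in> K"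
  using cell_subset_K by (auto simp: cell_def)

lemma cell_subdivide: "cell w = (\<Union>v\<in>words N m. cell (w @ v))"
  by (simp add: cell_append image_UN[symmetric] K_words[symmetric]) (simp add: cell_def)

lemma cell_append_subset: "v \<in> words N m \<Longrightarrow> cell (w @ v) \<subseteq> cell w"
  using cell_subdivide[of w m] by blast

lemma cell_ne: "cell w \<noteq> {}"
  using K_props(1) by (simp add: cell_def)

lemma compact_cell: "w \<in> words N n \<Longrightarrow> compact (cell w)"
  unfolding cell_def by (intro compact_continuous_image continuous_word_map K_props)

lemma fixed_point_in_K:
  assumes "i < N" "f i p = p" shows "p \<in> K"
proof -
  obtain x where x: "x \<in> K" using K_props by blast
  show ?thesis
  proof (rule closed_approx[OF compact_imp_closed[OF K_props(2)]])
    fix n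
    have r: "replicate n i \<in> words N n" using assms by (auto simp: words_def)
    have "word_map f (replicate n i) p = p" using assms by (induction n) auto
    then have "dist (word_map f (replicate n i) x) p \<le> dist x p / real L ^ n"
      using dist_word_map[OF r, of x p] by simp
    then show "\<exists>y\<in>K. dist y p \<le> dist x p / real L ^ n" using word_map_in_K[OF r x] by blast
  qed
qed

text \<open>Adding 1 gives positivity without an argument that \<open>K\<close> has more than one
  point.\<close>

definition D :: real where "D = diameter K + 1"

lemma D_pos: "0 < D"
  using diameter_ge_0[OF compact_imp_bounded[OF K_props(2)]] by (simp add: D_def)

lemma dist_le_D: "x \<in> K \<Longrightarrow> y \<in> K \<Longrightarrow> dist x y \<le> D"
  using diameter_bounded_bound[OF compact_imp_bounded[OF K_props(2)]] by (fastforce simp: D_def)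

lemma dist_cell_le: "w \<in> words N n \<Longrightarrow> x \<in> cell w \<Longrightarrow> y \<in> cell w \<Longrightarrow> dist x y \<le> D / real L ^ n"
  by (auto simp: cell_def dist_word_map intro!: divide_right_mono dist_le_D)

section \<open>Counting nearby cells\<close>

lemma offset_diff_bound:
  assumes "v \<in> words N n" "w \<in> words N n" "norm (offset v - offset w) \<le> r"
  shows "\<bar>int (digit_value L a v) - int (digit_value L a w)\<bar> \<le> \<lceil>\<kappa> * r\<rceil>"
    "\<bar>int (digit_value L b v) - int (digit_value L b w)\<bar> \<le> \<lceil>\<kappa> * r\<rceil>"
proof -
  define s where "s = real (digit_value L a v) - real (digit_value L a w)"
  define t where "t = real (digit_value L b v) - real (digit_value L b w)"
  have "offset v - offset w = s *\<^sub>R e1 + t *\<^sub>R e2"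
    by (simp add: offset_def s_def t_def scaleR_diff_left)
  then have "\<kappa> * norm (s *\<^sub>R e1 + t *\<^sub>R e2) \<le> \<kappa> * r" using assms(3) basis(1) by (simp add: mult_left_mono)
  then have "\<bar>s\<bar> \<le> \<kappa> * r" "\<bar>t\<bar> \<le> \<kappa> * r" using basis(2,3)[of s t] basis(3)[of t s] order_trans by blast+
  then have "real_of_int \<bar>int (digit_value L a v) - int (digit_value L a w)\<bar> \<le> \<kappa> * r"
     "real_of_int \<bar>int (digit_value L b v) - int (digit_value L b w)\<bar> \<le> \<kappa> * r" by (auto simp: s_def t_def)
  then show "\<bar>int (digit_value L a v) - int (digit_value L a w)\<bar> \<le> \<lceil>\<kappa> * r\<rceil>"
    "\<bar>int (digit_value L b v) - int (digit_value L b w)\<bar> \<le> \<lceil>\<kappa> * r\<rceil>"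
    by (metis le_of_int_ceiling of_int_le_iff order_trans)+
qed

text \<open>Counted after rescaling by \<open>L ^ n\<close>: relative to one such word
  \<open>w0\<close>, the lattice coordinates of all others are integers bounded by a constant
  \<open>M\<close>, and words are determined by them. The bound is the number of integer points in a
  square, uniform in level and centre.\<close>

lemma card_near_le:
  "\<exists>C. \<forall>n x. card {w \<in> words N n. dist (word_map f w 0) x \<le> r / real L ^ n} \<le> C"
proof -
  define M where "M = \<lceil>\<kappa> * (2 * r)\<rceil>"
  define Z where "Z = {-M..M} \<times> {-M..M}"
  have "card {w \<in> words N n. dist (word_map f w 0) x \<le> r / real L ^ n} \<le> card Z" for n x
  proof -
    let ?S = "{w \<in> words N n. dist (word_map f w 0) x \<le> r / real L ^ n}"
    show ?thesis
    proof (cases "?S = {}")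
      case False
      then obtain w0 where w0: "w0 \<in> ?S" by blast
      let ?g = "\<lambda>w. (int (digit_value L a w) - int (digit_value L a w0), int (digit_value L b w) - int (digit_value L b w0))"
      have "inj_on ?g ?S" by (rule inj_onI) (auto intro: offset_inj)
      moreover have "?g ` ?S \<subseteq> Z"
      proof
        fix z assume "z \<in> ?g ` ?S"
        then obtain w where w: "w \<in> ?S" "z = ?g w" by blast
        have "dist (word_map f w 0) (word_map f w0 0) \<le> r / real L ^ n + r / real L ^ n"
          using w w0 by (intro order_trans[OF dist_triangle2[of _ _ x]] add_mono) auto
        then have "norm ((1 / real L ^ n) *\<^sub>R (offset w - offset w0)) \<le> 2 * r / real L ^ n"
          using w w0 by (simp add: dist_norm word_map_eq[of w n] word_map_eq[of w0 n] scaleR_diff_right)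
        then have "norm (offset w - offset w0) / real L ^ n \<le> 2 * r / real L ^ n" unfolding norm_scaleR by simp
        then have "norm (offset w - offset w0) \<le> 2 * r" by (simp add: divide_le_cancel)
        moreover have "w \<in> words N n" "w0 \<in> words N n" using w w0 by auto
        ultimately have "\<bar>int (digit_value L a w) - int (digit_value L a w0)\<bar> \<le> M"
            "\<bar>int (digit_value L b w) - int (digit_value L b w0)\<bar> \<le> M"
          unfolding M_def by (simp_all only: offset_diff_bound)
        then show "z \<in> Z" by (auto simp: Z_def w(2))
      qed
      ultimately show ?thesis using card_inj_on_le[of ?g ?S Z] by (simp add: Z_def)
    next
      case True
      show ?thesis unfolding True by simp
    qed
  qed
  then show ?thesis by blast
qed

lemma card_cells_meeting_le:
  "\<exists>C. \<forall>n S. (\<forall>x\<in>S. \<forall>y\<in>S. dist x y \<le> r / real L ^ n) \<longrightarrow> card {w \<in> words N n. cell w \<inter> S \<noteq> {}} \<le> C"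
proof -
  obtain d where d: "\<And>x. x \<in> K \<Longrightarrow> dist 0 x \<le> d"
    using compact_imp_bounded[OF K_props(2)] bounded_any_center[of K 0] by auto
  obtain C where C: "\<And>n x. card {w \<in> words N n. dist (word_map f w 0) x \<le> (d + r) / real L ^ n} \<le> C"
    using card_near_le[of "d + r"] by blast
  have "card {w \<in> words N n. cell w \<inter> S \<noteq> {}} \<le> C" if S: "\<forall>x\<in>S. \<forall>y\<in>S. dist x y \<le> r / real L ^ n" for n S
  proof (cases "S = {}")
    case False
    then obtain x where x: "x \<in> S" by blast
    have "{w \<in> words N n. cell w \<inter> S \<noteq> {}} \<subseteq> {w \<in> words N n. dist (word_map f w 0) x \<le> (d + r) / real L ^ n}"
    proof safe
      fix w y assume w: "w \<in> words N n" and y: "y \<in> cell w" "y \<in> S"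
      then obtain z where z: "z \<in> K" "y = word_map f w z" by (auto simp: cell_def)
      have "dist (word_map f w 0) y \<le> d / real L ^ n"
        using z d w by (simp add: dist_word_map divide_right_mono)
      moreover have "dist y x \<le> r / real L ^ n" using S x y by blast
      ultimately show "dist (word_map f w 0) x \<le> (d + r) / real L ^ n"
        using dist_triangle[of "word_map f w 0" x y] by (simp add: add_divide_distrib)
    qed
    then have "card {w \<in> words N n. cell w \<inter> S \<noteq> {}}
        \<le> card {w \<in> words N n. dist (word_map f w 0) x \<le> (d + r) / real L ^ n}"
      by (intro card_mono) auto
    also have "\<dots> \<le> C" by (rule C)
    finally show ?thesis .
  qed simp
  then show ?thesis by blast
qed

text \<open>Rescaled differences of two nearby cells of equal level take finitely many values.\<close>

lemma cells_gap:
  "\<exists>c>0. \<forall>n. \<forall>v\<in>words N n. \<forall>w\<in>words N n. \<forall>x\<in>cell v. \<forall>y\<in>cell w.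
     dist x y < c / real L ^ n \<longrightarrow> cell v \<inter> cell w \<noteq> {}"
proof -
  define M where "M = \<lceil>\<kappa> * (1 + D)\<rceil>"
  define Z where "Z = {-M..M} \<times> {-M..M}"
  define T where "T z = (\<lambda>x. x + (real_of_int (fst z) *\<^sub>R e1 + real_of_int (snd z) *\<^sub>R e2)) ` K" for z
  have "\<exists>\<delta>>0. K \<inter> T z = {} \<longrightarrow> (\<forall>x\<in>K. \<forall>y\<in>T z. \<delta> \<le> dist x y)" for z
  proof (cases "K \<inter> T z = {}")
    case True
    have "compact (T z)" unfolding T_def by (intro compact_continuous_image K_props continuous_intros)
    then show ?thesis using separate_compact_closed[OF K_props(2) compact_imp_closed True] by blast
  qed (auto intro: exI[of _ 1])
  then obtain \<delta> where \<delta>: "\<And>z. 0 < \<delta> z" "\<And>z x y. K \<inter> T z = {} \<Longrightarrow> x \<in> K \<Longrightarrow> y \<in> T z \<Longrightarrow> \<delta> z \<le> dist x y"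
    by metis
  define c where "c = Min (insert 1 (\<delta> ` Z))"
  have fin: "finite Z" by (simp add: Z_def)
  have c: "0 < c" "c \<le> 1" "\<And>z. z \<in> Z \<Longrightarrow> c \<le> \<delta> z" using \<delta>(1) fin by (auto simp: c_def)
  have "cell v \<inter> cell w \<noteq> {}"
    if v: "v \<in> words N n" and w: "w \<in> words N n" and x: "x \<in> cell v" and y: "y \<in> cell w"
      and xy: "dist x y < c / real L ^ n" for n v w x y
  proof -
    obtain x0 where x0: "x0 \<in> K" "x = word_map f v x0" using x by (auto simp: cell_def)
    obtain y0 where y0: "y0 \<in> K" "y = word_map f w y0" using y by (auto simp: cell_def)
    define z where "z = (int (digit_value L a w) - int (digit_value L a v), int (digit_value L b w) - int (digit_value L b v))"
    have off: "real_of_int (fst z) *\<^sub>R e1 + real_of_int (snd z) *\<^sub>R e2 = offset w - offset v"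
      by (simp add: z_def offset_def scaleR_diff_left)
    have "x - y = (1 / real L ^ n) *\<^sub>R (x0 - (y0 + (offset w - offset v)))"
      unfolding x0(2) y0(2) word_map_eq[OF v] word_map_eq[OF w] by (simp add: algebra_simps)
    then have lt: "dist x0 (y0 + (offset w - offset v)) < c"
      using xy by (simp add: dist_norm divide_simps)
    have "norm (offset w - offset v) \<le> dist x0 (y0 + (offset w - offset v)) + dist x0 y0"
      using norm_triangle_ineq4[of "x0 - y0" "x0 - (y0 + (offset w - offset v))"] by (simp add: dist_norm)
    then have "norm (offset w - offset v) \<le> 1 + D" using lt c dist_le_D[OF x0(1) y0(1)] by simp
    from offset_diff_bound[OF w v this] have "z \<in> Z" by (auto simp: Z_def z_def M_def abs_le_iff)
    have "K \<inter> T z \<noteq> {}"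
    proof
      assume "K \<inter> T z = {}"
      moreover have "y0 + (offset w - offset v) \<in> T z" using y0 by (auto simp: T_def off)
      ultimately have "\<delta> z \<le> dist x0 (y0 + (offset w - offset v))" using \<delta>(2) x0(1) by blast
      then show False using lt c(3)[OF \<open>z \<in> Z\<close>] by simp
    qed
    then obtain y1 where y1: "y1 \<in> K" "y1 + (offset w - offset v) \<in> K" by (auto simp: T_def off)
    have "word_map f v (y1 + (offset w - offset v)) = word_map f w y1"
      by (simp add: word_map_eq[OF v] word_map_eq[OF w])
    then show ?thesis using y1 unfolding cell_def by (metis IntI empty_iff imageI)
  qed
  then show ?thesis using c(1) by blast
qed

end

text \<open>Serves to show that overlaps are null: the multiplicity of the covering is at least the
  indicator of the union, and equality of the total masses makes the nonnegative difference
  integrate to 0. The finite mass allows the subtraction.\<close>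

lemma AE_sum_indicator_eq:
  fixes A :: "'a set"
  assumes "finite I" and B: "\<And>i. i \<in> I \<Longrightarrow> B i \<in> sets M" and A: "A = (\<Union>i\<in>I. B i)"
    and eq: "emeasure M A = (\<Sum>i\<in>I. emeasure M (B i))" and fin: "emeasure M A < \<infinity>"
  shows "AE x in M. (\<Sum>i\<in>I. indicator (B i) x) = (indicator A x :: ennreal)"
proof -
  have [measurable]: "A \<in> sets M" using A B \<open>finite I\<close> by auto
  have le: "indicator A x \<le> (\<Sum>i\<in>I. indicator (B i) x :: ennreal)" for x
  proof (cases "x \<in> A")
    case True
    then obtain i where "i \<in> I" "x \<in> B i" using A by auto
    then show ?thesis using member_le_sum[of i I "\<lambda>i. indicator (B i) x :: ennreal"] \<open>finite I\<close>
      by (auto simp: indicator_def)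
  qed simp
  have mB: "(\<lambda>x. indicator (B i) x :: ennreal) \<in> borel_measurable M" if "i \<in> I" for i using B[OF that] by simp
  have m: "(\<lambda>x. \<Sum>i\<in>I. indicator (B i) x :: ennreal) \<in> borel_measurable M"
    using mB by (rule borel_measurable_sum)
  have "(\<integral>\<^sup>+x. (\<Sum>i\<in>I. indicator (B i) x) - indicator A x \<partial>M) =
      (\<integral>\<^sup>+x. (\<Sum>i\<in>I. indicator (B i) x) \<partial>M) - (\<integral>\<^sup>+x. indicator A x \<partial>M)"
    using fin le m by (intro nn_integral_diff) auto
  also have "(\<integral>\<^sup>+x. (\<Sum>i\<in>I. indicator (B i) x) \<partial>M) = emeasure M A"
    using mB by (subst nn_integral_sum) (auto simp: eq B)
  finally have "(\<integral>\<^sup>+x. (\<Sum>i\<in>I. indicator (B i) x) - indicator A x \<partial>M) = 0" using fin by simp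
  moreover have "(\<lambda>x. (\<Sum>i\<in>I. indicator (B i) x) - indicator A x :: ennreal) \<in> borel_measurable M"
    using m by (intro borel_measurable_minus_ennreal) auto
  ultimately have "AE x in M. (\<Sum>i\<in>I. indicator (B i) x) - indicator A x = (0::ennreal)"
    by (simp add: nn_integral_0_iff_AE)
  then show ?thesis
  proof (rule AE_mp, intro AE_I2 impI)
    fix x assume "(\<Sum>i\<in>I. indicator (B i) x) - indicator A x = (0::ennreal)"
    then have "(\<Sum>i\<in>I. indicator (B i) x :: ennreal) \<le> indicator A x" by (simp add: diff_eq_0_iff_ennreal)
    then show "(\<Sum>i\<in>I. indicator (B i) x) = (indicator A x :: ennreal)" using le[of x] by (rule antisym)
  qed
qed

context lattice_ifs
begin

section \<open>Positive and finite Hausdorff measure of the attractor\<close>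

text \<open>The \<open>N ^ n\<close> cells of level \<open>n\<close> contribute at most
  \<open>N ^ n * (D / L ^ n) powr \<alpha> = D powr \<alpha>\<close> at every level, since
  \<open>L powr \<alpha> = N\<close>.\<close>

lemma hausdorff_outer_K_finite: "hausdorff_outer \<alpha> K < \<infinity>"
proof -
  have "hausdorff_outer \<alpha> K \<le> ennreal (D powr \<alpha>)"
    unfolding hausdorff_outer_def
  proof (rule SUP_least)
    fix \<delta> :: real assume "\<delta> \<in> {0<..}"
    then have \<delta>: "0 < \<delta>" by simp
    obtain n where n: "D / \<delta> < real L ^ n" using real_arch_pow[of "real L" "D / \<delta>"] by auto
    then have n': "D / real L ^ n \<le> \<delta>" using \<delta> by (simp add: field_simps)
    obtain h where h: "bij_betw h {0..<N ^ n} (words N n)"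
      using ex_bij_betw_nat_finite[OF finite_words[of N n]] by (auto simp: card_words)
    define U where "U i = (if i < N ^ n then cell (h i) else {})" for i
    have hw: "h i \<in> words N n" if "i < N ^ n" for i using h that by (auto simp: bij_betw_def)
    have diam: "diameter (cell w) \<le> D / real L ^ n" if "w \<in> words N n" for w
      using dist_cell_le[OF that] cell_ne[of w] by (auto simp: diameter_def intro!: cSUP_least)
    have "hausdorff_premeasure \<delta> \<alpha> K \<le> (\<Sum>i. ennreal (diameter (U i) powr \<alpha>))"
    proof (rule hausdorff_premeasure_le)
      show "K \<subseteq> (\<Union>i. U i)"
      proof
        fix x assume "x \<in> K"
        then obtain w where w: "w \<in> words N n" "x \<in> cell w" using K_words by blast
        have "w \<in> h ` {0..<N ^ n}" using h w(1) by (simp add: bij_betw_def)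
        then obtain i where "i < N ^ n" "h i = w" by auto
        then have "x \<in> U i" using w by (simp add: U_def)
        then show "x \<in> (\<Union>i. U i)" by blast
      qed
      show "bounded (U i)" for i using compact_imp_bounded[OF compact_cell[OF hw[of i]]] by (auto simp: U_def)
      show "diameter (U i) \<le> \<delta>" for i using diam[OF hw[of i]] n' \<delta> by (auto simp: U_def)
    qed
    also have "\<dots> = (\<Sum>i<N ^ n. ennreal (diameter (U i) powr \<alpha>))"
      by (rule suminf_finite) (auto simp: U_def)
    also have "\<dots> \<le> (\<Sum>i<N ^ n. ennreal (D powr \<alpha> / real N ^ n))"
    proof (rule sum_mono)
      fix i assume i: "i \<in> {..<N ^ n}"
      have "diameter (U i) powr \<alpha> \<le> (D / real L ^ n) powr \<alpha>"
        using i diam[OF hw[of i]] diameter_ge_0[OF compact_imp_bounded[OF compact_cell[OF hw[of i]]]] alpha_pos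
        by (intro powr_mono2) (auto simp: U_def)
      also have "\<dots> = D powr \<alpha> / real N ^ n" by (simp add: powr_divide L_power_powr_alpha)
      finally show "ennreal (diameter (U i) powr \<alpha>) \<le> ennreal (D powr \<alpha> / real N ^ n)" by (rule ennreal_leI)
    qed
    also have "\<dots> = ennreal (\<Sum>i<N ^ n. D powr \<alpha> / real N ^ n)" by (subst sum_ennreal) auto
    also have "\<dots> = ennreal (D powr \<alpha>)" by simp
    finally show "hausdorff_premeasure \<delta> \<alpha> K \<le> ennreal (D powr \<alpha>)" .
  qed
  then show ?thesis by (rule le_less_trans) simp
qed

lemma card_subcells_meeting_le:
  assumes C: "card {w \<in> words N n. cell w \<inter> S \<noteq> {}} \<le> C"
  shows "card {w \<in> words N (n + m). cell w \<inter> S \<noteq> {}} \<le> C * N ^ m"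
proof -
  let ?A = "{w \<in> words N n. cell w \<inter> S \<noteq> {}}"
  have "{w \<in> words N (n + m). cell w \<inter> S \<noteq> {}} \<subseteq> (\<lambda>(v, w). v @ w) ` (?A \<times> words N m)"
  proof
    fix w assume w: "w \<in> {w \<in> words N (n + m). cell w \<inter> S \<noteq> {}}"
    note td = take_drop_words[of w N n m]
    have "cell (take n w @ drop n w) \<subseteq> cell (take n w)" using w td by (intro cell_append_subset) auto
    then have "take n w \<in> ?A" using w td by auto
    then show "w \<in> (\<lambda>(v, w). v @ w) ` (?A \<times> words N m)"
      using w td by (intro image_eqI[of _ _ "(take n w, drop n w)"]) auto
  qed
  then have "card {w \<in> words N (n + m). cell w \<inter> S \<noteq> {}} \<le> card (?A \<times> words N m)"
    by (rule surj_card_le[rotated]) auto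
  also have "\<dots> \<le> C * N ^ m" using C by (simp add: card_cartesian_product card_words)
  finally show ?thesis .
qed

text \<open>A Frostman estimate without a measure: the proportion of level-\<open>m\<close> cells
  that meet a set plays the role of its mass, for all \<open>m\<close> beyond a level depending only
  on \<open>r\<close>. The factor 3 anticipates that covering sets of diameter at most
  \<open>r\<close> get enlarged by \<open>r\<close> on each side.\<close>

lemma proportion_cells_meeting_le:
  "\<exists>C>0. \<forall>r>0. \<exists>n. \<forall>S m. (\<forall>x\<in>S. \<forall>y\<in>S. dist x y \<le> 3 * r) \<longrightarrow> n \<le> m \<longrightarrow>
     real (card {w \<in> words N m. cell w \<inter> S \<noteq> {}}) \<le> C * r powr \<alpha> * real N ^ m"
proof -
  obtain C where C: "\<And>n S. (\<forall>x\<in>S. \<forall>y\<in>S. dist x y \<le> 3 / real L ^ n) \<Longrightarrow> card {w \<in> words N n. cell w \<inter> S \<noteq> {}} \<le> C"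
    using card_cells_meeting_le[of 3] by blast
  define c where "c = real (C + 1) * real N"
  have "\<exists>n. \<forall>S m. (\<forall>x\<in>S. \<forall>y\<in>S. dist x y \<le> 3 * r) \<longrightarrow> n \<le> m \<longrightarrow>
     real (card {w \<in> words N m. cell w \<inter> S \<noteq> {}}) \<le> c * r powr \<alpha> * real N ^ m" if r: "0 < r" for r
  proof (cases "1 \<le> r")
    case True
    have "real (card {w \<in> words N m. cell w \<inter> S \<noteq> {}}) \<le> c * r powr \<alpha> * real N ^ m" for S m
    proof -
      have "card {w \<in> words N m. cell w \<inter> S \<noteq> {}} \<le> card (words N m)" by (intro card_mono) auto
      then have "real (card {w \<in> words N m. cell w \<inter> S \<noteq> {}}) \<le> real (N ^ m)"
        by (simp only: card_words of_nat_le_iff)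
      then have "real (card {w \<in> words N m. cell w \<inter> S \<noteq> {}}) \<le> 1 * 1 * real N ^ m" by simp
      also have "\<dots> \<le> c * r powr \<alpha> * real N ^ m"
      proof (intro mult_right_mono mult_mono)
        have "1 * 1 \<le> real (C + 1) * real N" using N by (intro mult_mono) auto
        then show "1 \<le> c" by (simp add: c_def)
        show "1 \<le> r powr \<alpha>" using True alpha_pos by (simp add: ge_one_powr_ge_zero)
      qed (auto simp: c_def)
      finally show ?thesis .
    qed
    then show ?thesis by blast
  next
    case False
    \<comment> \<open>\<open>k\<close> is the first level with \<open>1 / L ^ k < r\<close>, so
      \<open>n = k - 1\<close> satisfies \<open>r \<le> 1 / L ^ n\<close>; the loss of one level
      costs the factor \<open>N\<close> in \<open>c\<close>.\<close>
    define k where "k = (LEAST k. 1 / real L ^ k < r)"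
    have "\<exists>k. 1 / real L ^ k < r"
      using real_arch_pow[of "real L" "1 / r"] r by (auto simp: field_simps)
    then have k: "1 / real L ^ k < r" unfolding k_def by (rule LeastI_ex)
    have "k \<noteq> 0" using k False by (intro notI) auto
    then obtain n where n: "k = Suc n" by (cases k) auto
    have rn: "r \<le> 1 / real L ^ n"
      using not_less_Least[of n "\<lambda>k. 1 / real L ^ k < r"] n unfolding k_def by auto
    have "(1 / real L ^ Suc n) powr \<alpha> \<le> r powr \<alpha>"
      using k n alpha_pos by (intro powr_mono2) auto
    then have pr: "1 / real N ^ Suc n \<le> r powr \<alpha>" unfolding powr_divide L_power_powr_alpha by simp
    have "real (card {w \<in> words N m. cell w \<inter> S \<noteq> {}}) \<le> c * r powr \<alpha> * real N ^ m"
      if S: "\<forall>x\<in>S. \<forall>y\<in>S. dist x y \<le> 3 * r" and m: "n \<le> m" for S m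
    proof -
      have "3 * r \<le> 3 / real L ^ n" using rn by simp
      then have "\<forall>x\<in>S. \<forall>y\<in>S. dist x y \<le> 3 / real L ^ n" using S order_trans by blast
      from card_subcells_meeting_le[OF C[OF this], of "m - n"]
      have "card {w \<in> words N m. cell w \<inter> S \<noteq> {}} \<le> C * N ^ (m - n)" using m by simp
      then have "real (card {w \<in> words N m. cell w \<inter> S \<noteq> {}}) \<le> real (C * N ^ (m - n))"
        by (simp only: of_nat_le_iff)
      then have "real (card {w \<in> words N m. cell w \<inter> S \<noteq> {}}) \<le> real C * real N ^ (m - n)" by simp
      also have "\<dots> \<le> real (C + 1) * real N ^ (m - n)" by (intro mult_right_mono) auto
      also have "\<dots> = c * (1 / real N ^ Suc n) * real N ^ m"
        using m by (simp add: c_def power_diff field_simps)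
      also have "\<dots> \<le> c * r powr \<alpha> * real N ^ m"
        using pr by (intro mult_right_mono mult_left_mono) (auto simp: c_def)
      finally show ?thesis .
    qed
    then show ?thesis by blast
  qed
  moreover have "0 < c" by (simp add: c_def)
  ultimately show ?thesis by blast
qed

text \<open>Mass distribution principle: compactness reduces a cover to finitely many open sets,
  which have a common level \<open>m\<close> for the Frostman estimate, and counting all
  \<open>N ^ m\<close> cells bounds the sum of \<open>r i powr \<alpha>\<close> from below.\<close>

lemma hausdorff_outer_K_pos: "0 < hausdorff_outer \<alpha> K"
proof -
  obtain C where C: "0 < C" and bound: "\<And>r. 0 < r \<Longrightarrow> \<exists>n. \<forall>S m. (\<forall>x\<in>S. \<forall>y\<in>S. dist x y \<le> 3 * r) \<longrightarrow> n \<le> m \<longrightarrow>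
     real (card {w \<in> words N m. cell w \<inter> S \<noteq> {}}) \<le> C * r powr \<alpha> * real N ^ m"
    using proportion_cells_meeting_le by blast
  \<comment> \<open>Counting will give \<open>1 / C = 2 * e\<close> as a lower bound, of which half
    is spent on the enlargement of the radii.\<close>
  define e where "e = 1 / (2 * C)"
  have e: "0 < e" using C by (simp add: e_def)
  have "ennreal e \<le> hausdorff_premeasure 1 \<alpha> K"
  proof (rule hausdorff_premeasure_greatest)
    fix U :: "nat \<Rightarrow> plane set"
    assume U: "K \<subseteq> (\<Union>i. U i)" "\<And>i. bounded (U i)"
    define d where "d i = diameter (U i)" for i
    \<comment> \<open>The radius satisfies
      \<open>r i powr \<alpha> = d i powr \<alpha> + e / 2 ^ (i + 1)\<close>; it is positive also
      for sets of diameter 0, and the total excess is \<open>e\<close>.\<close>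
    define r where "r i = (d i powr \<alpha> + e * (1/2) ^ Suc i) powr (1 / \<alpha>)" for i
    have pos: "0 < d i powr \<alpha> + e * (1/2) ^ Suc i" for i using e by (intro add_nonneg_pos) auto
    have r_pos: "0 < r i" for i unfolding r_def powr_gt_zero using pos[of i] by linarith
    have r_powr: "r i powr \<alpha> = d i powr \<alpha> + e * (1/2) ^ Suc i" for i
      unfolding r_def powr_powr using alpha_pos pos[of i] by simp
    have d_r: "d i \<le> r i" for i
    proof -
      have "0 \<le> d i" using U by (simp add: d_def diameter_ge_0)
      then have "d i = (d i powr \<alpha>) powr (1 / \<alpha>)" using alpha_pos by (simp add: powr_powr)
      also have "\<dots> \<le> r i" unfolding r_def using e alpha_pos by (intro powr_mono2) auto
      finally show ?thesis .
    qed
    define V where "V i = (\<Union>x\<in>U i. ball x (r i))" for i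
    have V_diam: "dist y z \<le> 3 * r i" if yz: "y \<in> V i" "z \<in> V i" for i y z
    proof -
      obtain x x' where x: "x \<in> U i" "dist x y < r i" "x' \<in> U i" "dist x' z < r i" using yz by (auto simp: V_def)
      have "dist x x' \<le> r i" using diameter_bounded_bound[OF U(2) x(1) x(3)] d_r[of i] by (simp add: d_def)
      then show ?thesis using x dist_triangle[of y z x] dist_triangle[of x z x'] by (simp add: dist_commute)
    qed
    have "\<forall>i. \<exists>n. \<forall>S m. (\<forall>x\<in>S. \<forall>y\<in>S. dist x y \<le> 3 * r i) \<longrightarrow> n \<le> m \<longrightarrow>
       real (card {w \<in> words N m. cell w \<inter> S \<noteq> {}}) \<le> C * r i powr \<alpha> * real N ^ m"
      using bound r_pos by blast
    from choice[OF this] obtain n where n: "\<And>i S m. (\<forall>x\<in>S. \<forall>y\<in>S. dist x y \<le> 3 * r i) \<Longrightarrow> n i \<le> m \<Longrightarrow>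
       real (card {w \<in> words N m. cell w \<inter> S \<noteq> {}}) \<le> C * r i powr \<alpha> * real N ^ m" by blast
    have op: "open (V i)" for i by (auto simp: V_def)
    have UV: "U i \<subseteq> V i" for i using r_pos[of i] by (auto simp: V_def)
    have "K \<subseteq> (\<Union>i\<in>UNIV. V i)" using U(1) UV by blast
    from compactE_image[OF K_props(2) op this]
    obtain I where I: "finite I" "K \<subseteq> (\<Union>i\<in>I. V i)" by auto
    define m where "m = Max (insert 0 (n ` I))"
    have m: "n i \<le> m" if "i \<in> I" for i using that I(1) by (auto simp: m_def)
    have "words N m \<subseteq> (\<Union>i\<in>I. {w \<in> words N m. cell w \<inter> V i \<noteq> {}})"
    proof
      fix w assume w: "w \<in> words N m"
      obtain x where x: "x \<in> cell w" using cell_ne[of w] by auto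
      then have "x \<in> (\<Union>i\<in>I. V i)" using I(2) cell_subset_K[OF w] by (meson subsetD)
      then obtain i where i: "i \<in> I" "x \<in> V i" by (rule UN_E)
      then have "cell w \<inter> V i \<noteq> {}" using x by auto
      then show "w \<in> (\<Union>i\<in>I. {w \<in> words N m. cell w \<inter> V i \<noteq> {}})" using i w by auto
    qed
    then have "card (words N m) \<le> card (\<Union>i\<in>I. {w \<in> words N m. cell w \<inter> V i \<noteq> {}})"
      using I(1) by (intro card_mono) auto
    also have "\<dots> \<le> (\<Sum>i\<in>I. card {w \<in> words N m. cell w \<inter> V i \<noteq> {}})"
      by (rule card_UN_le[OF I(1)])
    finally have "real (N ^ m) \<le> real (\<Sum>i\<in>I. card {w \<in> words N m. cell w \<inter> V i \<noteq> {}})"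
      by (simp only: card_words of_nat_le_iff)
    then have "real N ^ m \<le> (\<Sum>i\<in>I. real (card {w \<in> words N m. cell w \<inter> V i \<noteq> {}}))" by simp
    also have "\<dots> \<le> (\<Sum>i\<in>I. C * r i powr \<alpha> * real N ^ m)"
      by (intro sum_mono n m) (use V_diam in blast)
    also have "\<dots> = real N ^ m * (C * (\<Sum>i\<in>I. r i powr \<alpha>))"
      by (simp add: sum_distrib_left mult_ac)
    finally have "1 \<le> C * (\<Sum>i\<in>I. r i powr \<alpha>)" by (simp add: mult_le_cancel_left1)
    then have "2 * e \<le> (\<Sum>i\<in>I. r i powr \<alpha>)" using C by (simp add: e_def field_simps)
    then have "ennreal (2 * e) \<le> (\<Sum>i\<in>I. ennreal (r i powr \<alpha>))" by (subst sum_ennreal) (auto intro: ennreal_leI)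
    also have "\<dots> \<le> (\<Sum>i. ennreal (r i powr \<alpha>))" using I(1) by (intro sum_le_suminf) auto
    also have "\<dots> = (\<Sum>i. ennreal (d i powr \<alpha>) + ennreal (e * (1/2) ^ Suc i))"
      unfolding r_powr using e by (intro suminf_cong ennreal_plus) auto
    also have "\<dots> = (\<Sum>i. ennreal (d i powr \<alpha>)) + (\<Sum>i. ennreal (e * (1/2) ^ Suc i))"
      by (rule suminf_add[symmetric]) auto
    also have "(\<Sum>i. ennreal (e * (1/2) ^ Suc i)) = ennreal e"
      using e sums_mult[OF power_half_series, of e] by (intro suminf_ennreal_eq) auto
    finally have "ennreal e + ennreal e \<le> (\<Sum>i. ennreal (d i powr \<alpha>)) + ennreal e"
      using e by (simp add: ennreal_plus[symmetric] del: ennreal_plus)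
    then have "ennreal e + ennreal e \<le> ennreal e + (\<Sum>i. ennreal (d i powr \<alpha>))" by (simp only: add.commute)
    then show "ennreal e \<le> (\<Sum>i. ennreal (diameter (U i) powr \<alpha>))"
      unfolding d_def by (simp only: ennreal_add_left_cancel_le) auto
  qed
  also have "\<dots> \<le> hausdorff_outer \<alpha> K" by (rule hausdorff_premeasure_le_outer) simp
  finally have "ennreal e \<le> hausdorff_outer \<alpha> K" .
  then show ?thesis using e by (meson ennreal_less_zero_iff less_le_trans)
qed

text \<open>The Lipschitz bounds for the word map and for its inverse \<open>g\<close> have matching
  constants, because all level-\<open>n\<close> maps are exact similarities.\<close>

lemma hausdorff_outer_cell:
  assumes w: "w \<in> words N n"
  shows "hausdorff_outer \<alpha> (cell w) = hausdorff_outer \<alpha> K / ennreal (real N ^ n)"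
proof (rule antisym)
  have "hausdorff_outer \<alpha> (cell w) \<le> ennreal ((1 / real L ^ n) powr \<alpha>) * hausdorff_outer \<alpha> K"
    unfolding cell_def using alpha_pos
    by (intro hausdorff_outer_lipschitz_image) (auto simp: dist_word_map[OF w])
  also have "ennreal ((1 / real L ^ n) powr \<alpha>) = 1 / ennreal (real N ^ n)"
    unfolding powr_divide L_power_powr_alpha by (simp add: divide_ennreal[symmetric])
  finally show "hausdorff_outer \<alpha> (cell w) \<le> hausdorff_outer \<alpha> K / ennreal (real N ^ n)"
    by (simp add: ennreal_times_divide mult.commute)
  define g where "g x = real L ^ n *\<^sub>R x - offset w" for x
  have "g (word_map f w x) = x" for x by (simp add: g_def word_map_eq[OF w])
  then have K: "K = g ` cell w" by (simp add: cell_def image_image)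
  have "dist (g x) (g y) = real L ^ n * dist x y" for x y
    unfolding g_def dist_norm by (simp flip: scaleR_diff_right)
  then have "hausdorff_outer \<alpha> (g ` cell w) \<le> ennreal ((real L ^ n) powr \<alpha>) * hausdorff_outer \<alpha> (cell w)"
    using alpha_pos by (intro hausdorff_outer_lipschitz_image) auto
  then have "hausdorff_outer \<alpha> K \<le> hausdorff_outer \<alpha> (cell w) * ennreal (real N ^ n)"
    by (simp add: K[symmetric] L_power_powr_alpha mult.commute)
  then show "hausdorff_outer \<alpha> K / ennreal (real N ^ n) \<le> hausdorff_outer \<alpha> (cell w)"
    by (intro divide_le_posI_ennreal) (auto simp: mult.commute)
qed

section \<open>The normalized measure on cells\<close>

lemma K_borel: "K \<in> sets borel" and cell_borel: "w \<in> words N n \<Longrightarrow> cell w \<in> sets borel"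
  using K_props(2) compact_cell by (auto intro: borel_compact)

lemma space_nu: "space \<nu> = K"
  using K_borel by (simp add: \<nu>_def normalized_hausdorff_def space_restrict_space uniform_measure_def space_hausdorff_measure)

lemma sets_nu: "sets \<nu> = sets (restrict_space borel K)"
  by (simp add: \<nu>_def normalized_hausdorff_def sets_restrict_space uniform_measure_def sets_hausdorff_measure)

lemma emeasure_nu:
  assumes "A \<in> sets borel" "A \<subseteq> K"
  shows "emeasure \<nu> A = hausdorff_outer \<alpha> A / hausdorff_outer \<alpha> K"
proof -
  have "emeasure \<nu> A = emeasure (uniform_measure (hausdorff_measure \<alpha>) K) A"
    unfolding \<nu>_def normalized_hausdorff_def using assms K_borel
    by (intro emeasure_restrict_space) (auto simp: sets_hausdorff_measure uniform_measure_def space_hausdorff_measure)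
  also have "\<dots> = emeasure (hausdorff_measure \<alpha>) (K \<inter> A) / emeasure (hausdorff_measure \<alpha>) K"
    using assms K_borel by (intro emeasure_uniform_measure) (simp_all add: sets_hausdorff_measure)
  finally show ?thesis using assms K_borel by (simp add: emeasure_hausdorff_measure Int_absorb1)
qed

lemma sets_nuI: "A \<in> sets borel \<Longrightarrow> A \<subseteq> K \<Longrightarrow> A \<in> sets \<nu>"
  by (auto simp: sets_nu sets_restrict_space_iff K_borel)

lemma cell_sets [measurable]: "w \<in> words N n \<Longrightarrow> cell w \<in> sets \<nu>"
  by (intro sets_nuI cell_borel cell_subset_K)

lemma emeasure_cell: "w \<in> words N n \<Longrightarrow> emeasure \<nu> (cell w) = ennreal (1 / real N ^ n)"
proof -
  assume w: "w \<in> words N n"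
  have fin: "hausdorff_outer \<alpha> K \<noteq> 0" "hausdorff_outer \<alpha> K \<noteq> top"
    using hausdorff_outer_K_pos hausdorff_outer_K_finite by auto
  have "emeasure \<nu> (cell w) = hausdorff_outer \<alpha> K / ennreal (real N ^ n) / hausdorff_outer \<alpha> K"
    using w by (simp add: emeasure_nu cell_borel cell_subset_K hausdorff_outer_cell)
  also have "\<dots> = 1 / ennreal (real N ^ n)"
    using fin by (cases "hausdorff_outer \<alpha> K") (auto simp: divide_ennreal ennreal_1[symmetric] simp del: ennreal_1)
  finally show ?thesis by (simp add: divide_ennreal[symmetric])
qed

lemma measure_cell: "w \<in> words N n \<Longrightarrow> measure \<nu> (cell w) = 1 / real N ^ n"
  by (simp add: measure_def emeasure_cell)

lemma prob_space_nu: "emeasure \<nu> (space \<nu>) = 1"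
  using emeasure_cell[of "[]" 0] by (simp add: words_def cell_Nil space_nu)

sublocale nu: finite_measure \<nu>
  by standard (simp add: prob_space_nu)

lemma continuous_measurable: "continuous_on K v \<Longrightarrow> v \<in> borel_measurable \<nu>"
  using borel_measurable_continuous_on_restrict[of K v] by (simp add: sets_nu cong: measurable_cong_sets)

lemma id_measurable [measurable]: "(\<lambda>x. x) \<in> measurable \<nu> borel"
  using borel_measurable_continuous_on_restrict[of K "\<lambda>x. x"] by (simp add: sets_nu cong: measurable_cong_sets)

text \<open>Overlaps are null by counting alone: the masses of the subcells add up exactly to the
  mass of the cell.\<close>

lemma AE_subcells: "w \<in> words N n \<Longrightarrow>
   AE x in \<nu>. (\<Sum>v\<in>words N m. indicator (cell (w @ v)) x) = (indicator (cell w) x :: ennreal)"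
proof (rule AE_sum_indicator_eq)
  assume w: "w \<in> words N n"
  show "cell (w @ v) \<in> sets \<nu>" if "v \<in> words N m" for v using append_in_words[OF w that] by simp
  show "cell w = (\<Union>v\<in>words N m. cell (w @ v))" by (rule cell_subdivide)
  have "(\<Sum>v\<in>words N m. emeasure \<nu> (cell (w @ v))) = (\<Sum>v\<in>words N m. ennreal (1 / real N ^ (n + m)))"
    using append_in_words[OF w] by (intro sum.cong emeasure_cell) auto
  also have "\<dots> = ennreal (\<Sum>v\<in>words N m. 1 / real N ^ (n + m))" by (rule sum_ennreal) auto
  also have "\<dots> = ennreal (1 / real N ^ n)" by (simp add: card_words power_add)
  finally show "emeasure \<nu> (cell w) = (\<Sum>v\<in>words N m. emeasure \<nu> (cell (w @ v)))"
    using w by (simp add: emeasure_cell)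
  show "emeasure \<nu> (cell w) < \<infinity>" using w by (simp add: emeasure_cell)
qed auto

lemma nn_integral_subcells:
  assumes w: "w \<in> words N n" and g: "g \<in> borel_measurable \<nu>"
  shows "(\<integral>\<^sup>+x\<in>cell w. g x \<partial>\<nu>) = (\<Sum>v\<in>words N m. \<integral>\<^sup>+x\<in>cell (w @ v). g x \<partial>\<nu>)"
proof -
  have "(\<integral>\<^sup>+x\<in>cell w. g x \<partial>\<nu>) = (\<integral>\<^sup>+x. (\<Sum>v\<in>words N m. g x * indicator (cell (w @ v)) x) \<partial>\<nu>)"
    using AE_subcells[OF w, of m] by (intro nn_integral_cong_AE) (auto elim!: AE_mp simp flip: sum_distrib_left)
  also have "\<dots> = (\<Sum>v\<in>words N m. \<integral>\<^sup>+x\<in>cell (w @ v). g x \<partial>\<nu>)"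
    using g append_in_words[OF w] by (intro nn_integral_sum) (auto intro!: borel_measurable_times_ennreal)
  finally show ?thesis .
qed

lemma nn_integral_cells:
  assumes "g \<in> borel_measurable \<nu>"
  shows "(\<integral>\<^sup>+x. g x \<partial>\<nu>) = (\<Sum>w\<in>words N n. \<integral>\<^sup>+x\<in>cell w. g x \<partial>\<nu>)"
proof -
  have "(\<integral>\<^sup>+x. g x \<partial>\<nu>) = (\<integral>\<^sup>+x\<in>cell []. g x \<partial>\<nu>)"
    by (intro nn_integral_cong) (simp add: cell_Nil space_nu)
  also have "\<dots> = (\<Sum>w\<in>words N n. \<integral>\<^sup>+x\<in>cell ([] @ w). g x \<partial>\<nu>)"
    by (rule nn_integral_subcells[OF _ assms]) (simp add: words_def)
  finally show ?thesis by simp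
qed

end

section \<open>Energies on shells\<close>

lemma sum_geometric_le:
  fixes t :: real assumes "2 \<le> t"
  shows "(\<Sum>k\<le>n. t ^ k) \<le> 2 * t ^ n"
proof (induction n)
  case (Suc n)
  have "2 * t ^ n \<le> t * t ^ n" using assms by (intro mult_right_mono) auto
  then show ?case using Suc by simp
qed simp

lemma powr_diff_le_ln:
  fixes l d :: real assumes "1 < l" "0 < d"
  shows "1 - l powr (- d) \<le> d * ln l" "0 < 1 - l powr (- d)"
  using assms exp_ge_add_one_self[of "- (d * ln l)"] by (auto simp: powr_def)

text \<open>With \<open>powr_diff_le_ln\<close> this keeps \<open>d / (1 - l powr (- d))\<close>,
  the normalization of the Abel mean, between \<open>1 / ln l\<close> and \<open>l / ln l\<close>
  for \<open>0 < d \<le> 1\<close>.\<close>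

lemma le_powr_diff_ln:
  fixes l d :: real assumes "1 < l" "0 < d" "d \<le> 1"
  shows "d / (1 - l powr (- d)) \<le> l / ln l"
proof -
  have "1 + d * ln l \<le> l powr d"
    using exp_ge_add_one_self[of "d * ln l"] assms by (simp add: powr_def)
  then have "d * ln l \<le> l powr d * (1 - l powr (- d))"
    using assms by (simp add: algebra_simps powr_minus)
  also have "\<dots> \<le> l powr 1 * (1 - l powr (- d))"
    using assms powr_diff_le_ln(2)[of l d] by (intro mult_right_mono powr_mono) auto
  finally show ?thesis using assms powr_diff_le_ln(2)[of l d] by (simp add: field_simps)
qed

lemma square_sum3_le: "(x + y + z)\<^sup>2 \<le> 3 * (x\<^sup>2 + y\<^sup>2 + (z::real)\<^sup>2)"
proof -
  have "0 \<le> (x - y)\<^sup>2 + (y - z)\<^sup>2 + (x - z)\<^sup>2" by simp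
  then show ?thesis by (simp add: power2_eq_square algebra_simps)
qed

lemma suminf_offset_le_ennreal:
  fixes g :: "nat \<Rightarrow> ennreal"
  shows "(\<Sum>n. g (n + k)) \<le> (\<Sum>n. g n)"
proof (rule suminf_le_const)
  fix m
  have "(\<Sum>n<m. g (n + k)) = sum g ((\<lambda>n. n + k) ` {..<m})" by (simp add: sum.reindex)
  also have "\<dots> \<le> (\<Sum>n. g n)" by (rule sum_le_suminf) auto
  finally show "(\<Sum>n<m. g (n + k)) \<le> (\<Sum>n. g n)" .
qed auto

context lattice_ifs
begin

definition shell :: "(plane \<Rightarrow> real) \<Rightarrow> real \<Rightarrow> ennreal" where
  "shell u r = (\<integral>\<^sup>+x. (\<integral>\<^sup>+y. ennreal (if dist x y < r then (u x - u y)\<^sup>2 else 0) \<partial>\<nu>) \<partial>\<nu>)"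

abbreviation renormalized :: "real \<Rightarrow> (plane \<Rightarrow> real) \<Rightarrow> real \<Rightarrow> ennreal" where
  "renormalized bs u \<equiv> \<lambda>\<beta>. ennreal (bs - \<beta>) * nonlocal_energy \<nu> \<alpha> \<beta> u"

lemma dist_measurable [measurable]: "(\<lambda>z. dist (fst z) (snd z)) \<in> borel_measurable (\<nu> \<Otimes>\<^sub>M \<nu>)"
  by (intro borel_measurable_dist measurable_compose[OF measurable_fst id_measurable]
      measurable_compose[OF measurable_snd id_measurable])

lemma dist_measurable2 [measurable]: "(\<lambda>y. dist x y) \<in> borel_measurable \<nu>"
  by (intro borel_measurable_dist measurable_const id_measurable) auto

lemma shell_measurable:
  assumes [measurable]: "u \<in> borel_measurable \<nu>"
  shows "(\<lambda>z. ennreal (if dist (fst z) (snd z) < r then (u (fst z) - u (snd z))\<^sup>2 else 0))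
    \<in> borel_measurable (\<nu> \<Otimes>\<^sub>M \<nu>)"
  by measurable

lemma nn_integral_suminf2:
  assumes "\<And>n :: nat. (\<lambda>z. g n (fst z) (snd z)) \<in> borel_measurable (\<nu> \<Otimes>\<^sub>M \<nu>)"
  shows "(\<integral>\<^sup>+x. (\<integral>\<^sup>+y. (\<Sum>n. g n x y) \<partial>\<nu>) \<partial>\<nu>) = (\<Sum>n. \<integral>\<^sup>+x. (\<integral>\<^sup>+y. g n x y \<partial>\<nu>) \<partial>\<nu>)"
proof -
  have "(\<lambda>x. \<integral>\<^sup>+y. g n x y \<partial>\<nu>) \<in> borel_measurable \<nu>" for n
    using assms[of n] by (intro nu.borel_measurable_nn_integral) (simp add: case_prod_unfold)
  moreover have "(\<lambda>y. g n x y) \<in> borel_measurable \<nu>" if "x \<in> space \<nu>" for n x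
    using measurable_compose_Pair1[OF that assms[of n]] by simp
  ultimately show ?thesis
    by (simp add: nn_integral_suminf cong: nn_integral_cong)
qed

text \<open>Splits the weight of level \<open>n\<close> into the critical weight of the limit
  exponent \<open>bs\<close> and the Abel factor \<open>q ^ n\<close> with
  \<open>q = L powr (- (bs - \<beta>))\<close>.\<close>

lemma powr_factor:
  "(real L powr (\<alpha> + \<beta>)) ^ n = (real N * real L powr bs) ^ n * (real L powr (- (bs - \<beta>))) ^ n"
  by (simp add: L_powr_alpha[symmetric] powr_add[symmetric] power_mult_distrib[symmetric])

text \<open>For a pair at distance \<open>d\<close> the active levels are those with
  \<open>d < R / L ^ n\<close>; their weights form a geometric sum with ratio at least
  \<open>N \<ge> 2\<close>, controlled by its last term, which is at most
  \<open>(R / d) powr (\<alpha> + \<beta>)\<close>. The constant contains \<open>bs\<close> instead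
  of \<open>\<beta>\<close> to be uniform in \<open>\<beta>\<close>; this uses
  \<open>1 \<le> R\<close>.\<close>

lemma shells_le_nonlocal_energy:
  assumes u: "u \<in> borel_measurable \<nu>" and \<beta>: "0 < \<beta>" "\<beta> < bs" and R: "1 \<le> R"
  shows "(\<Sum>n. ennreal ((real L powr (\<alpha> + \<beta>)) ^ n) * shell u (R / real L ^ n))
    \<le> ennreal (2 * R powr (\<alpha> + bs)) * nonlocal_energy \<nu> \<alpha> \<beta> u"
proof -
  define s where "s = \<alpha> + \<beta>"
  define t where "t = real L powr s"
  have s: "0 < s" "s \<le> \<alpha> + bs" using alpha_pos \<beta> by (auto simp: s_def)
  have "real L powr \<alpha> \<le> t" unfolding t_def s_def using \<beta> L by (intro powr_mono) auto
  then have t: "2 \<le> t" using N by (simp add: L_powr_alpha)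
  have tn: "t ^ n = (real L ^ n) powr s" for n
    by (simp add: t_def powr_power powr_powr powr_realpow[symmetric] mult.commute)
  have pw: "(\<Sum>n. ennreal (t ^ n) * ennreal (if dist x y < R / real L ^ n then (u x - u y)\<^sup>2 else 0))
      \<le> ennreal (2 * R powr (\<alpha> + bs)) * ennreal ((u x - u y)\<^sup>2 / dist x y powr s)" for x y
  proof (cases "x = y")
    case False
    define d where "d = dist x y"
    have d: "0 < d" using False by (simp add: d_def)
    define A where "A = 2 * R powr (\<alpha> + bs) / d powr s"
    have A: "0 \<le> A" by (simp add: A_def)
    \<comment> \<open>If the largest level is active, all weights up to it are bounded by the full
      geometric sum; otherwise the last term vanishes.\<close>
    have part: "(\<Sum>k<n. t ^ k * (if d < R / real L ^ k then 1 else 0)) \<le> A" for n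
    proof (induction n)
      case 0
      then show ?case by (simp add: A_def)
    next
      case (Suc n)
      show ?case
      proof (cases "d < R / real L ^ n")
        case True
        then have le: "real L ^ n \<le> R / d" using d by (simp add: field_simps)
        have "(\<Sum>k<Suc n. t ^ k * (if d < R / real L ^ k then 1 else 0)) \<le> (\<Sum>k\<le>n. t ^ k)"
          unfolding lessThan_Suc_atMost using t by (intro sum_mono) auto
        also have "\<dots> \<le> 2 * t ^ n" using t by (rule sum_geometric_le)
        also have "t ^ n \<le> (R / d) powr s" unfolding tn using le s by (intro powr_mono2) auto
        also have "(R / d) powr s = R powr s / d powr s" by (rule powr_divide)
        also have "2 * (R powr s / d powr s) \<le> A"
          unfolding A_def using s R by (simp add: divide_right_mono powr_mono)
        finally show ?thesis by simp
      next
        case False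
        then show ?thesis using Suc by simp
      qed
    qed
    have "(\<Sum>n. ennreal (t ^ n) * ennreal (if d < R / real L ^ n then (u x - u y)\<^sup>2 else 0)) =
        (\<Sum>n. ennreal ((u x - u y)\<^sup>2) * ennreal (t ^ n * (if d < R / real L ^ n then 1 else 0)))"
      using t by (intro suminf_cong) (auto simp: ennreal_mult[symmetric] mult.commute)
    also have "\<dots> = ennreal ((u x - u y)\<^sup>2) * (\<Sum>n. ennreal (t ^ n * (if d < R / real L ^ n then 1 else 0)))"
      by (rule ennreal_suminf_cmult)
    finally have eq: "(\<Sum>n. ennreal (t ^ n) * ennreal (if d < R / real L ^ n then (u x - u y)\<^sup>2 else 0)) =
      ennreal ((u x - u y)\<^sup>2) * (\<Sum>n. ennreal (t ^ n * (if d < R / real L ^ n then 1 else 0)))" .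
    have "(\<Sum>n. ennreal (t ^ n * (if d < R / real L ^ n then 1 else 0))) \<le> ennreal A"
    proof (rule suminf_le_const)
      show "sum (\<lambda>n. ennreal (t ^ n * (if d < R / real L ^ n then 1 else 0))) {..<n} \<le> ennreal A" for n
        using part[of n] t by (subst sum_ennreal) (auto intro: ennreal_leI)
    qed auto
    then have "ennreal ((u x - u y)\<^sup>2) * (\<Sum>n. ennreal (t ^ n * (if d < R / real L ^ n then 1 else 0)))
        \<le> ennreal ((u x - u y)\<^sup>2) * ennreal A" by (rule mult_left_mono) simp
    also have "\<dots> = ennreal (2 * R powr (\<alpha> + bs)) * ennreal ((u x - u y)\<^sup>2 / dist x y powr s)"
      using A by (simp add: d_def A_def ennreal_mult'[symmetric] mult_ac)
    finally show ?thesis unfolding eq[symmetric] unfolding d_def .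
  qed (simp cong: if_cong)
  have "(\<Sum>n. ennreal (t ^ n) * shell u (R / real L ^ n)) =
      (\<Sum>n. \<integral>\<^sup>+x. (\<integral>\<^sup>+y. ennreal (t ^ n) * ennreal (if dist x y < R / real L ^ n then (u x - u y)\<^sup>2 else 0) \<partial>\<nu>) \<partial>\<nu>)"
  proof (rule suminf_cong)
    fix n
    have m: "(\<lambda>x. \<integral>\<^sup>+y. ennreal (if dist x y < R / real L ^ n then (u x - u y)\<^sup>2 else 0) \<partial>\<nu>) \<in> borel_measurable \<nu>"
      using shell_measurable[OF u] by (intro nu.borel_measurable_nn_integral) (simp add: case_prod_unfold)
    have m': "(\<lambda>y. ennreal (if dist x y < R / real L ^ n then (u x - u y)\<^sup>2 else 0)) \<in> borel_measurable \<nu>" for x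
      using u by measurable
    show "ennreal (t ^ n) * shell u (R / real L ^ n) =
      (\<integral>\<^sup>+x. (\<integral>\<^sup>+y. ennreal (t ^ n) * ennreal (if dist x y < R / real L ^ n then (u x - u y)\<^sup>2 else 0) \<partial>\<nu>) \<partial>\<nu>)"
      unfolding shell_def nn_integral_cmult[OF m'] nn_integral_cmult[OF m] ..
  qed
  also have "\<dots> = (\<integral>\<^sup>+x. (\<integral>\<^sup>+y. (\<Sum>n. ennreal (t ^ n) * ennreal (if dist x y < R / real L ^ n then (u x - u y)\<^sup>2 else 0)) \<partial>\<nu>) \<partial>\<nu>)"
    using shell_measurable[OF u] by (subst nn_integral_suminf2) (auto intro!: borel_measurable_times_ennreal)
  also have "\<dots> \<le> (\<integral>\<^sup>+x. (\<integral>\<^sup>+y. ennreal (2 * R powr (\<alpha> + bs)) * ennreal ((u x - u y)\<^sup>2 / dist x y powr s) \<partial>\<nu>) \<partial>\<nu>)"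
    by (intro nn_integral_mono pw)
  also have "\<dots> = ennreal (2 * R powr (\<alpha> + bs)) * nonlocal_energy \<nu> \<alpha> \<beta> u"
  proof -
    have m: "(\<lambda>z. ennreal ((u (fst z) - u (snd z))\<^sup>2 / dist (fst z) (snd z) powr s)) \<in> borel_measurable (\<nu> \<Otimes>\<^sub>M \<nu>)"
      using u by measurable
    have m1: "(\<lambda>x. \<integral>\<^sup>+y. ennreal ((u x - u y)\<^sup>2 / dist x y powr s) \<partial>\<nu>) \<in> borel_measurable \<nu>"
      using m by (intro nu.borel_measurable_nn_integral) (simp add: case_prod_unfold)
    have m2: "(\<lambda>y. ennreal ((u x - u y)\<^sup>2 / dist x y powr s)) \<in> borel_measurable \<nu>" for x
      using u by measurable
    show ?thesis unfolding nonlocal_energy_def nn_integral_cmult[OF m2] nn_integral_cmult[OF m1] s_def[symmetric] ..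
  qed
  finally show ?thesis by (simp add: t_def s_def)
qed

text \<open>A lower bound \<open>m\<close> valid from some level \<open>n0\<close> on passes to the
  Abel mean, since dropping the first \<open>n0\<close> terms only costs the factor
  \<open>q ^ n0\<close>, which tends to 1. The same \<open>C\<close> serves all \<open>u\<close> and
  \<open>m\<close>, and \<open>m\<close> may be infinite.\<close>

lemma liminf_nonlocal_energy_ge:
  assumes bs: "0 < bs" and R: "1 \<le> R"
  shows "\<exists>C>0. \<forall>u m. u \<in> borel_measurable \<nu> \<longrightarrow>
    (\<forall>\<^sub>F n in sequentially. m \<le> ennreal ((real N * real L powr bs) ^ n) * shell u (R / real L ^ n)) \<longrightarrow>
    m \<le> ennreal C * Liminf (at_left bs) (renormalized bs u)"
proof -
  define A where "A = 2 * R powr (\<alpha> + bs)"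
  define C where "C = 2 * A * ln (real L)"
  have lnL: "0 < ln (real L)" by simp
  have A: "0 < A" using R by (simp add: A_def)
  have C: "0 < C" using A lnL by (simp add: C_def)
  have main: "m \<le> ennreal C * Liminf (at_left bs) (renormalized bs u)"
    if u: "u \<in> borel_measurable \<nu>"
      and ev: "\<forall>\<^sub>F n in sequentially. m \<le> ennreal ((real N * real L powr bs) ^ n) * shell u (R / real L ^ n)" for u m
  proof -
    obtain n0 where n0: "\<And>n. n0 \<le> n \<Longrightarrow> m \<le> ennreal ((real N * real L powr bs) ^ n) * shell u (R / real L ^ n)"
      using ev by (auto simp: eventually_sequentially)
    have lim: "((\<lambda>\<beta>. (real L powr (- (bs - \<beta>))) ^ n0) \<longlongrightarrow> (real L powr (- (bs - bs))) ^ n0) (at_left bs)"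
      by (intro tendsto_intros) auto
    have ev1: "\<forall>\<^sub>F \<beta> in at_left bs. 1 / 2 < (real L powr (- (bs - \<beta>))) ^ n0"
      using lim by (intro order_tendstoD) auto
    have ev2: "\<forall>\<^sub>F \<beta> in at_left bs. \<beta> \<in> {0<..<bs}" using bs by (rule eventually_at_left_real)
    have "\<forall>\<^sub>F \<beta> in at_left bs. m * ennreal (1 / C) \<le> ennreal (bs - \<beta>) * nonlocal_energy \<nu> \<alpha> \<beta> u"
      using ev1 ev2
    proof eventually_elim
      case (elim \<beta>)
      define d where "d = bs - \<beta>"
      define q where "q = real L powr (- d)"
      have d: "0 < d" using elim by (simp add: d_def)
      have q: "0 < q" "q < 1" using powr_diff_le_ln(2)[of "real L" d] d by (auto simp: q_def)
      have half: "1 / 2 < q ^ n0" using elim by (simp add: q_def d_def)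
      have "ennreal (1 / 2 / (1 - q)) * m \<le> ennreal (q ^ n0 / (1 - q)) * m"
        using half q by (intro mult_right_mono ennreal_leI divide_right_mono) auto
      also have "ennreal (q ^ n0 / (1 - q)) = (\<Sum>n. ennreal (q ^ (n + n0)))"
        using q sums_mult[OF geometric_sums[of q], of "q ^ n0"]
        by (intro suminf_ennreal_eq[symmetric]) (auto simp: power_add mult.commute)
      also have "\<dots> * m = (\<Sum>n. ennreal (q ^ (n + n0)) * m)"
        by (rule ennreal_suminf_multc[symmetric])
      also have "\<dots> \<le> (\<Sum>n. ennreal (q ^ (n + n0)) * (ennreal ((real N * real L powr bs) ^ (n + n0)) * shell u (R / real L ^ (n + n0))))"
        by (intro suminf_le mult_left_mono n0) auto
      also have "\<dots> = (\<Sum>n. ennreal ((real L powr (\<alpha> + \<beta>)) ^ (n + n0)) * shell u (R / real L ^ (n + n0)))"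
        unfolding powr_factor[of \<beta> _ bs] q_def d_def
        by (intro suminf_cong) (simp add: ennreal_mult mult_ac)
      also have "\<dots> \<le> (\<Sum>n. ennreal ((real L powr (\<alpha> + \<beta>)) ^ n) * shell u (R / real L ^ n))"
        by (rule suminf_offset_le_ennreal)
      also have "\<dots> \<le> ennreal A * nonlocal_energy \<nu> \<alpha> \<beta> u"
        unfolding A_def using elim R by (intro shells_le_nonlocal_energy u) auto
      finally have 1: "ennreal (1 / 2 / (1 - q)) * m \<le> ennreal A * nonlocal_energy \<nu> \<alpha> \<beta> u" .
      have "1 - q \<le> d * ln (real L)" using powr_diff_le_ln(1)[of "real L" d] d by (simp add: q_def)
      then have "1 / ln (real L) \<le> d / (1 - q)" using q lnL by (simp add: field_simps del: ln_gt_zero_iff)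
      then have "1 / ln (real L) * (1 / (2 * A)) \<le> d / (1 - q) * (1 / (2 * A))"
        using A by (intro mult_right_mono) auto
      then have "1 / C \<le> d / A * (1 / 2 / (1 - q))" by (simp add: C_def mult_ac)
      then have "m * ennreal (1 / C) \<le> m * ennreal (d / A * (1 / 2 / (1 - q)))" by (intro mult_left_mono ennreal_leI) auto
      also have "\<dots> = ennreal (d / A) * (ennreal (1 / 2 / (1 - q)) * m)"
        using d A q by (subst ennreal_mult) (auto simp: mult_ac)
      also have "\<dots> \<le> ennreal (d / A) * (ennreal A * nonlocal_energy \<nu> \<alpha> \<beta> u)" using 1 by (rule mult_left_mono) simp
      also have "\<dots> = ennreal d * nonlocal_energy \<nu> \<alpha> \<beta> u"
        using d A by (simp add: mult.assoc[symmetric] ennreal_mult[symmetric])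
      finally show ?case by (simp add: d_def)
    qed
    then have "m * ennreal (1 / C) \<le> Liminf (at_left bs) (renormalized bs u)"
      by (rule Liminf_bounded)
    then have "ennreal C * (m * ennreal (1 / C)) \<le> ennreal C * Liminf (at_left bs) (renormalized bs u)"
      by (rule mult_left_mono) simp
    moreover have "ennreal C * (m * ennreal (1 / C)) = m"
      using C by (simp add: mult.left_commute[of _ m] ennreal_mult[symmetric])
    ultimately show ?thesis by simp
  qed
  show ?thesis using C main by blast
qed

text \<open>Up to a constant this integral dominates the contribution of pairs at distance at least
  \<open>c\<close> in the upper estimate. It does not depend on \<open>\<beta>\<close>, so
  finiteness is enough for the factor \<open>bs - \<beta>\<close> to remove it in the limit.\<close>

lemma double_integral_finite:
  assumes u: "u \<in> L2 \<nu>"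
  shows "(\<integral>\<^sup>+x. (\<integral>\<^sup>+y. ennreal ((u x - u y)\<^sup>2) \<partial>\<nu>) \<partial>\<nu>) < \<infinity>"
proof -
  have m [measurable]: "u \<in> borel_measurable \<nu>" and int: "integrable \<nu> (\<lambda>x. (u x)\<^sup>2)" using u by (auto simp: L2_def)
  define G where "G = (\<integral>\<^sup>+x. ennreal ((u x)\<^sup>2) \<partial>\<nu>)"
  have G: "G < \<infinity>" using int by (simp add: G_def integrable_iff_bounded)
  have le: "ennreal ((u x - u y)\<^sup>2) \<le> 2 * ennreal ((u x)\<^sup>2) + 2 * ennreal ((u y)\<^sup>2)" for x y
  proof -
    have "0 \<le> (u x + u y)\<^sup>2" by simp
    then have "(u x - u y)\<^sup>2 \<le> 2 * (u x)\<^sup>2 + 2 * (u y)\<^sup>2" by (simp add: power2_eq_square algebra_simps)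
    then have "ennreal ((u x - u y)\<^sup>2) \<le> ennreal (2 * (u x)\<^sup>2 + 2 * (u y)\<^sup>2)" by (rule ennreal_leI)
    also have "\<dots> = 2 * ennreal ((u x)\<^sup>2) + 2 * ennreal ((u y)\<^sup>2)" by (simp add: ennreal_mult)
    finally show ?thesis .
  qed
  have "(\<integral>\<^sup>+x. (\<integral>\<^sup>+y. ennreal ((u x - u y)\<^sup>2) \<partial>\<nu>) \<partial>\<nu>)
      \<le> (\<integral>\<^sup>+x. (\<integral>\<^sup>+y. 2 * ennreal ((u x)\<^sup>2) + 2 * ennreal ((u y)\<^sup>2) \<partial>\<nu>) \<partial>\<nu>)"
    by (intro nn_integral_mono le)
  also have "\<dots> = (\<integral>\<^sup>+x. 2 * ennreal ((u x)\<^sup>2) + 2 * G \<partial>\<nu>)"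
    by (simp add: nn_integral_add nn_integral_cmult prob_space_nu G_def)
  also have "\<dots> = 2 * G + 2 * G"
    by (simp add: nn_integral_add nn_integral_cmult prob_space_nu G_def)
  also have "\<dots> < \<infinity>" using G by (simp add: ennreal_mult_less_top)
  finally show ?thesis .
qed

text \<open>Converse of \<open>shells_le_nonlocal_energy\<close>: a pair at distance
  \<open>d < c\<close> is charged to the single level \<open>n\<close> with
  \<open>c / L ^ (n + 1) \<le> d < c / L ^ n\<close>, a more distant pair to the unweighted double
  integral.\<close>

lemma nonlocal_energy_le_shells:
  assumes u: "u \<in> borel_measurable \<nu>" and \<beta>: "0 < \<beta>" "\<beta> < bs" and c: "0 < c" "c \<le> 1"
  shows "nonlocal_energy \<nu> \<alpha> \<beta> u \<le> ennreal ((real L / c) powr (\<alpha> + bs)) *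
    ((\<integral>\<^sup>+x. (\<integral>\<^sup>+y. ennreal ((u x - u y)\<^sup>2) \<partial>\<nu>) \<partial>\<nu>) +
     (\<Sum>n. ennreal ((real L powr (\<alpha> + \<beta>)) ^ n) * shell u (c / real L ^ n)))"
proof -
  define s where "s = \<alpha> + \<beta>"
  define t where "t = real L powr s"
  define A where "A = (real L / c) powr (\<alpha> + bs)"
  have s: "0 < s" "s \<le> \<alpha> + bs" using alpha_pos \<beta> by (auto simp: s_def)
  have tn: "t ^ n = (real L ^ n) powr s" for n
    by (simp add: t_def powr_power powr_powr powr_realpow[symmetric] mult.commute)
  have Lc: "1 \<le> real L / c" using c L by (simp add: field_simps)
  have As: "(real L / c) powr s \<le> A" unfolding A_def using Lc s by (intro powr_mono) auto
  define h where "h n x y = ennreal (t ^ n) * ennreal (if dist x y < c / real L ^ n then (u x - u y)\<^sup>2 else 0)" for n x y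
  have pw: "ennreal ((u x - u y)\<^sup>2 / dist x y powr s) \<le> ennreal A * (ennreal ((u x - u y)\<^sup>2) + (\<Sum>n. h n x y))" for x y
  proof (cases "x = y")
    case False
    define d where "d = dist x y"
    have d: "0 < d" using False by (simp add: d_def)
    show ?thesis
    proof (cases "d < c")
      case True
      define k where "k = (LEAST k. c / real L ^ k \<le> d)"
      have "\<exists>k. c / real L ^ k \<le> d"
        using real_arch_pow[of "real L" "c / d"] d by (auto simp: field_simps intro: less_imp_le)
      then have k: "c / real L ^ k \<le> d" unfolding k_def by (rule LeastI_ex)
      have "k \<noteq> 0" using k True by (intro notI) auto
      then obtain n where n: "k = Suc n" by (cases k) auto
      have dn: "d < c / real L ^ n"
        using not_less_Least[of n "\<lambda>k. c / real L ^ k \<le> d"] n unfolding k_def by auto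
      have "1 / d \<le> (real L / c) * real L ^ n" using k n d c by (simp add: field_simps)
      then have "(1 / d) powr s \<le> ((real L / c) * real L ^ n) powr s" using s d by (intro powr_mono2) auto
      also have "\<dots> = (real L / c) powr s * t ^ n" unfolding tn by (rule powr_mult)
      also have "\<dots> \<le> A * t ^ n" using As by (intro mult_right_mono) (auto simp: t_def)
      finally have "1 / d powr s \<le> A * t ^ n" by (simp add: powr_divide)
      then have "(u x - u y)\<^sup>2 * (1 / d powr s) \<le> (u x - u y)\<^sup>2 * (A * t ^ n)" by (rule mult_left_mono) simp
      then have "ennreal ((u x - u y)\<^sup>2 / d powr s) \<le> ennreal (A * (t ^ n * (u x - u y)\<^sup>2))"
        by (intro ennreal_leI) (simp add: mult_ac)
      also have "\<dots> = ennreal A * h n x y"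
        using dn unfolding h_def d_def by (simp add: ennreal_mult A_def t_def)
      also have "h n x y \<le> (\<Sum>n. h n x y)" using sum_le_suminf[of "\<lambda>n. h n x y" "{n}"] by simp
      also have "\<dots> \<le> ennreal ((u x - u y)\<^sup>2) + (\<Sum>n. h n x y)" by simp
      finally show ?thesis by (simp add: d_def mult_left_mono)
    next
      case False
      have "1 / d \<le> 1 / c" using False c by (intro divide_left_mono) auto
      also have "\<dots> \<le> real L / c" using c L by (intro divide_right_mono) auto
      finally have "1 / d \<le> real L / c" .
      then have "(1 / d) powr s \<le> (real L / c) powr s" using s d by (intro powr_mono2) auto
      then have "1 / d powr s \<le> A" using As by (simp add: powr_divide)
      then have "(u x - u y)\<^sup>2 * (1 / d powr s) \<le> (u x - u y)\<^sup>2 * A" by (rule mult_left_mono) simp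
      then have "ennreal ((u x - u y)\<^sup>2 / d powr s) \<le> ennreal (A * (u x - u y)\<^sup>2)"
        by (intro ennreal_leI) (simp add: mult_ac)
      also have "\<dots> = ennreal A * ennreal ((u x - u y)\<^sup>2)" by (simp add: ennreal_mult A_def)
      also have "\<dots> \<le> ennreal A * (ennreal ((u x - u y)\<^sup>2) + (\<Sum>n. h n x y))" by (intro mult_left_mono) auto
      finally show ?thesis by (simp add: d_def)
    qed
  qed simp
  have hm: "(\<lambda>z. h n (fst z) (snd z)) \<in> borel_measurable (\<nu> \<Otimes>\<^sub>M \<nu>)" for n
    unfolding h_def using shell_measurable[OF u] by (intro borel_measurable_times_ennreal) auto
  have Hm: "(\<lambda>z. \<Sum>n. h n (fst z) (snd z)) \<in> borel_measurable (\<nu> \<Otimes>\<^sub>M \<nu>)"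
    using hm by (rule borel_measurable_suminf_order)
  have um: "(\<lambda>z. ennreal ((u (fst z) - u (snd z))\<^sup>2)) \<in> borel_measurable (\<nu> \<Otimes>\<^sub>M \<nu>)"
    using u by measurable
  have sec: "(\<lambda>y. g (x, y)) \<in> borel_measurable \<nu>" if "g \<in> borel_measurable (\<nu> \<Otimes>\<^sub>M \<nu>)" "x \<in> space \<nu>"
    for g :: "plane \<times> plane \<Rightarrow> ennreal" and x
    using measurable_compose_Pair1[OF that(2,1)] .
  have int: "(\<lambda>x. \<integral>\<^sup>+y. g (x, y) \<partial>\<nu>) \<in> borel_measurable \<nu>" if "g \<in> borel_measurable (\<nu> \<Otimes>\<^sub>M \<nu>)"
    for g :: "plane \<times> plane \<Rightarrow> ennreal"
    using that by (intro nu.borel_measurable_nn_integral) simp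
  have "nonlocal_energy \<nu> \<alpha> \<beta> u \<le>
      (\<integral>\<^sup>+x. (\<integral>\<^sup>+y. ennreal A * (ennreal ((u x - u y)\<^sup>2) + (\<Sum>n. h n x y)) \<partial>\<nu>) \<partial>\<nu>)"
    unfolding nonlocal_energy_def s_def[symmetric] by (intro nn_integral_mono pw)
  also have "\<dots> = (\<integral>\<^sup>+x. ennreal A * ((\<integral>\<^sup>+y. ennreal ((u x - u y)\<^sup>2) \<partial>\<nu>) + (\<integral>\<^sup>+y. (\<Sum>n. h n x y) \<partial>\<nu>)) \<partial>\<nu>)"
  proof (rule nn_integral_cong)
    fix x assume x: "x \<in> space \<nu>"
    have "(\<integral>\<^sup>+y. ennreal A * (ennreal ((u x - u y)\<^sup>2) + (\<Sum>n. h n x y)) \<partial>\<nu>) =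
       ennreal A * (\<integral>\<^sup>+y. ennreal ((u x - u y)\<^sup>2) + (\<Sum>n. h n x y) \<partial>\<nu>)"
      using sec[OF um x] sec[OF Hm x] by (intro nn_integral_cmult borel_measurable_add) simp_all
    also have "(\<integral>\<^sup>+y. ennreal ((u x - u y)\<^sup>2) + (\<Sum>n. h n x y) \<partial>\<nu>) =
       (\<integral>\<^sup>+y. ennreal ((u x - u y)\<^sup>2) \<partial>\<nu>) + (\<integral>\<^sup>+y. (\<Sum>n. h n x y) \<partial>\<nu>)"
      using sec[OF um x] sec[OF Hm x] by (intro nn_integral_add) simp_all
    finally show "(\<integral>\<^sup>+y. ennreal A * (ennreal ((u x - u y)\<^sup>2) + (\<Sum>n. h n x y)) \<partial>\<nu>) =
       ennreal A * ((\<integral>\<^sup>+y. ennreal ((u x - u y)\<^sup>2) \<partial>\<nu>) + (\<integral>\<^sup>+y. (\<Sum>n. h n x y) \<partial>\<nu>))" .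
  qed
  also have "\<dots> = ennreal A * (\<integral>\<^sup>+x. (\<integral>\<^sup>+y. ennreal ((u x - u y)\<^sup>2) \<partial>\<nu>) + (\<integral>\<^sup>+y. (\<Sum>n. h n x y) \<partial>\<nu>) \<partial>\<nu>)"
    using int[OF um] int[OF Hm] by (intro nn_integral_cmult borel_measurable_add) simp_all
  also have "(\<integral>\<^sup>+x. (\<integral>\<^sup>+y. ennreal ((u x - u y)\<^sup>2) \<partial>\<nu>) + (\<integral>\<^sup>+y. (\<Sum>n. h n x y) \<partial>\<nu>) \<partial>\<nu>) =
      (\<integral>\<^sup>+x. (\<integral>\<^sup>+y. ennreal ((u x - u y)\<^sup>2) \<partial>\<nu>) \<partial>\<nu>) + (\<integral>\<^sup>+x. (\<integral>\<^sup>+y. (\<Sum>n. h n x y) \<partial>\<nu>) \<partial>\<nu>)"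
    using int[OF um] int[OF Hm] by (intro nn_integral_add) simp_all
  also have "(\<integral>\<^sup>+x. (\<integral>\<^sup>+y. (\<Sum>n. h n x y) \<partial>\<nu>) \<partial>\<nu>) = (\<Sum>n. \<integral>\<^sup>+x. (\<integral>\<^sup>+y. h n x y \<partial>\<nu>) \<partial>\<nu>)"
    by (rule nn_integral_suminf2[OF hm])
  also have "\<dots> = (\<Sum>n. ennreal (t ^ n) * shell u (c / real L ^ n))"
  proof (rule suminf_cong)
    fix n
    note sm = shell_measurable[OF u, of "c / real L ^ n"]
    have s1: "(\<lambda>y. ennreal (if dist x y < c / real L ^ n then (u x - u y)\<^sup>2 else 0)) \<in> borel_measurable \<nu>"
      if "x \<in> space \<nu>" for x using sec[OF sm that] unfolding fst_conv snd_conv .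
    have "(\<integral>\<^sup>+x. (\<integral>\<^sup>+y. h n x y \<partial>\<nu>) \<partial>\<nu>) = (\<integral>\<^sup>+x. ennreal (t ^ n) * (\<integral>\<^sup>+y. ennreal (if dist x y < c / real L ^ n then (u x - u y)\<^sup>2 else 0) \<partial>\<nu>) \<partial>\<nu>)"
      unfolding h_def by (intro nn_integral_cong nn_integral_cmult s1)
    also have "\<dots> = ennreal (t ^ n) * shell u (c / real L ^ n)"
      unfolding shell_def using int[OF sm] unfolding fst_conv snd_conv by (rule nn_integral_cmult)
    finally show "(\<integral>\<^sup>+x. (\<integral>\<^sup>+y. h n x y \<partial>\<nu>) \<partial>\<nu>) = ennreal (t ^ n) * shell u (c / real L ^ n)" .
  qed
  finally show ?thesis by (simp add: A_def t_def s_def)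
qed

lemma limsup_nonlocal_energy_le:
  assumes bs: "0 < bs" and c: "0 < c" "c \<le> 1"
  shows "\<exists>C>0. \<forall>u m. u \<in> L2 \<nu> \<longrightarrow> 0 \<le> m \<longrightarrow>
    (\<forall>n. ennreal ((real N * real L powr bs) ^ n) * shell u (c / real L ^ n) \<le> ennreal m) \<longrightarrow>
    Limsup (at_left bs) (renormalized bs u) \<le> ennreal (C * m)"
proof -
  define A where "A = (real L / c) powr (\<alpha> + bs)"
  define C where "C = A * (real L / ln (real L))"
  have lnL: "0 < ln (real L)" by simp
  have A: "0 < A" using c by (simp add: A_def)
  have C: "0 < C" using A lnL by (simp add: C_def)
  have main: "Limsup (at_left bs) (renormalized bs u) \<le> ennreal (C * m)"
    if u2: "u \<in> L2 \<nu>" and m: "0 \<le> m"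
      and b: "\<And>n. ennreal ((real N * real L powr bs) ^ n) * shell u (c / real L ^ n) \<le> ennreal m" for u m
  proof (rule ennreal_le_epsilon)
    fix e :: real assume e: "0 < e"
    have u: "u \<in> borel_measurable \<nu>" using u2 by (simp add: L2_def)
    define G where "G = enn2real (\<integral>\<^sup>+x. (\<integral>\<^sup>+y. ennreal ((u x - u y)\<^sup>2) \<partial>\<nu>) \<partial>\<nu>)"
    have G: "(\<integral>\<^sup>+x. (\<integral>\<^sup>+y. ennreal ((u x - u y)\<^sup>2) \<partial>\<nu>) \<partial>\<nu>) = ennreal G" "0 \<le> G"
      using double_integral_finite[OF u2] by (auto simp: G_def)
    \<comment> \<open>Beyond \<open>a\<close> the exponent \<open>\<beta>\<close> is positive,
      \<open>d = bs - \<beta>\<close> is at most 1 as \<open>le_powr_diff_ln\<close> demands, and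
      the unweighted part \<open>A * d * G\<close> is at most \<open>e\<close>; \<open>G + 1\<close>
      avoids dividing by 0.\<close>
    define a where "a = Max {0, bs - 1, bs - e / (A * (G + 1))}"
    have a: "a < bs" "0 \<le> a" "bs - 1 \<le> a" "bs - e / (A * (G + 1)) \<le> a"
      using bs e A G by (auto simp: a_def)
    have "\<forall>\<^sub>F \<beta> in at_left bs. \<beta> \<in> {a<..<bs}" using a(1) by (rule eventually_at_left_real)
    then have "\<forall>\<^sub>F \<beta> in at_left bs. ennreal (bs - \<beta>) * nonlocal_energy \<nu> \<alpha> \<beta> u \<le> ennreal (C * m + e)"
    proof eventually_elim
      case (elim \<beta>)
      define d where "d = bs - \<beta>"
      define q where "q = real L powr (- d)"
      have d: "0 < d" "d \<le> 1" "d \<le> e / (A * (G + 1))" "0 < \<beta>" using elim a by (auto simp: d_def)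
      have q: "0 < q" "q < 1" using powr_diff_le_ln(2)[of "real L" d] d by (auto simp: q_def)
      have "(\<Sum>n. ennreal ((real L powr (\<alpha> + \<beta>)) ^ n) * shell u (c / real L ^ n)) =
         (\<Sum>n. ennreal (q ^ n) * (ennreal ((real N * real L powr bs) ^ n) * shell u (c / real L ^ n)))"
        unfolding powr_factor[of \<beta> _ bs] q_def d_def
        by (intro suminf_cong) (simp add: ennreal_mult mult_ac)
      also have "\<dots> \<le> (\<Sum>n. ennreal (q ^ n) * ennreal m)" by (intro suminf_le mult_left_mono b) auto
      also have "\<dots> = (\<Sum>n. ennreal (q ^ n)) * ennreal m" by (rule ennreal_suminf_multc)
      also have "(\<Sum>n. ennreal (q ^ n)) = ennreal (1 / (1 - q))"
        using q geometric_sums[of q] by (intro suminf_ennreal_eq) auto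
      finally have S: "(\<Sum>n. ennreal ((real L powr (\<alpha> + \<beta>)) ^ n) * shell u (c / real L ^ n)) \<le> ennreal (1 / (1 - q) * m)"
        using q m by (simp add: ennreal_mult[symmetric])
      have "nonlocal_energy \<nu> \<alpha> \<beta> u \<le> ennreal A * (ennreal G +
         (\<Sum>n. ennreal ((real L powr (\<alpha> + \<beta>)) ^ n) * shell u (c / real L ^ n)))"
        unfolding A_def G(1)[symmetric] using d elim c by (intro nonlocal_energy_le_shells u) auto
      also have "\<dots> \<le> ennreal A * (ennreal G + ennreal (1 / (1 - q) * m))"
        using S by (intro mult_left_mono add_left_mono) auto
      also have "\<dots> = ennreal (A * (G + 1 / (1 - q) * m))"
        using G q m A by (simp add: ennreal_mult ennreal_plus)
      finally have "ennreal d * nonlocal_energy \<nu> \<alpha> \<beta> u \<le> ennreal d * ennreal (A * (G + 1 / (1 - q) * m))"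
        by (rule mult_left_mono) simp
      also have "\<dots> = ennreal (A * d * G + A * (d / (1 - q)) * m)"
        using d by (simp add: ennreal_mult'[symmetric] algebra_simps)
      also have "\<dots> \<le> ennreal (C * m + e)"
      proof (rule ennreal_leI)
        have "A * d * G \<le> A * (e / (A * (G + 1))) * (G + 1)" using A d G e by (intro mult_mono) auto
        also have "\<dots> = e" using A G by simp
        finally have "A * d * G \<le> e" .
        moreover have "A * (d / (1 - q)) * m \<le> C * m"
          unfolding C_def q_def using le_powr_diff_ln[of "real L" d] d A m by (intro mult_right_mono mult_left_mono) auto
        ultimately show "A * d * G + A * (d / (1 - q)) * m \<le> C * m + e" by simp
      qed
      finally show ?case by (simp add: d_def)
    qed
    then have "Limsup (at_left bs) (renormalized bs u) \<le> ennreal (C * m + e)"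
      by (rule Limsup_bounded)
    then show "Limsup (at_left bs) (renormalized bs u) \<le> ennreal (C * m) + ennreal e"
      using C m e by (simp add: ennreal_plus)
  qed
  show ?thesis using C main by blast
qed

subsection \<open>Comparison with discrete differences\<close>

text \<open>The diagonal is included: two close points may share a cell, and diagonal pairs add
  nothing to sums of squared differences.\<close>

definition adjacent :: "nat \<Rightarrow> (nat list \<times> nat list) set" where
  "adjacent n = {(v, w). v \<in> words N n \<and> w \<in> words N n \<and> cell v \<inter> cell w \<noteq> {}}"

lemma finite_adjacent [simp]: "finite (adjacent n)"
  by (rule finite_subset[of _ "words N n \<times> words N n"]) (auto simp: adjacent_def)

lemma adjacent_sym: "(v, w) \<in> adjacent n \<longleftrightarrow> (w, v) \<in> adjacent n"
  by (auto simp: adjacent_def)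

lemma adjacent_degree:
  "\<exists>C. \<forall>n. \<forall>v\<in>words N n. card {w. (v, w) \<in> adjacent n} \<le> C"
proof -
  obtain C where C: "\<And>n S. (\<forall>x\<in>S. \<forall>y\<in>S. dist x y \<le> D / real L ^ n) \<Longrightarrow> card {w \<in> words N n. cell w \<inter> S \<noteq> {}} \<le> C"
    using card_cells_meeting_le[of D] by blast
  have "card {w. (v, w) \<in> adjacent n} \<le> C" if v: "v \<in> words N n" for n v
  proof -
    have "{w. (v, w) \<in> adjacent n} = {w \<in> words N n. cell w \<inter> cell v \<noteq> {}}" using v by (auto simp: adjacent_def)
    then show ?thesis using C[of "cell v" n] dist_cell_le[OF v] by simp
  qed
  then show ?thesis by blast
qed

lemma sum_adjacent_fst:
  fixes g :: "nat list \<Rightarrow> 'b::comm_semiring_1"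
  shows "(\<Sum>(v, w)\<in>adjacent n. g v) = (\<Sum>v\<in>words N n. of_nat (card {w. (v, w) \<in> adjacent n}) * g v)"
proof -
  have "adjacent n = Sigma (words N n) (\<lambda>v. {w. (v, w) \<in> adjacent n})" by (auto simp: adjacent_def)
  moreover have "finite {w. (v, w) \<in> adjacent n}" for v
    by (rule finite_subset[of _ "words N n"]) (auto simp: adjacent_def)
  ultimately have "(\<Sum>(v, w)\<in>adjacent n. g v) = (\<Sum>v\<in>words N n. \<Sum>w\<in>{w. (v, w) \<in> adjacent n}. g v)"
    by (subst sum.Sigma) auto
  then show ?thesis by simp
qed

lemma sum_adjacent_snd:
  fixes g :: "nat list \<Rightarrow> 'b::comm_semiring_1"
  shows "(\<Sum>(v, w)\<in>adjacent n. g w) = (\<Sum>(v, w)\<in>adjacent n. g v)"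
  by (rule sum.reindex_bij_witness[of _ prod.swap prod.swap]) (auto simp: adjacent_sym)

text \<open>The discrete values \<open>q w\<close> stand for the cell averages (gasket) or for vertex values (carpet).\<close>

lemma shell_le_discrete:
  "\<exists>c>0. c \<le> 1 \<and> (\<exists>C>0. \<forall>u n q. u \<in> borel_measurable \<nu> \<longrightarrow>
     shell u (c / real L ^ n) \<le>
       ennreal (C / real N ^ n) * (\<Sum>w\<in>words N n. \<integral>\<^sup>+x\<in>cell w. ennreal ((u x - q w)\<^sup>2) \<partial>\<nu>) +
       ennreal (C / real N ^ (2 * n) * (\<Sum>(v, w)\<in>adjacent n. (q v - q w)\<^sup>2)))"
proof -
  obtain c0 where c0: "0 < c0" and gap: "\<And>n v w x y. v \<in> words N n \<Longrightarrow> w \<in> words N n \<Longrightarrow> x \<in> cell v \<Longrightarrow> y \<in> cell w \<Longrightarrow>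
     dist x y < c0 / real L ^ n \<Longrightarrow> cell v \<inter> cell w \<noteq> {}" using cells_gap by blast
  define c where "c = min c0 1"
  obtain C0 where C0: "\<And>n v. v \<in> words N n \<Longrightarrow> card {w. (v, w) \<in> adjacent n} \<le> C0" using adjacent_degree by blast
  \<comment> \<open>The factor 3 comes from the three-term square inequality; the two local terms
    have equal sums by symmetry of adjacency, and each cell is counted at most \<open>C0\<close>
    times.\<close>
  define C where "C = 6 * real C0 + 3"
  have C: "0 < C" by (simp add: C_def)
  have "shell u (c / real L ^ n) \<le>
       ennreal (C / real N ^ n) * (\<Sum>w\<in>words N n. \<integral>\<^sup>+x\<in>cell w. ennreal ((u x - q w)\<^sup>2) \<partial>\<nu>) +
       ennreal (C / real N ^ (2 * n) * (\<Sum>(v, w)\<in>adjacent n. (q v - q w)\<^sup>2))"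
    if u: "u \<in> borel_measurable \<nu>" for u n q
  proof -
    note [measurable] = u
    define I where "I w = (\<integral>\<^sup>+x\<in>cell w. ennreal ((u x - q w)\<^sup>2) \<partial>\<nu>)" for w
    \<comment> \<open>Inserting \<open>q v\<close> and \<open>q w\<close> between \<open>u x\<close>
      and \<open>u y\<close> gives three squares; each factorizes into a function of
      \<open>x\<close> times a function of \<open>y\<close>, so the double integral is
      explicit.\<close>
    define P where "P v w x y = ennreal 3 * (ennreal ((u x - q v)\<^sup>2) * indicator (cell v) x * indicator (cell w) y +
       ennreal ((q v - q w)\<^sup>2) * indicator (cell v) x * indicator (cell w) y +
       ennreal ((u y - q w)\<^sup>2) * indicator (cell w) y * indicator (cell v) x)" for v w x y
    have pw: "ennreal (if dist x y < c / real L ^ n then (u x - u y)\<^sup>2 else 0) \<le> (\<Sum>(v, w)\<in>adjacent n. P v w x y)"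
      if x: "x \<in> K" and y: "y \<in> K" for x y
    proof (cases "dist x y < c / real L ^ n")
      case True
      obtain v where v: "v \<in> words N n" "x \<in> cell v" using K_words[of n] x by blast
      obtain w where w: "w \<in> words N n" "y \<in> cell w" using K_words[of n] y by blast
      have "c / real L ^ n \<le> c0 / real L ^ n" by (intro divide_right_mono) (auto simp: c_def)
      then have "(v, w) \<in> adjacent n" using gap[OF v(1) w(1) v(2) w(2)] True v w by (simp add: adjacent_def)
      then have "P v w x y \<le> (\<Sum>(v, w)\<in>adjacent n. P v w x y)"
        using member_le_sum[of "(v, w)" "adjacent n" "\<lambda>(v, w). P v w x y"] by simp
      moreover have "ennreal ((u x - u y)\<^sup>2) \<le> P v w x y"
      proof -
        have "(u x - u y)\<^sup>2 \<le> 3 * ((u x - q v)\<^sup>2 + (q v - q w)\<^sup>2 + (u y - q w)\<^sup>2)"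
          using square_sum3_le[of "u x - q v" "q v - q w" "q w - u y"] by (simp add: power2_commute[of "q w" "u y"])
        then have "ennreal ((u x - u y)\<^sup>2) \<le> ennreal (3 * ((u x - q v)\<^sup>2 + (q v - q w)\<^sup>2 + (u y - q w)\<^sup>2))"
          by (rule ennreal_leI)
        also have "\<dots> = P v w x y" unfolding P_def using v w by (simp add: ennreal_mult)
        finally show ?thesis .
      qed
      ultimately show ?thesis using True by simp
    qed simp
    have Pint: "(\<integral>\<^sup>+x. (\<integral>\<^sup>+y. P v w x y \<partial>\<nu>) \<partial>\<nu>) =
        ennreal 3 * (I v * ennreal (1 / real N ^ n) + ennreal ((q v - q w)\<^sup>2) * ennreal (1 / real N ^ n) * ennreal (1 / real N ^ n) + I w * ennreal (1 / real N ^ n))"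
      if vw: "(v, w) \<in> adjacent n" for v w
    proof -
      have [measurable]: "cell v \<in> sets \<nu>" "cell w \<in> sets \<nu>"
        using vw cell_sets[of v n] cell_sets[of w n] by (auto simp: adjacent_def)
      have e: "emeasure \<nu> (cell v) = ennreal (1 / real N ^ n)" "emeasure \<nu> (cell w) = ennreal (1 / real N ^ n)"
        using vw by (auto simp: adjacent_def emeasure_cell)
      have "(\<integral>\<^sup>+y. P v w x y \<partial>\<nu>) = ennreal 3 * (ennreal ((u x - q v)\<^sup>2) * indicator (cell v) x * ennreal (1 / real N ^ n) +
         ennreal ((q v - q w)\<^sup>2) * indicator (cell v) x * ennreal (1 / real N ^ n) + I w * indicator (cell v) x)" for x
        unfolding P_def I_def by (simp add: nn_integral_add nn_integral_cmult nn_integral_multc e)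
      then show ?thesis
        by (simp add: nn_integral_add nn_integral_cmult nn_integral_multc e I_def)
    qed
    have Pm: "(\<lambda>y. P v w x y) \<in> borel_measurable \<nu>" "(\<lambda>x. \<integral>\<^sup>+y. P v w x y \<partial>\<nu>) \<in> borel_measurable \<nu>"
      if vw: "(v, w) \<in> adjacent n" for v w x
    proof -
      have [measurable]: "cell v \<in> sets \<nu>" "cell w \<in> sets \<nu>"
        using vw cell_sets[of v n] cell_sets[of w n] by (auto simp: adjacent_def)
      show "(\<lambda>y. P v w x y) \<in> borel_measurable \<nu>" unfolding P_def by measurable
      show "(\<lambda>x. \<integral>\<^sup>+y. P v w x y \<partial>\<nu>) \<in> borel_measurable \<nu>"
        by (intro nu.borel_measurable_nn_integral) (simp add: P_def case_prod_unfold)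
    qed
    have "shell u (c / real L ^ n) \<le> (\<integral>\<^sup>+x. (\<integral>\<^sup>+y. (\<Sum>z\<in>adjacent n. P (fst z) (snd z) x y) \<partial>\<nu>) \<partial>\<nu>)"
      unfolding shell_def using pw by (intro nn_integral_mono) (simp add: space_nu case_prod_unfold)
    also have "\<dots> = (\<integral>\<^sup>+x. (\<Sum>z\<in>adjacent n. (\<integral>\<^sup>+y. P (fst z) (snd z) x y \<partial>\<nu>)) \<partial>\<nu>)"
      using Pm(1) by (intro nn_integral_cong nn_integral_sum) simp
    also have "\<dots> = (\<Sum>z\<in>adjacent n. \<integral>\<^sup>+x. (\<integral>\<^sup>+y. P (fst z) (snd z) x y \<partial>\<nu>) \<partial>\<nu>)"
      using Pm(2) by (intro nn_integral_sum) simp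
    also have "\<dots> = (\<Sum>(v, w)\<in>adjacent n. ennreal 3 * (I v * ennreal (1 / real N ^ n) +
        ennreal ((q v - q w)\<^sup>2) * ennreal (1 / real N ^ n) * ennreal (1 / real N ^ n) + I w * ennreal (1 / real N ^ n)))"
      using Pint by (intro sum.cong) auto
    also have "\<dots> = ennreal 3 * (ennreal (1 / real N ^ n) * (\<Sum>(v, w)\<in>adjacent n. I v) +
        ennreal (1 / real N ^ n) * ennreal (1 / real N ^ n) * (\<Sum>(v, w)\<in>adjacent n. ennreal ((q v - q w)\<^sup>2)) +
        ennreal (1 / real N ^ n) * (\<Sum>(v, w)\<in>adjacent n. I w))"
      by (simp only: sum_distrib_left sum.distrib case_prod_unfold distrib_left mult_ac)
    also have "\<dots> = ennreal (6 / real N ^ n) * (\<Sum>(v, w)\<in>adjacent n. I v) +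
        ennreal (3 / real N ^ (2 * n)) * (\<Sum>(v, w)\<in>adjacent n. ennreal ((q v - q w)\<^sup>2))"
    proof -
      have "ennreal (6 / real N ^ n) = ennreal 6 * ennreal (1 / real N ^ n)"
        by (subst ennreal_mult''[symmetric]) simp_all
      then have "ennreal (6 / real N ^ n) = ennreal 3 * ennreal (1 / real N ^ n) + ennreal 3 * ennreal (1 / real N ^ n)"
        by (simp add: distrib_right[symmetric])
      moreover have "ennreal (3 / real N ^ (2 * n)) = ennreal 3 * (ennreal (1 / real N ^ n) * ennreal (1 / real N ^ n))"
        by (simp add: ennreal_mult''[symmetric] power_add[symmetric] mult_2 del: ennreal_numeral)
      ultimately show ?thesis unfolding sum_adjacent_snd by (simp only: distrib_left distrib_right mult_ac add_ac)
    qed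
    also have "\<dots> \<le> ennreal (C / real N ^ n) * (\<Sum>v\<in>words N n. I v) +
        ennreal (C / real N ^ (2 * n) * (\<Sum>(v, w)\<in>adjacent n. (q v - q w)\<^sup>2))"
    proof (rule add_mono)
      have "(\<Sum>(v, w)\<in>adjacent n. I v) \<le> (\<Sum>v\<in>words N n. ennreal (real C0) * I v)"
        unfolding sum_adjacent_fst using C0 by (intro sum_mono mult_right_mono) (auto simp: ennreal_of_nat_eq_real_of_nat)
      also have "\<dots> = ennreal (real C0) * (\<Sum>v\<in>words N n. I v)" by (rule sum_distrib_left[symmetric])
      finally have "ennreal (6 / real N ^ n) * (\<Sum>(v, w)\<in>adjacent n. I v) \<le>
          ennreal (6 / real N ^ n) * (ennreal (real C0) * (\<Sum>v\<in>words N n. I v))" by (rule mult_left_mono) simp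
      also have "\<dots> = ennreal (6 / real N ^ n * real C0) * (\<Sum>v\<in>words N n. I v)"
        by (simp only: mult.assoc[symmetric]) (subst ennreal_mult'', simp_all)
      also have "\<dots> \<le> ennreal (C / real N ^ n) * (\<Sum>v\<in>words N n. I v)"
        unfolding C_def by (intro mult_right_mono ennreal_leI) (auto simp: divide_right_mono)
      finally show "ennreal (6 / real N ^ n) * (\<Sum>(v, w)\<in>adjacent n. I v) \<le> ennreal (C / real N ^ n) * (\<Sum>v\<in>words N n. I v)" .
      have "(\<Sum>(v, w)\<in>adjacent n. ennreal ((q v - q w)\<^sup>2)) = ennreal (\<Sum>(v, w)\<in>adjacent n. (q v - q w)\<^sup>2)"
        by (subst sum_ennreal[symmetric]) (auto simp: case_prod_unfold)
      then have "ennreal (3 / real N ^ (2 * n)) * (\<Sum>(v, w)\<in>adjacent n. ennreal ((q v - q w)\<^sup>2)) =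
          ennreal (3 / real N ^ (2 * n) * (\<Sum>(v, w)\<in>adjacent n. (q v - q w)\<^sup>2))"
        by (subst ennreal_mult') simp_all
      also have "\<dots> \<le> ennreal (C / real N ^ (2 * n) * (\<Sum>(v, w)\<in>adjacent n. (q v - q w)\<^sup>2))"
        unfolding C_def by (intro ennreal_leI mult_right_mono divide_right_mono sum_nonneg) auto
      finally show "ennreal (3 / real N ^ (2 * n)) * (\<Sum>(v, w)\<in>adjacent n. ennreal ((q v - q w)\<^sup>2)) \<le>
          ennreal (C / real N ^ (2 * n) * (\<Sum>(v, w)\<in>adjacent n. (q v - q w)\<^sup>2))" .
    qed
    finally show ?thesis unfolding I_def .
  qed
  moreover have "0 < c" "c \<le> 1" using c0 by (auto simp: c_def)
  ultimately show ?thesis using C by blast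
qed

subsection \<open>Cell averages\<close>

definition mean :: "(plane \<Rightarrow> real) \<Rightarrow> nat list \<Rightarrow> real" where
  "mean u w = (1 / measure \<nu> (cell w)) * (LINT x:cell w|\<nu>. u x)"

lemma L2_integrable:
  assumes "u \<in> L2 \<nu>" shows "integrable \<nu> u"
proof (rule nu.square_integrable_imp_integrable)
  show "u \<in> borel_measurable \<nu>" "integrable \<nu> (\<lambda>x. (u x)\<^sup>2)" using assms by (simp_all add: L2_def)
qed

lemma L2_diff_const_integrable:
  assumes "u \<in> L2 \<nu>" shows "integrable \<nu> (\<lambda>x. (u x - k)\<^sup>2)"
proof -
  have "integrable \<nu> (\<lambda>x. (u x)\<^sup>2)" using assms by (simp add: L2_def)
  then have "integrable \<nu> (\<lambda>x. (u x)\<^sup>2 - 2 * k * u x + k\<^sup>2)" using L2_integrable[OF assms] by simp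
  also have "(\<lambda>x. (u x)\<^sup>2 - 2 * k * u x + k\<^sup>2) = (\<lambda>x. (u x - k)\<^sup>2)"
    by (simp add: fun_eq_iff power2_eq_square algebra_simps)
  finally show ?thesis .
qed

text \<open>Splitting of the mean square deviation from \<open>k\<close> into variance and squared
  bias. It shows that the mean is the best constant on a cell, contains Jensen's inequality, and
  gives the orthogonality of increments between levels.\<close>

lemma variance_cell:
  assumes u: "u \<in> L2 \<nu>" and w: "w \<in> words N n"
  shows "(\<integral>\<^sup>+x\<in>cell w. ennreal ((u x - k)\<^sup>2) \<partial>\<nu>) =
    (\<integral>\<^sup>+x\<in>cell w. ennreal ((u x - mean u w)\<^sup>2) \<partial>\<nu>) + ennreal ((mean u w - k)\<^sup>2 / real N ^ n)"
proof -
  define p where "p = mean u w"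
  have cm [measurable]: "cell w \<in> sets \<nu>" using w by simp
  have i1: "integrable \<nu> (\<lambda>x. indicator (cell w) x * u x)"
    using integrable_mult_indicator[OF cm L2_integrable[OF u]] by simp
  have i2: "integrable \<nu> (\<lambda>x. indicator (cell w) x * (u x - b)\<^sup>2)" for b
    using integrable_mult_indicator[OF cm L2_diff_const_integrable[OF u]] by simp
  have i3: "integrable \<nu> (\<lambda>x. indicator (cell w) x :: real)"
    using w by (intro integrable_real_indicator) (simp_all add: emeasure_cell)
  have nn: "(\<integral>\<^sup>+x\<in>cell w. ennreal ((u x - b)\<^sup>2) \<partial>\<nu>) = ennreal (LINT x|\<nu>. indicator (cell w) x * (u x - b)\<^sup>2)" for b
    by (subst nn_integral_eq_integral[OF i2, symmetric])
      (auto intro!: nn_integral_cong simp: indicator_def)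
  have I0: "(LINT x|\<nu>. indicator (cell w) x :: real) = 1 / real N ^ n"
    using w measure_cell[OF w] cm by simp
  have Iu: "(LINT x|\<nu>. indicator (cell w) x * u x) = p / real N ^ n"
    using w by (simp add: p_def mean_def set_lebesgue_integral_def measure_cell)
  have "(LINT x|\<nu>. indicator (cell w) x * (u x - k)\<^sup>2) =
      (LINT x|\<nu>. indicator (cell w) x * (u x - p)\<^sup>2 + (2 * (p - k) * (indicator (cell w) x * u x) +
        ((p - k)\<^sup>2 - 2 * (p - k) * p) * indicator (cell w) x))"
    by (intro Bochner_Integration.integral_cong refl) (simp add: power2_eq_square algebra_simps)
  also have "\<dots> = (LINT x|\<nu>. indicator (cell w) x * (u x - p)\<^sup>2) + (2 * (p - k) * (p / real N ^ n) +
        ((p - k)\<^sup>2 - 2 * (p - k) * p) * (1 / real N ^ n))"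
    using i1 i2 i3 by (simp add: I0 Iu measure_cell[OF w])
  also have "2 * (p - k) * (p / real N ^ n) + ((p - k)\<^sup>2 - 2 * (p - k) * p) * (1 / real N ^ n) = (p - k)\<^sup>2 / real N ^ n"
    by (simp add: field_simps)
  finally show ?thesis unfolding nn p_def[symmetric] by (simp add: ennreal_plus)
qed

lemma mean_diff_le:
  assumes u: "u \<in> L2 \<nu>" and w: "w \<in> words N n"
  shows "ennreal ((mean u w - k)\<^sup>2) \<le> ennreal (real N ^ n) * (\<integral>\<^sup>+x\<in>cell w. ennreal ((u x - k)\<^sup>2) \<partial>\<nu>)"
proof -
  have "ennreal (real N ^ n) * ennreal ((mean u w - k)\<^sup>2 / real N ^ n) \<le>
      ennreal (real N ^ n) * (\<integral>\<^sup>+x\<in>cell w. ennreal ((u x - k)\<^sup>2) \<partial>\<nu>)"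
    by (subst variance_cell[OF assms]) (intro mult_left_mono, auto)
  then show ?thesis by (simp add: ennreal_mult'[symmetric])
qed

text \<open>Jensen's inequality twice, once in each variable; the two normalizations by the cell
  mass \<open>1 / N ^ n\<close> make up the factor \<open>N ^ (2 * n)\<close>.\<close>

lemma mean_mean_diff_le:
  assumes u: "u \<in> L2 \<nu>" and v: "v \<in> words N n" and w: "w \<in> words N n"
    and near: "\<And>x y. x \<in> cell v \<Longrightarrow> y \<in> cell w \<Longrightarrow> dist x y < r"
  shows "ennreal ((mean u v - mean u w)\<^sup>2) \<le> ennreal (real N ^ (2 * n)) *
    (\<integral>\<^sup>+x\<in>cell v. (\<integral>\<^sup>+y. ennreal (if dist x y < r then (u x - u y)\<^sup>2 else 0) \<partial>\<nu>) \<partial>\<nu>)"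
proof -
  have um: "u \<in> borel_measurable \<nu>" using u by (simp add: L2_def)
  have m: "(\<lambda>x. \<integral>\<^sup>+y. ennreal (if dist x y < r then (u x - u y)\<^sup>2 else 0) \<partial>\<nu>) \<in> borel_measurable \<nu>"
    using shell_measurable[OF um] by (intro nu.borel_measurable_nn_integral) (simp add: case_prod_unfold)
  have "ennreal ((mean u v - mean u w)\<^sup>2) \<le> ennreal (real N ^ n) * (\<integral>\<^sup>+x\<in>cell v. ennreal ((u x - mean u w)\<^sup>2) \<partial>\<nu>)"
    by (rule mean_diff_le[OF u v])
  also have "(\<integral>\<^sup>+x\<in>cell v. ennreal ((u x - mean u w)\<^sup>2) \<partial>\<nu>) \<le>
    (\<integral>\<^sup>+x. ennreal (real N ^ n) * ((\<integral>\<^sup>+y. ennreal (if dist x y < r then (u x - u y)\<^sup>2 else 0) \<partial>\<nu>) * indicator (cell v) x) \<partial>\<nu>)"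
  proof (rule nn_integral_mono)
    fix x
    show "ennreal ((u x - mean u w)\<^sup>2) * indicator (cell v) x \<le>
      ennreal (real N ^ n) * ((\<integral>\<^sup>+y. ennreal (if dist x y < r then (u x - u y)\<^sup>2 else 0) \<partial>\<nu>) * indicator (cell v) x)"
    proof (cases "x \<in> cell v")
      case True
      have "ennreal ((mean u w - u x)\<^sup>2) \<le> ennreal (real N ^ n) * (\<integral>\<^sup>+y\<in>cell w. ennreal ((u y - u x)\<^sup>2) \<partial>\<nu>)"
        by (rule mean_diff_le[OF u w])
      also have "(\<integral>\<^sup>+y\<in>cell w. ennreal ((u y - u x)\<^sup>2) \<partial>\<nu>) \<le> (\<integral>\<^sup>+y. ennreal (if dist x y < r then (u x - u y)\<^sup>2 else 0) \<partial>\<nu>)"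
        using near[OF True] by (intro nn_integral_mono) (auto simp: indicator_def power2_commute)
      finally show ?thesis using True by (simp add: power2_commute mult_left_mono)
    qed simp
  qed
  also have "\<dots> = ennreal (real N ^ n) * (\<integral>\<^sup>+x\<in>cell v. (\<integral>\<^sup>+y. ennreal (if dist x y < r then (u x - u y)\<^sup>2 else 0) \<partial>\<nu>) \<partial>\<nu>)"
    using v m by (intro nn_integral_cmult borel_measurable_times_ennreal) auto
  also have "ennreal (real N ^ n) * (ennreal (real N ^ n) * X) = ennreal (real N ^ (2 * n)) * X" for X
    by (simp add: mult.assoc[symmetric] ennreal_mult'[symmetric] mult_2 power_add)
  finally show ?thesis by (simp add: mult_left_mono)
qed

text \<open>Only the multiplicity of the first word has to be bounded: the second variable is
  integrated over everything within distance \<open>r\<close>. The free index set \<open>I\<close>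
  covers neighbouring cells on the gasket as well as pairs of cells chosen at corners on the
  carpet.\<close>

lemma sum_mean_diff_le_shell:
  assumes u: "u \<in> L2 \<nu>" and I: "finite I" and VW: "\<And>i. i \<in> I \<Longrightarrow> V i \<in> words N n \<and> W i \<in> words N n"
    and near: "\<And>i x y. i \<in> I \<Longrightarrow> x \<in> cell (V i) \<Longrightarrow> y \<in> cell (W i) \<Longrightarrow> dist x y < r"
    and deg: "\<And>v. v \<in> words N n \<Longrightarrow> card {i \<in> I. V i = v} \<le> C"
  shows "ennreal (\<Sum>i\<in>I. (mean u (V i) - mean u (W i))\<^sup>2) \<le> ennreal (real C * real N ^ (2 * n)) * shell u r"
proof -
  have um: "u \<in> borel_measurable \<nu>" using u by (simp add: L2_def)
  define h where "h x = (\<integral>\<^sup>+y. ennreal (if dist x y < r then (u x - u y)\<^sup>2 else 0) \<partial>\<nu>)" for x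
  have m: "h \<in> borel_measurable \<nu>" unfolding h_def
    using shell_measurable[OF um] by (intro nu.borel_measurable_nn_integral) (simp add: case_prod_unfold)
  have "ennreal (\<Sum>i\<in>I. (mean u (V i) - mean u (W i))\<^sup>2) = (\<Sum>i\<in>I. ennreal ((mean u (V i) - mean u (W i))\<^sup>2))"
    by (rule sum_ennreal[symmetric]) simp
  also have "\<dots> \<le> (\<Sum>i\<in>I. ennreal (real N ^ (2 * n)) * (\<integral>\<^sup>+x\<in>cell (V i). h x \<partial>\<nu>))"
    unfolding h_def using VW near by (intro sum_mono mean_mean_diff_le u) auto
  also have "\<dots> = (\<Sum>v\<in>words N n. \<Sum>i\<in>{i \<in> I. V i = v}. ennreal (real N ^ (2 * n)) * (\<integral>\<^sup>+x\<in>cell (V i). h x \<partial>\<nu>))"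
    using I VW by (intro sum.group[symmetric]) auto
  also have "\<dots> = (\<Sum>v\<in>words N n. of_nat (card {i \<in> I. V i = v}) * (ennreal (real N ^ (2 * n)) * (\<integral>\<^sup>+x\<in>cell v. h x \<partial>\<nu>)))"
    by (intro sum.cong) auto
  also have "\<dots> \<le> (\<Sum>v\<in>words N n. of_nat C * (ennreal (real N ^ (2 * n)) * (\<integral>\<^sup>+x\<in>cell v. h x \<partial>\<nu>)))"
    using deg by (intro sum_mono mult_right_mono) auto
  also have "\<dots> = of_nat C * (ennreal (real N ^ (2 * n)) * (\<integral>\<^sup>+x. h x \<partial>\<nu>))"
    unfolding nn_integral_cells[OF m, of n] by (simp add: sum_distrib_left)
  also have "\<dots> = ennreal (real C * real N ^ (2 * n)) * shell u r"
    by (simp add: shell_def h_def ennreal_mult mult.assoc ennreal_of_nat_eq_real_of_nat)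
  finally show ?thesis .
qed

end

context lattice_ifs
begin

lemma mean_subcells:
  assumes u: "u \<in> L2 \<nu>" and w: "w \<in> words N n"
  shows "mean u w = (\<Sum>v\<in>words N m. mean u (w @ v)) / real N ^ m"
proof -
  have int: "integrable \<nu> (\<lambda>x. indicator (cell v) x * u x)" if "v \<in> words N k" for v k
    using integrable_mult_indicator[OF cell_sets[OF that] L2_integrable[OF u]] by simp
  have wv: "w @ v \<in> words N (n + m)" if "v \<in> words N m" for v using append_in_words[OF w that] .
  have ae: "AE x in \<nu>. indicator (cell w) x * u x = (\<Sum>v\<in>words N m. indicator (cell (w @ v)) x * u x)"
    using AE_subcells[OF w, of m]
  proof (rule AE_mp, intro AE_I2 impI)
    fix x assume *: "(\<Sum>v\<in>words N m. indicator (cell (w @ v)) x) = (indicator (cell w) x :: ennreal)"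
    have "ennreal (\<Sum>v\<in>words N m. indicator (cell (w @ v)) x) = ennreal (indicator (cell w) x)"
      unfolding ennreal_indicator using * by (subst sum_ennreal[symmetric]) (simp_all add: ennreal_indicator)
    then have "(\<Sum>v\<in>words N m. indicator (cell (w @ v)) x) = (indicator (cell w) x :: real)"
      by (subst (asm) ennreal_inj) (auto intro: sum_nonneg)
    then show "indicator (cell w) x * u x = (\<Sum>v\<in>words N m. indicator (cell (w @ v)) x * u x)"
      by (simp add: sum_distrib_right[symmetric])
  qed
  have "(LINT x|\<nu>. indicator (cell w) x * u x) = (LINT x|\<nu>. (\<Sum>v\<in>words N m. indicator (cell (w @ v)) x * u x))"
    by (intro integral_cong_AE borel_measurable_sum borel_measurable_integrable int[OF w] int[OF wv] ae)
  also have "\<dots> = (\<Sum>v\<in>words N m. LINT x|\<nu>. indicator (cell (w @ v)) x * u x)"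
    using int[OF wv] by (rule Bochner_Integration.integral_sum)
  finally have split: "(LINT x|\<nu>. indicator (cell w) x * u x) = (\<Sum>v\<in>words N m. LINT x|\<nu>. indicator (cell (w @ v)) x * u x)" .
  have mean: "mean u v = real N ^ k * (LINT x|\<nu>. indicator (cell v) x * u x)" if "v \<in> words N k" for v k
    using measure_cell[OF that] by (simp add: mean_def set_lebesgue_integral_def)
  have "(\<Sum>v\<in>words N m. mean u (w @ v)) = (\<Sum>v\<in>words N m. real N ^ (n + m) * (LINT x|\<nu>. indicator (cell (w @ v)) x * u x))"
    by (intro sum.cong refl mean wv)
  also have "\<dots> = real N ^ m * mean u w"
    unfolding mean[OF w] split by (simp add: sum_distrib_left power_add mult_ac)
  finally show ?thesis by simp
qed

definition deviation :: "(plane \<Rightarrow> real) \<Rightarrow> nat \<Rightarrow> ennreal" where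
  "deviation u n = (\<Sum>w\<in>words N n. \<integral>\<^sup>+x\<in>cell w. ennreal ((u x - mean u w)\<^sup>2) \<partial>\<nu>)"

lemma L2_sq_measurable: "u \<in> L2 \<nu> \<Longrightarrow> (\<lambda>x. ennreal ((u x - k)\<^sup>2)) \<in> borel_measurable \<nu>"
  by (intro measurable_compose[OF _ measurable_ennreal] borel_measurable_power borel_measurable_diff)
    (auto simp: L2_def)

text \<open>Pythagoras for averages over successive levels: the loss of variance is the sum of
  squared differences between children and parent, weighted by the mass of a child.\<close>

lemma deviation_Suc:
  assumes u: "u \<in> L2 \<nu>"
  shows "deviation u n = deviation u (Suc n) +
    ennreal ((\<Sum>w\<in>words N n. \<Sum>i<N. (mean u (w @ [i]) - mean u w)\<^sup>2) / real N ^ Suc n)"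
proof -
  have wi: "w @ [i] \<in> words N (Suc n)" if "w \<in> words N n" "i < N" for w i
    using append_in_words[OF that(1) singleton_words[OF that(2)]] by simp
  have "(\<integral>\<^sup>+x\<in>cell w. ennreal ((u x - mean u w)\<^sup>2) \<partial>\<nu>) =
     (\<Sum>i<N. \<integral>\<^sup>+x\<in>cell (w @ [i]). ennreal ((u x - mean u (w @ [i]))\<^sup>2) \<partial>\<nu>) +
     ennreal ((\<Sum>i<N. (mean u (w @ [i]) - mean u w)\<^sup>2) / real N ^ Suc n)" if w: "w \<in> words N n" for w
  proof -
    have "(\<integral>\<^sup>+x\<in>cell w. ennreal ((u x - mean u w)\<^sup>2) \<partial>\<nu>) =
       (\<Sum>i<N. \<integral>\<^sup>+x\<in>cell (w @ [i]). ennreal ((u x - mean u w)\<^sup>2) \<partial>\<nu>)"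
      using nn_integral_subcells[OF w L2_sq_measurable[OF u], of "mean u w" "Suc 0"] by (simp add: sum_words_1)
    also have "\<dots> = (\<Sum>i<N. (\<integral>\<^sup>+x\<in>cell (w @ [i]). ennreal ((u x - mean u (w @ [i]))\<^sup>2) \<partial>\<nu>) +
        ennreal ((mean u (w @ [i]) - mean u w)\<^sup>2 / real N ^ Suc n))"
      using wi[OF w] by (intro sum.cong refl variance_cell[OF u]) simp
    also have "\<dots> = (\<Sum>i<N. \<integral>\<^sup>+x\<in>cell (w @ [i]). ennreal ((u x - mean u (w @ [i]))\<^sup>2) \<partial>\<nu>) +
       (\<Sum>i<N. ennreal ((mean u (w @ [i]) - mean u w)\<^sup>2 / real N ^ Suc n))" by (rule sum.distrib)
    also have "(\<Sum>i<N. ennreal ((mean u (w @ [i]) - mean u w)\<^sup>2 / real N ^ Suc n)) =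
        ennreal ((\<Sum>i<N. (mean u (w @ [i]) - mean u w)\<^sup>2) / real N ^ Suc n)"
      by (subst sum_ennreal) (auto simp: sum_divide_distrib)
    finally show ?thesis .
  qed
  note cells = this
  have "deviation u n = (\<Sum>w\<in>words N n. (\<Sum>i<N. \<integral>\<^sup>+x\<in>cell (w @ [i]). ennreal ((u x - mean u (w @ [i]))\<^sup>2) \<partial>\<nu>) +
     ennreal ((\<Sum>i<N. (mean u (w @ [i]) - mean u w)\<^sup>2) / real N ^ Suc n))"
    unfolding deviation_def by (intro sum.cong refl cells)
  also have "\<dots> = deviation u (Suc n) +
      (\<Sum>w\<in>words N n. ennreal ((\<Sum>i<N. (mean u (w @ [i]) - mean u w)\<^sup>2) / real N ^ Suc n))"
    unfolding deviation_def sum_words_snoc by (rule sum.distrib)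
  also have "(\<Sum>w\<in>words N n. ennreal ((\<Sum>i<N. (mean u (w @ [i]) - mean u w)\<^sup>2) / real N ^ Suc n)) =
      ennreal ((\<Sum>w\<in>words N n. \<Sum>i<N. (mean u (w @ [i]) - mean u w)\<^sup>2) / real N ^ Suc n)"
    by (subst sum_ennreal) (auto simp: sum_divide_distrib sum_nonneg)
  finally show ?thesis .
qed

lemma uniformly_continuous_cells:
  fixes v :: "plane \<Rightarrow> real"
  assumes v: "continuous_on K v" and e: "0 < e"
  shows "\<exists>m0. \<forall>m\<ge>m0. \<forall>w\<in>words N m. \<forall>x\<in>cell w. \<forall>y\<in>cell w. \<bar>v x - v y\<bar> < e"
proof -
  have "uniformly_continuous_on K v" using v K_props(2) by (rule compact_uniformly_continuous)
  then have "\<exists>d>0. \<forall>x\<in>K. \<forall>y\<in>K. dist y x < d \<longrightarrow> dist (v y) (v x) < e"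
    using e by (simp add: uniformly_continuous_on_def)
  then obtain d where d: "0 < d" "\<And>x y. x \<in> K \<Longrightarrow> y \<in> K \<Longrightarrow> dist y x < d \<Longrightarrow> dist (v y) (v x) < e"
    by blast
  obtain m0 where m0: "D / d < real L ^ m0" using real_arch_pow[of "real L" "D / d"] by auto
  have "\<bar>v x - v y\<bar> < e" if "m0 \<le> m" "w \<in> words N m" "x \<in> cell w" "y \<in> cell w" for m w x y
  proof -
    have "real L ^ m0 \<le> real L ^ m" using that(1) L by (intro power_increasing) auto
    with m0 have "D / d < real L ^ m" by (rule less_le_trans)
    then have "D / real L ^ m < d" using d(1) by (simp add: field_simps)
    then have "dist x y < d" using dist_cell_le[OF that(2-4)] by simp
    moreover have "x \<in> K" "y \<in> K" using that cell_subset_K[OF that(2)] by auto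
    ultimately show ?thesis using d(2)[of y x] by (simp add: dist_real_def)
  qed
  then show ?thesis by blast
qed

text \<open>Telescoping only compares levels, so it needs an endpoint. On a fine cell the mean is no
  worse than the constant \<open>v y\<close> for a continuous \<open>v\<close> close to
  \<open>u\<close>; the approximating functions will come from regularity of the form.\<close>

lemma deviation_tendsto_0:
  assumes u: "u \<in> L2 \<nu>" and approx: "\<And>e. 0 < e \<Longrightarrow> \<exists>v. v \<in> L2 \<nu> \<and> continuous_on K v \<and> (\<integral>\<^sup>+x. ennreal ((u x - v x)\<^sup>2) \<partial>\<nu>) \<le> ennreal e"
    and e: "0 < e"
  shows "\<exists>m0. \<forall>m\<ge>m0. deviation u m \<le> ennreal e"
proof -
  obtain v where v: "v \<in> L2 \<nu>" "continuous_on K v" "(\<integral>\<^sup>+x. ennreal ((u x - v x)\<^sup>2) \<partial>\<nu>) \<le> ennreal (e / 4)"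
    using approx[of "e / 4"] e by auto
  have "0 < sqrt (e / 4)" using e by simp
  from uniformly_continuous_cells[OF v(2) this]
  obtain m0 where m0: "\<And>m w x y. m0 \<le> m \<Longrightarrow> w \<in> words N m \<Longrightarrow> x \<in> cell w \<Longrightarrow> y \<in> cell w \<Longrightarrow> \<bar>v x - v y\<bar> < sqrt (e / 4)"
    by blast
  have [measurable]: "u \<in> borel_measurable \<nu>" "v \<in> borel_measurable \<nu>" using u v by (auto simp: L2_def)
  have gm: "(\<lambda>x. 2 * ennreal ((u x - v x)\<^sup>2) + ennreal (e / 2)) \<in> borel_measurable \<nu>" by measurable
  have "deviation u m \<le> ennreal e" if m: "m0 \<le> m" for m
  proof -
    have "(\<integral>\<^sup>+x\<in>cell w. ennreal ((u x - mean u w)\<^sup>2) \<partial>\<nu>) \<le> (\<integral>\<^sup>+x\<in>cell w. (2 * ennreal ((u x - v x)\<^sup>2) + ennreal (e / 2)) \<partial>\<nu>)"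
      if w: "w \<in> words N m" for w
    proof -
      obtain y where y: "y \<in> cell w" using cell_ne by blast
      have "(\<integral>\<^sup>+x\<in>cell w. ennreal ((u x - mean u w)\<^sup>2) \<partial>\<nu>) \<le> (\<integral>\<^sup>+x\<in>cell w. ennreal ((u x - v y)\<^sup>2) \<partial>\<nu>)"
        by (subst variance_cell[OF u w, of "v y"]) simp
      also have "\<dots> \<le> (\<integral>\<^sup>+x\<in>cell w. (2 * ennreal ((u x - v x)\<^sup>2) + ennreal (e / 2)) \<partial>\<nu>)"
      proof (rule nn_integral_mono)
        fix x
        show "ennreal ((u x - v y)\<^sup>2) * indicator (cell w) x \<le> (2 * ennreal ((u x - v x)\<^sup>2) + ennreal (e / 2)) * indicator (cell w) x"
        proof (cases "x \<in> cell w")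
          case True
          have "(v x - v y)\<^sup>2 \<le> (sqrt (e / 4))\<^sup>2"
            using m0[OF m w True y] e by (intro abs_le_square_iff[THEN iffD1]) auto
          then have *: "(v x - v y)\<^sup>2 \<le> e / 4" using e by simp
          have "0 \<le> ((u x - v x) - (v x - v y))\<^sup>2" by simp
          then have "(u x - v y)\<^sup>2 \<le> 2 * (u x - v x)\<^sup>2 + 2 * (v x - v y)\<^sup>2"
            by (simp add: power2_eq_square algebra_simps)
          also have "\<dots> \<le> 2 * (u x - v x)\<^sup>2 + e / 2" using * by simp
          finally have "ennreal ((u x - v y)\<^sup>2) \<le> ennreal (2 * (u x - v x)\<^sup>2 + e / 2)" by (rule ennreal_leI)
          also have "\<dots> = 2 * ennreal ((u x - v x)\<^sup>2) + ennreal (e / 2)"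
            using e by (simp add: ennreal_mult)
          finally show ?thesis using True by simp
        qed simp
      qed
      finally show ?thesis .
    qed
    note cells = this
    have "deviation u m \<le> (\<Sum>w\<in>words N m. \<integral>\<^sup>+x\<in>cell w. (2 * ennreal ((u x - v x)\<^sup>2) + ennreal (e / 2)) \<partial>\<nu>)"
      unfolding deviation_def by (intro sum_mono cells)
    also have "\<dots> = (\<integral>\<^sup>+x. 2 * ennreal ((u x - v x)\<^sup>2) + ennreal (e / 2) \<partial>\<nu>)"
      by (rule nn_integral_cells[OF gm, symmetric])
    also have "\<dots> = 2 * (\<integral>\<^sup>+x. ennreal ((u x - v x)\<^sup>2) \<partial>\<nu>) + ennreal (e / 2)"
      by (simp add: nn_integral_add nn_integral_cmult prob_space_nu)
    also have "\<dots> \<le> 2 * ennreal (e / 4) + ennreal (e / 2)" using v(3) by (intro add_right_mono mult_left_mono) auto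
    also have "\<dots> = ennreal (2 * (e / 4) + e / 2)" using e by (subst ennreal_plus) (simp_all add: ennreal_mult'[of 2, symmetric, simplified])
    also have "\<dots> = ennreal e" by simp
    finally show ?thesis .
  qed
  then show ?thesis by blast
qed

end

text \<open>Merges three constants into one: \<open>c\<close> from the comparison of form and
  seminorm, \<open>C1\<close> and \<open>C2\<close> from the lower and upper estimates of the
  nonlocal energies.\<close>

lemma two_sided_bound:
  fixes X Y :: ennreal
  assumes c: "0 < c" "0 < C1" "0 < C2" and e: "0 \<le> e"
    and lo: "ennreal (e / c) \<le> ennreal C1 * X" and up: "Y \<le> ennreal (C2 * e)"
  shows "ennreal (1 / max (c * C1) C2 * e) \<le> X \<and> Y \<le> ennreal (max (c * C1) C2 * e)"
proof
  have pos: "0 < c * C1" using c by simp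
  have "1 / max (c * C1) C2 * e \<le> 1 / (c * C1) * e"
    using c e pos by (intro mult_right_mono divide_left_mono) auto
  then have "ennreal (1 / max (c * C1) C2 * e) \<le> ennreal (1 / C1 * (e / c))" by (intro ennreal_leI) (simp add: mult.commute)
  also have "\<dots> = ennreal (1 / C1) * ennreal (e / c)" using c e by (intro ennreal_mult) auto
  also have "\<dots> \<le> ennreal (1 / C1) * (ennreal C1 * X)" using lo by (rule mult_left_mono) simp
  also have "\<dots> = X" using c by (simp add: mult.assoc[symmetric] ennreal_mult[symmetric])
  finally show "ennreal (1 / max (c * C1) C2 * e) \<le> X" .
  have "C2 * e \<le> max (c * C1) C2 * e" using e by (intro mult_right_mono) auto
  then show "Y \<le> ennreal (max (c * C1) C2 * e)" using up by (meson ennreal_leI order_trans)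
qed

section \<open>The gasket\<close>

lemma less_3_cases: "i < (3::nat) \<longleftrightarrow> i = 0 \<or> i = 1 \<or> i = 2"
  by auto

interpretation G: lattice_ifs 3 2 "\<lambda>i. if i = 1 then 1 else 0" "\<lambda>i. if i = 2 then 1 else 0"
  "(1, 0)" "(1/2, sqrt 3 / 2)" 2 gasket_map
proof
  show "gasket_map i x = (1 / real 2) *\<^sub>R (x + (real (if i = 1 then 1 else 0) *\<^sub>R (1, 0) +
      real (if i = 2 then 1 else 0) *\<^sub>R (1 / 2, sqrt 3 / 2)))" if "i < 3" for i x
    using that unfolding less_3_cases by (auto simp: gasket_map_def gasket_point_def zero_prod_def)
  show "inj_on (\<lambda>i::nat. (if i = 1 then 1 else 0 :: nat, if i = 2 then 1 else 0 :: nat)) {..<3}"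
    by (auto simp: inj_on_def split: if_splits)
  fix s t :: real
  have n: "norm (s *\<^sub>R (1, 0) + t *\<^sub>R ((1 / 2, sqrt 3 / 2) :: plane)) = sqrt (s\<^sup>2 + s * t + t\<^sup>2)"
    by (simp add: norm_prod_def power_mult_distrib power_divide) (simp add: power2_eq_square field_simps)
  \<comment> \<open>These are \<open>4 * (s\<^sup>2 + s * t + t\<^sup>2)\<close> minus
    \<open>s\<^sup>2\<close>, respectively minus \<open>t\<^sup>2\<close>, with squares completed;
    they yield \<open>\<kappa> = 2\<close> for the oblique basis.\<close>
  have "0 \<le> 2 * s\<^sup>2 + (s + 2 * t)\<^sup>2" "0 \<le> 2 * t\<^sup>2 + (t + 2 * s)\<^sup>2" by simp_all
  then have "s\<^sup>2 \<le> 4 * (s\<^sup>2 + s * t + t\<^sup>2)" "t\<^sup>2 \<le> 4 * (s\<^sup>2 + s * t + t\<^sup>2)"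
    by (simp_all add: power2_eq_square algebra_simps)
  then have "sqrt (s\<^sup>2) \<le> sqrt (4 * (s\<^sup>2 + s * t + t\<^sup>2))" "sqrt (t\<^sup>2) \<le> sqrt (4 * (s\<^sup>2 + s * t + t\<^sup>2))"
    by (simp_all only: real_sqrt_le_iff)
  then show "\<bar>s\<bar> \<le> 2 * norm (s *\<^sub>R (1, 0) + t *\<^sub>R ((1 / 2, sqrt 3 / 2) :: plane))"
    "\<bar>t\<bar> \<le> 2 * norm (s *\<^sub>R (1, 0) + t *\<^sub>R ((1 / 2, sqrt 3 / 2) :: plane))"
    unfolding n real_sqrt_mult by simp_all
qed auto

lemma gasket_eqs: "G.K = gasket" "G.cell = gasket_cell" "G.\<alpha> = gasket_dim" "G.\<nu> = gasket_measure"
  "G.mean = gasket_mean"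
proof -
  show K: "G.K = gasket" by (simp add: G.K_def gasket_def)
  show cell: "G.cell = gasket_cell" by (simp add: fun_eq_iff G.cell_def gasket_cell_def K)
  show al: "G.\<alpha> = gasket_dim" by (simp add: G.\<alpha>_def gasket_dim_def)
  show nu: "G.\<nu> = gasket_measure" by (simp add: G.\<nu>_def gasket_measure_def K al)
  show "G.mean = gasket_mean" by (simp add: fun_eq_iff G.mean_def gasket_mean_def nu cell)
qed

definition nbr_energy :: "nat \<Rightarrow> (nat list \<Rightarrow> real) \<Rightarrow> real" where
  "nbr_energy n g = (\<Sum>(v, w)\<in>gasket_neighbours n. (g v - g w)\<^sup>2)"

lemma gasket_neighbours_iff:
  "(v, w) \<in> gasket_neighbours n \<longleftrightarrow> v \<in> words 3 n \<and> w \<in> words 3 n \<and> v \<noteq> w \<and> G.cell v \<inter> G.cell w \<noteq> {}"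
  by (simp add: gasket_neighbours_def gasket_eqs)

lemma gasket_neighbours_adjacent: "gasket_neighbours n = {z \<in> G.adjacent n. fst z \<noteq> snd z}"
  by (auto simp: gasket_neighbours_def G.adjacent_def gasket_eqs)

lemma finite_gasket_neighbours [simp]: "finite (gasket_neighbours n)"
  by (simp add: gasket_neighbours_adjacent)

lemma nbr_energy_adjacent: "nbr_energy n g = (\<Sum>(v, w)\<in>G.adjacent n. (g v - g w)\<^sup>2)"
  unfolding nbr_energy_def gasket_neighbours_adjacent by (rule sum.mono_neutral_left) auto

lemma nbr_energy_nonneg: "0 \<le> nbr_energy n g"
  unfolding nbr_energy_def by (intro sum_nonneg) auto

lemma gasket_neighbours_prefix:
  assumes "v \<in> words 3 k" "(s, t) \<in> gasket_neighbours n"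
  shows "(v @ s, v @ t) \<in> gasket_neighbours (k + n)"
  using assms by (auto simp: gasket_neighbours_iff append_in_words G.cell_append)

lemma sum_le_nbr_energy:
  assumes "inj_on h I" "h ` I \<subseteq> gasket_neighbours n"
  shows "(\<Sum>i\<in>I. (g (fst (h i)) - g (snd (h i)))\<^sup>2) \<le> nbr_energy n g"
proof -
  have "(\<Sum>i\<in>I. (g (fst (h i)) - g (snd (h i)))\<^sup>2) = (\<Sum>z\<in>h ` I. (g (fst z) - g (snd z))\<^sup>2)"
    using assms(1) by (simp add: sum.reindex)
  also have "\<dots> \<le> nbr_energy n g"
    unfolding nbr_energy_def case_prod_unfold using assms(2) by (intro sum_mono2) auto
  finally show ?thesis .
qed

lemma sum_prefix_le_nbr_energy:
  "(\<Sum>v\<in>words 3 k. nbr_energy n (\<lambda>s. g (v @ s))) \<le> nbr_energy (k + n) g"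
proof -
  let ?h = "\<lambda>(v, z). (v @ fst z, v @ snd z)"
  have "(\<Sum>v\<in>words 3 k. nbr_energy n (\<lambda>s. g (v @ s))) =
      (\<Sum>i\<in>words 3 k \<times> gasket_neighbours n. (g (fst (?h i)) - g (snd (?h i)))\<^sup>2)"
    by (simp add: nbr_energy_def sum.cartesian_product case_prod_unfold)
  also have "\<dots> \<le> nbr_energy (k + n) g"
  proof (rule sum_le_nbr_energy)
    show "inj_on ?h (words 3 k \<times> gasket_neighbours n)"
      by (auto simp: inj_on_def words_def)
    show "?h ` (words 3 k \<times> gasket_neighbours n) \<subseteq> gasket_neighbours (k + n)"
      using gasket_neighbours_prefix by fastforce
  qed
  finally show ?thesis .
qed

section \<open>Resistance between the corners of the gasket graph\<close>

lemma gasket_corner: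
  assumes "i < 3"
  shows "word_map gasket_map (replicate n i) (gasket_point i) = gasket_point i" "gasket_point i \<in> G.K"
proof -
  have fix_i: "gasket_map i (gasket_point i) = gasket_point i"
    by (simp add: gasket_map_def flip: scaleR_2)
  then show "word_map gasket_map (replicate n i) (gasket_point i) = gasket_point i" by (induction n) auto
  show "gasket_point i \<in> G.K" using assms fix_i by (rule G.fixed_point_in_K)
qed

text \<open>The midpoint of a side is the image of corner \<open>j\<close> under map
  \<open>i\<close> and of corner \<open>i\<close> under map \<open>j\<close>, and a corner is
  reached along a constant word. These pairs are the junctions used in the resistance
  estimate.\<close>

lemma corner_neighbours:
  assumes "i < 3" "j < 3" "i \<noteq> j"
  shows "(i # replicate n j, j # replicate n i) \<in> gasket_neighbours (Suc n)"
proof -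
  have mid: "gasket_map i (gasket_point j) = gasket_map j (gasket_point i)"
    by (simp add: gasket_map_def add.commute)
  have in_cell: "gasket_map i (gasket_point j) \<in> G.cell (i # replicate n j)" if "j < 3" for i j
    unfolding G.cell_def using gasket_corner(1)[OF that, of n] gasket_corner(2)[OF that]
    by (intro image_eqI[of _ _ "gasket_point j"]) auto
  have "gasket_map i (gasket_point j) \<in> G.cell (i # replicate n j) \<inter> G.cell (j # replicate n i)"
    using in_cell[OF assms(2), of i] in_cell[OF assms(1), of j] mid by simp
  then show ?thesis using assms by (auto simp: gasket_neighbours_iff words_def)
qed

definition delta_energy :: "real \<Rightarrow> real \<Rightarrow> real \<Rightarrow> real" where
  "delta_energy x y z = (x - y)\<^sup>2 + (y - z)\<^sup>2 + (z - x)\<^sup>2"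

text \<open>Delta-star transformation with the optimal centre value, the mean: a triangle of unit
  resistances is a star with legs of resistance \<open>1 / 3\<close>.\<close>

lemma delta_energy_star:
  "delta_energy p q r / 3 = (p - (p + q + r) / 3)\<^sup>2 + (q - (p + q + r) / 3)\<^sup>2 + (r - (p + q + r) / 3)\<^sup>2"
  by (simp add: delta_energy_def power2_eq_square field_simps)

text \<open>Series law for resistances \<open>p\<close> and \<open>q\<close>.\<close>

lemma weighted_cauchy2: "0 < p \<Longrightarrow> 0 < q \<Longrightarrow> (x + y)\<^sup>2 \<le> (p + q) * (x\<^sup>2 / p + y\<^sup>2 / (q::real))"
proof -
  assume p: "0 < p" and q: "0 < q"
  have "0 \<le> (q * x - p * y)\<^sup>2 / (p * q)" using p q by simp
  also have "\<dots> = (p + q) * (x\<^sup>2 / p + y\<^sup>2 / q) - (x + y)\<^sup>2"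
    using p q by (simp add: field_simps power2_eq_square)
  finally show ?thesis by simp
qed

text \<open>Parallel and series reduction after replacing each triangle by the star centred at the mean of its
  three vertex values.\<close>

lemma delta_star_reduction:
  fixes x :: "nat \<Rightarrow> nat \<Rightarrow> real"
  assumes y: "0 < y"
  shows "delta_energy (x 0 0) (x 1 1) (x 2 2) \<le> (5 * y + 1) *
    ((delta_energy (x 0 0) (x 0 1) (x 0 2) + delta_energy (x 1 0) (x 1 1) (x 1 2) + delta_energy (x 2 0) (x 2 1) (x 2 2)) / (3 * y)
     + (x 0 1 - x 1 0)\<^sup>2 + (x 1 2 - x 2 1)\<^sup>2 + (x 2 0 - x 0 2)\<^sup>2)"
proof -
  define z where "z i = (x i 0 + x i 1 + x i 2) / 3" for i
  define Z where "Z = (z 0 + z 1 + z 2) / 3"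
  have ts: "delta_energy (x i 0) (x i 1) (x i 2) / (3 * y) = (x i 0 - z i)\<^sup>2 / y + (x i 1 - z i)\<^sup>2 / y + (x i 2 - z i)\<^sup>2 / y" for i
    using delta_energy_star[of "x i 0" "x i 1" "x i 2"] y unfolding z_def by (simp add: field_simps)
  \<comment> \<open>Leg, connecting edge and leg in series: resistance
    \<open>y + 1 + y\<close>.\<close>
  have edge: "(z i - z j)\<^sup>2 / (2 * y + 1) \<le> (x i j - z i)\<^sup>2 / y + (x i j - x j i)\<^sup>2 + (x j i - z j)\<^sup>2 / y" for i j
  proof -
    have "((z i - x i j) + ((x i j - x j i) + (x j i - z j)))\<^sup>2 \<le>
        (y + (1 + y)) * ((z i - x i j)\<^sup>2 / y + ((x i j - x j i) + (x j i - z j))\<^sup>2 / (1 + y))"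
      using y by (intro weighted_cauchy2) auto
    also have "\<dots> \<le> (y + (1 + y)) * ((z i - x i j)\<^sup>2 / y + ((x i j - x j i)\<^sup>2 / 1 + (x j i - z j)\<^sup>2 / y))"
      using weighted_cauchy2[of 1 y "x i j - x j i" "x j i - z j"] y
      by (intro mult_left_mono add_left_mono) (auto simp: pos_divide_le_eq mult.commute)
    finally have "(z i - z j)\<^sup>2 \<le> (2 * y + 1) * ((x i j - z i)\<^sup>2 / y + (x i j - x j i)\<^sup>2 + (x j i - z j)\<^sup>2 / y)"
      by (simp add: power2_commute[of "z i" "x i j"] algebra_simps)
    then show ?thesis using y by (simp add: pos_divide_le_eq mult.commute)
  qed
  have outer: "(x i i - Z)\<^sup>2 \<le> (y + (2 * y + 1) / 3) * ((x i i - z i)\<^sup>2 / y + (z i - Z)\<^sup>2 / ((2 * y + 1) / 3))" for i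
    using weighted_cauchy2[of y "(2 * y + 1) / 3" "x i i - z i" "z i - Z"] y by simp
  have far: "delta_energy p q r / 3 \<le> (p - s)\<^sup>2 + (q - s)\<^sup>2 + (r - s)\<^sup>2" for p q r s
  proof -
    have "0 \<le> (p + q + r - 3 * s)\<^sup>2 / 3" by simp
    then show ?thesis by (simp add: delta_energy_def power2_eq_square field_simps)
  qed
  have zz: "(z 0 - Z)\<^sup>2 + (z 1 - Z)\<^sup>2 + (z 2 - Z)\<^sup>2 = delta_energy (z 0) (z 1) (z 2) / 3"
    unfolding delta_energy_star Z_def by simp
  \<comment> \<open>The inner triangle of resistances \<open>2 * y + 1\<close> becomes a star with
    legs \<open>(2 * y + 1) / 3\<close>, in series with the outer legs \<open>y\<close>; returning
    from star to triangle gives \<open>3 * k = 5 * y + 1\<close>.\<close>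
  define k where "k = y + (2 * y + 1) / 3"
  have k: "0 < k" unfolding k_def using y by (intro add_pos_pos divide_pos_pos) auto
  have "delta_energy (x 0 0) (x 1 1) (x 2 2) / 3 \<le> (x 0 0 - Z)\<^sup>2 + (x 1 1 - Z)\<^sup>2 + (x 2 2 - Z)\<^sup>2" by (rule far)
  also have "\<dots> \<le> k * ((x 0 0 - z 0)\<^sup>2 / y + (z 0 - Z)\<^sup>2 / ((2 * y + 1) / 3)) +
     k * ((x 1 1 - z 1)\<^sup>2 / y + (z 1 - Z)\<^sup>2 / ((2 * y + 1) / 3)) + k * ((x 2 2 - z 2)\<^sup>2 / y + (z 2 - Z)\<^sup>2 / ((2 * y + 1) / 3))"
    unfolding k_def by (intro add_mono outer)
  also have "\<dots> = k * ((x 0 0 - z 0)\<^sup>2 / y + (x 1 1 - z 1)\<^sup>2 / y + (x 2 2 - z 2)\<^sup>2 / y +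
      ((z 0 - Z)\<^sup>2 + (z 1 - Z)\<^sup>2 + (z 2 - Z)\<^sup>2) / ((2 * y + 1) / 3))"
    by (simp only: distrib_left add_divide_distrib add_ac)
  also have "((z 0 - Z)\<^sup>2 + (z 1 - Z)\<^sup>2 + (z 2 - Z)\<^sup>2) / ((2 * y + 1) / 3) =
      (z 0 - z 1)\<^sup>2 / (2 * y + 1) + (z 1 - z 2)\<^sup>2 / (2 * y + 1) + (z 2 - z 0)\<^sup>2 / (2 * y + 1)"
    unfolding zz delta_energy_def by (simp add: add_divide_distrib)
  also have "k * ((x 0 0 - z 0)\<^sup>2 / y + (x 1 1 - z 1)\<^sup>2 / y + (x 2 2 - z 2)\<^sup>2 / y + \<dots>) \<le>
      k * ((delta_energy (x 0 0) (x 0 1) (x 0 2) + delta_energy (x 1 0) (x 1 1) (x 1 2) + delta_energy (x 2 0) (x 2 1) (x 2 2)) / (3 * y)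
     + (x 0 1 - x 1 0)\<^sup>2 + (x 1 2 - x 2 1)\<^sup>2 + (x 2 0 - x 0 2)\<^sup>2)"
    unfolding add_divide_distrib[of _ _ "3 * y"] ts using edge[of 0 1] edge[of 1 2] edge[of 2 0] k
    by (intro mult_left_mono) auto
  finally show ?thesis by (simp add: k_def field_simps)
qed

text \<open>The leg resistance obeys the recursion \<open>y' = (5 * y + 1) / 3\<close>, whose
  solution with \<open>y = 1\<close> at level 0 is \<open>3 / 2 * (5 / 3) ^ n - 1 / 2\<close>; the
  constant is three times this. At level 0 the corners coincide, so the left side vanishes and the
  initial value is harmless.\<close>

lemma corner_resistance:
  "delta_energy (g (replicate n 0)) (g (replicate n 1)) (g (replicate n 2)) \<le> (9 / 2 * (5 / 3) ^ n - 3 / 2) * nbr_energy n g"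
proof (induction n arbitrary: g)
  case 0
  then show ?case using nbr_energy_nonneg[of 0 g] by (simp add: delta_energy_def)
next
  case (Suc n)
  define y where "y = 3 / 2 * (5 / 3) ^ n - (1 / 2 :: real)"
  have "(1::real) \<le> (5 / 3) ^ n" by (rule one_le_power) simp
  then have y: "0 < y" unfolding y_def by linarith
  define x where "x i j = g (i # replicate n j)" for i j
  have tri: "delta_energy (x i 0) (x i 1) (x i 2) / (3 * y) \<le> nbr_energy n (\<lambda>s. g (i # s))" for i
    using Suc.IH[of "\<lambda>s. g (i # s)"] y by (simp add: x_def y_def field_simps)
  let ?I = "{(0,1), (1,2), (2,0)} :: (nat \<times> nat) set"
  \<comment> \<open>Edges inside the three subcells together with one orientation of each of the
    three junctions; these ordered pairs are distinct, so \<open>nbr_energy\<close> dominates their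
    squares.\<close>
  let ?J = "({..<3::nat} \<times> gasket_neighbours n) <+> ?I"
  let ?h = "\<lambda>s. case s of Inl (i, z) \<Rightarrow> (i # fst z, i # snd z) | Inr (i, j) \<Rightarrow> (i # replicate n j, j # replicate n i)"
  have "(\<Sum>i\<in>?J. (g (fst (?h i)) - g (snd (?h i)))\<^sup>2) \<le> nbr_energy (Suc n) g"
  proof (rule sum_le_nbr_energy)
    show "inj_on ?h ?J" by (auto simp: inj_on_def split: sum.splits)
    have "(i # s, i # t) \<in> gasket_neighbours (Suc n)" if "i < 3" "(s, t) \<in> gasket_neighbours n" for i s t
      using gasket_neighbours_prefix[of "[i]" 1 s t n] that by (simp add: words_def)
    moreover have "(i # replicate n j, j # replicate n i) \<in> gasket_neighbours (Suc n)" if "(i, j) \<in> ?I" for i j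
      using that by (intro corner_neighbours) auto
    ultimately show "?h ` ?J \<subseteq> gasket_neighbours (Suc n)" by (auto simp: image_subset_iff)
  qed
  also have "(\<Sum>i\<in>?J. (g (fst (?h i)) - g (snd (?h i)))\<^sup>2) =
      (\<Sum>i<3. nbr_energy n (\<lambda>s. g (i # s))) + (\<Sum>(i, j)\<in>?I. (x i j - x j i)\<^sup>2)"
    by (subst sum.Plus) (auto simp: nbr_energy_def sum.cartesian_product case_prod_unfold x_def)
  also have "(\<Sum>i<3. nbr_energy n (\<lambda>s. g (i # s))) = nbr_energy n (\<lambda>s. g (0 # s)) + nbr_energy n (\<lambda>s. g (1 # s)) + nbr_energy n (\<lambda>s. g (2 # s))"
    by (simp add: numeral_3_eq_3 numeral_2_eq_2)
  finally have "(delta_energy (x 0 0) (x 0 1) (x 0 2) + delta_energy (x 1 0) (x 1 1) (x 1 2) + delta_energy (x 2 0) (x 2 1) (x 2 2)) / (3 * y)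
     + (x 0 1 - x 1 0)\<^sup>2 + (x 1 2 - x 2 1)\<^sup>2 + (x 2 0 - x 0 2)\<^sup>2 \<le> nbr_energy (Suc n) g"
    using tri[of 0] tri[of 1] tri[of 2] by (simp add: add_divide_distrib)
  then have "(5 * y + 1) * ((delta_energy (x 0 0) (x 0 1) (x 0 2) + delta_energy (x 1 0) (x 1 1) (x 1 2) + delta_energy (x 2 0) (x 2 1) (x 2 2)) / (3 * y)
     + (x 0 1 - x 1 0)\<^sup>2 + (x 1 2 - x 2 1)\<^sup>2 + (x 2 0 - x 0 2)\<^sup>2) \<le> (5 * y + 1) * nbr_energy (Suc n) g"
    using y by (intro mult_left_mono) auto
  with delta_star_reduction[OF y, of x]
  have "delta_energy (x 0 0) (x 1 1) (x 2 2) \<le> (5 * y + 1) * nbr_energy (Suc n) g" by (rule order_trans)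
  then show ?case by (simp add: x_def y_def algebra_simps)
qed

lemma corner_diff_le:
  assumes "i < 3" "j < 3"
  shows "\<bar>g (replicate n i) - g (replicate n j)\<bar> \<le> 3 * sqrt (5 / 3) ^ n * sqrt (nbr_energy n g)"
proof -
  have "(g (replicate n i) - g (replicate n j))\<^sup>2 \<le> delta_energy (g (replicate n 0)) (g (replicate n 1)) (g (replicate n 2))"
    using assms unfolding less_3_cases delta_energy_def by (auto simp: power2_commute)
  also have "\<dots> \<le> (9 / 2 * (5 / 3) ^ n - 3 / 2) * nbr_energy n g" by (rule corner_resistance)
  also have "\<dots> \<le> 9 * (5 / 3) ^ n * nbr_energy n g"
    using zero_le_power[of "5 / 3 :: real" n] by (intro mult_right_mono nbr_energy_nonneg) linarith+
  also have "\<dots> = (3 * sqrt (5 / 3) ^ n * sqrt (nbr_energy n g))\<^sup>2"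
    using nbr_energy_nonneg[of n g] by (simp add: power_mult_distrib flip: power_mult[of "sqrt (5/3)"])
      (simp add: mult.commute[of n 2] power_mult)
  finally have "\<bar>g (replicate n i) - g (replicate n j)\<bar> \<le> \<bar>3 * sqrt (5 / 3) ^ n * sqrt (nbr_energy n g)\<bar>"
    by (simp only: abs_le_square_iff)
  also have "\<dots> = 3 * sqrt (5 / 3) ^ n * sqrt (nbr_energy n g)"
    using nbr_energy_nonneg[of n g] by simp
  finally show ?thesis .
qed

text \<open>A path from \<open>w\<close> to corner 0: inside subcell \<open>i\<close> to its corner
  0, from there to its corner \<open>i\<close>, which is corner \<open>i\<close> of the whole, and
  then between corners of the whole. With \<open>s = sqrt (5 / 3)\<close> the induction needs
  \<open>27 * s ^ n + 3 * s ^ n + 3 * s ^ (n + 1) \<le> 27 * s ^ (n + 1)\<close>, which holds as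
  \<open>s \<ge> 5 / 4\<close>.\<close>

lemma diff_corner_le:
  assumes "w \<in> words 3 n"
  shows "\<bar>g w - g (replicate n 0)\<bar> \<le> 27 * sqrt (5 / 3) ^ n * sqrt (nbr_energy n g)"
  using assms
proof (induction n arbitrary: w g)
  case 0
  then show ?case using nbr_energy_nonneg[of 0 g] by (simp add: words_0)
next
  case (Suc n)
  then obtain i v where w: "w = i # v" "i < 3" "v \<in> words 3 n" by (auto simp: words_Suc)
  define s where "s = sqrt (5 / 3)"
  have s: "5 / 4 \<le> s" unfolding s_def by (rule real_le_rsqrt) (simp add: power2_eq_square)
  have mono: "nbr_energy n (\<lambda>t. g (i # t)) \<le> nbr_energy (Suc n) g"
  proof -
    have "nbr_energy n (\<lambda>t. g ([i] @ t)) \<le> (\<Sum>v\<in>words 3 1. nbr_energy n (\<lambda>s. g (v @ s)))"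
      using w by (intro member_le_sum) (auto simp: words_def nbr_energy_nonneg finite_words[unfolded words_def])
    also have "\<dots> \<le> nbr_energy (1 + n) g" by (rule sum_prefix_le_nbr_energy)
    finally show ?thesis by simp
  qed
  define R where "R = sqrt (nbr_energy (Suc n) g)"
  have R: "sqrt (nbr_energy n (\<lambda>t. g (i # t))) \<le> R" "0 \<le> R" using mono nbr_energy_nonneg by (auto simp: R_def)
  have sn: "0 \<le> s ^ n" using s by simp
  have 1: "\<bar>g (i # v) - g (i # replicate n 0)\<bar> \<le> 27 * s ^ n * R"
    using Suc.IH[OF w(3), of "\<lambda>t. g (i # t)"] R sn unfolding s_def[symmetric]
    by (meson mult_left_mono order_trans mult_nonneg_nonneg zero_le_numeral)
  have 2: "\<bar>g (i # replicate n 0) - g (i # replicate n i)\<bar> \<le> 3 * s ^ n * R"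
    using corner_diff_le[of 0 i "\<lambda>t. g (i # t)" n] w R sn unfolding s_def[symmetric]
    by (meson mult_left_mono order_trans mult_nonneg_nonneg zero_le_numeral zero_less_numeral)
  have 3: "\<bar>g (i # replicate n i) - g (0 # replicate n 0)\<bar> \<le> 3 * (s * s ^ n) * R"
    using corner_diff_le[of i 0 g "Suc n"] w unfolding s_def[symmetric] R_def by simp
  have "30 + 3 * s \<le> 27 * s" using s by simp
  then have "(30 + 3 * s) * (s ^ n * R) \<le> 27 * s * (s ^ n * R)" using sn R by (intro mult_right_mono) auto
  then show ?case using 1 2 3 unfolding w(1) s_def[symmetric] R_def[symmetric] by (simp add: algebra_simps)
qed

lemma words_diff_le:
  assumes "v \<in> words 3 n" "w \<in> words 3 n"
  shows "(g v - g w)\<^sup>2 \<le> 54\<^sup>2 * (5 / 3) ^ n * nbr_energy n g"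
proof -
  have "\<bar>g v - g w\<bar> \<le> 54 * sqrt (5 / 3) ^ n * sqrt (nbr_energy n g)"
    using diff_corner_le[OF assms(1), of g] diff_corner_le[OF assms(2), of g] by simp
  then have "\<bar>g v - g w\<bar> \<le> \<bar>54 * sqrt (5 / 3) ^ n * sqrt (nbr_energy n g)\<bar>" by simp
  then have "(g v - g w)\<^sup>2 \<le> (54 * sqrt (5 / 3) ^ n * sqrt (nbr_energy n g))\<^sup>2"
    by (simp only: abs_le_square_iff)
  also have "\<dots> = 54\<^sup>2 * (5 / 3) ^ n * nbr_energy n g"
    using nbr_energy_nonneg[of n g] by (simp add: power_mult_distrib flip: power_mult[of "sqrt (5/3)"])
      (simp add: mult.commute[of n 2] power_mult)
  finally show ?thesis .
qed

text \<open>A touching pair at level \<open>k\<close> contains a touching pair of subcells at level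
  \<open>k + j\<close>, and the resistance bound connects every other subcell with these. Since a
  mean is the average over subcells, the difference of two means is an average of differences over
  equal suffixes. Level \<open>k\<close> is compared with \<open>m\<close> directly, because
  iterating would multiply the constant.\<close>

lemma mean_energy_weakly_monotone:
  "\<exists>C>0. \<forall>u\<in>L2 G.\<nu>. \<forall>k m. k \<le> m \<longrightarrow>
     (5 / 3) ^ k * nbr_energy k (G.mean u) \<le> C * ((5 / 3) ^ m * nbr_energy m (G.mean u))"
proof -
  obtain d where d: "\<And>n v. v \<in> words 3 n \<Longrightarrow> card {w. (v, w) \<in> G.adjacent n} \<le> d" using G.adjacent_degree by blast
  \<comment> \<open>The 3 comes from the square of a three-term sum; the two inner terms carry the
    factor \<open>54\<^sup>2\<close> of \<open>words_diff_le\<close> and the degree bound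
    \<open>d\<close>, and \<open>3 * 2 = 6\<close>.\<close>
  define C where "C = 6 * 54\<^sup>2 * real d + 3"
  have C: "0 < C" by (simp add: C_def add_nonneg_pos)
  have main: "nbr_energy k (G.mean u) \<le> C * ((5 / 3) ^ j * nbr_energy (k + j) (G.mean u))"
    if u: "u \<in> L2 G.\<nu>" for u k j
  proof -
    define P where "P = G.mean u"
    define r where "r = 54\<^sup>2 * (5 / 3 :: real) ^ j"
    define I where "I v = nbr_energy j (\<lambda>s. P (v @ s))" for v
    have r: "0 \<le> r" by (simp add: r_def)
    have I0: "0 \<le> I v" for v by (simp add: I_def nbr_energy_nonneg)
    have "\<exists>st. (fst z @ fst st, snd z @ snd st) \<in> gasket_neighbours (k + j) \<and> fst st \<in> words 3 j \<and> snd st \<in> words 3 j"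
      if z: "z \<in> gasket_neighbours k" for z
    proof -
      obtain v w where vw: "z = (v, w)" "v \<in> words 3 k" "w \<in> words 3 k" "v \<noteq> w" "G.cell v \<inter> G.cell w \<noteq> {}"
        using z by (cases z) (auto simp: gasket_neighbours_iff)
      then obtain x where "x \<in> G.cell v" "x \<in> G.cell w" by blast
      then obtain s t where "s \<in> words 3 j" "x \<in> G.cell (v @ s)" "t \<in> words 3 j" "x \<in> G.cell (w @ t)"
        unfolding G.cell_subdivide[of v j] G.cell_subdivide[of w j] by blast
      then have "(v @ s, w @ t) \<in> gasket_neighbours (k + j)"
        using vw by (auto simp: gasket_neighbours_iff append_in_words words_def)
      then show ?thesis using vw \<open>s \<in> words 3 j\<close> \<open>t \<in> words 3 j\<close> by (intro exI[of _ "(s, t)"]) auto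
    qed
    then obtain st where st: "\<And>z. z \<in> gasket_neighbours k \<Longrightarrow> (fst z @ fst (st z), snd z @ snd (st z)) \<in> gasket_neighbours (k + j)"
      "\<And>z. z \<in> gasket_neighbours k \<Longrightarrow> fst (st z) \<in> words 3 j" "\<And>z. z \<in> gasket_neighbours k \<Longrightarrow> snd (st z) \<in> words 3 j"
      by metis
    define h where "h z = (fst z @ fst (st z), snd z @ snd (st z))" for z
    have est: "(P v - P w)\<^sup>2 \<le> 3 * (r * I v + r * I w) + 3 * (P (fst (h (v, w))) - P (snd (h (v, w))))\<^sup>2"
      if vw: "(v, w) \<in> gasket_neighbours k" for v w
    proof -
      define B where "B = 3 * (r * I v + r * I w) + 3 * (P (fst (h (v, w))) - P (snd (h (v, w))))\<^sup>2"
      have B: "0 \<le> B" using r I0[of v] I0[of w] by (simp add: B_def)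
      have vk: "v \<in> words 3 k" "w \<in> words 3 k" using vw by (auto simp: gasket_neighbours_iff)
      \<comment> \<open>From \<open>v @ t\<close> inside \<open>v\<close> to the touching subcell,
        across to \<open>w\<close>, and inside \<open>w\<close> to the same suffix
        \<open>t\<close>.\<close>
      have diff: "\<bar>P (v @ t) - P (w @ t)\<bar> \<le> sqrt B" if t: "t \<in> words 3 j" for t
      proof -
        let ?s = "fst (st (v, w))" and ?s' = "snd (st (v, w))"
        have "(P (v @ t) - P (v @ ?s))\<^sup>2 \<le> r * I v" "(P (w @ ?s') - P (w @ t))\<^sup>2 \<le> r * I w"
          unfolding r_def I_def
          using words_diff_le[OF t st(2)[OF vw], of "\<lambda>s. P (v @ s)"] words_diff_le[OF st(3)[OF vw] t, of "\<lambda>s. P (w @ s)"] by simp_all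
        moreover have "(P (v @ t) - P (w @ t))\<^sup>2 \<le> 3 * ((P (v @ t) - P (v @ ?s))\<^sup>2 + (P (v @ ?s) - P (w @ ?s'))\<^sup>2 + (P (w @ ?s') - P (w @ t))\<^sup>2)"
          using square_sum3_le[of "P (v @ t) - P (v @ ?s)" "P (v @ ?s) - P (w @ ?s')" "P (w @ ?s') - P (w @ t)"] by simp
        ultimately have "(P (v @ t) - P (w @ t))\<^sup>2 \<le> B" by (simp add: B_def h_def)
        then show ?thesis by (simp add: real_le_rsqrt abs_le_iff) (metis power2_commute power2_abs real_le_rsqrt abs_le_iff minus_diff_eq)
      qed
      have "P v - P w = (\<Sum>t\<in>words 3 j. P (v @ t) - P (w @ t)) / 3 ^ j"
        unfolding P_def using G.mean_subcells[OF u vk(1), of j] G.mean_subcells[OF u vk(2), of j]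
        by (simp add: sum_subtractf diff_divide_distrib)
      then have "\<bar>P v - P w\<bar> \<le> (\<Sum>t\<in>words 3 j. \<bar>P (v @ t) - P (w @ t)\<bar>) / 3 ^ j"
        by (simp add: abs_divide divide_right_mono sum_abs)
      also have "\<dots> \<le> (\<Sum>t\<in>words 3 j. sqrt B) / 3 ^ j" by (intro divide_right_mono sum_mono diff) auto
      also have "\<dots> = sqrt B" by (simp add: card_words)
      finally have "(P v - P w)\<^sup>2 \<le> (sqrt B)\<^sup>2" by (intro abs_le_square_iff[THEN iffD1]) (simp add: B)
      then show ?thesis using B by (simp add: B_def)
    qed
    have "nbr_energy k P \<le> (\<Sum>(v, w)\<in>gasket_neighbours k. 3 * (r * I v + r * I w) + 3 * (P (fst (h (v, w))) - P (snd (h (v, w))))\<^sup>2)"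
      unfolding nbr_energy_def using est by (intro sum_mono) auto
    also have "\<dots> = 3 * r * (\<Sum>(v, w)\<in>gasket_neighbours k. I v + I w) + 3 * (\<Sum>z\<in>gasket_neighbours k. (P (fst (h z)) - P (snd (h z)))\<^sup>2)"
      by (simp add: sum.distrib sum_distrib_left case_prod_unfold distrib_left mult.assoc)
    also have "\<dots> \<le> 3 * r * (2 * (real d * nbr_energy (k + j) P)) + 3 * nbr_energy (k + j) P"
    proof (intro add_mono mult_left_mono)
      have "(\<Sum>(v, w)\<in>gasket_neighbours k. I v + I w) \<le> (\<Sum>(v, w)\<in>G.adjacent k. I v + I w)"
        using I0 by (intro sum_mono2) (auto simp: gasket_neighbours_adjacent)
      also have "\<dots> = 2 * (\<Sum>(v, w)\<in>G.adjacent k. I v)"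
        using G.sum_adjacent_snd[of I k] by (simp add: sum.distrib case_prod_unfold)
      also have "(\<Sum>(v, w)\<in>G.adjacent k. I v) = (\<Sum>v\<in>words 3 k. real (card {w. (v, w) \<in> G.adjacent k}) * I v)"
        by (rule G.sum_adjacent_fst)
      also have "2 * \<dots> \<le> 2 * (\<Sum>v\<in>words 3 k. real d * I v)"
        using d I0 by (intro mult_left_mono sum_mono mult_right_mono) auto
      also have "\<dots> = 2 * (real d * (\<Sum>v\<in>words 3 k. I v))" by (simp add: sum_distrib_left)
      also have "\<dots> \<le> 2 * (real d * nbr_energy (k + j) P)"
        unfolding I_def by (intro mult_left_mono sum_prefix_le_nbr_energy) auto
      finally show "(\<Sum>(v, w)\<in>gasket_neighbours k. I v + I w) \<le> 2 * (real d * nbr_energy (k + j) P)" .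
      show "(\<Sum>z\<in>gasket_neighbours k. (P (fst (h z)) - P (snd (h z)))\<^sup>2) \<le> nbr_energy (k + j) P"
      proof (rule sum_le_nbr_energy)
        show "inj_on h (gasket_neighbours k)"
          by (auto simp: inj_on_def h_def gasket_neighbours_iff words_def)
        show "h ` gasket_neighbours k \<subseteq> gasket_neighbours (k + j)" using st(1) by (auto simp: h_def)
      qed
    qed (use r in auto)
    also have "\<dots> \<le> C * ((5 / 3) ^ j * nbr_energy (k + j) P)"
    proof -
      have "1 * nbr_energy (k + j) P \<le> (5 / 3) ^ j * nbr_energy (k + j) P"
        by (intro mult_right_mono nbr_energy_nonneg one_le_power) simp
      then show ?thesis by (simp add: C_def r_def algebra_simps)
    qed
    finally show ?thesis by (simp add: P_def)
  qed
  have "(5 / 3) ^ k * nbr_energy k (G.mean u) \<le> C * ((5 / 3) ^ m * nbr_energy m (G.mean u))"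
    if "u \<in> L2 G.\<nu>" "k \<le> m" for u k m
  proof -
    have "(5 / 3) ^ k * nbr_energy k (G.mean u) \<le> (5 / 3) ^ k * (C * ((5 / 3) ^ (m - k) * nbr_energy (k + (m - k)) (G.mean u)))"
      by (intro mult_left_mono main that) auto
    also have "\<dots> = C * ((5 / 3) ^ (k + (m - k)) * nbr_energy (k + (m - k)) (G.mean u))"
      by (simp only: power_add mult_ac)
    finally show ?thesis using that by simp
  qed
  then show ?thesis using C by blast
qed

lemma gasket_seminorm_eq:
  "gasket_seminorm u = (SUP n\<in>{1..}. ennreal ((5/3) ^ n * nbr_energy n (G.mean u)))"
  by (simp add: gasket_seminorm_def nbr_energy_def gasket_eqs)

lemma gasket_powr: "real 2 powr gasket_walk_dim = 5"
  by (simp add: gasket_walk_dim_def)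

section \<open>Lower and upper estimates on the gasket\<close>

lemma gasket_lower:
  "\<exists>C>0. \<forall>u\<in>L2 G.\<nu>. gasket_seminorm u \<le> ennreal C * Liminf (at_left gasket_walk_dim)
     (G.renormalized gasket_walk_dim u)"
proof -
  obtain C1 where C1: "0 < C1" and mono: "\<And>u k m. u \<in> L2 G.\<nu> \<Longrightarrow> k \<le> m \<Longrightarrow>
     (5 / 3) ^ k * nbr_energy k (G.mean u) \<le> C1 * ((5 / 3) ^ m * nbr_energy m (G.mean u))"
    using mean_energy_weakly_monotone by blast
  obtain d where d: "\<And>n v. v \<in> words 3 n \<Longrightarrow> card {w. (v, w) \<in> G.adjacent n} \<le> d" using G.adjacent_degree by blast
  \<comment> \<open>Points of two touching cells are at most \<open>2 * D / 2 ^ n\<close> apart; the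
    added 1 makes the inequality strict, as \<open>shell\<close> requires.\<close>
  define R where "R = 2 * G.D + 1"
  have R: "1 \<le> R" using G.D_pos by (simp add: R_def)
  have wd: "0 < gasket_walk_dim" by (simp add: gasket_walk_dim_def)
  obtain C2 where C2: "0 < C2" and lim: "\<And>u m. u \<in> borel_measurable G.\<nu> \<Longrightarrow>
    (\<forall>\<^sub>F n in sequentially. m \<le> ennreal ((real 3 * real 2 powr gasket_walk_dim) ^ n) * G.shell u (R / real 2 ^ n)) \<Longrightarrow>
    m \<le> ennreal C2 * Liminf (at_left gasket_walk_dim) (G.renormalized gasket_walk_dim u)"
    using G.liminf_nonlocal_energy_ge[OF wd R] by blast
  define B where "B = C1 * (real d + 1)"
  have B: "0 < B" using C1 by (simp add: B_def)
  have bound: "ennreal (nbr_energy n (G.mean u)) \<le> ennreal (real d * real 3 ^ (2 * n)) * G.shell u (R / real 2 ^ n)"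
    if u: "u \<in> L2 G.\<nu>" for u n
  proof -
    have "ennreal (\<Sum>z\<in>gasket_neighbours n. (G.mean u (fst z) - G.mean u (snd z))\<^sup>2) \<le> ennreal (real d * real 3 ^ (2 * n)) * G.shell u (R / real 2 ^ n)"
    proof (rule G.sum_mean_diff_le_shell[OF u])
      show "fst z \<in> words 3 n \<and> snd z \<in> words 3 n" if "z \<in> gasket_neighbours n" for z
        using that by (cases z) (auto simp: gasket_neighbours_iff)
      show "dist x y < R / real 2 ^ n" if z: "z \<in> gasket_neighbours n" and xy: "x \<in> G.cell (fst z)" "y \<in> G.cell (snd z)" for z x y
      proof -
        obtain v w where vw: "z = (v, w)" "v \<in> words 3 n" "w \<in> words 3 n" "G.cell v \<inter> G.cell w \<noteq> {}"
          using z by (cases z) (auto simp: gasket_neighbours_iff)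
        then obtain p where p: "p \<in> G.cell v" "p \<in> G.cell w" by blast
        have "dist x p \<le> G.D / real 2 ^ n" "dist p y \<le> G.D / real 2 ^ n"
          using G.dist_cell_le[OF vw(2)] G.dist_cell_le[OF vw(3)] p xy vw(1) by auto
        then have "dist x y \<le> 2 * G.D / real 2 ^ n" using dist_triangle[of x y p] by simp
        also have "\<dots> < R / real 2 ^ n" unfolding R_def by (intro divide_strict_right_mono) auto
        finally show ?thesis .
      qed
      show "card {z \<in> gasket_neighbours n. fst z = v} \<le> d" if v: "v \<in> words 3 n" for v
      proof -
        have fin: "finite {w. (v, w) \<in> G.adjacent n}"
          by (rule finite_subset[OF _ finite_words[of 3 n]]) (auto simp: G.adjacent_def)
        have "card {z \<in> gasket_neighbours n. fst z = v} \<le> card (Pair v ` {w. (v, w) \<in> G.adjacent n})"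
          using fin by (intro card_mono) (auto simp: gasket_neighbours_adjacent)
        also have "\<dots> \<le> card {w. (v, w) \<in> G.adjacent n}" using fin by (rule card_image_le)
        also have "\<dots> \<le> d" by (rule d[OF v])
        finally show ?thesis .
      qed
    qed simp
    then show ?thesis by (simp add: nbr_energy_def case_prod_unfold)
  qed
  have "gasket_seminorm u \<le> ennreal (B * C2) * Liminf (at_left gasket_walk_dim)
     (G.renormalized gasket_walk_dim u)" if u: "u \<in> L2 G.\<nu>" for u
    unfolding gasket_seminorm_eq
  proof (rule SUP_least)
    fix k
    \<comment> \<open>For fixed \<open>k\<close> weak monotonicity makes \<open>a / B\<close> a
      lower bound for the rescaled shells at every level \<open>n \<ge> k\<close>; the supremum over
      \<open>k\<close> is taken last.\<close>
    define a where "a = (5 / 3) ^ k * nbr_energy k (G.mean u)"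
    have a0: "0 \<le> a" by (simp add: a_def nbr_energy_nonneg)
    have ev: "ennreal (a / B) \<le> ennreal ((real 3 * real 2 powr gasket_walk_dim) ^ n) * G.shell u (R / real 2 ^ n)" if n: "k \<le> n" for n
    proof -
      have "a \<le> C1 * ((5 / 3) ^ n * nbr_energy n (G.mean u))" unfolding a_def by (rule mono[OF u n])
      then have "ennreal (a / B) \<le> ennreal (C1 / B * (5 / 3) ^ n * nbr_energy n (G.mean u))"
        using B by (intro ennreal_leI) (simp add: divide_right_mono mult.assoc)
      also have "\<dots> = ennreal (C1 / B * (5 / 3) ^ n) * ennreal (nbr_energy n (G.mean u))"
        using B C1 by (intro ennreal_mult) (auto simp: nbr_energy_nonneg)
      also have "\<dots> \<le> ennreal (C1 / B * (5 / 3) ^ n) * (ennreal (real d * real 3 ^ (2 * n)) * G.shell u (R / real 2 ^ n))"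
        by (intro mult_left_mono bound u) simp
      also have "\<dots> = ennreal (C1 / B * (5 / 3) ^ n * (real d * real 3 ^ (2 * n))) * G.shell u (R / real 2 ^ n)"
        by (subst ennreal_mult'', simp) (simp add: mult.assoc)
      also have "\<dots> \<le> ennreal ((real 3 * real 2 powr gasket_walk_dim) ^ n) * G.shell u (R / real 2 ^ n)"
      proof (intro mult_right_mono ennreal_leI)
        \<comment> \<open>\<open>(5 / 3) ^ n * 3 ^ (2 * n) = 15 ^ n\<close> is the critical weight,
          and \<open>B\<close> was chosen to absorb the constants.\<close>
        have "C1 / B * real d \<le> 1" using C1 by (simp add: B_def)
        then have "(C1 / B * real d) * 15 ^ n \<le> 1 * 15 ^ n" by (intro mult_right_mono) auto
        also have "(C1 / B * real d) * 15 ^ n = C1 / B * (5 / 3) ^ n * (real d * real 3 ^ (2 * n))"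
          by (simp add: power_mult) (simp add: field_simps flip: power_mult_distrib)
        finally show "C1 / B * (5 / 3) ^ n * (real d * real 3 ^ (2 * n)) \<le> (real 3 * real 2 powr gasket_walk_dim) ^ n"
          unfolding gasket_powr by simp
      qed simp
      finally show ?thesis .
    qed
    have "ennreal (a / B) \<le> ennreal C2 * Liminf (at_left gasket_walk_dim)
     (G.renormalized gasket_walk_dim u)"
      using u ev by (intro lim) (auto simp: L2_def eventually_sequentially)
    then have "ennreal B * ennreal (a / B) \<le> ennreal B * (ennreal C2 * Liminf (at_left gasket_walk_dim)
     (G.renormalized gasket_walk_dim u))" by (rule mult_left_mono) simp
    moreover have "ennreal B * ennreal (a / B) = ennreal a" using B a0 by (simp add: ennreal_mult[symmetric])
    moreover have "ennreal (B * C2) = ennreal B * ennreal C2" using B C2 by (intro ennreal_mult) auto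
    ultimately show "ennreal ((5 / 3) ^ k * nbr_energy k (G.mean u)) \<le> ennreal (B * C2) * Liminf (at_left gasket_walk_dim)
     (G.renormalized gasket_walk_dim u)"
      by (simp only: a_def mult.assoc)
  qed
  moreover have "0 < B * C2" using B C2 by simp
  ultimately show ?thesis by blast
qed

text \<open>The parent mean is the mean of its three children, so the increment is a star energy,
  one third of the triangle energy; the children are pairwise neighbours.\<close>

lemma sum_child_mean_diff_le:
  assumes u: "u \<in> L2 G.\<nu>"
  shows "(\<Sum>w\<in>words 3 n. \<Sum>i<3. (G.mean u (w @ [i]) - G.mean u w)\<^sup>2) \<le> nbr_energy (Suc n) (G.mean u)"
proof -
  define P where "P = G.mean u"
  have "(\<Sum>i<3. (P (w @ [i]) - P w)\<^sup>2) \<le> nbr_energy 1 (\<lambda>s. P (w @ s))" if w: "w \<in> words 3 n" for w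
  proof -
    define p where "p i = P (w @ [i])" for i
    have sum3: "(\<Sum>i<3. h i) = h 0 + h 1 + h 2" for h :: "nat \<Rightarrow> real"
      by (simp add: numeral_3_eq_3 numeral_2_eq_2)
    have "P w = (\<Sum>i<3. p i) / 3"
      using G.mean_subcells[OF u w, of "Suc 0"] by (simp add: sum_words_1 P_def p_def)
    then have "(\<Sum>i<3. (p i - P w)\<^sup>2) = delta_energy (p 0) (p 1) (p 2) / 3"
      unfolding delta_energy_star sum3 by (simp only:)
    also have "\<dots> \<le> delta_energy (p 0) (p 1) (p 2)" by (simp add: delta_energy_def)
    also have "\<dots> = (\<Sum>(i, j)\<in>{(0,1), (1,2), (2,0)}. (p i - p j)\<^sup>2)" by (simp add: delta_energy_def)
    also have "\<dots> = (\<Sum>z\<in>{(0,1), (1,2), (2,0)}. (P (w @ fst ([fst z], [snd z])) - P (w @ snd ([fst z], [snd z])))\<^sup>2)"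
      by (simp add: p_def)
    also have "\<dots> \<le> nbr_energy 1 (\<lambda>s. P (w @ s))"
    proof (rule sum_le_nbr_energy[of "\<lambda>z. ([fst z], [snd z])" _ 1 "\<lambda>s. P (w @ s)"])
      show "(\<lambda>z. ([fst z], [snd z])) ` {(0,1), (1,2), (2,0)} \<subseteq> gasket_neighbours 1"
        using corner_neighbours[of _ _ 0] by auto
    qed (auto simp: inj_on_def)
    finally show ?thesis by (simp add: p_def)
  qed
  then have "(\<Sum>w\<in>words 3 n. \<Sum>i<3. (P (w @ [i]) - P w)\<^sup>2) \<le> (\<Sum>w\<in>words 3 n. nbr_energy 1 (\<lambda>s. P (w @ s)))"
    by (rule sum_mono)
  also have "\<dots> \<le> nbr_energy (n + 1) P" by (rule sum_prefix_le_nbr_energy)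
  finally show ?thesis by (simp add: P_def)
qed

text \<open>The increment of the deviation from level \<open>n\<close> to \<open>n + 1\<close> is at
  most \<open>m * (3 / 5) ^ (n + 1) / 3 ^ (n + 1) = m / 5 ^ (n + 1)\<close>, so the deviation itself
  is at most \<open>m / 5 ^ n\<close>. Both terms of the discrete bound are then of order
  \<open>m / 15 ^ n\<close>, the inverse of the critical weight.\<close>

lemma gasket_upper:
  "\<exists>C>0. \<forall>u m. u \<in> L2 G.\<nu> \<longrightarrow> 0 \<le> m \<longrightarrow> gasket_seminorm u \<le> ennreal m \<longrightarrow>
     (\<forall>e>0. \<exists>v. v \<in> L2 G.\<nu> \<and> continuous_on G.K v \<and> (\<integral>\<^sup>+x. ennreal ((u x - v x)\<^sup>2) \<partial>G.\<nu>) \<le> ennreal e) \<longrightarrow>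
     Limsup (at_left gasket_walk_dim) (G.renormalized gasket_walk_dim u) \<le> ennreal (C * m)"
proof -
  obtain c C1 where c: "0 < c" "c \<le> 1" and C1: "0 < C1" and shell: "\<And>u n q. u \<in> borel_measurable G.\<nu> \<Longrightarrow>
     G.shell u (c / real 2 ^ n) \<le>
       ennreal (C1 / real 3 ^ n) * (\<Sum>w\<in>words 3 n. \<integral>\<^sup>+x\<in>G.cell w. ennreal ((u x - q w)\<^sup>2) \<partial>G.\<nu>) +
       ennreal (C1 / real 3 ^ (2 * n) * (\<Sum>(v, w)\<in>G.adjacent n. (q v - q w)\<^sup>2))"
    using G.shell_le_discrete by blast
  have wd: "0 < gasket_walk_dim" by (simp add: gasket_walk_dim_def)
  obtain C2 where C2: "0 < C2" and lim: "\<And>u m. u \<in> L2 G.\<nu> \<Longrightarrow> 0 \<le> m \<Longrightarrow>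
    (\<And>n. ennreal ((real 3 * real 2 powr gasket_walk_dim) ^ n) * G.shell u (c / real 2 ^ n) \<le> ennreal m) \<Longrightarrow>
    Limsup (at_left gasket_walk_dim) (G.renormalized gasket_walk_dim u) \<le> ennreal (C2 * m)"
    using G.limsup_nonlocal_energy_le[OF wd c] by blast
  have main: "Limsup (at_left gasket_walk_dim) (G.renormalized gasket_walk_dim u) \<le> ennreal (C2 * (2 * C1 * m))"
    if u: "u \<in> L2 G.\<nu>" and m: "0 \<le> m" and S: "gasket_seminorm u \<le> ennreal m"
      and approx: "\<And>e. 0 < e \<Longrightarrow> \<exists>v. v \<in> L2 G.\<nu> \<and> continuous_on G.K v \<and> (\<integral>\<^sup>+x. ennreal ((u x - v x)\<^sup>2) \<partial>G.\<nu>) \<le> ennreal e" for u m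
  proof (rule lim[OF u])
    define A where "A n = nbr_energy n (G.mean u)" for n
    have A: "A n \<le> m * (3 / 5) ^ n" if "1 \<le> n" for n
    proof -
      have "ennreal ((5 / 3) ^ n * A n) \<le> gasket_seminorm u"
        unfolding gasket_seminorm_eq A_def using that by (intro SUP_upper) auto
      then have "(5 / 3) ^ n * A n \<le> m" using S m by (meson ennreal_le_iff order_trans)
      then have le: "(3 / 5) ^ n * ((5 / 3) ^ n * A n) \<le> (3 / 5) ^ n * m" by (intro mult_left_mono) auto
      have "(3 / 5) ^ n * (5 / 3) ^ n = (1 :: real)" by (simp flip: power_mult_distrib)
      then have "(3 / 5) ^ n * ((5 / 3) ^ n * A n) = A n" by (subst mult.assoc[symmetric]) simp
      with le have "A n \<le> (3 / 5) ^ n * m" by (simp only:)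
      then show ?thesis by (subst mult.commute)
    qed
    have step: "G.deviation u n \<le> G.deviation u (Suc n) + ennreal (m / 5 ^ Suc n)" for n
    proof -
      have "(\<Sum>w\<in>words 3 n. \<Sum>i<3. (G.mean u (w @ [i]) - G.mean u w)\<^sup>2) / real 3 ^ Suc n \<le> m * (3 / 5) ^ Suc n / real 3 ^ Suc n"
        using sum_child_mean_diff_le[OF u, of n] A[of "Suc n"] unfolding A_def by (intro divide_right_mono) auto
      also have "\<dots> = m / 5 ^ Suc n" by (simp add: power_divide)
      finally show ?thesis unfolding G.deviation_Suc[OF u, of n] by (intro add_left_mono ennreal_leI)
    qed
    \<comment> \<open>The subtracted \<open>(1 / 5) ^ k\<close> is the room that the induction needs
      for the next increment.\<close>
    have tele: "G.deviation u n \<le> G.deviation u (n + k) + ennreal (m / 5 ^ n * (1 - (1 / 5) ^ k))" for n k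
    proof (induction k)
      case (Suc k)
      have "G.deviation u n \<le> G.deviation u (n + k) + ennreal (m / 5 ^ n * (1 - (1 / 5) ^ k))" by (rule Suc)
      also have "\<dots> \<le> (G.deviation u (Suc (n + k)) + ennreal (m / 5 ^ Suc (n + k))) + ennreal (m / 5 ^ n * (1 - (1 / 5) ^ k))"
        by (intro add_right_mono step)
      also have "\<dots> = G.deviation u (n + Suc k) + ennreal (m / 5 ^ Suc (n + k) + m / 5 ^ n * (1 - (1 / 5) ^ k))"
        using m by (subst ennreal_plus) (auto simp: add.assoc power_le_one)
      also have "\<dots> \<le> G.deviation u (n + Suc k) + ennreal (m / 5 ^ n * (1 - (1 / 5) ^ Suc k))"
      proof (intro add_left_mono ennreal_leI)
        have "m / 5 ^ Suc (n + k) = m / 5 ^ n * ((1 / 5) ^ k / 5)" by (simp add: power_add power_divide)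
        then have "m / 5 ^ Suc (n + k) + m / 5 ^ n * (1 - (1 / 5) ^ k) = m / 5 ^ n * ((1 / 5) ^ k / 5 + (1 - (1 / 5) ^ k))"
          by (simp only: distrib_left)
        also have "\<dots> \<le> m / 5 ^ n * (1 - (1 / 5) ^ Suc k)"
          using m by (intro mult_left_mono) auto
        finally show "m / 5 ^ Suc (n + k) + m / 5 ^ n * (1 - (1 / 5) ^ k) \<le> m / 5 ^ n * (1 - (1 / 5) ^ Suc k)" .
      qed
      finally show ?case .
    qed simp
    have dev: "G.deviation u n \<le> ennreal (m / 5 ^ n)" for n
    proof (rule ennreal_le_epsilon)
      fix e :: real assume e: "0 < e"
      obtain m0 where m0: "\<And>k. m0 \<le> k \<Longrightarrow> G.deviation u k \<le> ennreal e"
        using G.deviation_tendsto_0[OF u approx e] by blast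
      have "G.deviation u n \<le> G.deviation u (n + m0) + ennreal (m / 5 ^ n * (1 - (1 / 5) ^ m0))" by (rule tele)
      also have "\<dots> \<le> ennreal e + ennreal (m / 5 ^ n)"
        using m by (intro add_mono m0 ennreal_leI mult_left_le) auto
      finally show "G.deviation u n \<le> ennreal (m / 5 ^ n) + ennreal e" by (simp add: add.commute)
    qed
    have adj: "(\<Sum>(v, w)\<in>G.adjacent n. (G.mean u v - G.mean u w)\<^sup>2) \<le> m * (3 / 5) ^ n" for n
    proof (cases "n = 0")
      \<comment> \<open>The seminorm starts at level 1; at level 0 there is a single cell and
        nothing to bound.\<close>
      case True
      have "(\<Sum>(v, w)\<in>G.adjacent 0. (G.mean u v - G.mean u w)\<^sup>2) = 0"
        by (intro sum.neutral) (auto simp: G.adjacent_def words_0)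
      then show ?thesis using True m by simp
    next
      case False
      then show ?thesis using A[of n] by (simp add: A_def nbr_energy_adjacent)
    qed
    show "ennreal ((real 3 * real 2 powr gasket_walk_dim) ^ n) * G.shell u (c / real 2 ^ n) \<le> ennreal (2 * C1 * m)" for n
    proof -
      have um: "u \<in> borel_measurable G.\<nu>" using u by (simp add: L2_def)
      have "G.shell u (c / real 2 ^ n) \<le> ennreal (C1 / real 3 ^ n) * G.deviation u n +
          ennreal (C1 / real 3 ^ (2 * n) * (\<Sum>(v, w)\<in>G.adjacent n. (G.mean u v - G.mean u w)\<^sup>2))"
        unfolding G.deviation_def by (rule shell[OF um])
      also have "\<dots> \<le> ennreal (C1 / real 3 ^ n) * ennreal (m / 5 ^ n) + ennreal (C1 / real 3 ^ (2 * n) * (m * (3 / 5) ^ n))"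
        using C1 by (intro add_mono mult_left_mono dev ennreal_leI adj) auto
      also have "\<dots> = ennreal (C1 / real 3 ^ n * (m / 5 ^ n) + C1 / real 3 ^ (2 * n) * (m * (3 / 5) ^ n))"
        using C1 m by (subst ennreal_plus) (auto simp: ennreal_mult[symmetric])
      also have "C1 / real 3 ^ n * (m / 5 ^ n) + C1 / real 3 ^ (2 * n) * (m * (3 / 5) ^ n) = 2 * C1 * m / 15 ^ n"
      proof -
        have "(15::real) ^ n = 3 ^ n * 5 ^ n" by (simp flip: power_mult_distrib)
        moreover have "(3::real) ^ (2 * n) = 3 ^ n * 3 ^ n" by (simp add: mult_2 power_add)
        ultimately show ?thesis by (simp add: power_divide field_simps)
      qed
      finally have "ennreal ((real 3 * real 2 powr gasket_walk_dim) ^ n) * G.shell u (c / real 2 ^ n) \<le>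
          ennreal ((real 3 * real 2 powr gasket_walk_dim) ^ n) * ennreal (2 * C1 * m / 15 ^ n)"
        by (rule mult_left_mono) simp
      also have "\<dots> = ennreal (2 * C1 * m)" unfolding gasket_powr using C1 m by (simp add: ennreal_mult[symmetric])
      finally show ?thesis .
    qed
  qed (use C1 that in auto)
  show ?thesis
    using main C1 C2 by (intro exI[of _ "C2 * (2 * C1)"]) (auto simp: mult.assoc)
qed

lemma gasket_convergence:
  assumes form: "gasket_local_form F E"
  shows "\<exists>C>0. \<forall>u\<in>F.
     ennreal (1 / C * E u u) \<le> Liminf (at_left gasket_walk_dim)
        (\<lambda>\<beta>. ennreal (gasket_walk_dim - \<beta>) * nonlocal_energy gasket_measure gasket_dim \<beta> u) \<and>
     Limsup (at_left gasket_walk_dim)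
        (\<lambda>\<beta>. ennreal (gasket_walk_dim - \<beta>) * nonlocal_energy gasket_measure gasket_dim \<beta> u) \<le> ennreal (C * E u u)"
proof -
  interpret dirichlet_form gasket_measure F E using form unfolding gasket_local_form_def by blast
  have reg: "regular_form gasket gasket_measure F E" using form unfolding gasket_local_form_def by blast
  obtain c where c: "0 < c" and comp: "\<And>u. u \<in> F \<Longrightarrow> ennreal (E u u / c) \<le> gasket_seminorm u \<and> gasket_seminorm u \<le> ennreal (c * E u u)"
    using form unfolding gasket_local_form_def by blast
  obtain C1 where C1: "0 < C1" and lower: "\<And>u. u \<in> L2 gasket_measure \<Longrightarrow> gasket_seminorm u \<le> ennreal C1 * Liminf (at_left gasket_walk_dim)
     (\<lambda>\<beta>. ennreal (gasket_walk_dim - \<beta>) * nonlocal_energy gasket_measure gasket_dim \<beta> u)"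
    using gasket_lower unfolding gasket_eqs by blast
  obtain C2 where C2: "0 < C2" and upper: "\<And>u m. u \<in> L2 gasket_measure \<Longrightarrow> 0 \<le> m \<Longrightarrow> gasket_seminorm u \<le> ennreal m \<Longrightarrow>
     (\<And>e. 0 < e \<Longrightarrow> \<exists>v. v \<in> L2 gasket_measure \<and> continuous_on gasket v \<and> (\<integral>\<^sup>+x. ennreal ((u x - v x)\<^sup>2) \<partial>gasket_measure) \<le> ennreal e) \<Longrightarrow>
     Limsup (at_left gasket_walk_dim) (\<lambda>\<beta>. ennreal (gasket_walk_dim - \<beta>) * nonlocal_energy gasket_measure gasket_dim \<beta> u) \<le> ennreal (C2 * m)"
    using gasket_upper unfolding gasket_eqs by blast
  have "ennreal (1 / max (c * C1) (C2 * c) * E u u) \<le> Liminf (at_left gasket_walk_dim)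
        (\<lambda>\<beta>. ennreal (gasket_walk_dim - \<beta>) * nonlocal_energy gasket_measure gasket_dim \<beta> u) \<and>
     Limsup (at_left gasket_walk_dim)
        (\<lambda>\<beta>. ennreal (gasket_walk_dim - \<beta>) * nonlocal_energy gasket_measure gasket_dim \<beta> u) \<le> ennreal (max (c * C1) (C2 * c) * E u u)"
    if u: "u \<in> F" for u
  proof (rule two_sided_bound)
    show "0 \<le> E u u" using u by (rule form_nonneg)
    have uL: "u \<in> L2 gasket_measure" using u domain_L2 by blast
    show "ennreal (E u u / c) \<le> ennreal C1 * Liminf (at_left gasket_walk_dim)
        (\<lambda>\<beta>. ennreal (gasket_walk_dim - \<beta>) * nonlocal_energy gasket_measure gasket_dim \<beta> u)"
      using comp[OF u] lower[OF uL] by (blast intro: order_trans)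
    have "Limsup (at_left gasket_walk_dim)
        (\<lambda>\<beta>. ennreal (gasket_walk_dim - \<beta>) * nonlocal_energy gasket_measure gasket_dim \<beta> u) \<le> ennreal (C2 * (c * E u u))"
    proof (rule upper[OF uL])
      show "0 \<le> c * E u u" using c form_nonneg[OF u] by simp
      show "gasket_seminorm u \<le> ennreal (c * E u u)" using comp[OF u] by blast
      fix e :: real assume "0 < e"
      \<comment> \<open>Regularity supplies the continuous approximation; since the form is
        nonnegative, \<open>energy_1\<close> dominates the squared \<open>L2\<close>
        distance.\<close>
      then obtain v where v: "v \<in> F" "continuous_on gasket v" "energy_1 gasket_measure E (\<lambda>x. u x - v x) < e"
        using reg u unfolding regular_form_def by blast
      have diff: "(\<lambda>x. u x - v x) \<in> F"
        using domain_add[OF u domain_scale[OF v(1), of "-1"]] by simp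
      then have dL: "(\<lambda>x. u x - v x) \<in> L2 gasket_measure" using domain_L2 by blast
      have "(\<integral>\<^sup>+x. ennreal ((u x - v x)\<^sup>2) \<partial>gasket_measure) = ennreal (LINT x|gasket_measure. (u x - v x)\<^sup>2)"
        using dL by (intro nn_integral_eq_integral) (auto simp: L2_def)
      also have "\<dots> \<le> ennreal e"
        using v(3) form_nonneg[OF diff] by (intro ennreal_leI) (simp add: energy_1_def)
      finally show "\<exists>v. v \<in> L2 gasket_measure \<and> continuous_on gasket v \<and> (\<integral>\<^sup>+x. ennreal ((u x - v x)\<^sup>2) \<partial>gasket_measure) \<le> ennreal e"
        using v domain_L2 by blast
    qed
    then show "Limsup (at_left gasket_walk_dim)
        (\<lambda>\<beta>. ennreal (gasket_walk_dim - \<beta>) * nonlocal_energy gasket_measure gasket_dim \<beta> u) \<le> ennreal (C2 * c * E u u)"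
      by (simp add: mult.assoc)
  qed (use c C1 C2 in auto)
  moreover have "0 < max (c * C1) (C2 * c)" using c C1 by (simp add: less_max_iff_disj)
  ultimately show ?thesis by blast
qed

section \<open>The carpet\<close>

lemma less_8_cases: "i < (8::nat) \<longleftrightarrow> i = 0 \<or> i = 1 \<or> i = 2 \<or> i = 3 \<or> i = 4 \<or> i = 5 \<or> i = 6 \<or> i = 7"
  by auto

definition carpet_digit1 :: "nat \<Rightarrow> nat" where "carpet_digit1 i = [0, 1, 2, 2, 2, 1, 0, 0] ! i"
definition carpet_digit2 :: "nat \<Rightarrow> nat" where "carpet_digit2 i = [0, 0, 0, 1, 2, 2, 2, 1] ! i"

interpretation C: lattice_ifs 8 3 carpet_digit1 carpet_digit2 "(1, 0)" "(0, 1)" 1 carpet_map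
proof
  show "carpet_map i x = (1 / real 3) *\<^sub>R (x + (real (carpet_digit1 i) *\<^sub>R (1, 0) + real (carpet_digit2 i) *\<^sub>R (0, 1)))"
    if "i < 8" for i x
    using that unfolding less_8_cases
    by (auto simp: carpet_map_def carpet_point_def carpet_digit1_def carpet_digit2_def)
  show "carpet_digit1 i < 3 \<and> carpet_digit2 i < 3" if "i < 8" for i
    using that unfolding less_8_cases by (auto simp: carpet_digit1_def carpet_digit2_def)
  show "inj_on (\<lambda>i. (carpet_digit1 i, carpet_digit2 i)) {..<8}"
    by (auto simp: inj_on_def less_8_cases carpet_digit1_def carpet_digit2_def)
  fix s t :: real
  have n: "norm (s *\<^sub>R (1, 0) + t *\<^sub>R ((0, 1) :: plane)) = sqrt (s\<^sup>2 + t\<^sup>2)"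
    by (simp add: norm_prod_def)
  show "\<bar>s\<bar> \<le> 1 * norm (s *\<^sub>R (1, 0) + t *\<^sub>R ((0, 1) :: plane))"
    "\<bar>t\<bar> \<le> 1 * norm (s *\<^sub>R (1, 0) + t *\<^sub>R ((0, 1) :: plane))"
    unfolding n by (auto intro: real_le_rsqrt)
qed auto

lemma carpet_eqs: "C.K = carpet" "C.\<alpha> = carpet_dim" "C.\<nu> = carpet_measure"
proof -
  show K: "C.K = carpet" by (simp add: C.K_def carpet_def)
  show al: "C.\<alpha> = carpet_dim" by (simp add: C.\<alpha>_def carpet_dim_def)
  show "C.\<nu> = carpet_measure" by (simp add: C.\<nu>_def carpet_measure_def K al)
qed

lemma carpet_subset_square: "C.K \<subseteq> {0..1} \<times> {0..1}"
proof (rule C.invariant_compact_subset[OF C.K_props(2,3)])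
  show "closed ({0..1} \<times> {0..1} :: plane set)" by (intro closed_Times) auto
  show "carpet_map i ` ({0..1} \<times> {0..1}) \<subseteq> {0..1} \<times> {0..1}" if "i < 8" for i
    using that unfolding less_8_cases by (auto simp: carpet_map_def carpet_point_def)
qed auto

lemma carpet_point_in_K: "i < 8 \<Longrightarrow> carpet_point i \<in> C.K"
  by (rule C.fixed_point_in_K) (auto simp: carpet_map_def scaleR_add_left[symmetric] scaleR_right_distrib)

lemma carpet_vertices_0_subset: "carpet_vertices 0 \<subseteq> C.K"
  using carpet_point_in_K by auto

lemma carpet_cell_vertices_subset: "w \<in> words 8 n \<Longrightarrow> carpet_cell_vertices w \<subseteq> C.cell w"
  unfolding carpet_cell_vertices_def C.cell_def using carpet_vertices_0_subset by (rule image_mono)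

lemma carpet_vertices_subset: "carpet_vertices n \<subseteq> C.K"
proof (induction n)
  case (Suc n)
  then have "carpet_vertices (Suc n) \<subseteq> (\<Union>i<8. carpet_map i ` C.K)" by auto
  then show ?case using C.K_props(3) by simp
qed (rule carpet_vertices_0_subset)

section \<open>Discrete energies on the carpet\<close>

definition carpet_edges :: "nat \<Rightarrow> nat list \<Rightarrow> (plane \<times> plane) set" where
  "carpet_edges n w = {(p, q). p \<in> carpet_cell_vertices w \<and> q \<in> carpet_cell_vertices w \<and> dist p q = 1 / (2 * 3 ^ n)}"

lemma carpet_energy_edges: "carpet_energy n u = (\<Sum>w\<in>words 8 n. \<Sum>(p, q)\<in>carpet_edges n w. (u p - u q)\<^sup>2)"
  by (simp add: carpet_energy_def carpet_edges_def)

lemma finite_carpet_edges [simp]: "finite (carpet_edges n w)"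
  by (rule finite_subset[of _ "carpet_cell_vertices w \<times> carpet_cell_vertices w"])
    (auto simp: carpet_edges_def carpet_cell_vertices_def)

lemma carpet_edges_in_K:
  assumes "w \<in> words 8 n" "(p, q) \<in> carpet_edges m w" shows "p \<in> C.K" "q \<in> C.K"
  using assms carpet_cell_vertices_subset[OF assms(1)] C.cell_subset_K[OF assms(1)] by (auto simp: carpet_edges_def)

lemma pairs_at_distance_image:
  fixes g :: "'a::metric_space \<Rightarrow> 'b::metric_space"
  assumes "\<And>p q. dist (g p) (g q) = c \<longleftrightarrow> dist p q = c'"
  shows "{(p, q). p \<in> g ` A \<and> q \<in> g ` A \<and> dist p q = c} = (\<lambda>(p, q). (g p, g q)) ` {(p, q). p \<in> A \<and> q \<in> A \<and> dist p q = c'}"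
proof (intro set_eqI iffI)
  fix z assume "z \<in> {(p, q). p \<in> g ` A \<and> q \<in> g ` A \<and> dist p q = c}"
  then obtain p q where "p \<in> A" "q \<in> A" "z = (g p, g q)" "dist (g p) (g q) = c" by auto
  then show "z \<in> (\<lambda>(p, q). (g p, g q)) ` {(p, q). p \<in> A \<and> q \<in> A \<and> dist p q = c'}"
    using assms by (intro image_eqI[of _ _ "(p, q)"]) auto
qed (auto simp: assms)

lemma carpet_edges_append:
  assumes "w \<in> words 8 n"
  shows "carpet_edges (n + m) (w @ v) = (\<lambda>(p, q). (word_map carpet_map w p, word_map carpet_map w q)) ` carpet_edges m v"
proof -
  have V: "carpet_cell_vertices (w @ v) = word_map carpet_map w ` carpet_cell_vertices v"
    by (auto simp: carpet_cell_vertices_def word_map_append image_iff)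
  have d: "dist (word_map carpet_map w p) (word_map carpet_map w q) = 1 / (2 * 3 ^ (n + m)) \<longleftrightarrow> dist p q = 1 / (2 * 3 ^ m)" for p q
    unfolding C.dist_word_map[OF assms] by (simp add: power_add field_simps)
  show ?thesis unfolding carpet_edges_def V using d by (rule pairs_at_distance_image)
qed

lemma carpet_energy_add:
  "carpet_energy (n + m) u = (\<Sum>w\<in>words 8 n. carpet_energy m (u \<circ> word_map carpet_map w))"
proof -
  have eq: "(\<Sum>(p, q)\<in>carpet_edges (n + m) (w @ v). (u p - u q)\<^sup>2) =
     (\<Sum>(p, q)\<in>carpet_edges m v. ((u \<circ> word_map carpet_map w) p - (u \<circ> word_map carpet_map w) q)\<^sup>2)"
    if w: "w \<in> words 8 n" for w v
    unfolding carpet_edges_append[OF w]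
    by (subst sum.reindex) (auto simp: inj_on_def case_prod_unfold dest: C.word_map_inj[OF w])
  show ?thesis unfolding carpet_energy_edges sum_words_append by (intro sum.cong[OF refl] eq)
qed

lemma carpet_energy_Suc: "carpet_energy (Suc n) u = (\<Sum>i<8. carpet_energy n (u \<circ> carpet_map i))"
  using carpet_energy_add[of 1 n u] by (simp add: sum_words_1)

lemma carpet_energy_nonneg: "0 \<le> carpet_energy n u"
  unfolding carpet_energy_def by (intro sum_nonneg) auto

text \<open>Energies are sums of squared increments between points of \<open>K\<close>, so pointwise
  control of increments passes to every level at once. This handles truncations, averages and
  products without recourse to the Dirichlet form.\<close>

lemma carpet_energy_comparison:
  assumes "\<And>x y. x \<in> C.K \<Longrightarrow> y \<in> C.K \<Longrightarrow> (u x - u y)\<^sup>2 \<le> a * ((v x - v y)\<^sup>2 + (w x - w y)\<^sup>2)"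
  shows "carpet_energy n u \<le> a * (carpet_energy n v + carpet_energy n w)"
proof -
  have "carpet_energy n u \<le> (\<Sum>z\<in>words 8 n. \<Sum>(p, q)\<in>carpet_edges n z. a * ((v p - v q)\<^sup>2 + (w p - w q)\<^sup>2))"
    unfolding carpet_energy_edges using assms carpet_edges_in_K by (intro sum_mono) auto
  also have "\<dots> = a * (carpet_energy n v + carpet_energy n w)"
    unfolding carpet_energy_edges by (simp add: sum_distrib_left sum.distrib case_prod_unfold distrib_left)
  finally show ?thesis .
qed

lemma carpet_energy_const: "carpet_energy n (\<lambda>_. k) = 0"
  by (simp add: carpet_energy_def)

lemma carpet_energy_le:
  assumes "\<And>x y. x \<in> C.K \<Longrightarrow> y \<in> C.K \<Longrightarrow> (u x - u y)\<^sup>2 \<le> a * (v x - v y)\<^sup>2"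
  shows "carpet_energy n u \<le> a * carpet_energy n v"
  using carpet_energy_comparison[of u a v "\<lambda>_. 0" n] assms by (simp add: carpet_energy_const)

lemma carpet_energy_cong: "(\<And>x. x \<in> C.K \<Longrightarrow> u x = v x) \<Longrightarrow> carpet_energy n u = carpet_energy n v"
  using carpet_energy_le[of u 1 v n] carpet_energy_le[of v 1 u n] by (intro antisym) auto

text \<open>The eight points are numbered along the boundary of the square, so successive ones are
  joined by an edge.\<close>

lemma carpet_consecutive_edge:
  assumes "k < 7" shows "(carpet_point k, carpet_point (Suc k)) \<in> carpet_edges 0 []"
proof -
  have "dist (carpet_point k) (carpet_point (Suc k)) = 1 / 2"
  proof -
    have "k = 0 \<or> k = 1 \<or> k = 2 \<or> k = 3 \<or> k = 4 \<or> k = 5 \<or> k = 6" using assms by auto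
    then show ?thesis by (auto simp: carpet_point_def dist_prod_def dist_real_def power_divide real_sqrt_divide)
  qed
  then show ?thesis using assms by (auto simp: carpet_edges_def carpet_cell_vertices_def)
qed

text \<open>A boundary path of at most seven edges and Cauchy-Schwarz.\<close>

lemma carpet_vertex_diff:
  assumes "i < 8" "j < 8"
  shows "(u (carpet_point i) - u (carpet_point j))\<^sup>2 \<le> 7 * carpet_energy 0 u"
proof -
  have main: "(u (carpet_point i) - u (carpet_point j))\<^sup>2 \<le> 7 * carpet_energy 0 u" if ij: "i \<le> j" "j < 8" for i j
  proof -
    define d where "d k = u (carpet_point (Suc k)) - u (carpet_point k)" for k
    have "u (carpet_point j) - u (carpet_point i) = (\<Sum>k\<in>{i..<j}. d k)"
      unfolding d_def using ij(1) by (rule sum_Suc_diff'[symmetric])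
    then have "(u (carpet_point i) - u (carpet_point j))\<^sup>2 = (\<Sum>k\<in>{i..<j}. d k)\<^sup>2"
      by (metis power2_commute)
    also have "\<dots> \<le> (\<Sum>k\<in>{i..<j}. (d k)\<^sup>2) * card {i..<j}" by (rule sum_squared_le_sum_of_squares)
    also have "\<dots> \<le> (\<Sum>k<7. (d k)\<^sup>2) * 7"
      using ij by (intro mult_mono sum_mono2 sum_nonneg) auto
    also have "(\<Sum>k<7. (d k)\<^sup>2) = (\<Sum>(p, q)\<in>(\<lambda>k. (carpet_point k, carpet_point (Suc k))) ` {..<7}. (u p - u q)\<^sup>2)"
    proof (subst sum.reindex)
      have "inj_on carpet_point {..<8}"
        by (auto simp: inj_on_def less_8_cases carpet_point_def)
      then show "inj_on (\<lambda>k. (carpet_point k, carpet_point (Suc k))) {..<7}" by (auto simp: inj_on_def)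
    qed (auto simp: d_def power2_commute)
    also have "\<dots> \<le> carpet_energy 0 u"
      unfolding carpet_energy_edges words_0 using carpet_consecutive_edge
      by (simp add: case_prod_unfold) (intro sum_mono2, auto)
    finally show ?thesis by simp
  qed
  show ?thesis using main[of i j] main[of j i] assms by (cases "i \<le> j") (auto simp: power2_commute)
qed

lemma carpet_shared_vertex:
  assumes i: "i < 8" "i' < 8" and j: "j < 8" "j' < 8"
    and eq: "word_map carpet_map v (carpet_point i) = word_map carpet_map w (carpet_point j)"
  shows "(u (word_map carpet_map v (carpet_point i')) - u (word_map carpet_map w (carpet_point j')))\<^sup>2
    \<le> 14 * (carpet_energy 0 (u \<circ> word_map carpet_map v) + carpet_energy 0 (u \<circ> word_map carpet_map w))"
proof -
  define p q s where "p = u (word_map carpet_map v (carpet_point i'))" and "q = u (word_map carpet_map w (carpet_point j'))"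
    and "s = u (word_map carpet_map v (carpet_point i))"
  have "(p - s)\<^sup>2 \<le> 7 * carpet_energy 0 (u \<circ> word_map carpet_map v)"
    using carpet_vertex_diff[OF i(2,1), of "u \<circ> word_map carpet_map v"] by (simp add: p_def s_def)
  moreover have "(q - s)\<^sup>2 \<le> 7 * carpet_energy 0 (u \<circ> word_map carpet_map w)"
    using carpet_vertex_diff[OF j(2,1), of "u \<circ> word_map carpet_map w"] by (simp add: q_def s_def eq)
  moreover have "(p - q)\<^sup>2 \<le> 2 * (p - s)\<^sup>2 + 2 * (q - s)\<^sup>2"
  proof -
    have "0 \<le> ((p - s) + (q - s))\<^sup>2" by simp
    then show ?thesis by (simp add: power2_eq_square algebra_simps)
  qed
  ultimately show ?thesis by (simp add: p_def q_def)
qed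

text \<open>Integer arguments allow relative positions of cells to be added to corners; outside
  \<open>{0, 1}\<close> the point is a corner of a neighbouring unit square.\<close>

definition corner :: "int \<Rightarrow> int \<Rightarrow> plane" where "corner s t = (of_int s, of_int t)"

lemma corner_is_point:
  assumes "s \<in> {0, 1}" "t \<in> {0, 1}" shows "\<exists>i<8. corner s t = carpet_point i"
proof -
  have "corner 0 0 = carpet_point 0" "corner 1 0 = carpet_point 2" "corner 1 1 = carpet_point 4" "corner 0 1 = carpet_point 6"
    by (auto simp: corner_def carpet_point_def)
  then show ?thesis using assms by (metis insert_iff empty_iff less_8_cases)
qed

lemma carpet_offset: "C.offset w = (real (digit_value 3 carpet_digit1 w), real (digit_value 3 carpet_digit2 w))"
  by (simp add: C.offset_def)

text \<open>Offsets of equal-level cells differ by integers and the carpet lies in the unit square;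
  a common point therefore forces a relative shift with entries in
  \<open>{-1, 0, 1}\<close>.\<close>

lemma carpet_meeting_cells:
  assumes v: "v \<in> words 8 n" and w: "w \<in> words 8 n" and x: "x \<in> C.K" and y: "y \<in> C.K"
    and eq: "word_map carpet_map v x = word_map carpet_map w y"
  obtains d e :: int where "d \<in> {-1, 0, 1}" "e \<in> {-1, 0, 1}" "x = y + corner d e" "C.offset w = C.offset v + corner d e"
proof -
  define d where "d = int (digit_value 3 carpet_digit1 w) - int (digit_value 3 carpet_digit1 v)"
  define e where "e = int (digit_value 3 carpet_digit2 w) - int (digit_value 3 carpet_digit2 v)"
  have off: "C.offset w = C.offset v + corner d e" by (simp add: carpet_offset d_def e_def corner_def)
  have "x + C.offset v = y + C.offset w"
    using eq unfolding C.word_map_eq[OF v] C.word_map_eq[OF w] by simp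
  then have xy: "x = y + corner d e" by (simp add: off algebra_simps)
  have "x \<in> {0..1} \<times> {0..1}" "y \<in> {0..1} \<times> {0..1}" using x y carpet_subset_square by auto
  then have "real_of_int d \<le> 1" "-1 \<le> real_of_int d" "real_of_int e \<le> 1" "-1 \<le> real_of_int e"
    unfolding xy by (auto simp: corner_def mem_Times_iff)
  then have "d \<in> {-1, 0, 1}" "e \<in> {-1, 0, 1}" by auto
  then show thesis using that xy off by blast
qed

text \<open>Touching cells share a corner of their squares, since both squares belong to the same
  grid; two boundary paths through that corner connect the two vertices.\<close>

lemma carpet_adjacent_diff:
  assumes "(v, w) \<in> C.adjacent n"
  shows "(u (word_map carpet_map v 0) - u (word_map carpet_map w 0))\<^sup>2
    \<le> 14 * (carpet_energy 0 (u \<circ> word_map carpet_map v) + carpet_energy 0 (u \<circ> word_map carpet_map w))"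
proof -
  have vw: "v \<in> words 8 n" "w \<in> words 8 n" using assms by (auto simp: C.adjacent_def)
  obtain x y where "x \<in> C.K" "y \<in> C.K" "word_map carpet_map v x = word_map carpet_map w y"
    using assms by (auto simp: C.adjacent_def C.cell_def) (metis imageE)
  then obtain d e where de: "d \<in> {-1, 0, 1}" "e \<in> {-1, 0, 1}" "C.offset w = C.offset v + corner d e"
    using carpet_meeting_cells[OF vw] by metis
  \<comment> \<open>A corner of \<open>w\<close> on the side of \<open>v\<close>: coordinate 1 where
    \<open>w\<close> is shifted by -1, so that the shifted corner again has coordinates in
    \<open>{0, 1}\<close>.\<close>
  define s t where "s = (if d = -1 then 1 else 0 :: int)" and "t = (if e = -1 then 1 else 0 :: int)"
  have st: "s \<in> {0, 1}" "t \<in> {0, 1}" by (auto simp: s_def t_def)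
  have eq: "word_map carpet_map v (corner (s + d) (t + e)) = word_map carpet_map w (corner s t)"
    unfolding C.word_map_eq[OF vw(1)] C.word_map_eq[OF vw(2)] by (simp add: de(3) corner_def)
  obtain i where i: "i < 8" "corner (s + d) (t + e) = carpet_point i"
    using corner_is_point[of "s + d" "t + e"] de by (auto simp: s_def t_def)
  obtain j where j: "j < 8" "corner s t = carpet_point j"
    using corner_is_point[of s t] st by blast
  have "carpet_point 0 = 0" by (simp add: carpet_point_def zero_prod_def)
  then show ?thesis
    using carpet_shared_vertex[of i 0 j 0 v w u] i j eq by simp
qed

text \<open>Successive subcells around the hole share a vertex, so each step costs a factor 14; at
  most seven steps and Cauchy-Schwarz give \<open>7 * 7 * 14 = 686\<close>.\<close>

lemma carpet_child_diff:
  assumes "i < 8"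
  shows "(g (carpet_map i 0) - g (carpet_map 0 0))\<^sup>2 \<le> 686 * carpet_energy 1 g"
proof -
  define d where "d k = g (carpet_map (Suc k) 0) - g (carpet_map k 0)" for k
  have p0: "carpet_point 0 = 0" by (simp add: carpet_point_def zero_prod_def)
  have dk: "(d k)\<^sup>2 \<le> 14 * carpet_energy 1 g" if k: "k < 7" for k
  proof -
    have "k = 0 \<or> k = 1 \<or> k = 2 \<or> k = 3 \<or> k = 4 \<or> k = 5 \<or> k = 6" using k by auto
    \<comment> \<open>Common vertices of consecutive subcells along the bottom, right, top and left
      sides.\<close>
    then have "carpet_map k (carpet_point (if k < 2 then 2 else if k < 4 then 6 else 0)) =
        carpet_map (Suc k) (carpet_point (if k < 4 then 0 else if k < 6 then 2 else 6))"
      by (elim disjE) (simp_all add: carpet_map_def carpet_point_def)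
    moreover have "(if k < 2 then 2 else if k < 4 then 6 else 0) < (8::nat)" "(if k < 4 then 0 else if k < 6 then 2 else 6) < (8::nat)"
      by auto
    ultimately have "\<exists>p<8. \<exists>q<8. carpet_map k (carpet_point p) = carpet_map (Suc k) (carpet_point q)" by blast
    then obtain p q where pq: "p < 8" "q < 8" "carpet_map k (carpet_point p) = carpet_map (Suc k) (carpet_point q)" by blast
    have "(g (word_map carpet_map [k] (carpet_point 0)) - g (word_map carpet_map [Suc k] (carpet_point 0)))\<^sup>2
      \<le> 14 * (carpet_energy 0 (g \<circ> word_map carpet_map [k]) + carpet_energy 0 (g \<circ> word_map carpet_map [Suc k]))"
      using pq by (intro carpet_shared_vertex[of p 0 q 0]) auto
    also have "carpet_energy 0 (g \<circ> word_map carpet_map [k]) + carpet_energy 0 (g \<circ> word_map carpet_map [Suc k])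
        = (\<Sum>i\<in>{k, Suc k}. carpet_energy 0 (g \<circ> carpet_map i))" by simp
    also have "\<dots> \<le> (\<Sum>i<8. carpet_energy 0 (g \<circ> carpet_map i))"
      using k by (intro sum_mono2) (auto simp: carpet_energy_nonneg)
    also have "\<dots> = carpet_energy 1 g" using carpet_energy_Suc[of 0 g] by simp
    finally show ?thesis by (simp add: d_def p0 power2_commute)
  qed
  have "g (carpet_map i 0) - g (carpet_map 0 0) = (\<Sum>k<i. d k)"
    unfolding d_def by (rule sum_lessThan_telescope[symmetric])
  then have "(g (carpet_map i 0) - g (carpet_map 0 0))\<^sup>2 = (\<Sum>k<i. d k)\<^sup>2" by simp
  also have "\<dots> \<le> (\<Sum>k<i. (d k)\<^sup>2) * card {..<i}" by (rule sum_squared_le_sum_of_squares)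
  also have "\<dots> \<le> (\<Sum>k<7. (d k)\<^sup>2) * 7"
    using assms by (intro mult_mono sum_mono2 sum_nonneg) auto
  also have "\<dots> \<le> (\<Sum>k<(7::nat). 14 * carpet_energy 1 g) * 7" by (intro mult_right_mono sum_mono dk) auto
  finally show ?thesis by simp
qed

text \<open>Real-valued form of \<open>carpet_seminorm \<rho> u \<le> ennreal m\<close>, with
  \<open>\<rho> ^ n\<close> for the weight of level \<open>n\<close>; it keeps the estimates out of
  the extended reals.\<close>

definition energy_bounded :: "real \<Rightarrow> (plane \<Rightarrow> real) \<Rightarrow> real \<Rightarrow> bool" where
  "energy_bounded \<rho> u m \<longleftrightarrow> (\<forall>n\<ge>1. \<rho> ^ n * carpet_energy n u \<le> m)"

lemma energy_boundedD: "energy_bounded \<rho> u m \<Longrightarrow> 1 \<le> n \<Longrightarrow> \<rho> ^ n * carpet_energy n u \<le> m"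
  by (simp add: energy_bounded_def)

lemma energy_bounded_nonneg: "0 < \<rho> \<Longrightarrow> energy_bounded \<rho> u m \<Longrightarrow> 0 \<le> m"
  using energy_boundedD[of \<rho> u m 1] carpet_energy_nonneg[of 1 u]
  by (meson le_numeral_extra(4) mult_nonneg_nonneg order_trans less_imp_le zero_le_power)

lemma carpet_walk_dim_powr:
  assumes "0 < \<rho>"
  shows "3 powr carpet_walk_dim \<rho> = 8 * \<rho>" "3 powr ((carpet_walk_dim \<rho> - carpet_dim) * real n) = \<rho> ^ n"
proof -
  show *: "3 powr carpet_walk_dim \<rho> = 8 * \<rho>" using assms by (simp add: carpet_walk_dim_def)
  have "3 powr (carpet_walk_dim \<rho> - carpet_dim) = \<rho>"
    unfolding powr_diff * using assms by (simp add: carpet_dim_def)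
  then show "3 powr ((carpet_walk_dim \<rho> - carpet_dim) * real n) = \<rho> ^ n"
    using assms by (simp add: powr_powr[symmetric] powr_realpow)
qed

lemma carpet_seminorm_eq: "0 < \<rho> \<Longrightarrow> carpet_seminorm \<rho> u = (SUP n\<in>{1..}. ennreal (\<rho> ^ n * carpet_energy n u))"
  by (simp add: carpet_seminorm_def carpet_walk_dim_powr)

lemma carpet_seminorm_le_iff:
  assumes "0 < \<rho>" "0 \<le> m" shows "carpet_seminorm \<rho> u \<le> ennreal m \<longleftrightarrow> energy_bounded \<rho> u m"
  unfolding carpet_seminorm_eq[OF assms(1)] SUP_le_iff energy_bounded_def using assms(2) by (auto simp: ennreal_le_iff)

section \<open>Upper estimate on the carpet\<close>

text \<open>Increments of vertex values are not orthogonal, so the telescoping uses the triangle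
  inequality in \<open>L2_set\<close>. Going down one level repeats each word eight times, hence the
  factor \<open>sqrt 8\<close>; as \<open>sqrt 8 \<ge> 2\<close>, the errors normalized by
  \<open>sqrt 8 ^ k\<close> are dominated by a geometric series of ratio \<open>1 / 2\<close>. The
  constant is \<open>5488 = 8 * 686\<close>.\<close>

lemma carpet_telescope:
  assumes \<rho>: "1 \<le> \<rho>" and m: "energy_bounded \<rho> u m"
  shows "(\<Sum>v\<in>words 8 (n + k). (u (word_map carpet_map v 0) - u (word_map carpet_map (take n v) 0))\<^sup>2) \<le> 8 ^ k * (5488 * m / \<rho> ^ n)"
proof -
  have m0: "0 \<le> m" using \<rho> m by (intro energy_bounded_nonneg[of \<rho>]) auto
  define q where "q w = u (word_map carpet_map w 0)" for w
  define R where "R = sqrt (5488 * m / \<rho> ^ n)"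
  have R: "0 \<le> R" using m0 \<rho> by (simp add: R_def)
  have s8: "2 \<le> sqrt 8" by (rule real_le_rsqrt) simp
  \<comment> \<open>Vertex 0 of a cell is vertex 0 of its child 0, so
    \<open>carpet_child_diff\<close> also compares each cell with its children.\<close>
  have map0: "carpet_map 0 0 = 0" by (simp add: carpet_map_def carpet_point_def zero_prod_def)
  define s where "s k = L2_set (\<lambda>v. q v - q (take n v)) (words 8 (n + k))" for k
  have child: "(\<Sum>w\<in>words 8 N. \<Sum>i<8. (q (w @ [i]) - q w)\<^sup>2) \<le> 5488 * carpet_energy (Suc N) u" for N
  proof -
    have "(\<Sum>i<8. (q (w @ [i]) - q w)\<^sup>2) \<le> (\<Sum>i<(8::nat). 686 * carpet_energy 1 (u \<circ> word_map carpet_map w))" for w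
    proof (rule sum_mono)
      fix i :: nat assume "i \<in> {..<8}"
      then show "(q (w @ [i]) - q w)\<^sup>2 \<le> 686 * carpet_energy 1 (u \<circ> word_map carpet_map w)"
        using carpet_child_diff[of i "u \<circ> word_map carpet_map w"] by (simp add: q_def word_map_append map0)
    qed
    then have "(\<Sum>w\<in>words 8 N. \<Sum>i<8. (q (w @ [i]) - q w)\<^sup>2) \<le> (\<Sum>w\<in>words 8 N. 5488 * carpet_energy 1 (u \<circ> word_map carpet_map w))"
      by (intro sum_mono) simp
    also have "\<dots> = 5488 * carpet_energy (Suc N) u" using carpet_energy_add[of N 1 u] by (simp add: sum_distrib_left)
    finally show ?thesis .
  qed
  have step: "s (Suc k) \<le> R + sqrt 8 * s k" for k
  proof -
    let ?I = "words 8 (n + k) \<times> {..<8::nat}"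
    have "s (Suc k) = L2_set (\<lambda>(w, i). (q (w @ [i]) - q w) + (q w - q (take n w))) ?I"
    proof -
      have "(\<Sum>v\<in>words 8 (Suc (n + k)). (q v - q (take n v))\<^sup>2) = (\<Sum>w\<in>words 8 (n + k). \<Sum>i<8. (q (w @ [i]) - q (take n w))\<^sup>2)"
        unfolding sum_words_snoc by (intro sum.cong refl) (simp add: length_words)
      then show ?thesis by (simp add: s_def L2_set_def sum.cartesian_product case_prod_unfold)
    qed
    also have "\<dots> = L2_set (\<lambda>z. (\<lambda>(w, i). q (w @ [i]) - q w) z + (\<lambda>(w, i). q w - q (take n w)) z) ?I"
      by (simp add: case_prod_unfold)
    also have "\<dots> \<le> L2_set (\<lambda>(w, i). q (w @ [i]) - q w) ?I + L2_set (\<lambda>(w, i). q w - q (take n w)) ?I"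
      by (rule L2_set_triangle_ineq)
    also have "L2_set (\<lambda>(w, i). q w - q (take n w)) ?I = sqrt 8 * s k"
    proof -
      have "(\<Sum>(w, i)\<in>?I. (q w - q (take n w))\<^sup>2) = 8 * (\<Sum>w\<in>words 8 (n + k). (q w - q (take n w))\<^sup>2)"
        by (simp add: sum.cartesian_product[symmetric] sum_distrib_left)
      then show ?thesis by (simp add: s_def L2_set_def case_prod_unfold real_sqrt_mult)
    qed
    also have "L2_set (\<lambda>(w, i). q (w @ [i]) - q w) ?I \<le> R"
    proof -
      have "\<rho> ^ n * carpet_energy (Suc (n + k)) u \<le> \<rho> ^ Suc (n + k) * carpet_energy (Suc (n + k)) u"
        using \<rho> by (intro mult_right_mono power_increasing carpet_energy_nonneg) auto
      also have "\<dots> \<le> m" using m by (rule energy_boundedD) simp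
      finally have "carpet_energy (Suc (n + k)) u \<le> m / \<rho> ^ n" using \<rho> by (simp add: pos_le_divide_eq mult.commute)
      then have "(\<Sum>(w, i)\<in>?I. (q (w @ [i]) - q w)\<^sup>2) \<le> 5488 * m / \<rho> ^ n"
        using child[of "n + k"] by (simp add: sum.cartesian_product)
      then show ?thesis by (simp add: L2_set_def R_def case_prod_unfold)
    qed
    finally show ?thesis by simp
  qed
  have bound: "s k \<le> sqrt 8 ^ k * R * (1 - (1/2) ^ k)" for k
  proof (induction k)
    case 0
    have "take n v = v" if "v \<in> words 8 n" for v using that by (simp add: words_def)
    then show ?case by (simp add: s_def L2_set_def)
  next
    case (Suc k)
    have "2 ^ Suc k \<le> sqrt 8 ^ Suc k" by (rule power_mono[OF s8]) simp
    then have "1 \<le> sqrt 8 ^ Suc k * (1/2) ^ Suc k" by (simp add: power_divide)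
    then have "1 * R \<le> sqrt 8 ^ Suc k * (1/2) ^ Suc k * R" using R by (rule mult_right_mono)
    moreover have "sqrt 8 * s k \<le> sqrt 8 * (sqrt 8 ^ k * R * (1 - (1/2) ^ k))" by (intro mult_left_mono Suc) simp
    ultimately have "s (Suc k) \<le> sqrt 8 ^ Suc k * (1/2) ^ Suc k * R + sqrt 8 * (sqrt 8 ^ k * R * (1 - (1/2) ^ k))"
      using step[of k] by linarith
    also have "\<dots> = sqrt 8 ^ Suc k * R * (1 - (1/2) ^ Suc k)" by (simp add: algebra_simps)
    finally show ?case .
  qed
  have "s k \<le> sqrt 8 ^ k * R"
  proof (rule order_trans[OF bound])
    show "sqrt 8 ^ k * R * (1 - (1/2) ^ k) \<le> sqrt 8 ^ k * R" using R by (intro mult_left_le) auto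
  qed
  then have "(s k)\<^sup>2 \<le> (sqrt 8 ^ k * R)\<^sup>2" by (intro power_mono) (auto simp: s_def L2_set_nonneg)
  also have "\<dots> = 8 ^ k * (5488 * m / \<rho> ^ n)"
  proof -
    have "(sqrt 8 ^ k)\<^sup>2 = (8::real) ^ k" by (simp add: power_mult[symmetric] mult.commute[of k 2]) (simp add: power_mult)
    moreover have "R\<^sup>2 = 5488 * m / \<rho> ^ n" using m0 \<rho> by (simp add: R_def)
    ultimately show ?thesis by (simp add: power_mult_distrib)
  qed
  also have "(s k)\<^sup>2 = (\<Sum>v\<in>words 8 (n + k). (q v - q (take n v))\<^sup>2)"
    unfolding s_def L2_set_def by (rule real_sqrt_pow2) (auto intro: sum_nonneg)
  finally show ?thesis by (simp add: q_def)
qed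

text \<open>Continuity ends the telescoping: on a cell of level \<open>n + k\<close> the function is
  uniformly close to its vertex value, and vertex values are compared by
  \<open>carpet_telescope\<close>. Squaring a two-term sum doubles \<open>5488\<close> to
  \<open>10976\<close>.\<close>

lemma carpet_deviation:
  assumes \<rho>: "1 \<le> \<rho>" and u: "continuous_on C.K u" and m: "energy_bounded \<rho> u m"
  shows "(\<Sum>w\<in>words 8 n. \<integral>\<^sup>+x\<in>C.cell w. ennreal ((u x - u (word_map carpet_map w 0))\<^sup>2) \<partial>C.\<nu>) \<le> ennreal (10976 * m / (8 * \<rho>) ^ n)"
proof (rule ennreal_le_epsilon)
  fix e :: real assume e: "0 < e"
  have m0: "0 \<le> m" using \<rho> m by (intro energy_bounded_nonneg[of \<rho>]) auto
  define q where "q w = u (word_map carpet_map w 0)" for w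
  have um: "u \<in> borel_measurable C.\<nu>" using u by (rule C.continuous_measurable)
  have e': "0 < sqrt (e / 2)" using e by simp
  from C.uniformly_continuous_cells[OF u e'] obtain k where
    k: "\<And>l w x y. k \<le> l \<Longrightarrow> w \<in> words 8 l \<Longrightarrow> x \<in> C.cell w \<Longrightarrow> y \<in> C.cell w \<Longrightarrow> \<bar>u x - u y\<bar> < sqrt (e / 2)" by blast
  have "0 \<in> C.K" using carpet_point_in_K[of 0] by (simp add: carpet_point_def zero_prod_def)
  then have in_cell: "word_map carpet_map w 0 \<in> C.cell w" for w by (simp add: C.cell_def)
  have "(\<Sum>w\<in>words 8 n. \<integral>\<^sup>+x\<in>C.cell w. ennreal ((u x - q w)\<^sup>2) \<partial>C.\<nu>) =
     (\<Sum>w\<in>words 8 n. \<Sum>v\<in>words 8 k. \<integral>\<^sup>+x\<in>C.cell (w @ v). ennreal ((u x - q w)\<^sup>2) \<partial>C.\<nu>)"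
    using um by (intro sum.cong refl C.nn_integral_subcells) (auto intro!: measurable_compose[OF _ measurable_ennreal])
  also have "\<dots> = (\<Sum>w\<in>words 8 n. \<Sum>v\<in>words 8 k. \<integral>\<^sup>+x\<in>C.cell (w @ v). ennreal ((u x - q (take n (w @ v)))\<^sup>2) \<partial>C.\<nu>)"
    by (intro sum.cong refl) (simp add: length_words)
  also have "\<dots> = (\<Sum>v\<in>words 8 (n + k). \<integral>\<^sup>+x\<in>C.cell v. ennreal ((u x - q (take n v))\<^sup>2) \<partial>C.\<nu>)"
    by (rule sum_words_append[symmetric])
  also have "\<dots> \<le> (\<Sum>v\<in>words 8 (n + k). ennreal (e / 8 ^ (n + k) + 2 * (q v - q (take n v))\<^sup>2 / 8 ^ (n + k)))"
  proof (rule sum_mono)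
    fix v assume v: "v \<in> words 8 (n + k)"
    have "(\<integral>\<^sup>+x\<in>C.cell v. ennreal ((u x - q (take n v))\<^sup>2) \<partial>C.\<nu>) \<le>
        (\<integral>\<^sup>+x. ennreal (e + 2 * (q v - q (take n v))\<^sup>2) * indicator (C.cell v) x \<partial>C.\<nu>)"
    proof (rule nn_integral_mono)
      fix x
      show "ennreal ((u x - q (take n v))\<^sup>2) * indicator (C.cell v) x \<le> ennreal (e + 2 * (q v - q (take n v))\<^sup>2) * indicator (C.cell v) x"
      proof (cases "x \<in> C.cell v")
        case True
        have "(u x - q v)\<^sup>2 \<le> (sqrt (e / 2))\<^sup>2"
          using k[OF _ v True in_cell[of v]] e' unfolding q_def
          by (intro abs_le_square_iff[THEN iffD1]) auto
        then have *: "(u x - q v)\<^sup>2 \<le> e / 2" using e by simp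
        have "0 \<le> ((u x - q v) - (q v - q (take n v)))\<^sup>2" by simp
        then have "(u x - q (take n v))\<^sup>2 \<le> 2 * (u x - q v)\<^sup>2 + 2 * (q v - q (take n v))\<^sup>2"
          by (simp add: power2_eq_square algebra_simps)
        then have "(u x - q (take n v))\<^sup>2 \<le> e + 2 * (q v - q (take n v))\<^sup>2" using * by simp
        then show ?thesis using True by (simp add: ennreal_leI)
      qed simp
    qed
    also have "\<dots> = ennreal (e + 2 * (q v - q (take n v))\<^sup>2) * ennreal (1 / 8 ^ (n + k))"
      using C.emeasure_cell[OF v] v by (subst nn_integral_cmult_indicator) auto
    also have "\<dots> = ennreal (e / 8 ^ (n + k) + 2 * (q v - q (take n v))\<^sup>2 / 8 ^ (n + k))"
      using e by (subst ennreal_mult[symmetric]) (auto simp: add_divide_distrib)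
    finally show "(\<integral>\<^sup>+x\<in>C.cell v. ennreal ((u x - q (take n v))\<^sup>2) \<partial>C.\<nu>) \<le> ennreal (e / 8 ^ (n + k) + 2 * (q v - q (take n v))\<^sup>2 / 8 ^ (n + k))" .
  qed
  also have "\<dots> = ennreal (e + 2 * (\<Sum>v\<in>words 8 (n + k). (q v - q (take n v))\<^sup>2) / 8 ^ (n + k))"
  proof -
    have "(\<Sum>v\<in>words 8 (n + k). e / 8 ^ (n + k) + 2 * (q v - q (take n v))\<^sup>2 / 8 ^ (n + k)) =
       e + 2 * (\<Sum>v\<in>words 8 (n + k). (q v - q (take n v))\<^sup>2) / 8 ^ (n + k)"
      by (simp add: sum.distrib card_words sum_distrib_left sum_divide_distrib)
    then show ?thesis using e by (subst sum_ennreal) auto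
  qed
  also have "\<dots> \<le> ennreal (e + 2 * (8 ^ k * (5488 * m / \<rho> ^ n)) / 8 ^ (n + k))"
    using carpet_telescope[OF \<rho> m, of n k] unfolding q_def
    by (intro ennreal_leI add_left_mono divide_right_mono mult_left_mono) auto
  also have "e + 2 * (8 ^ k * (5488 * m / \<rho> ^ n)) / 8 ^ (n + k) = 10976 * m / (8 * \<rho>) ^ n + e"
    by (simp add: power_add power_mult_distrib field_simps)
  also have "ennreal (10976 * m / (8 * \<rho>) ^ n + e) = ennreal (10976 * m / (8 * \<rho>) ^ n) + ennreal e"
    using m0 \<rho> e by (intro ennreal_plus) auto
  finally show "(\<Sum>w\<in>words 8 n. \<integral>\<^sup>+x\<in>C.cell w. ennreal ((u x - u (word_map carpet_map w 0))\<^sup>2) \<partial>C.\<nu>) \<le> ennreal (10976 * m / (8 * \<rho>) ^ n) + ennreal e"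
    by (simp add: q_def)
qed

lemma continuous_L2:
  assumes "continuous_on C.K u" shows "u \<in> L2 C.\<nu>"
proof -
  have m: "u \<in> borel_measurable C.\<nu>" using assms by (rule C.continuous_measurable)
  have "bounded (u ` C.K)" by (intro compact_imp_bounded compact_continuous_image assms C.K_props)
  then obtain b where b: "\<And>x. x \<in> C.K \<Longrightarrow> \<bar>u x\<bar> \<le> b" unfolding bounded_iff by auto
  have "integrable C.\<nu> (\<lambda>x. (u x)\<^sup>2)"
  proof (rule C.nu.integrable_const_bound)
    show "AE x in C.\<nu>. norm ((u x)\<^sup>2) \<le> b\<^sup>2"
    proof (rule AE_I2)
      fix x assume "x \<in> space C.\<nu>"
      then have "\<bar>u x\<bar> \<le> b" using b by (simp add: C.space_nu)
      then have "\<bar>u x\<bar>\<^sup>2 \<le> b\<^sup>2" by (intro power_mono) auto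
      then show "norm ((u x)\<^sup>2) \<le> b\<^sup>2" by simp
    qed
    show "(\<lambda>x. (u x)\<^sup>2) \<in> borel_measurable C.\<nu>" using m by measurable
  qed
  then show ?thesis using m by (simp add: L2_def)
qed

text \<open>Both terms of the discrete bound are of order \<open>m / (64 * \<rho>) ^ n\<close>: the
  deviation \<open>m / (8 * \<rho>) ^ n\<close> is normalized by the cell mass once, the differences
  of order \<open>m / \<rho> ^ n\<close> twice.\<close>

lemma carpet_upper:
  assumes \<rho>: "1 < \<rho>"
  shows "\<exists>C>0. \<forall>u m. continuous_on C.K u \<longrightarrow> energy_bounded \<rho> u m \<longrightarrow>
     Limsup (at_left (carpet_walk_dim \<rho>)) (C.renormalized (carpet_walk_dim \<rho>) u) \<le> ennreal (C * m)"
proof -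
  obtain c C1 where c: "0 < c" "c \<le> 1" and C1: "0 < C1" and shell: "\<And>u n q. u \<in> borel_measurable C.\<nu> \<Longrightarrow>
     C.shell u (c / real 3 ^ n) \<le>
       ennreal (C1 / real 8 ^ n) * (\<Sum>w\<in>words 8 n. \<integral>\<^sup>+x\<in>C.cell w. ennreal ((u x - q w)\<^sup>2) \<partial>C.\<nu>) +
       ennreal (C1 / real 8 ^ (2 * n) * (\<Sum>(v, w)\<in>C.adjacent n. (q v - q w)\<^sup>2))"
    using C.shell_le_discrete by blast
  obtain d where d: "\<And>n v. v \<in> words 8 n \<Longrightarrow> card {w. (v, w) \<in> C.adjacent n} \<le> d" using C.adjacent_degree by blast
  have wd: "0 < carpet_walk_dim \<rho>" using \<rho> by (simp add: carpet_walk_dim_def log_def)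
  obtain C2 where C2: "0 < C2" and lim: "\<And>u m. u \<in> L2 C.\<nu> \<Longrightarrow> 0 \<le> m \<Longrightarrow>
    (\<And>n. ennreal ((real 8 * real 3 powr carpet_walk_dim \<rho>) ^ n) * C.shell u (c / real 3 ^ n) \<le> ennreal m) \<Longrightarrow>
    Limsup (at_left (carpet_walk_dim \<rho>)) (C.renormalized (carpet_walk_dim \<rho>) u) \<le> ennreal (C2 * m)"
    using C.limsup_nonlocal_energy_le[OF wd c] by blast
  define B where "B = C1 * (10976 + 28 * real d)"
  have B: "0 < B" using C1 by (simp add: B_def add_pos_nonneg)
  have main: "Limsup (at_left (carpet_walk_dim \<rho>)) (C.renormalized (carpet_walk_dim \<rho>) u) \<le> ennreal (C2 * (B * m))"
    if u: "continuous_on C.K u" and m: "energy_bounded \<rho> u m" for u m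
  proof (rule lim[OF continuous_L2[OF u]])
    have m0: "0 \<le> m" using \<rho> m by (intro energy_bounded_nonneg[of \<rho>]) auto
    then show "0 \<le> B * m" using B by simp
    define q where "q w = u (word_map carpet_map w 0)" for w
    have adj: "(\<Sum>(v, w)\<in>C.adjacent n. (q v - q w)\<^sup>2) \<le> 28 * real d * m / \<rho> ^ n" for n
    proof (cases "n = 0")
      case True
      have "(\<Sum>(v, w)\<in>C.adjacent 0. (q v - q w)\<^sup>2) = 0"
        by (intro sum.neutral) (auto simp: C.adjacent_def words_0)
      then show ?thesis using True m0 by simp
    next
      case False
      define I where "I w = carpet_energy 0 (u \<circ> word_map carpet_map w)" for w
      have "(\<Sum>(v, w)\<in>C.adjacent n. (q v - q w)\<^sup>2) \<le> (\<Sum>(v, w)\<in>C.adjacent n. 14 * (I v + I w))"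
        unfolding q_def I_def case_prod_unfold by (intro sum_mono carpet_adjacent_diff) simp
      also have "\<dots> = 28 * (\<Sum>(v, w)\<in>C.adjacent n. I v)"
        using C.sum_adjacent_snd[of I n] by (simp add: sum.distrib case_prod_unfold sum_distrib_left[symmetric])
      also have "(\<Sum>(v, w)\<in>C.adjacent n. I v) = (\<Sum>v\<in>words 8 n. real (card {w. (v, w) \<in> C.adjacent n}) * I v)"
        by (rule C.sum_adjacent_fst)
      also have "28 * \<dots> \<le> 28 * (\<Sum>v\<in>words 8 n. real d * I v)"
        using d by (intro mult_left_mono sum_mono mult_right_mono) (auto simp: I_def carpet_energy_nonneg)
      also have "\<dots> = 28 * real d * carpet_energy n u"
        using carpet_energy_add[of n 0 u] by (simp add: I_def sum_distrib_left mult.assoc)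
      also have "carpet_energy n u \<le> m / \<rho> ^ n"
        using energy_boundedD[OF m, of n] False \<rho> by (simp add: pos_le_divide_eq mult.commute)
      finally show ?thesis by (simp add: mult_left_mono)
    qed
    show "ennreal ((real 8 * real 3 powr carpet_walk_dim \<rho>) ^ n) * C.shell u (c / real 3 ^ n) \<le> ennreal (B * m)" for n
    proof -
      have "C.shell u (c / real 3 ^ n) \<le> ennreal (C1 / real 8 ^ n) * (\<Sum>w\<in>words 8 n. \<integral>\<^sup>+x\<in>C.cell w. ennreal ((u x - q w)\<^sup>2) \<partial>C.\<nu>) +
         ennreal (C1 / real 8 ^ (2 * n) * (\<Sum>(v, w)\<in>C.adjacent n. (q v - q w)\<^sup>2))"
        using u by (intro shell C.continuous_measurable)
      also have "\<dots> \<le> ennreal (C1 / real 8 ^ n) * ennreal (10976 * m / (8 * \<rho>) ^ n) + ennreal (C1 / real 8 ^ (2 * n) * (28 * real d * m / \<rho> ^ n))"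
        using C1 \<rho> unfolding q_def
        by (intro add_mono mult_left_mono carpet_deviation u m ennreal_leI adj[unfolded q_def]) auto
      also have "\<dots> = ennreal (C1 / real 8 ^ n * (10976 * m / (8 * \<rho>) ^ n) + C1 / real 8 ^ (2 * n) * (28 * real d * m / \<rho> ^ n))"
        using C1 m0 \<rho> by (subst ennreal_plus) (auto simp: ennreal_mult[symmetric])
      also have "C1 / real 8 ^ n * (10976 * m / (8 * \<rho>) ^ n) + C1 / real 8 ^ (2 * n) * (28 * real d * m / \<rho> ^ n) = B * m / (64 * \<rho>) ^ n"
      proof -
        have "(64 * \<rho>) ^ n = (8 * (8 * \<rho>)) ^ n" by simp
        then have e1: "(64 * \<rho>) ^ n = 8 ^ n * (8 ^ n * \<rho> ^ n)" by (simp only: power_mult_distrib)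
        have e2: "(8::real) ^ (2 * n) = 8 ^ n * 8 ^ n" by (simp add: mult_2 power_add)
        have e3: "C1 / X * (10976 * m / (X * Y)) + C1 / (X * X) * (28 * real d * m / Y) = B * m / (X * (X * Y))" for X Y :: real
          unfolding times_divide_times_eq mult.assoc[of X X Y] add_divide_distrib[symmetric] by (simp add: B_def algebra_simps)
        show ?thesis unfolding of_nat_numeral e1 e2 power_mult_distrib[of 8 \<rho>] by (rule e3)
      qed
      finally have "ennreal ((64 * \<rho>) ^ n) * C.shell u (c / real 3 ^ n) \<le>
          ennreal ((64 * \<rho>) ^ n) * ennreal (B * m / (64 * \<rho>) ^ n)"
        by (rule mult_left_mono) simp
      also have "ennreal ((64 * \<rho>) ^ n) * ennreal (B * m / (64 * \<rho>) ^ n) = ennreal (B * m)"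
        using B m0 \<rho> by (simp add: ennreal_mult[symmetric])
      also have "64 * \<rho> = real 8 * real 3 powr carpet_walk_dim \<rho>" using \<rho> by (simp add: carpet_walk_dim_powr)
      finally show ?thesis .
    qed
  qed
  show ?thesis
    using main C2 B by (intro exI[of _ "C2 * B"]) (auto simp: mult.assoc)
qed

lemma energy_bounded_comparison:
  assumes "0 < \<rho>" "0 \<le> k" "\<And>x y. x \<in> C.K \<Longrightarrow> y \<in> C.K \<Longrightarrow> (u x - u y)\<^sup>2 \<le> k * ((v x - v y)\<^sup>2 + (w x - w y)\<^sup>2)"
    and "energy_bounded \<rho> v m" "energy_bounded \<rho> w m'"
  shows "energy_bounded \<rho> u (k * (m + m'))"
  unfolding energy_bounded_def
proof (intro allI impI)
  fix n :: nat assume n: "1 \<le> n"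
  have "\<rho> ^ n * carpet_energy n u \<le> \<rho> ^ n * (k * (carpet_energy n v + carpet_energy n w))"
    using assms(1) by (intro mult_left_mono carpet_energy_comparison assms(3)) auto
  also have "\<dots> = k * (\<rho> ^ n * carpet_energy n v + \<rho> ^ n * carpet_energy n w)" by (simp add: algebra_simps)
  also have "\<dots> \<le> k * (m + m')"
    using assms(2,4,5) n by (intro mult_left_mono add_mono energy_boundedD) auto
  finally show "\<rho> ^ n * carpet_energy n u \<le> k * (m + m')" .
qed

section \<open>Symmetries and coordinate functions of the carpet\<close>

text \<open>An isometry that permutes the maps and the vertices permutes the edges at each level. It
  sends \<open>K\<close> to an invariant compact set, which lies in \<open>K\<close> by
  \<open>C.invariant_compact_subset\<close>.\<close>

lemma carpet_symmetry:
  assumes p: "bij_betw p {..<8} {..<8}"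
    and s: "\<And>i x. i < 8 \<Longrightarrow> s (carpet_map i x) = carpet_map (p i) (s x)"
    and pt: "\<And>i. i < 8 \<Longrightarrow> s (carpet_point i) = carpet_point (p i)"
    and iso: "\<And>x y. dist (s x) (s y) = dist x y"
  shows "carpet_energy n (u \<circ> s) = carpet_energy n u" "s ` C.K \<subseteq> C.K"
proof -
  have s_inj: "x = y" if "s x = s y" for x y using iso[of x y] that by simp
  have inj: "inj_on (\<lambda>(x, y). (s x, s y)) Z" for Z
    by (rule inj_onI) (clarsimp, blast dest: s_inj)
  show "carpet_energy n (u \<circ> s) = carpet_energy n u"
  proof (induction n arbitrary: u)
    case 0
    have V: "s ` carpet_vertices 0 = carpet_vertices 0"
    proof -
      have "s ` carpet_vertices 0 = carpet_point ` (p ` {..<8})" using pt by (auto simp: image_image intro!: image_cong)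
      then show ?thesis using p by (simp add: bij_betw_def)
    qed
    have e: "carpet_edges 0 [] = {(x, y). x \<in> carpet_vertices 0 \<and> y \<in> carpet_vertices 0 \<and> dist x y = 1 / 2}"
      by (simp add: carpet_edges_def carpet_cell_vertices_def)
    have "carpet_edges 0 [] = (\<lambda>(x, y). (s x, s y)) ` carpet_edges 0 []"
      unfolding e using pairs_at_distance_image[of s "1 / 2" "1 / 2" "carpet_vertices 0"] iso V by simp
    then have "(\<Sum>(x, y)\<in>carpet_edges 0 []. (u x - u y)\<^sup>2) = (\<Sum>(x, y)\<in>(\<lambda>(x, y). (s x, s y)) ` carpet_edges 0 []. (u x - u y)\<^sup>2)" by simp
    also have "\<dots> = (\<Sum>(x, y)\<in>carpet_edges 0 []. ((u \<circ> s) x - (u \<circ> s) y)\<^sup>2)"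
      by (subst sum.reindex[OF inj]) (simp add: case_prod_unfold)
    finally show ?case by (simp add: carpet_energy_edges words_0)
  next
    case (Suc n)
    have "carpet_energy (Suc n) (u \<circ> s) = (\<Sum>i<8. carpet_energy n ((u \<circ> carpet_map (p i)) \<circ> s))"
      unfolding carpet_energy_Suc using s by (intro sum.cong refl arg_cong[of _ _ "carpet_energy n"]) auto
    also have "\<dots> = (\<Sum>i<8. carpet_energy n (u \<circ> carpet_map (p i)))" by (intro sum.cong refl Suc)
    also have "\<dots> = carpet_energy (Suc n) u"
      unfolding carpet_energy_Suc using p by (rule sum.reindex_bij_betw)
    finally show ?case .
  qed
  have "s ` C.K = (\<Union>i<8. s ` (carpet_map i ` C.K))" using C.K_props(3) by (simp add: image_UN[symmetric])
  also have "\<dots> = (\<Union>i<8. carpet_map (p i) ` (s ` C.K))"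
    using s by (intro SUP_cong refl) (auto simp: image_image)
  also have "\<dots> = (\<Union>i\<in>p ` {..<8}. carpet_map i ` (s ` C.K))" by (simp add: image_image)
  finally have inv: "s ` C.K = (\<Union>i<8. carpet_map i ` (s ` C.K))" using p by (simp only: bij_betw_def)
  have "continuous_on C.K s"
    unfolding continuous_on_iff iso by blast
  then have "compact (s ` C.K)" using C.K_props(2) by (rule compact_continuous_image)
  then show "s ` C.K \<subseteq> C.K"
  proof (rule C.invariant_compact_subset[OF _ inv C.K_props(1) compact_imp_closed[OF C.K_props(2)]])
    show "carpet_map i ` C.K \<subseteq> C.K" if "i < 8" for i
      by (subst (2) C.K_props(3)) (use that in auto)
  qed
qed

definition reflect :: "plane \<Rightarrow> plane" where "reflect z = (1 - fst z, snd z)"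

lemma reflect_symmetry: "carpet_energy n (u \<circ> reflect) = carpet_energy n u" "reflect ` C.K \<subseteq> C.K"
proof -
  let ?p = "\<lambda>i. [2, 1, 0, 7, 6, 5, 4, 3] ! i :: nat"
  have p: "bij_betw ?p {..<8} {..<8}"
    by (rule bij_betwI[where g = ?p]) (auto simp: less_8_cases)
  have s: "reflect (carpet_map i x) = carpet_map (?p i) (reflect x)" if "i < 8" for i x
    using that unfolding less_8_cases
    by (elim disjE; cases x) (simp_all add: reflect_def carpet_map_def carpet_point_def field_simps)
  have pt: "reflect (carpet_point i) = carpet_point (?p i)" if "i < 8" for i
    using that unfolding less_8_cases by (auto simp: reflect_def carpet_point_def)
  have iso: "dist (reflect x) (reflect y) = dist x y" for x y
    by (simp add: reflect_def dist_prod_def dist_real_def abs_minus_commute)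
  show "carpet_energy n (u \<circ> reflect) = carpet_energy n u" "reflect ` C.K \<subseteq> C.K"
    using carpet_symmetry[OF p s pt iso] by auto
qed

lemma swap_symmetry: "carpet_energy n (u \<circ> prod.swap) = carpet_energy n u" "prod.swap ` C.K \<subseteq> C.K"
proof -
  let ?p = "\<lambda>i. [0, 7, 6, 5, 4, 3, 2, 1] ! i :: nat"
  have p: "bij_betw ?p {..<8} {..<8}"
    by (rule bij_betwI[where g = ?p]) (auto simp: less_8_cases)
  have s: "prod.swap (carpet_map i x) = carpet_map (?p i) (prod.swap x)" if "i < 8" for i x
    using that unfolding less_8_cases
    by (elim disjE; cases x) (simp_all add: carpet_map_def carpet_point_def)
  have pt: "prod.swap (carpet_point i) = carpet_point (?p i)" if "i < 8" for i
    using that unfolding less_8_cases by (auto simp: carpet_point_def)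
  have iso: "dist (prod.swap x) (prod.swap y) = dist x y" for x y :: plane
    by (simp add: dist_prod_def add.commute)
  show "carpet_energy n (u \<circ> prod.swap) = carpet_energy n u" "prod.swap ` C.K \<subseteq> C.K"
    using carpet_symmetry[OF p s pt iso] by auto
qed

text \<open>The facts about the form used for the lower estimate, stated through
  \<open>energy_bounded\<close>. \<open>scaling_upper\<close> and \<open>scaling_lower\<close> are
  the two directions of \<open>n\<close>-fold self-similarity with the unknown factor
  \<open>r\<close>; a bound \<open>M\<close> stands for membership in the form domain, and one
  constant \<open>c\<close> absorbs all comparisons.\<close>

locale carpet_scaling =
  fixes \<rho> c r :: real
  assumes rho: "1 < \<rho>" and c: "0 < c" and r: "0 < r"
    and resistance: "\<And>n. 1 \<le> n \<Longrightarrow> 0 < carpet_resistance n \<and> carpet_resistance n \<le> c * \<rho> ^ n"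
    and scaling_upper: "\<And>u M n m. continuous_on C.K u \<Longrightarrow> energy_bounded \<rho> u M \<Longrightarrow>
       (\<And>w. w \<in> words 8 n \<Longrightarrow> energy_bounded \<rho> (u \<circ> word_map carpet_map w) (m w)) \<Longrightarrow>
       energy_bounded \<rho> u (c * r ^ n * (\<Sum>w\<in>words 8 n. m w))"
    and scaling_lower: "\<And>u M n. continuous_on C.K u \<Longrightarrow> energy_bounded \<rho> u M \<Longrightarrow>
       r ^ n * (\<rho> * carpet_energy (Suc n) u) \<le> c * M"
    and density: "\<And>u e. continuous_on C.K u \<Longrightarrow> 0 < e \<Longrightarrow>
       \<exists>v M. continuous_on C.K v \<and> energy_bounded \<rho> v M \<and> (\<forall>x\<in>C.K. \<bar>u x - v x\<bar> < e)"
begin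

text \<open>Regularity provides a function close to the height; clamping makes it exactly 0 and 1 on
  the bottom and top sides, and averaging with its reflection makes it agree on the left and right
  sides. This periodicity later lets copies on neighbouring cells match. \<open>X\<close> is
  \<open>Y\<close> with the axes exchanged.\<close>

lemma coordinate_functions:
  "\<exists>X Y M. continuous_on C.K X \<and> continuous_on C.K Y \<and> energy_bounded \<rho> X M \<and> energy_bounded \<rho> Y M \<and>
     (\<forall>x\<in>C.K. 0 \<le> X x \<and> X x \<le> 1 \<and> 0 \<le> Y x \<and> Y x \<le> 1) \<and>
     (\<forall>x\<in>C.K. (fst x = 0 \<longrightarrow> X x = 0) \<and> (fst x = 1 \<longrightarrow> X x = 1) \<and> (snd x = 0 \<longrightarrow> Y x = 0) \<and> (snd x = 1 \<longrightarrow> Y x = 1)) \<and>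
     (\<forall>t. Y (0, t) = Y (1, t) \<and> X (t, 0) = X (t, 1))"
proof -
  have "continuous_on C.K (\<lambda>x. snd x)" by (intro continuous_intros)
  then obtain v M where v: "continuous_on C.K v" "energy_bounded \<rho> v M" "\<And>x. x \<in> C.K \<Longrightarrow> \<bar>snd x - v x\<bar> < 1 / 4"
    using density[of "\<lambda>x. snd x" "1 / 4"] by auto
  \<comment> \<open>Values below \<open>1 / 4\<close> go to 0 and values above \<open>3 / 4\<close>
    to 1, so an approximation error below \<open>1 / 4\<close> is removed exactly on the two sides;
    \<open>g\<close> is 2-Lipschitz.\<close>
  define g where "g z = min 1 (max 0 (2 * (z - 1 / 4)))" for z :: real
  have g: "0 \<le> g z" "g z \<le> 1" for z by (auto simp: g_def)
  have g_lip: "\<bar>g y - g z\<bar> \<le> 2 * \<bar>y - z\<bar>" for y z unfolding g_def by (auto simp: min_def max_def abs_if)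
  define Y where "Y x = (g (v x) + g (v (reflect x))) / 2" for x
  have refl_K: "reflect x \<in> C.K" if "x \<in> C.K" for x using that reflect_symmetry(2) by blast
  have swap_K: "prod.swap x \<in> C.K" if "x \<in> C.K" for x using that swap_symmetry(2) by blast
  have "continuous_on C.K (\<lambda>x. v (reflect x))"
    by (rule continuous_on_compose2[OF v(1) _ reflect_symmetry(2)]) (simp add: reflect_def[abs_def] continuous_intros)
  then have Yc: "continuous_on C.K Y" unfolding Y_def g_def using v(1) by (intro continuous_intros) auto
  have Yb: "energy_bounded \<rho> Y (2 * (M + M))"
  proof (rule energy_bounded_comparison[where v = v and w = "v \<circ> reflect"])
    show "energy_bounded \<rho> (v \<circ> reflect) M" using v(2) by (simp add: energy_bounded_def reflect_symmetry(1))
    show "(Y x - Y y)\<^sup>2 \<le> 2 * ((v x - v y)\<^sup>2 + ((v \<circ> reflect) x - (v \<circ> reflect) y)\<^sup>2)" for x y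
    proof -
      define s where "s = \<bar>v x - v y\<bar>"
      define t where "t = \<bar>v (reflect x) - v (reflect y)\<bar>"
      have "\<bar>g (v x) - g (v y)\<bar> \<le> 2 * s" "\<bar>g (v (reflect x)) - g (v (reflect y))\<bar> \<le> 2 * t"
        unfolding s_def t_def by (rule g_lip)+
      then have "\<bar>Y x - Y y\<bar> \<le> s + t" unfolding Y_def abs_le_iff by (auto simp: field_simps)
      then have "\<bar>Y x - Y y\<bar>\<^sup>2 \<le> (s + t)\<^sup>2" by (intro power_mono) auto
      also have "\<dots> \<le> 2 * (s\<^sup>2 + t\<^sup>2)"
        using zero_le_power2[of "s - t"] by (simp add: power2_eq_square algebra_simps)
      finally show ?thesis by (simp add: s_def t_def)
    qed
  qed (use rho v in auto)
  have Y0: "Y x = 0" if "x \<in> C.K" "snd x = 0" for x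
  proof -
    have "v x < 1 / 4" "v (reflect x) < 1 / 4"
      using v(3)[OF that(1)] v(3)[OF refl_K[OF that(1)]] that(2) by (auto simp: reflect_def)
    then show ?thesis by (simp add: Y_def g_def)
  qed
  have Y1: "Y x = 1" if "x \<in> C.K" "snd x = 1" for x
  proof -
    have "snd (reflect x) = 1" using that(2) by (simp add: reflect_def)
    then have "3 / 4 < v x" "3 / 4 < v (reflect x)"
      using v(3)[OF that(1)] v(3)[OF refl_K[OF that(1)]] that(2) by linarith+
    then show ?thesis by (simp add: Y_def g_def)
  qed
  have Yr: "Y (0, t) = Y (1, t)" for t by (simp add: Y_def reflect_def)
  have Y01: "0 \<le> Y x" "Y x \<le> 1" for x using g[of "v x"] g[of "v (reflect x)"] by (auto simp: Y_def)
  define X where "X = Y \<circ> prod.swap"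
  have "continuous_on C.K X" unfolding X_def o_def
    by (rule continuous_on_compose2[OF Yc]) (use swap_K in \<open>auto intro!: continuous_intros continuous_on_swap\<close>)
  moreover have "energy_bounded \<rho> X (2 * (M + M))" using Yb by (simp add: X_def energy_bounded_def swap_symmetry(1))
  moreover have "X x = 0" if "x \<in> C.K" "fst x = 0" for x using Y0[OF swap_K[OF that(1)]] that(2) by (simp add: X_def)
  moreover have "X x = 1" if "x \<in> C.K" "fst x = 1" for x using Y1[OF swap_K[OF that(1)]] that(2) by (simp add: X_def)
  moreover have "X (t, 0) = X (t, 1)" for t using Yr[of t] by (simp add: X_def)
  ultimately show ?thesis
    using Yc Yb Y0 Y1 Yr Y01 by (intro exI[of _ X] exI[of _ Y] exI[of _ "2 * (M + M)"]) (auto simp: X_def)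
qed

end

section \<open>Interpolation of cell averages\<close>

definition corner_diff :: "(plane \<Rightarrow> real) \<Rightarrow> nat list \<Rightarrow> real" where
  "corner_diff G w = (\<Sum>(s, t)\<in>{0, 1} \<times> {0, 1}.
     (G (word_map carpet_map w (corner s t)) - G (word_map carpet_map w (corner 0 0)))\<^sup>2)"

lemma corner_diff_eq:
  "corner_diff G w = (G (word_map carpet_map w (corner 1 0)) - G (word_map carpet_map w (corner 0 0)))\<^sup>2 +
     (G (word_map carpet_map w (corner 0 1)) - G (word_map carpet_map w (corner 0 0)))\<^sup>2 +
     (G (word_map carpet_map w (corner 1 1)) - G (word_map carpet_map w (corner 0 0)))\<^sup>2"
  by (simp add: corner_diff_def sum.cartesian_product[symmetric])

lemma product_diff_le:
  fixes p q p' q' :: real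
  assumes "0 \<le> p" "p \<le> 1" "0 \<le> q'" "q' \<le> 1"
  shows "(p * q - p' * q')\<^sup>2 \<le> 2 * ((p - p')\<^sup>2 + (q - q')\<^sup>2)"
proof -
  have "\<bar>p * q - p' * q'\<bar> = \<bar>p * (q - q') + (p - p') * q'\<bar>" by (simp add: algebra_simps)
  also have "\<dots> \<le> \<bar>p\<bar> * \<bar>q - q'\<bar> + \<bar>p - p'\<bar> * \<bar>q'\<bar>"
    by (rule order_trans[OF abs_triangle_ineq]) (simp add: abs_mult)
  also have "\<dots> \<le> 1 * \<bar>q - q'\<bar> + \<bar>p - p'\<bar> * 1" using assms by (intro add_mono mult_mono) auto
  finally have "\<bar>p * q - p' * q'\<bar>\<^sup>2 \<le> (\<bar>q - q'\<bar> + \<bar>p - p'\<bar>)\<^sup>2" by (intro power_mono) auto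
  also have "\<dots> \<le> 2 * (\<bar>p - p'\<bar>\<^sup>2 + \<bar>q - q'\<bar>\<^sup>2)"
    using zero_le_power2[of "\<bar>q - q'\<bar> - \<bar>p - p'\<bar>"] by (simp add: power2_eq_square algebra_simps)
  finally show ?thesis by simp
qed

lemma corner_in_K: "s \<in> {0, 1} \<Longrightarrow> t \<in> {0, 1} \<Longrightarrow> corner s t \<in> C.K"
  using corner_is_point[of s t] carpet_point_in_K by auto

text \<open>A vertex lies in several cells. Choosing one cell per point, independently of the cell
  from which it is viewed, makes the averages \<open>C.mean u (cell_of n z)\<close> single-valued at
  shared vertices, as gluing requires.\<close>

definition cell_of :: "nat \<Rightarrow> plane \<Rightarrow> nat list" where
  "cell_of n z = (SOME v. v \<in> words 8 n \<and> z \<in> C.cell v)"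

lemma cell_of: "z \<in> C.K \<Longrightarrow> cell_of n z \<in> words 8 n \<and> z \<in> C.cell (cell_of n z)"
  unfolding cell_of_def by (rule someI_ex) (use C.K_words[of n] in blast)

text \<open>The two cells chosen at vertices of \<open>w\<close> both meet \<open>w\<close>, so
  their points are within three cell diameters. A given cell \<open>v\<close> is chosen at most once
  for each adjacent word and each of the four corners.\<close>

lemma sum_corner_diff_le_shell:
  "\<exists>d. \<forall>u n. u \<in> L2 C.\<nu> \<longrightarrow>
     ennreal (\<Sum>w\<in>words 8 n. corner_diff (\<lambda>z. C.mean u (cell_of n z)) w) \<le>
     ennreal (real d * 8 ^ (2 * n)) * C.shell u ((3 * C.D + 1) / 3 ^ n)"
proof -
  obtain d where d: "\<And>n v. v \<in> words 8 n \<Longrightarrow> card {w. (v, w) \<in> C.adjacent n} \<le> d" using C.adjacent_degree by blast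
  have "ennreal (\<Sum>w\<in>words 8 n. corner_diff (\<lambda>z. C.mean u (cell_of n z)) w) \<le>
     ennreal (real (d * 4) * 8 ^ (2 * n)) * C.shell u ((3 * C.D + 1) / 3 ^ n)" if u: "u \<in> L2 C.\<nu>" for u n
  proof -
    let ?J = "{0, 1} \<times> {0, 1} :: (int \<times> int) set"
    let ?I = "words 8 n \<times> ?J"
    define z where "z i = word_map carpet_map (fst i) (corner (fst (snd i)) (snd (snd i)))" for i :: "nat list \<times> int \<times> int"
    define z0 where "z0 i = word_map carpet_map (fst i) (corner 0 0)" for i :: "nat list \<times> int \<times> int"
    have z: "z i \<in> C.cell (fst i)" "z0 i \<in> C.cell (fst i)" "fst i \<in> words 8 n" if "i \<in> ?I" for i
      using that corner_in_K by (auto simp: z_def z0_def C.cell_def)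
    have zK: "z i \<in> C.K" "z0 i \<in> C.K" if "i \<in> ?I" for i using z[OF that] C.cell_subset_K[OF z(3)[OF that]] by auto
    have "(\<Sum>w\<in>words 8 n. corner_diff (\<lambda>z. C.mean u (cell_of n z)) w) =
        (\<Sum>i\<in>?I. (C.mean u (cell_of n (z i)) - C.mean u (cell_of n (z0 i)))\<^sup>2)"
      unfolding corner_diff_def z_def z0_def by (subst sum.cartesian_product) (simp add: case_prod_unfold)
    also have "ennreal \<dots> \<le> ennreal (real (d * 4) * real 8 ^ (2 * n)) * C.shell u ((3 * C.D + 1) / 3 ^ n)"
    proof (rule C.sum_mean_diff_le_shell[OF u])
      show "cell_of n (z i) \<in> words 8 n \<and> cell_of n (z0 i) \<in> words 8 n" if "i \<in> ?I" for i
        using cell_of zK[OF that] by blast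
      show "dist x y < (3 * C.D + 1) / 3 ^ n"
        if i: "i \<in> ?I" and x: "x \<in> C.cell (cell_of n (z i))" and y: "y \<in> C.cell (cell_of n (z0 i))" for i x y
      proof -
        have a: "dist x (z i) \<le> C.D / real 3 ^ n" using cell_of[OF zK(1)[OF i], of n] x by (intro C.dist_cell_le) auto
        have b: "dist (z i) (z0 i) \<le> C.D / real 3 ^ n" using z[OF i] by (intro C.dist_cell_le)
        have e: "dist (z0 i) y \<le> C.D / real 3 ^ n" using cell_of[OF zK(2)[OF i], of n] y by (intro C.dist_cell_le) auto
        have "dist x y \<le> dist x (z i) + (dist (z i) (z0 i) + dist (z0 i) y)"
          using dist_triangle[of x y "z i"] dist_triangle[of "z i" y "z0 i"] by simp
        also have "\<dots> \<le> 3 * C.D / 3 ^ n" using a b e by simp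
        also have "\<dots> < (3 * C.D + 1) / 3 ^ n" by (intro divide_strict_right_mono) auto
        finally show ?thesis .
      qed
      show "card {i \<in> ?I. cell_of n (z i) = v} \<le> d * 4" if v: "v \<in> words 8 n" for v
      proof -
        have fin: "finite {w. (v, w) \<in> C.adjacent n}"
          by (rule finite_subset[OF _ finite_words[of 8 n]]) (auto simp: C.adjacent_def)
        have "{i \<in> ?I. cell_of n (z i) = v} \<subseteq> {w. (v, w) \<in> C.adjacent n} \<times> ?J"
        proof
          fix i assume i: "i \<in> {i \<in> ?I. cell_of n (z i) = v}"
          then have "i \<in> ?I" by simp
          then have "z i \<in> C.cell v" "z i \<in> C.cell (fst i)" using cell_of[OF zK(1), of i n] z(1) i by auto
          then have "(v, fst i) \<in> C.adjacent n" using v z(3)[OF \<open>i \<in> ?I\<close>] by (auto simp: C.adjacent_def)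
          then show "i \<in> {w. (v, w) \<in> C.adjacent n} \<times> ?J" using \<open>i \<in> ?I\<close> by (auto simp: mem_Times_iff)
        qed
        then have "card {i \<in> ?I. cell_of n (z i) = v} \<le> card ({w. (v, w) \<in> C.adjacent n} \<times> ?J)"
          using fin by (intro card_mono) auto
        also have "\<dots> = card {w. (v, w) \<in> C.adjacent n} * 4" by (simp add: card_cartesian_product)
        also have "\<dots> \<le> d * 4" using d[OF v] by simp
        finally show ?thesis .
      qed
    qed auto
    finally show ?thesis by simp
  qed
  then show ?thesis by blast
qed

lemma mean_near:
  assumes u: "u \<in> L2 C.\<nu>" and v: "v \<in> words 8 n" and e: "0 \<le> e" and near: "\<And>x. x \<in> C.cell v \<Longrightarrow> \<bar>u x - k\<bar> \<le> e"
  shows "\<bar>C.mean u v - k\<bar> \<le> e"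
proof -
  have "ennreal ((C.mean u v - k)\<^sup>2) \<le> ennreal (real 8 ^ n) * (\<integral>\<^sup>+x\<in>C.cell v. ennreal ((u x - k)\<^sup>2) \<partial>C.\<nu>)"
    by (rule C.mean_diff_le[OF u v])
  also have "\<dots> \<le> ennreal (real 8 ^ n) * (\<integral>\<^sup>+x. ennreal (e\<^sup>2) * indicator (C.cell v) x \<partial>C.\<nu>)"
  proof (intro mult_left_mono nn_integral_mono)
    fix x
    show "ennreal ((u x - k)\<^sup>2) * indicator (C.cell v) x \<le> ennreal (e\<^sup>2) * indicator (C.cell v) x"
    proof (cases "x \<in> C.cell v")
      case True
      have "\<bar>u x - k\<bar>\<^sup>2 \<le> e\<^sup>2" using near[OF True] by (intro power_mono) auto
      then show ?thesis by (simp add: True ennreal_leI)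
    qed simp
  qed simp
  also have "\<dots> = ennreal (real 8 ^ n) * (ennreal (e\<^sup>2) * ennreal (1 / real 8 ^ n))"
    using v by (subst nn_integral_cmult_indicator) (auto simp: C.emeasure_cell)
  also have "\<dots> = ennreal (e\<^sup>2)" by (simp add: ennreal_mult[symmetric])
  finally have "(C.mean u v - k)\<^sup>2 \<le> e\<^sup>2" by (simp add: ennreal_le_iff)
  then show ?thesis using e by (simp add: abs_le_square_iff[symmetric])
qed

text \<open>The error involves the number of edges of level \<open>k\<close>, so the estimate serves
  for fixed \<open>k\<close> while the approximation improves.\<close>

lemma carpet_energy_perturb:
  assumes near: "\<And>x. x \<in> C.K \<Longrightarrow> \<bar>U x - u x\<bar> \<le> e"
  shows "carpet_energy k u \<le> 2 * carpet_energy k U + 8 * e\<^sup>2 * real (\<Sum>w\<in>words 8 k. card (carpet_edges k w))"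
proof -
  have "carpet_energy k u \<le> (\<Sum>w\<in>words 8 k. \<Sum>(p, q)\<in>carpet_edges k w. 2 * (U p - U q)\<^sup>2 + 8 * e\<^sup>2)"
    unfolding carpet_energy_edges
  proof (intro sum_mono)
    fix w i assume w: "w \<in> words 8 k" and i: "i \<in> carpet_edges k w"
    obtain p q where pq: "i = (p, q)" by (metis surj_pair)
    have K: "p \<in> C.K" "q \<in> C.K" using carpet_edges_in_K[OF w] i pq by auto
    define h where "h = (u p - u q) - (U p - U q)"
    have "\<bar>h\<bar> \<le> 2 * e" using near[OF K(1)] near[OF K(2)] by (simp add: h_def)
    then have "\<bar>h\<bar>\<^sup>2 \<le> (2 * e)\<^sup>2" by (intro power_mono) auto
    then have h: "h\<^sup>2 \<le> 4 * e\<^sup>2" by (simp add: power_mult_distrib)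
    have "(u p - u q)\<^sup>2 = ((U p - U q) + h)\<^sup>2" by (simp add: h_def)
    also have "\<dots> \<le> 2 * (U p - U q)\<^sup>2 + 2 * h\<^sup>2"
      using zero_le_power2[of "(U p - U q) - h"] by (simp add: power2_eq_square algebra_simps)
    also have "\<dots> \<le> 2 * (U p - U q)\<^sup>2 + 8 * e\<^sup>2" using h by simp
    finally show "(case i of (p, q) \<Rightarrow> (u p - u q)\<^sup>2) \<le> (case i of (p, q) \<Rightarrow> 2 * (U p - U q)\<^sup>2 + 8 * e\<^sup>2)" by (simp add: pq)
  qed
  also have "\<dots> = 2 * carpet_energy k U + 8 * e\<^sup>2 * real (\<Sum>w\<in>words 8 k. card (carpet_edges k w))"
    unfolding carpet_energy_edges by (simp add: sum.distrib sum_distrib_left case_prod_unfold mult.commute)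
  finally show ?thesis .
qed

locale carpet_coordinates = carpet_scaling +
  fixes X Y :: "plane \<Rightarrow> real" and M :: real
  assumes continuous_X: "continuous_on C.K X" and continuous_Y: "continuous_on C.K Y"
    and bounded_X: "energy_bounded \<rho> X M" and bounded_Y: "energy_bounded \<rho> Y M"
    and unit: "\<And>x. x \<in> C.K \<Longrightarrow> 0 \<le> X x \<and> X x \<le> 1 \<and> 0 \<le> Y x \<and> Y x \<le> 1"
    and X_boundary: "\<And>t. (0, t) \<in> C.K \<Longrightarrow> X (0, t) = 0" "\<And>t. (1, t) \<in> C.K \<Longrightarrow> X (1, t) = 1"
    and Y_boundary: "\<And>t. (t, 0) \<in> C.K \<Longrightarrow> Y (t, 0) = 0" "\<And>t. (t, 1) \<in> C.K \<Longrightarrow> Y (t, 1) = 1"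
    and periodic: "\<And>t. Y (0, t) = Y (1, t)" "\<And>t. X (t, 0) = X (t, 1)"
begin

lemma M_nonneg: "0 \<le> M"
  using bounded_X rho by (intro energy_bounded_nonneg[of \<rho> X]) auto

text \<open>The function \<open>X\<close> competes in the variational problem defining the resistance.\<close>

lemma scaling_le: "r \<le> \<rho>"
proof (rule ccontr)
  assume "\<not> r \<le> \<rho>"
  then have q: "1 < r / \<rho>" using rho by simp
  have bound: "(r / \<rho>) ^ n \<le> c * c * M" for n
  proof -
    let ?S = "{u. (\<forall>p\<in>carpet_vertices (Suc n) \<inter> {0} \<times> {0..1}. u p = 0) \<and> (\<forall>p\<in>carpet_vertices (Suc n) \<inter> {1} \<times> {0..1}. u p = (1::real))}"
    define I where "I = (INF u\<in>?S. carpet_energy (Suc n) u)"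
    have V: "p \<in> C.K" if "p \<in> carpet_vertices (Suc n)" for p using carpet_vertices_subset that by blast
    have "X \<in> ?S" using X_boundary by (auto simp del: carpet_vertices.simps dest: V)
    then have "I \<le> carpet_energy (Suc n) X"
      unfolding I_def by (intro cINF_lower bdd_belowI[of _ 0]) (auto simp: carpet_energy_nonneg)
    then have 1: "r ^ n * (\<rho> * I) \<le> c * M"
      using scaling_lower[OF continuous_X bounded_X, of n] r rho
      by (meson mult_left_mono order_trans less_imp_le zero_le_power zero_less_one less_trans)
    have R: "carpet_resistance (Suc n) = inverse I" by (simp add: carpet_resistance_def I_def)
    have I: "0 < I" "inverse I \<le> c * \<rho> ^ Suc n" using resistance[of "Suc n"] unfolding R by auto
    \<comment> \<open>The resistance bounds the infimum \<open>I\<close> below by a multiple of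
      \<open>1 / \<rho> ^ n\<close>, the competitor \<open>X\<close> bounds it above by a multiple
      of \<open>1 / r ^ n\<close>.\<close>
    then have "1 \<le> c * \<rho> ^ Suc n * I" by (simp add: field_simps)
    then have "r ^ n * 1 \<le> r ^ n * (c * \<rho> ^ Suc n * I)" using r by (intro mult_left_mono) auto
    also have "\<dots> = c * \<rho> ^ n * (r ^ n * (\<rho> * I))" by simp
    also have "\<dots> \<le> c * \<rho> ^ n * (c * M)" using 1 c rho by (intro mult_left_mono) auto
    finally have "r ^ n \<le> c * c * M * \<rho> ^ n" by (simp add: mult_ac)
    then show ?thesis using rho by (simp add: power_divide pos_divide_le_eq)
  qed
  obtain n where "c * c * M < (r / \<rho>) ^ n" using real_arch_pow[OF q] by blast
  then show False using bound[of n] by simp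
qed

definition interp :: "(plane \<Rightarrow> real) \<Rightarrow> nat list \<Rightarrow> plane \<Rightarrow> real" where
  "interp G w y =
     G (word_map carpet_map w (corner 0 0)) * (1 - X y) * (1 - Y y) +
     G (word_map carpet_map w (corner 1 0)) * X y * (1 - Y y) +
     G (word_map carpet_map w (corner 0 1)) * (1 - X y) * Y y +
     G (word_map carpet_map w (corner 1 1)) * X y * Y y"

text \<open>On a common side only the corner values of that side carry nonzero weight, by the
  boundary values of \<open>X\<close> and \<open>Y\<close>, and the coordinate along the side agrees
  from both cells by periodicity. At a common corner a single weight equals 1. The nine shifts
  \<open>(d, e)\<close> are checked separately.\<close>

lemma interp_consistent:
  assumes v: "v \<in> words 8 n" and w: "w \<in> words 8 n" and x: "x \<in> C.K" and y: "y \<in> C.K"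
    and eq: "word_map carpet_map v x = word_map carpet_map w y"
  shows "interp G v x = interp G w y"
proof -
  obtain d e where de: "d \<in> {-1, 0, 1}" "e \<in> {-1, 0, 1}" "x = y + corner d e" "C.offset w = C.offset v + corner d e"
    using carpet_meeting_cells[OF v w x y eq] by metis
  define H where "H s t = G (word_map carpet_map v (corner s t))" for s t
  have Hw: "G (word_map carpet_map w (corner s t)) = H (s + d) (t + e)" for s t
  proof -
    have "corner s t + C.offset w = corner (s + d) (t + e) + C.offset v"
      by (simp add: de(4) corner_def prod_eq_iff)
    then show ?thesis unfolding H_def C.word_map_eq[OF v] C.word_map_eq[OF w] by (simp only:)
  qed
  obtain y1 y2 where yy: "y = (y1, y2)" by (metis surj_pair)
  then have xx: "x = (y1 + of_int d, y2 + of_int e)" by (simp add: de(3) corner_def)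
  have b: "0 \<le> y1" "y1 \<le> 1" "0 \<le> y2" "y2 \<le> 1" "0 \<le> y1 + of_int d" "y1 + of_int d \<le> 1" "0 \<le> y2 + of_int e" "y2 + of_int e \<le> 1"
    using x y carpet_subset_square unfolding xx yy by auto
  have d1: "y1 = 0" if "d = 1" using b that by simp
  have d2: "y1 = 1" if "d = -1" using b that by simp
  have e1: "y2 = 0" if "e = 1" using b that by simp
  have e2: "y2 = 1" if "e = -1" using b that by simp
  have I: "interp G v x = H 0 0 * (1 - X x) * (1 - Y x) + H 1 0 * X x * (1 - Y x) + H 0 1 * (1 - X x) * Y x + H 1 1 * X x * Y x"
    "interp G w y = H d e * (1 - X y) * (1 - Y y) + H (1 + d) e * X y * (1 - Y y) + H d (1 + e) * (1 - X y) * Y y + H (1 + d) (1 + e) * X y * Y y"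
    unfolding interp_def Hw by (simp_all add: H_def)
  consider "d = -1" | "d = 0" | "d = 1" using de(1) by auto
  then show ?thesis
  proof cases
    case 1
    have *: "X x = 0" "X y = 1" using X_boundary(1)[of "snd x"] X_boundary(2)[of y2] x y d2[OF 1] 1 unfolding xx yy by auto
    consider "e = -1" | "e = 0" | "e = 1" using de(2) by auto
    then show ?thesis
    proof cases
      case 1
      have "Y x = 0" "Y y = 1" using Y_boundary(1)[of "fst x"] Y_boundary(2)[of y1] x y e2[OF 1] 1 unfolding xx yy by auto
      then show ?thesis unfolding I using * 1 \<open>d = -1\<close> by simp
    next
      case 2
      have "Y x = Y y" using periodic(1)[of y2] d2[OF \<open>d = -1\<close>] \<open>d = -1\<close> 2 unfolding xx yy by simp
      then show ?thesis unfolding I using * 2 \<open>d = -1\<close> by simp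
    next
      case 3
      have "Y x = 1" "Y y = 0" using Y_boundary(2)[of "fst x"] Y_boundary(1)[of y1] x y e1[OF 3] 3 unfolding xx yy by auto
      then show ?thesis unfolding I using * 3 \<open>d = -1\<close> by simp
    qed
  next
    case 2
    consider "e = -1" | "e = 0" | "e = 1" using de(2) by auto
    then show ?thesis
    proof cases
      case 1
      have *: "Y x = 0" "Y y = 1" using Y_boundary(1)[of "fst x"] Y_boundary(2)[of y1] x y e2[OF 1] 1 unfolding xx yy by auto
      have "X x = X y" using periodic(2)[of y1] e2[OF 1] \<open>d = 0\<close> 1 unfolding xx yy by simp
      then show ?thesis unfolding I using * 1 \<open>d = 0\<close> by simp
    next
      case 2
      then show ?thesis unfolding I using \<open>d = 0\<close> unfolding xx yy by simp
    next
      case 3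
      have *: "Y x = 1" "Y y = 0" using Y_boundary(2)[of "fst x"] Y_boundary(1)[of y1] x y e1[OF 3] 3 unfolding xx yy by auto
      have "X x = X y" using periodic(2)[of y1] e1[OF 3] \<open>d = 0\<close> 3 unfolding xx yy by simp
      then show ?thesis unfolding I using * 3 \<open>d = 0\<close> by simp
    qed
  next
    case 3
    have *: "X x = 1" "X y = 0" using X_boundary(2)[of "snd x"] X_boundary(1)[of y2] x y d1[OF 3] 3 unfolding xx yy by auto
    consider "e = -1" | "e = 0" | "e = 1" using de(2) by auto
    then show ?thesis
    proof cases
      case 1
      have "Y x = 0" "Y y = 1" using Y_boundary(1)[of "fst x"] Y_boundary(2)[of y1] x y e2[OF 1] 1 unfolding xx yy by auto
      then show ?thesis unfolding I using * 1 \<open>d = 1\<close> by simp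
    next
      case 2
      have "Y x = Y y" using periodic(1)[of y2] d1[OF \<open>d = 1\<close>] \<open>d = 1\<close> 2 unfolding xx yy by simp
      then show ?thesis unfolding I using * 2 \<open>d = 1\<close> by simp
    next
      case 3
      have "Y x = 1" "Y y = 0" using Y_boundary(2)[of "fst x"] Y_boundary(1)[of y1] x y e1[OF 3] 3 unfolding xx yy by auto
      then show ?thesis unfolding I using * 3 \<open>d = 1\<close> by simp
    qed
  qed
qed

lemma continuous_interp: "continuous_on C.K (interp G w)"
  unfolding interp_def by (intro continuous_intros continuous_X continuous_Y)

lemma interp_glue:
  "\<exists>U. continuous_on C.K U \<and> (\<forall>w\<in>words 8 n. \<forall>y\<in>C.K. U (word_map carpet_map w y) = interp G w y)"
proof -
  define U where "U x = (SOME z. \<exists>w\<in>words 8 n. \<exists>y\<in>C.K. x = word_map carpet_map w y \<and> z = interp G w y)" for x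
  have U: "U (word_map carpet_map w y) = interp G w y" if "w \<in> words 8 n" "y \<in> C.K" for w y
    unfolding U_def
  proof (rule some_equality)
    fix z assume "\<exists>v\<in>words 8 n. \<exists>x\<in>C.K. word_map carpet_map w y = word_map carpet_map v x \<and> z = interp G v x"
    then obtain v x where "v \<in> words 8 n" "x \<in> C.K" "word_map carpet_map w y = word_map carpet_map v x" "z = interp G v x" by blast
    then show "z = interp G w y" using interp_consistent[of w n v y x G] that by simp
  qed (use that in blast)
  have "continuous_on (\<Union>w\<in>words 8 n. C.cell w) U"
  proof (rule continuous_on_closed_Union)
    show "closed (C.cell w)" if "w \<in> words 8 n" for w using C.compact_cell[OF that] by (rule compact_imp_closed)
    show "continuous_on (C.cell w) U" if w: "w \<in> words 8 n" for w
    proof -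
      define g where "g x = (3 ^ n) *\<^sub>R x - C.offset w" for x
      have gw: "g (word_map carpet_map w y) = y" for y by (simp add: g_def C.word_map_eq[OF w])
      have "continuous_on (C.cell w) (\<lambda>x. interp G w (g x))"
      proof (rule continuous_on_compose2[OF continuous_interp])
        show "continuous_on (C.cell w) g" unfolding g_def by (intro continuous_intros)
        show "g ` C.cell w \<subseteq> C.K" by (auto simp: C.cell_def gw)
      qed
      moreover have "interp G w (g x) = U x" if "x \<in> C.cell w" for x
        using that U[OF w] by (auto simp: C.cell_def gw)
      ultimately show ?thesis by (simp cong: continuous_on_cong)
    qed
  qed simp
  then have "continuous_on C.K U" by (simp only: C.K_words[of n, symmetric])
  then show ?thesis using U by blast
qed

text \<open>The constant part drops out of increments. Cauchy-Schwarz separates the three corner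
  differences from the increments of the products, each bounded through
  \<open>product_diff_le\<close> because the factors lie in the unit interval; three times 2,
  doubled by \<open>M + M\<close>, gives 12.\<close>

lemma interp_energy: "energy_bounded \<rho> (interp G w) (12 * M * corner_diff G w)"
proof -
  define g where "g = G (word_map carpet_map w (corner 0 0))"
  define k1 where "k1 = G (word_map carpet_map w (corner 1 0)) - g"
  define k2 where "k2 = G (word_map carpet_map w (corner 0 1)) - g"
  define k3 where "k3 = G (word_map carpet_map w (corner 1 1)) - g"
  have cd: "corner_diff G w = k1\<^sup>2 + k2\<^sup>2 + k3\<^sup>2" by (simp add: corner_diff_eq k1_def k2_def k3_def g_def)
  have form: "interp G w y = g + k1 * (X y * (1 - Y y)) + k2 * ((1 - X y) * Y y) + k3 * (X y * Y y)" for y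
    unfolding interp_def k1_def k2_def k3_def g_def by (simp add: algebra_simps)
  have cs: "(k1 * d1 + k2 * d2 + k3 * d3)\<^sup>2 \<le> (k1\<^sup>2 + k2\<^sup>2 + k3\<^sup>2) * (d1\<^sup>2 + d2\<^sup>2 + d3\<^sup>2)" for d1 d2 d3
  proof -
    have "0 \<le> (k1 * d2 - k2 * d1)\<^sup>2 + (k1 * d3 - k3 * d1)\<^sup>2 + (k2 * d3 - k3 * d2)\<^sup>2" by simp
    then show ?thesis by (simp add: power2_eq_square algebra_simps)
  qed
  have "energy_bounded \<rho> (interp G w) (6 * (k1\<^sup>2 + k2\<^sup>2 + k3\<^sup>2) * (M + M))"
  proof (rule energy_bounded_comparison[OF _ _ _ bounded_X bounded_Y])
    fix x y assume "x \<in> C.K" "y \<in> C.K"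
    then have u: "0 \<le> X x" "X x \<le> 1" "0 \<le> Y x" "Y x \<le> 1" "0 \<le> X y" "X y \<le> 1" "0 \<le> Y y" "Y y \<le> 1" using unit by auto
    define Q where "Q = (X x - X y)\<^sup>2 + (Y x - Y y)\<^sup>2"
    have "(X x * (1 - Y x) - X y * (1 - Y y))\<^sup>2 \<le> 2 * Q"
      using product_diff_le[of "X x" "1 - Y y" "1 - Y x" "X y"] u by (simp add: Q_def power2_commute)
    moreover have "((1 - X x) * Y x - (1 - X y) * Y y)\<^sup>2 \<le> 2 * Q"
      using product_diff_le[of "1 - X x" "Y y" "Y x" "1 - X y"] u by (simp add: Q_def power2_commute)
    moreover have "(X x * Y x - X y * Y y)\<^sup>2 \<le> 2 * Q"
      using product_diff_le[of "X x" "Y y" "Y x" "X y"] u by (simp add: Q_def)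
    ultimately have s: "(X x * (1 - Y x) - X y * (1 - Y y))\<^sup>2 + ((1 - X x) * Y x - (1 - X y) * Y y)\<^sup>2 + (X x * Y x - X y * Y y)\<^sup>2 \<le> 6 * Q" by simp
    have "interp G w x - interp G w y = k1 * (X x * (1 - Y x) - X y * (1 - Y y)) + k2 * ((1 - X x) * Y x - (1 - X y) * Y y) + k3 * (X x * Y x - X y * Y y)"
      unfolding form by (simp add: algebra_simps)
    then have "(interp G w x - interp G w y)\<^sup>2 \<le> (k1\<^sup>2 + k2\<^sup>2 + k3\<^sup>2) *
        ((X x * (1 - Y x) - X y * (1 - Y y))\<^sup>2 + ((1 - X x) * Y x - (1 - X y) * Y y)\<^sup>2 + (X x * Y x - X y * Y y)\<^sup>2)"
      using cs by simp
    also have "\<dots> \<le> (k1\<^sup>2 + k2\<^sup>2 + k3\<^sup>2) * (6 * Q)" using s by (intro mult_left_mono) auto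
    also have "\<dots> = 6 * (k1\<^sup>2 + k2\<^sup>2 + k3\<^sup>2) * Q" by (simp only: mult.left_commute mult.assoc)
    finally show "(interp G w x - interp G w y)\<^sup>2 \<le> 6 * (k1\<^sup>2 + k2\<^sup>2 + k3\<^sup>2) * ((X x - X y)\<^sup>2 + (Y x - Y y)\<^sup>2)"
      unfolding Q_def .
  qed (use rho in auto)
  then show ?thesis by (simp add: cd mult_ac)
qed

lemma interp_near:
  assumes "y \<in> C.K" "\<And>s t. s \<in> {0, 1} \<Longrightarrow> t \<in> {0, 1} \<Longrightarrow> \<bar>G (word_map carpet_map w (corner s t)) - z\<bar> \<le> e"
  shows "\<bar>interp G w y - z\<bar> \<le> e"
proof -
  define g where "g s t = G (word_map carpet_map w (corner s t)) - z" for s t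
  have g: "\<bar>g 0 0\<bar> \<le> e" "\<bar>g 1 0\<bar> \<le> e" "\<bar>g 0 1\<bar> \<le> e" "\<bar>g 1 1\<bar> \<le> e" using assms(2) by (auto simp: g_def)
  define h00 h10 h01 h11 where h: "h00 = (1 - X y) * (1 - Y y)" "h10 = X y * (1 - Y y)" "h01 = (1 - X y) * Y y" "h11 = X y * Y y"
  have h0: "0 \<le> h00" "0 \<le> h10" "0 \<le> h01" "0 \<le> h11" using unit[OF assms(1)] by (auto simp: h)
  have h1: "h00 + h10 + h01 + h11 = 1" by (simp add: h algebra_simps)
  have "interp G w y - z = g 0 0 * h00 + g 1 0 * h10 + g 0 1 * h01 + g 1 1 * h11"
    unfolding interp_def g_def h by (simp add: algebra_simps)
  also have "\<bar>\<dots>\<bar> \<le> \<bar>g 0 0 * h00\<bar> + \<bar>g 1 0 * h10\<bar> + \<bar>g 0 1 * h01\<bar> + \<bar>g 1 1 * h11\<bar>" by linarith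
  also have "\<dots> \<le> e * h00 + e * h10 + e * h01 + e * h11"
    using g h0 by (intro add_mono) (auto simp: abs_mult intro: mult_right_mono)
  also have "\<dots> = e" using h1 by (simp add: distrib_left[symmetric])
  finally show ?thesis .
qed

text \<open>The energy of the glued function must be controlled also at levels coarser than
  \<open>n\<close>, where an edge is much longer than a cell of level \<open>n\<close>.
  Self-similarity of the form achieves this, and \<open>r \<le> \<rho>\<close> replaces the unknown
  scaling by \<open>\<rho> ^ n\<close>.\<close>

lemma interp_extension:
  "\<exists>U. continuous_on C.K U \<and> (\<forall>w\<in>words 8 n. \<forall>y\<in>C.K. U (word_map carpet_map w y) = interp G w y) \<and>
     energy_bounded \<rho> U (12 * c * M * \<rho> ^ n * (\<Sum>w\<in>words 8 n. corner_diff G w))"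
proof -
  obtain U where U: "continuous_on C.K U" "\<And>w y. w \<in> words 8 n \<Longrightarrow> y \<in> C.K \<Longrightarrow> U (word_map carpet_map w y) = interp G w y"
    using interp_glue by blast
  define m where "m w = 12 * M * corner_diff G w" for w
  have m0: "0 \<le> m w" for w using M_nonneg by (simp add: m_def corner_diff_eq)
  have cells: "energy_bounded \<rho> (U \<circ> word_map carpet_map w) (m w)" if w: "w \<in> words 8 n" for w
  proof -
    have "carpet_energy k (U \<circ> word_map carpet_map w) = carpet_energy k (interp G w)" for k
      using U(2)[OF w] by (intro carpet_energy_cong) simp
    then show ?thesis using interp_energy[of G w] by (simp add: energy_bounded_def m_def)
  qed
  \<comment> \<open>A crude finite bound that places \<open>U\<close> in the form domain: coarse
    levels are finitely many, finer ones reduce to cells. \<open>scaling_upper\<close> then yields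
    the bound with a controlled constant.\<close>
  define B where "B = (\<Sum>k\<le>n. \<rho> ^ k * carpet_energy k U) + \<rho> ^ n * (\<Sum>w\<in>words 8 n. m w)"
  have "energy_bounded \<rho> U B"
    unfolding energy_bounded_def
  proof (intro allI impI)
    fix k :: nat
    show "\<rho> ^ k * carpet_energy k U \<le> B"
    proof (cases "k \<le> n")
      case True
      have "\<rho> ^ k * carpet_energy k U \<le> (\<Sum>k\<le>n. \<rho> ^ k * carpet_energy k U)"
        using True rho by (intro member_le_sum) (auto simp: carpet_energy_nonneg)
      moreover have "0 \<le> \<rho> ^ n * (\<Sum>w\<in>words 8 n. m w)" using rho m0 by (intro mult_nonneg_nonneg sum_nonneg) auto
      ultimately show ?thesis by (simp add: B_def)
    next
      case False
      have "\<rho> ^ (n + (k - n)) * carpet_energy (n + (k - n)) U = \<rho> ^ n * (\<Sum>w\<in>words 8 n. \<rho> ^ (k - n) * carpet_energy (k - n) (U \<circ> word_map carpet_map w))"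
        unfolding carpet_energy_add power_add by (simp add: sum_distrib_left mult_ac)
      also have "\<dots> \<le> \<rho> ^ n * (\<Sum>w\<in>words 8 n. m w)"
        using rho False by (intro mult_left_mono sum_mono energy_boundedD cells) auto
      also have "\<dots> \<le> B" using rho by (simp add: B_def sum_nonneg carpet_energy_nonneg)
      finally show ?thesis using False by simp
    qed
  qed
  from scaling_upper[OF U(1) this cells]
  have eb: "energy_bounded \<rho> U (c * r ^ n * (\<Sum>w\<in>words 8 n. m w))" .
  have "c * r ^ n * (\<Sum>w\<in>words 8 n. m w) \<le> c * \<rho> ^ n * (\<Sum>w\<in>words 8 n. m w)"
    using scaling_le r c m0 by (intro mult_right_mono mult_left_mono power_mono sum_nonneg) auto
  also have "\<dots> = 12 * c * M * \<rho> ^ n * (\<Sum>w\<in>words 8 n. corner_diff G w)"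
    by (simp add: m_def sum_distrib_left mult_ac)
  finally have "energy_bounded \<rho> U (12 * c * M * \<rho> ^ n * (\<Sum>w\<in>words 8 n. corner_diff G w))"
    using eb unfolding energy_bounded_def by (meson order_trans)
  then show ?thesis using U by blast
qed

text \<open>One \<open>e\<close> pays for replacing an average by the value at the vertex, one for
  moving within the cell; interpolation is a convex combination and adds nothing.\<close>

lemma interp_mean_uniform:
  assumes u: "continuous_on C.K u" and e: "0 < e"
  shows "\<exists>n0. \<forall>n\<ge>n0. \<forall>w\<in>words 8 n. \<forall>y\<in>C.K.
     \<bar>interp (\<lambda>z. C.mean u (cell_of n z)) w y - u (word_map carpet_map w y)\<bar> \<le> 2 * e"
proof -
  from C.uniformly_continuous_cells[OF u e] obtain n0 where
    n0: "\<And>n w x y. n0 \<le> n \<Longrightarrow> w \<in> words 8 n \<Longrightarrow> x \<in> C.cell w \<Longrightarrow> y \<in> C.cell w \<Longrightarrow> \<bar>u x - u y\<bar> < e" by blast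
  have "\<bar>interp (\<lambda>z. C.mean u (cell_of n z)) w y - u (word_map carpet_map w y)\<bar> \<le> 2 * e"
    if n: "n0 \<le> n" and w: "w \<in> words 8 n" and y: "y \<in> C.K" for n w y
  proof (rule interp_near[OF y])
    fix s t :: int assume st: "s \<in> {0, 1}" "t \<in> {0, 1}"
    define z where "z = word_map carpet_map w (corner s t)"
    have zc: "z \<in> C.cell w" using corner_in_K[OF st] by (simp add: z_def C.cell_def)
    then have zK: "z \<in> C.K" using C.cell_subset_K[OF w] by blast
    have "\<bar>C.mean u (cell_of n z) - u z\<bar> \<le> e"
    proof (rule mean_near[OF continuous_L2[OF u]])
      show "cell_of n z \<in> words 8 n" using cell_of[OF zK] by blast
      show "\<bar>u x - u z\<bar> \<le> e" if "x \<in> C.cell (cell_of n z)" for x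
        using n0[OF n _ that, of z] cell_of[OF zK, of n] by (auto intro: less_imp_le)
    qed (use e in simp)
    moreover have "\<bar>u z - u (word_map carpet_map w y)\<bar> < e"
      using y by (intro n0[OF n w zc]) (simp add: C.cell_def)
    ultimately show "\<bar>C.mean u (cell_of n (word_map carpet_map w (corner s t))) - u (word_map carpet_map w y)\<bar> \<le> 2 * e"
      unfolding z_def by linarith
  qed
  then show ?thesis by blast
qed

text \<open>For fixed \<open>k\<close> the level-\<open>k\<close> energy of \<open>u\<close> is
  controlled by that of the interpolation \<open>U\<close>, up to a factor 2 and a small error. The
  energy bound for \<open>U\<close> turns this into \<open>\<rho> ^ n\<close> times the corner
  differences at every large level \<open>n\<close>, hence into the rescaled shells. This takes the
  place of weak monotonicity of the averages on the gasket.\<close>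

lemma carpet_lower:
  "\<exists>C>0. \<forall>u. continuous_on C.K u \<longrightarrow> carpet_seminorm \<rho> u \<le> ennreal C * Liminf (at_left (carpet_walk_dim \<rho>))
     (C.renormalized (carpet_walk_dim \<rho>) u)"
proof -
  obtain d where d: "\<And>u n. u \<in> L2 C.\<nu> \<Longrightarrow>
     ennreal (\<Sum>w\<in>words 8 n. corner_diff (\<lambda>z. C.mean u (cell_of n z)) w) \<le>
     ennreal (real d * 8 ^ (2 * n)) * C.shell u ((3 * C.D + 1) / 3 ^ n)"
    using sum_corner_diff_le_shell by blast
  define R where "R = 3 * C.D + 1"
  have R: "1 \<le> R" using C.D_pos by (simp add: R_def)
  have wd: "0 < carpet_walk_dim \<rho>" using rho by (simp add: carpet_walk_dim_def log_def)
  obtain C2 where C2: "0 < C2" and lim: "\<And>u m. u \<in> borel_measurable C.\<nu> \<Longrightarrow>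
    (\<forall>\<^sub>F n in sequentially. m \<le> ennreal ((real 8 * real 3 powr carpet_walk_dim \<rho>) ^ n) * C.shell u (R / real 3 ^ n)) \<Longrightarrow>
    m \<le> ennreal C2 * Liminf (at_left (carpet_walk_dim \<rho>)) (C.renormalized (carpet_walk_dim \<rho>) u)"
    using C.liminf_nonlocal_energy_ge[OF wd R] by blast
  have pw: "real 8 * real 3 powr carpet_walk_dim \<rho> = 64 * \<rho>" using rho by (simp add: carpet_walk_dim_powr)
  define B where "B = 24 * c * M * real d + 1"
  have B: "0 < B" using c M_nonneg by (simp add: B_def add_nonneg_pos)
  have "carpet_seminorm \<rho> u \<le> ennreal (B * C2) * Liminf (at_left (carpet_walk_dim \<rho>))
     (C.renormalized (carpet_walk_dim \<rho>) u)" if u: "continuous_on C.K u" for u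
  proof -
    define Lim where "Lim = Liminf (at_left (carpet_walk_dim \<rho>))
       (C.renormalized (carpet_walk_dim \<rho>) u)"
    have "ennreal (\<rho> ^ k * carpet_energy k u) \<le> ennreal (B * C2) * Lim" if k: "1 \<le> k" for k
    proof (rule ennreal_le_epsilon)
      fix \<eta> :: real assume \<eta>: "0 < \<eta>"
      define A where "A = \<rho> ^ k * carpet_energy k u"
      define E where "E = real (\<Sum>w\<in>words 8 k. card (carpet_edges k w))"
      have E: "0 \<le> E" unfolding E_def by (rule of_nat_0_le_iff)
      \<comment> \<open>Chosen so that the perturbation error over all \<open>E\<close> edges of
        level \<open>k\<close>, weighted by \<open>\<rho> ^ k\<close>, is at most
        \<open>\<eta>\<close>; the uniform approximation has error \<open>2 * e\<close>.\<close>
      define e where "e = sqrt (\<eta> / (32 * \<rho> ^ k * (E + 1)))"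
      have e: "0 < e" using \<eta> E rho by (simp add: e_def)
      have e2: "\<rho> ^ k * (8 * (2 * e)\<^sup>2 * E) \<le> \<eta>"
      proof -
        have "e\<^sup>2 = \<eta> / (32 * \<rho> ^ k * (E + 1))" using \<eta> E rho by (simp add: e_def)
        then have "\<rho> ^ k * (8 * (2 * e)\<^sup>2 * E) = \<eta> * (E / (E + 1))" using rho E by (simp add: power_mult_distrib)
        also have "\<dots> \<le> \<eta>" using \<eta> E by (intro mult_left_le) auto
        finally show ?thesis .
      qed
      obtain n0 where n0: "\<And>n w y. n0 \<le> n \<Longrightarrow> w \<in> words 8 n \<Longrightarrow> y \<in> C.K \<Longrightarrow>
         \<bar>interp (\<lambda>z. C.mean u (cell_of n z)) w y - u (word_map carpet_map w y)\<bar> \<le> 2 * e"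
        using interp_mean_uniform[OF u e] by blast
      have "ennreal ((A - \<eta>) / B) \<le> ennreal ((real 8 * real 3 powr carpet_walk_dim \<rho>) ^ n) * C.shell u (R / real 3 ^ n)" if n: "n0 \<le> n" for n
      proof -
        define G where "G = (\<lambda>z. C.mean u (cell_of n z))"
        define \<Delta> where "\<Delta> = (\<Sum>w\<in>words 8 n. corner_diff G w)"
        have \<Delta>: "0 \<le> \<Delta>" unfolding \<Delta>_def corner_diff_eq by (intro sum_nonneg) auto
        obtain U where U: "\<And>w y. w \<in> words 8 n \<Longrightarrow> y \<in> C.K \<Longrightarrow> U (word_map carpet_map w y) = interp G w y"
          "energy_bounded \<rho> U (12 * c * M * \<rho> ^ n * \<Delta>)"
          using interp_extension[of n G] unfolding \<Delta>_def by blast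
        have near: "\<bar>U x - u x\<bar> \<le> 2 * e" if "x \<in> C.K" for x
        proof -
          obtain w where "w \<in> words 8 n" "x \<in> C.cell w" using C.K_words[of n] \<open>x \<in> C.K\<close> by blast
          moreover from this obtain y where "y \<in> C.K" "x = word_map carpet_map w y" by (auto simp: C.cell_def)
          ultimately show ?thesis using n0[OF n] U(1) by (simp add: G_def)
        qed
        have "A \<le> \<rho> ^ k * (2 * carpet_energy k U + 8 * (2 * e)\<^sup>2 * E)"
          unfolding A_def E_def using rho by (intro mult_left_mono carpet_energy_perturb near) auto
        also have "\<dots> = 2 * (\<rho> ^ k * carpet_energy k U) + \<rho> ^ k * (8 * (2 * e)\<^sup>2 * E)" by (simp add: algebra_simps)
        also have "\<dots> \<le> 2 * (12 * c * M * \<rho> ^ n * \<Delta>) + \<eta>"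
          using energy_boundedD[OF U(2) k] e2 by (intro add_mono mult_left_mono) auto
        finally have "(A - \<eta>) / B \<le> (24 * c * M * \<rho> ^ n) / B * \<Delta>"
          using B by (simp add: divide_right_mono)
        then have "ennreal ((A - \<eta>) / B) \<le> ennreal ((24 * c * M * \<rho> ^ n) / B * \<Delta>)" by (rule ennreal_leI)
        also have "\<dots> = ennreal ((24 * c * M * \<rho> ^ n) / B) * ennreal \<Delta>"
          using c M_nonneg rho B \<Delta> by (intro ennreal_mult) auto
        also have "\<dots> \<le> ennreal ((24 * c * M * \<rho> ^ n) / B) * (ennreal (real d * 8 ^ (2 * n)) * C.shell u (R / 3 ^ n))"
          unfolding \<Delta>_def G_def R_def by (intro mult_left_mono d continuous_L2 u) simp
        also have "\<dots> = ennreal ((24 * c * M * \<rho> ^ n) / B * (real d * 8 ^ (2 * n))) * C.shell u (R / 3 ^ n)"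
          by (subst ennreal_mult'', simp) (simp add: mult.assoc)
        also have "\<dots> \<le> ennreal ((64 * \<rho>) ^ n) * C.shell u (R / 3 ^ n)"
        proof (intro mult_right_mono ennreal_leI)
          have e64: "(64 * \<rho>) ^ n = 8 ^ (2 * n) * \<rho> ^ n" by (simp add: power_mult_distrib power_mult)
          have "24 * c * M * real d / B \<le> 1" using B by (simp add: B_def)
          then have "24 * c * M * real d / B * (8 ^ (2 * n) * \<rho> ^ n) \<le> 1 * (8 ^ (2 * n) * \<rho> ^ n)"
            using rho by (intro mult_right_mono) auto
          then show "24 * c * M * \<rho> ^ n / B * (real d * 8 ^ (2 * n)) \<le> (64 * \<rho>) ^ n"
            unfolding e64 by (simp add: mult_ac)
        qed simp
        finally show ?thesis unfolding pw by simp
      qed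
      then have "ennreal ((A - \<eta>) / B) \<le> ennreal C2 * Lim"
        unfolding Lim_def using C.continuous_measurable[OF u]
        by (intro lim) (auto simp: eventually_sequentially)
      then have 1: "ennreal B * ennreal ((A - \<eta>) / B) \<le> ennreal B * (ennreal C2 * Lim)" by (rule mult_left_mono) simp
      \<comment> \<open>\<open>ennreal\<close> truncates a negative \<open>A - \<eta>\<close> to 0,
        hence the case distinction.\<close>
      have "ennreal A \<le> ennreal (B * ((A - \<eta>) / B)) + ennreal \<eta>"
      proof (cases "A \<le> \<eta>")
        case True
        then show ?thesis by (intro order_trans[OF ennreal_leI[OF True]]) simp
      next
        case False
        then show ?thesis using B \<eta> by (simp add: ennreal_plus[symmetric] del: ennreal_plus)
      qed
      also have "\<dots> = ennreal B * ennreal ((A - \<eta>) / B) + ennreal \<eta>" by (subst ennreal_mult'[OF less_imp_le[OF B]]) (rule refl)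
      also have "\<dots> \<le> ennreal (B * C2) * Lim + ennreal \<eta>"
        using 1 B C2 by (intro add_right_mono) (simp add: ennreal_mult mult.assoc)
      finally show "ennreal (\<rho> ^ k * carpet_energy k u) \<le> ennreal (B * C2) * Lim + ennreal \<eta>" by (simp add: A_def)
    qed
    then show ?thesis using rho unfolding Lim_def by (subst carpet_seminorm_eq) (auto intro!: SUP_least)
  qed
  moreover have "0 < B * C2" using B C2 by simp
  ultimately show ?thesis by blast
qed

end

lemma carpet_lower_bound:
  assumes "carpet_scaling \<rho> c r"
  shows "\<exists>C>0. \<forall>u. continuous_on C.K u \<longrightarrow> carpet_seminorm \<rho> u \<le> ennreal C * Liminf (at_left (carpet_walk_dim \<rho>))
     (C.renormalized (carpet_walk_dim \<rho>) u)"
proof -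
  interpret carpet_scaling \<rho> c r by (rule assms)
  obtain X Y M where XY: "continuous_on C.K X" "continuous_on C.K Y" "energy_bounded \<rho> X M" "energy_bounded \<rho> Y M"
     "\<forall>x\<in>C.K. 0 \<le> X x \<and> X x \<le> 1 \<and> 0 \<le> Y x \<and> Y x \<le> 1"
     "\<forall>x\<in>C.K. (fst x = 0 \<longrightarrow> X x = 0) \<and> (fst x = 1 \<longrightarrow> X x = 1) \<and> (snd x = 0 \<longrightarrow> Y x = 0) \<and> (snd x = 1 \<longrightarrow> Y x = 1)"
     "\<forall>t. Y (0, t) = Y (1, t) \<and> X (t, 0) = X (t, 1)"
    using coordinate_functions by blast
  interpret carpet_coordinates \<rho> c r X Y M
  proof unfold_locales
    show "0 \<le> X x \<and> X x \<le> 1 \<and> 0 \<le> Y x \<and> Y x \<le> 1" if "x \<in> C.K" for x using XY(5) that by blast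
    show "X (0, t) = 0" if "(0, t) \<in> C.K" for t using bspec[OF XY(6) that] by simp
    show "X (1, t) = 1" if "(1, t) \<in> C.K" for t using bspec[OF XY(6) that] by simp
    show "Y (t, 0) = 0" if "(t, 0) \<in> C.K" for t using bspec[OF XY(6) that] by simp
    show "Y (t, 1) = 1" if "(t, 1) \<in> C.K" for t using bspec[OF XY(6) that] by simp
    show "Y (0, t) = Y (1, t)" "X (t, 0) = X (t, 1)" for t using XY(7) by auto
  qed (fact XY)+
  show ?thesis by (rule carpet_lower)
qed

section \<open>From the carpet form to the two-sided estimate\<close>

text \<open>Self-similarity is iterated over words, with the form exchanged for
  \<open>energy_bounded\<close> before and after; each exchange costs a factor \<open>c\<close>, so
  \<open>c * c\<close> appears. The comparison with the seminorm is available for continuous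
  representatives only, hence the continuity assumptions throughout.\<close>

lemma carpet_form_scaling:
  assumes res: "carpet_resistance_factor \<rho>" and form: "carpet_local_form \<rho> F E"
    and c: "0 < c" "\<And>u. u \<in> F \<Longrightarrow> continuous_on carpet u \<Longrightarrow> ennreal (E u u / c) \<le> carpet_seminorm \<rho> u \<and> carpet_seminorm \<rho> u \<le> ennreal (c * E u u)"
  shows "\<exists>c r. carpet_scaling \<rho> c r"
proof -
  interpret dirichlet_form carpet_measure F E using form unfolding carpet_local_form_def by blast
  have rho: "1 < \<rho>" using res by (auto simp: carpet_resistance_factor_def)
  then have rho0: "0 < \<rho>" by simp
  obtain R where R: "0 < R" "\<And>n. 1 \<le> n \<Longrightarrow> 1 / R \<le> carpet_resistance n / \<rho> ^ n \<and> carpet_resistance n / \<rho> ^ n \<le> R"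
    using res unfolding carpet_resistance_factor_def by blast
  have selfsim: "self_similar_form 8 carpet_map F E" and reg: "regular_form carpet carpet_measure F E"
    using form unfolding carpet_local_form_def by auto
  have F: "F = {u \<in> L2 carpet_measure. \<exists>v. continuous_on carpet v \<and> (AE x in carpet_measure. u x = v x) \<and> carpet_seminorm \<rho> v < \<infinity>}"
    using form unfolding carpet_local_form_def by blast
  obtain r where r: "0 < r" and E_Suc: "\<And>u. u \<in> F \<Longrightarrow> E u u = r * (\<Sum>i<8. E (u \<circ> carpet_map i) (u \<circ> carpet_map i))"
    using selfsim unfolding self_similar_form_def by blast
  have comp1: "u \<circ> carpet_map i \<in> F" if "u \<in> F" "i < 8" for u i
    using selfsim that unfolding self_similar_form_def by blast
  have compw: "u \<circ> word_map carpet_map w \<in> F" if "u \<in> F" "w \<in> words 8 n" for u w n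
    using that
  proof (induction w arbitrary: u n)
    case (Cons i w)
    then have "i < 8" "w \<in> words 8 (length w)" by (auto simp: words_def)
    then have "(u \<circ> carpet_map i) \<circ> word_map carpet_map w \<in> F" using Cons comp1 by blast
    then show ?case by (simp add: comp_def)
  qed (simp add: comp_def)
  have E_words: "E u u = r ^ n * (\<Sum>w\<in>words 8 n. E (u \<circ> word_map carpet_map w) (u \<circ> word_map carpet_map w))" if "u \<in> F" for u n
    using that
  proof (induction n arbitrary: u)
    case 0
    then show ?case by (simp add: words_0)
  next
    case (Suc n)
    have "E u u = r * (\<Sum>i<8. E (u \<circ> carpet_map i) (u \<circ> carpet_map i))" by (rule E_Suc[OF Suc.prems])
    also have "\<dots> = r * (\<Sum>i<8. r ^ n * (\<Sum>w\<in>words 8 n. E (u \<circ> carpet_map i \<circ> word_map carpet_map w) (u \<circ> carpet_map i \<circ> word_map carpet_map w)))"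
      by (intro arg_cong[of _ _ "\<lambda>z. r * z"] sum.cong refl Suc.IH comp1[OF Suc.prems]) simp
    also have "\<dots> = r ^ Suc n * (\<Sum>i<8. \<Sum>w\<in>words 8 n. E (u \<circ> word_map carpet_map ([i] @ w)) (u \<circ> word_map carpet_map ([i] @ w)))"
      by (simp add: sum_distrib_left comp_assoc mult.assoc)
    also have "(\<Sum>i<8. \<Sum>w\<in>words 8 n. E (u \<circ> word_map carpet_map ([i] @ w)) (u \<circ> word_map carpet_map ([i] @ w))) =
        (\<Sum>w\<in>words 8 (Suc n). E (u \<circ> word_map carpet_map w) (u \<circ> word_map carpet_map w))"
      using sum_words_append[of "\<lambda>w. E (u \<circ> word_map carpet_map w) (u \<circ> word_map carpet_map w)" 8 1 n] by (simp add: sum_words_1)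
    finally show ?case .
  qed
  have inF: "u \<in> F" if "continuous_on C.K u" "energy_bounded \<rho> u m" for u m
  proof -
    have "carpet_seminorm \<rho> u \<le> ennreal m"
      using that(2) rho0 energy_bounded_nonneg[OF rho0 that(2)] by (simp add: carpet_seminorm_le_iff)
    then have "carpet_seminorm \<rho> u < \<infinity>" by (rule le_less_trans) simp
    moreover have "u \<in> L2 carpet_measure" using continuous_L2[OF that(1)] by (simp add: carpet_eqs)
    ultimately show ?thesis unfolding F using that(1) by (auto simp: carpet_eqs)
  qed
  have cont_w: "continuous_on C.K (u \<circ> word_map carpet_map w)" if "continuous_on C.K u" "w \<in> words 8 n" for u w n
    unfolding o_def
    by (rule continuous_on_compose2[OF that(1) C.continuous_word_map[OF that(2)]]) (use C.word_map_in_K[OF that(2)] in auto)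
  have upper: "E u u \<le> c * m" if "u \<in> F" "continuous_on C.K u" "energy_bounded \<rho> u m" for u m
  proof -
    have m0: "0 \<le> m" using energy_bounded_nonneg[OF rho0 that(3)] .
    have "ennreal (E u u / c) \<le> ennreal m"
      using c(2)[OF that(1)] that(2,3) m0 rho0 carpet_seminorm_le_iff[of \<rho> m u] unfolding carpet_eqs by (meson order_trans)
    then have "E u u / c \<le> m" using m0 by (simp add: ennreal_le_iff)
    then show ?thesis using c(1) by (simp add: pos_divide_le_eq mult.commute)
  qed
  have lower: "energy_bounded \<rho> u (c * E u u)" if "u \<in> F" "continuous_on C.K u" for u
  proof -
    have "carpet_seminorm \<rho> u \<le> ennreal (c * E u u)" using c(2)[OF that(1)] that(2) unfolding carpet_eqs by blast
    then show ?thesis using carpet_seminorm_le_iff[OF rho0, of "c * E u u" u] c(1) form_nonneg[OF that(1)] by simp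
  qed
  define k where "k = max R (c * c)"
  have k: "0 < k" "R \<le> k" "c * c \<le> k" using R(1) by (auto simp: k_def less_max_iff_disj)
  have "carpet_scaling \<rho> k r"
  proof
    show "1 < \<rho>" "0 < k" "0 < r" using rho k r by auto
    show "0 < carpet_resistance n \<and> carpet_resistance n \<le> k * \<rho> ^ n" if "1 \<le> n" for n
    proof
      have "0 < carpet_resistance n / \<rho> ^ n" using R(1) R(2)[OF that] by (meson divide_pos_pos less_le_trans zero_less_one)
      then show "0 < carpet_resistance n" using rho0 by (simp add: zero_less_divide_iff)
      have "carpet_resistance n \<le> R * \<rho> ^ n" using R(2)[OF that] rho0 by (simp add: pos_divide_le_eq)
      also have "\<dots> \<le> k * \<rho> ^ n" using k rho0 by (intro mult_right_mono) auto
      finally show "carpet_resistance n \<le> k * \<rho> ^ n" .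
    qed
    show "energy_bounded \<rho> u (k * r ^ n * (\<Sum>w\<in>words 8 n. m w))"
      if u: "continuous_on C.K u" "energy_bounded \<rho> u M" and m: "\<And>w. w \<in> words 8 n \<Longrightarrow> energy_bounded \<rho> (u \<circ> word_map carpet_map w) (m w)" for u M n m
    proof -
      have uF: "u \<in> F" by (rule inF[OF u])
      have m0: "0 \<le> m w" if "w \<in> words 8 n" for w using energy_bounded_nonneg[OF rho0 m[OF that]] .
      have "E u u \<le> r ^ n * (\<Sum>w\<in>words 8 n. c * m w)"
        unfolding E_words[OF uF, of n] using r
        by (intro mult_left_mono sum_mono upper compw[OF uF] cont_w[OF u(1)] m) auto
      also have "\<dots> = c * (r ^ n * (\<Sum>w\<in>words 8 n. m w))" by (simp add: sum_distrib_left mult_ac)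
      finally have "c * E u u \<le> c * (c * (r ^ n * (\<Sum>w\<in>words 8 n. m w)))" using c(1) by (intro mult_left_mono) auto
      also have "\<dots> = c * c * (r ^ n * (\<Sum>w\<in>words 8 n. m w))" by (simp add: mult.assoc)
      also have "\<dots> \<le> k * (r ^ n * (\<Sum>w\<in>words 8 n. m w))"
        using k(3) r m0 by (intro mult_right_mono mult_nonneg_nonneg sum_nonneg) auto
      finally show ?thesis
        using lower[OF uF u(1)] unfolding energy_bounded_def by (metis order_trans mult.assoc)
    qed
    show "r ^ n * (\<rho> * carpet_energy (Suc n) u) \<le> k * M" if u: "continuous_on C.K u" "energy_bounded \<rho> u M" for u M n
    proof -
      have uF: "u \<in> F" by (rule inF[OF u])
      have M0: "0 \<le> M" using energy_bounded_nonneg[OF rho0 u(2)] .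
      have "\<rho> * carpet_energy (Suc n) u = (\<Sum>w\<in>words 8 n. \<rho> ^ 1 * carpet_energy 1 (u \<circ> word_map carpet_map w))"
        using carpet_energy_add[of n 1 u] by (simp add: sum_distrib_left)
      also have "\<dots> \<le> (\<Sum>w\<in>words 8 n. c * E (u \<circ> word_map carpet_map w) (u \<circ> word_map carpet_map w))"
        by (intro sum_mono energy_boundedD[OF lower] compw[OF uF] cont_w[OF u(1)]) auto
      finally have "r ^ n * (\<rho> * carpet_energy (Suc n) u) \<le> r ^ n * (\<Sum>w\<in>words 8 n. c * E (u \<circ> word_map carpet_map w) (u \<circ> word_map carpet_map w))"
        using r by (intro mult_left_mono) auto
      also have "\<dots> = c * E u u" unfolding E_words[OF uF, of n] by (simp add: sum_distrib_left mult_ac)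
      also have "\<dots> \<le> c * (c * M)" using c(1) by (intro mult_left_mono upper[OF uF u]) auto
      also have "\<dots> \<le> k * M" using mult_right_mono[OF k(3) M0] by (simp add: mult.assoc)
      finally show ?thesis .
    qed
    show "\<exists>v M. continuous_on C.K v \<and> energy_bounded \<rho> v M \<and> (\<forall>x\<in>C.K. \<bar>u x - v x\<bar> < e)"
      if u: "continuous_on C.K u" and e: "0 < e" for u :: "plane \<Rightarrow> real" and e
    proof -
      obtain v where "v \<in> F" "continuous_on C.K v" "\<forall>x\<in>C.K. \<bar>u x - v x\<bar> < e"
        using reg u e unfolding regular_form_def carpet_eqs by blast
      then show ?thesis using lower by blast
    qed
  qed
  then show ?thesis by blast
qed

lemma nonlocal_energy_cong_AE:
  assumes "AE x in N. u x = v x"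
  shows "nonlocal_energy N a b u = nonlocal_energy N a b v"
  unfolding nonlocal_energy_def
proof (rule nn_integral_cong_AE, use assms in eventually_elim)
  fix x assume "u x = v x"
  then show "(\<integral>\<^sup>+y. ennreal ((u x - u y)\<^sup>2 / dist x y powr (a + b)) \<partial>N) = (\<integral>\<^sup>+y. ennreal ((v x - v y)\<^sup>2 / dist x y powr (a + b)) \<partial>N)"
    using assms by (intro nn_integral_cong_AE) (auto elim!: eventually_mono)
qed

text \<open>Nonlocal energies and the form depend only on the class of \<open>u\<close> modulo null
  sets, so \<open>u\<close> is replaced by its continuous version, for which the seminorm is
  comparable with the form.\<close>

lemma carpet_convergence:
  assumes res: "carpet_resistance_factor \<rho>" and form: "carpet_local_form \<rho> F E"
  shows "\<exists>C>0. \<forall>u\<in>F.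
     ennreal (1 / C * E u u) \<le> Liminf (at_left (carpet_walk_dim \<rho>))
        (\<lambda>\<beta>. ennreal (carpet_walk_dim \<rho> - \<beta>) * nonlocal_energy carpet_measure carpet_dim \<beta> u) \<and>
     Limsup (at_left (carpet_walk_dim \<rho>))
        (\<lambda>\<beta>. ennreal (carpet_walk_dim \<rho> - \<beta>) * nonlocal_energy carpet_measure carpet_dim \<beta> u) \<le> ennreal (C * E u u)"
proof -
  interpret dirichlet_form carpet_measure F E using form unfolding carpet_local_form_def by blast
  have rho: "1 < \<rho>" using res by (auto simp: carpet_resistance_factor_def)
  then have rho0: "0 < \<rho>" by simp
  have F: "F = {u \<in> L2 carpet_measure. \<exists>v. continuous_on carpet v \<and> (AE x in carpet_measure. u x = v x) \<and> carpet_seminorm \<rho> v < \<infinity>}"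
    using form unfolding carpet_local_form_def by blast
  obtain c where c: "0 < c" and comp: "\<And>u. u \<in> F \<Longrightarrow> continuous_on carpet u \<Longrightarrow> ennreal (E u u / c) \<le> carpet_seminorm \<rho> u \<and> carpet_seminorm \<rho> u \<le> ennreal (c * E u u)"
    using form unfolding carpet_local_form_def by blast
  obtain k r where "carpet_scaling \<rho> k r" using carpet_form_scaling[OF res form c comp] by blast
  from carpet_lower_bound[OF this] obtain C1 where C1: "0 < C1" and lower: "\<And>u. continuous_on carpet u \<Longrightarrow>
     carpet_seminorm \<rho> u \<le> ennreal C1 * Liminf (at_left (carpet_walk_dim \<rho>))
     (\<lambda>\<beta>. ennreal (carpet_walk_dim \<rho> - \<beta>) * nonlocal_energy carpet_measure carpet_dim \<beta> u)"
    unfolding carpet_eqs by blast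
  obtain C2 where C2: "0 < C2" and upper: "\<And>u m. continuous_on carpet u \<Longrightarrow> energy_bounded \<rho> u m \<Longrightarrow>
     Limsup (at_left (carpet_walk_dim \<rho>)) (\<lambda>\<beta>. ennreal (carpet_walk_dim \<rho> - \<beta>) * nonlocal_energy carpet_measure carpet_dim \<beta> u) \<le> ennreal (C2 * m)"
    using carpet_upper[OF rho] unfolding carpet_eqs by blast
  have main: "ennreal (1 / max (c * C1) (C2 * c) * E u u) \<le> Liminf (at_left (carpet_walk_dim \<rho>))
        (\<lambda>\<beta>. ennreal (carpet_walk_dim \<rho> - \<beta>) * nonlocal_energy carpet_measure carpet_dim \<beta> u) \<and>
     Limsup (at_left (carpet_walk_dim \<rho>))
        (\<lambda>\<beta>. ennreal (carpet_walk_dim \<rho> - \<beta>) * nonlocal_energy carpet_measure carpet_dim \<beta> u) \<le> ennreal (max (c * C1) (C2 * c) * E u u)"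
    if u: "u \<in> F" for u
  proof -
    obtain v where v: "continuous_on carpet v" "AE x in carpet_measure. u x = v x" "carpet_seminorm \<rho> v < \<infinity>"
      using u unfolding F by blast
    have vF: "v \<in> F"
      using domain_cong[OF u _ v(2)] C.continuous_measurable[of v] v(1) unfolding carpet_eqs by blast
    \<comment> \<open>Replacement is available in the first argument; symmetry moves the second one
      there.\<close>
    have Euv: "E u u = E v v"
    proof -
      have "E u u = E v u" by (rule form_cong[OF u vF u v(2)])
      also have "\<dots> = E u v" by (rule form_sym[OF vF u])
      also have "\<dots> = E v v" by (rule form_cong[OF u vF vF v(2)])
      finally show ?thesis .
    qed
    have nl: "nonlocal_energy carpet_measure carpet_dim \<beta> u = nonlocal_energy carpet_measure carpet_dim \<beta> v" for \<beta>
      using v(2) by (rule nonlocal_energy_cong_AE)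
    show ?thesis unfolding Euv nl
    proof (rule two_sided_bound)
      show "0 \<le> E v v" using vF by (rule form_nonneg)
      show "ennreal (E v v / c) \<le> ennreal C1 * Liminf (at_left (carpet_walk_dim \<rho>))
        (\<lambda>\<beta>. ennreal (carpet_walk_dim \<rho> - \<beta>) * nonlocal_energy carpet_measure carpet_dim \<beta> v)"
        using comp[OF vF v(1)] lower[OF v(1)] by (blast intro: order_trans)
      have "energy_bounded \<rho> v (c * E v v)"
        using comp[OF vF v(1)] c form_nonneg[OF vF] carpet_seminorm_le_iff[OF rho0, of "c * E v v" v] by simp
      from upper[OF v(1) this]
      show "Limsup (at_left (carpet_walk_dim \<rho>))
        (\<lambda>\<beta>. ennreal (carpet_walk_dim \<rho> - \<beta>) * nonlocal_energy carpet_measure carpet_dim \<beta> v) \<le> ennreal (C2 * c * E v v)"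
        by (simp add: mult.assoc)
    qed (use c C1 C2 in auto)
  qed
  have "0 < max (c * C1) (C2 * c)" using c C1 by (simp add: less_max_iff_disj)
  then show ?thesis using main by blast
qed

theorem theorem1p5:
  shows
   "(\<forall>F E. gasket_local_form F E \<longrightarrow>
       (\<exists>C>0. \<forall>u\<in>F.
          ennreal (1 / C * E u u)
            \<le> Liminf (at_left gasket_walk_dim)
                (\<lambda>\<beta>. ennreal (gasket_walk_dim - \<beta>) * nonlocal_energy gasket_measure gasket_dim \<beta> u) \<and>
          Liminf (at_left gasket_walk_dim)
                (\<lambda>\<beta>. ennreal (gasket_walk_dim - \<beta>) * nonlocal_energy gasket_measure gasket_dim \<beta> u)
            \<le> Limsup (at_left gasket_walk_dim)
                (\<lambda>\<beta>. ennreal (gasket_walk_dim - \<beta>) * nonlocal_energy gasket_measure gasket_dim \<beta> u) \<and>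
          Limsup (at_left gasket_walk_dim)
                (\<lambda>\<beta>. ennreal (gasket_walk_dim - \<beta>) * nonlocal_energy gasket_measure gasket_dim \<beta> u)
            \<le> ennreal (C * E u u))) \<and>
    (\<forall>\<rho> F E. carpet_resistance_factor \<rho> \<and> carpet_local_form \<rho> F E \<longrightarrow>
       (\<exists>C>0. \<forall>u\<in>F.
          ennreal (1 / C * E u u)
            \<le> Liminf (at_left (carpet_walk_dim \<rho>))
                (\<lambda>\<beta>. ennreal (carpet_walk_dim \<rho> - \<beta>) * nonlocal_energy carpet_measure carpet_dim \<beta> u) \<and>
          Liminf (at_left (carpet_walk_dim \<rho>))
                (\<lambda>\<beta>. ennreal (carpet_walk_dim \<rho> - \<beta>) * nonlocal_energy carpet_measure carpet_dim \<beta> u)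
            \<le> Limsup (at_left (carpet_walk_dim \<rho>))
                (\<lambda>\<beta>. ennreal (carpet_walk_dim \<rho> - \<beta>) * nonlocal_energy carpet_measure carpet_dim \<beta> u) \<and>
          Limsup (at_left (carpet_walk_dim \<rho>))
                (\<lambda>\<beta>. ennreal (carpet_walk_dim \<rho> - \<beta>) * nonlocal_energy carpet_measure carpet_dim \<beta> u)
            \<le> ennreal (C * E u u)))"
proof (intro conjI allI impI)
  have le: "Liminf (at_left b) g \<le> Limsup (at_left b) g" for b :: real and g :: "real \<Rightarrow> ennreal"
    by (rule Liminf_le_Limsup) (rule trivial_limit_at_left_real)
  fix F E assume "gasket_local_form F E"
  from gasket_convergence[OF this] le show "\<exists>C>0. \<forall>u\<in>F.
          ennreal (1 / C * E u u)
            \<le> Liminf (at_left gasket_walk_dim)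
                (\<lambda>\<beta>. ennreal (gasket_walk_dim - \<beta>) * nonlocal_energy gasket_measure gasket_dim \<beta> u) \<and>
          Liminf (at_left gasket_walk_dim)
                (\<lambda>\<beta>. ennreal (gasket_walk_dim - \<beta>) * nonlocal_energy gasket_measure gasket_dim \<beta> u)
            \<le> Limsup (at_left gasket_walk_dim)
                (\<lambda>\<beta>. ennreal (gasket_walk_dim - \<beta>) * nonlocal_energy gasket_measure gasket_dim \<beta> u) \<and>
          Limsup (at_left gasket_walk_dim)
                (\<lambda>\<beta>. ennreal (gasket_walk_dim - \<beta>) * nonlocal_energy gasket_measure gasket_dim \<beta> u)
            \<le> ennreal (C * E u u)" by blast
next
  have le: "Liminf (at_left b) g \<le> Limsup (at_left b) g" for b :: real and g :: "real \<Rightarrow> ennreal"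
    by (rule Liminf_le_Limsup) (rule trivial_limit_at_left_real)
  fix \<rho> F E assume "carpet_resistance_factor \<rho> \<and> carpet_local_form \<rho> F E"
  then have "carpet_resistance_factor \<rho>" "carpet_local_form \<rho> F E" by auto
  from carpet_convergence[OF this] le show "\<exists>C>0. \<forall>u\<in>F.
          ennreal (1 / C * E u u)
            \<le> Liminf (at_left (carpet_walk_dim \<rho>))
                (\<lambda>\<beta>. ennreal (carpet_walk_dim \<rho> - \<beta>) * nonlocal_energy carpet_measure carpet_dim \<beta> u) \<and>
          Liminf (at_left (carpet_walk_dim \<rho>))
                (\<lambda>\<beta>. ennreal (carpet_walk_dim \<rho> - \<beta>) * nonlocal_energy carpet_measure carpet_dim \<beta> u)
            \<le> Limsup (at_left (carpet_walk_dim \<rho>))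
                (\<lambda>\<beta>. ennreal (carpet_walk_dim \<rho> - \<beta>) * nonlocal_energy carpet_measure carpet_dim \<beta> u) \<and>
          Limsup (at_left (carpet_walk_dim \<rho>))
                (\<lambda>\<beta>. ennreal (carpet_walk_dim \<rho> - \<beta>) * nonlocal_energy carpet_measure carpet_dim \<beta> u)
            \<le> ennreal (C * E u u)" by blast
qed

end
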